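(* Let $n\geq 5$. Then for $G=A_n$, or for $G=S_n$ with $n$ odd, $$\gamma(G)\geq\begin{cases}\frac{\phi(n)}{2}+1 & \text{if } G=S_n \text{ with } n \text{ odd and composite, or } G=A_n \text{ with } n \text{ even and } n\neq 8,\\[2pt] \frac{\phi(n)}{2} & \text{if } G=S_n \text{ with } n \text{ prime, or } G=A_8,\\[2pt] \frac{\phi(n)+2}{4} & \text{if } G=A_n \text{ with } n \text{ odd and } n\neq 2^e+1 \text{ for every } e,\\[2pt] \frac{\phi(n)}{4} & \text{if } G=A_n \text{ with } n=2^e+1 \text{ for some } e.\end{cases}$$ For $G=S_n$ with $n$ even, $$\gamma(S_n)\geq \frac{\phi(I(n);n)}{c(n)}+1, \qquad\text{and}\qquad \frac{\phi(I(n);n)}{c(n)}+1\ \sim\ \frac{\phi(n)}{c(n)d(n)},$$ where the interval $I(n)$ and the constants $c(n),d(n)$ are given, for $n$ even, by: (i) if $3\nmid n$: $I(n)=[1,\frac{n-1}{3})$, $c(n)=2$, $d(n)=3$; (ii) if $n\equiv 3$ or $6 \pmod 9$: $I(n)=[1,\frac n9)$, $c(n)=1$, $d(n)=9$; (iii) if $9\mid n$: $I(n)=[\frac{n}{18},\frac n6)$, $c(n)=1$, $d(n)=9$.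
   Context: $S_n$ and $A_n$ denote the symmetric and alternating groups on $\{1,\dots,n\}$. For a finite group $G$, a basic set for $G$ is a set $\{H_1,\dots,H_k\}$ of pairwise non-conjugate proper subgroups of $G$ such that $G=\bigcup_{i=1}^k\bigcup_{g\in G}H_i^g$. A basic set exists if and only if $G$ is non-cyclic. For non-cyclic finite $G$, $\gamma(G)$ denotes the smallest size of a basic set for $G$. $\phi$ is the Euler function. For an interval $I\subseteq[0,n]$, $\phi(I;n)$ is the number of positive integers $i\in I$ with $\gcd(i,n)=1$. $f\sim g$ means $f(n)/g(n)\to 1$ as $n\to+\infty$ (here with $n$ running through the even integers in the corresponding line (i), (ii) or (iii)). *)

theory Defs
  imports
    Complex_Main
    "HOL-Algebra.Sym_Groups"
    "HOL-Library.Landau_Symbols"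
    "HOL-Number_Theory.Totient"
begin

definition conj_subset :: "('a, 'b) monoid_scheme \<Rightarrow> 'a set \<Rightarrow> 'a \<Rightarrow> 'a set" where
  "conj_subset G H g = (inv\<^bsub>G\<^esub> g <#\<^bsub>G\<^esub> H) #>\<^bsub>G\<^esub> g"

definition conjugate_in :: "('a, 'b) monoid_scheme \<Rightarrow> 'a set \<Rightarrow> 'a set \<Rightarrow> bool" where
  "conjugate_in G H K \<longleftrightarrow> (\<exists>g\<in>carrier G. K = conj_subset G H g)"

definition basic_set :: "('a, 'b) monoid_scheme \<Rightarrow> 'a set set \<Rightarrow> bool" where
  "basic_set G \<H> \<longleftrightarrow>
     finite \<H> \<and>
     (\<forall>H\<in>\<H>. subgroup H G \<and> H \<noteq> carrier G) \<and>
     (\<forall>H\<in>\<H>. \<forall>K\<in>\<H>. H \<noteq> K \<longrightarrow> \<not> conjugate_in G H K) \<and>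
     carrier G = (\<Union>H\<in>\<H>. \<Union>g\<in>carrier G. conj_subset G H g)"

(* Meaningful only for finite non-cyclic G; a cyclic group has no basic set,
   and the value is then unspecified. *)
definition normal_covering_number :: "('a, 'b) monoid_scheme \<Rightarrow> nat" where
  "normal_covering_number G = (LEAST k. \<exists>\<H>. basic_set G \<H> \<and> card \<H> = k)"

definition phi_interval :: "real set \<Rightarrow> nat \<Rightarrow> nat" where
  "phi_interval I n = card {i::nat. 0 < i \<and> real i \<in> I \<and> coprime i n}"

(* The following three parameters are used for even n only; the final "else" branches
   are then the case 9 dvd n. *)
definition I_of :: "nat \<Rightarrow> real set" where
  "I_of n =
     (if \<not> 3 dvd n then {1..<(real n - 1) / 3}
      else if n mod 9 = 3 \<or> n mod 9 = 6 then {1..<real n / 9}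
      else {real n / 18..<real n / 6})"

definition c_of :: "nat \<Rightarrow> real" where
  "c_of n = (if \<not> 3 dvd n then 2 else 1)"

definition d_of :: "nat \<Rightarrow> real" where
  "d_of n = (if \<not> 3 dvd n then 3 else 9)"

definition sym_even_bound :: "nat \<Rightarrow> real" where
  "sym_even_bound n = real (phi_interval (I_of n) n) / c_of n + 1"

end

(* Let a transitive group of degree n contain an element whose cycle lengths are p, q (and possibly r),
   with p >= 2 coprime to q, r and q + r, and with p + q and p + r not dividing n in the case of three cycles.
   By exchanging points one at a time, the support of the p-cycle can be moved to every p-subset; hence
   the group is primitive, contains a 3-cycle and so contains A_n.  A component
   covering such a cycle type is therefore intransitive, and the size of an invariant set is a subset sum
   of every cycle type that the component covers.  Choosing the cycle types so that few of them share
   a subset sum bounds the number of intransitive components from below by phi(n)/2 - 1, phi(n)/4 - 1, ...,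
   and a component with an n-cycle (or another type without suitable subset sums) is a further one.

   To gain one more component, suppose that there is only one component H besides these.  Then H covers
   every cycle type avoiding the invariant sizes in use.  It is 2-transitive, and a power of a suitable
   element has small degree; averaging over H the number of points that a conjugate shares
   with the support of an element of minimal degree (Bochert's method) yields a 3-cycle again.
   In degree p^2 the degrees are too large for this, and a central element of a Sylow
   p-subgroup is used to construct a p-cycle.

   The asymptotic statements follow from the Legendre sieve, as 2^omega(n) = o(phi(n)). *)
theory Submission
  imports Defs "HOL-Algebra.Sylow" "HOL-Algebra.Multiplicative_Group" "HOL-Number_Theory.Residues"
begin

section \<open>Cycle types\<close>

text \<open>Parity decides which cycle types are usable. A component containing A_n is impossible in
  A_n and can only be A_n itself in S_n, so in S_n the chosen types have to be odd. Two-cycle types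
  [k, n - k] therefore serve A_n with n even and S_n with n odd, one component for each pair k, n -
  k of totatives other than 1, n - 1. The two remaining cases need three cycles. For A_n with n odd,
  a type [r, m, m] has only the invariant sizes r, m and their complements; as 2m = -r modulo n, one
  component can serve two classes, which is why phi(n)/4 replaces phi(n)/2. For S_n with n even, the
  types are indexed by I(n), and c(n) bounds how many of them share a subset sum. The further
  component has to be won from the cycle types alone: the group is known only through the types that
  it covers. The thresholds 29, 19 and 14 in the averaging lemmas are the degrees from which the
  respective averages become contradictory; the degrees below them are the reason for the many
  special cases.\<close>

definition cyc_on :: "('a \<Rightarrow> 'a) \<Rightarrow> 'a set \<Rightarrow> bool" where
  "cyc_on f C \<longleftrightarrow> finite C \<and> f ` C = C \<and> (\<forall>a\<in>C. \<forall>b\<in>C. \<exists>k. (f ^^ k) a = b)"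

lemma cyc_on_finite: "cyc_on f C \<Longrightarrow> finite C" and cyc_on_image: "cyc_on f C \<Longrightarrow> f ` C = C"
  by (auto simp: cyc_on_def)

lemma cyc_onD: "cyc_on f C \<Longrightarrow> a \<in> C \<Longrightarrow> b \<in> C \<Longrightarrow> \<exists>k. (f ^^ k) a = b"
  by (simp add: cyc_on_def)

lemma image_funpow: "f ` C = C \<Longrightarrow> (f ^^ k) ` C = C"
  by (induction k) (simp, simp only: funpow.simps image_comp[symmetric])

lemma funpow_in_image: "f ` C = C \<Longrightarrow> a \<in> C \<Longrightarrow> (f ^^ k) a \<in> C"
  using image_funpow by fastforce

lemma funpow_fixed: "f a = a \<Longrightarrow> (f ^^ k) a = a"
  by (induction k) auto

lemma funpow_add_apply: "(f ^^ (m + k)) x = (f ^^ m) ((f ^^ k) x)"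
  by (simp add: funpow_add)

lemma funpow_agree:
  assumes "f ` C = C" "\<And>x. x \<in> C \<Longrightarrow> f x = g x" "a \<in> C"
  shows "(f ^^ k) a = (g ^^ k) a"
proof (induction k)
  case (Suc k)
  have "(f ^^ k) a \<in> C" using assms funpow_in_image by metis
  then show ?case using Suc assms(2) by simp
qed auto

lemma cyc_on_cong:
  assumes "cyc_on f C" "\<And>x. x \<in> C \<Longrightarrow> f x = g x"
  shows "cyc_on g C"
proof -
  have "g ` C = f ` C" using assms(2) by (metis image_cong)
  then have "g ` C = C" using assms(1) by (simp add: cyc_on_def)
  moreover have "(f ^^ k) a = (g ^^ k) a" if "a \<in> C" for a k
    using funpow_agree[of f C g a k] assms that by (auto simp: cyc_on_def)
  ultimately show ?thesis using assms(1) by (auto simp: cyc_on_def)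
qed

text \<open>Let \<open>m\<close> be the least return time of \<open>a\<close>. Injectivity on
  \<open>C\<close> makes the first \<open>m\<close> iterates distinct; transitivity and reduction of
  exponents modulo \<open>m\<close> make them exhaust \<open>C\<close>. So \<open>m\<close> is the
  length of the cycle.\<close>

lemma cyc_on_funpow_eq:
  assumes "cyc_on f C" "a \<in> C"
  shows "(f ^^ k) a = a \<longleftrightarrow> card C dvd k"
proof -
  have fC: "finite C" "f ` C = C" and tr: "\<And>a b. a \<in> C \<Longrightarrow> b \<in> C \<Longrightarrow> \<exists>k. (f ^^ k) a = b"
    using assms by (auto simp: cyc_on_def)
  have inj: "inj_on f C" using fC by (simp add: finite_surj_inj eq_card_imp_inj_on)
  obtain j where j: "(f ^^ j) (f a) = a" using tr[of "f a" a] fC assms(2) by auto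
  have ex: "\<exists>m>0. (f ^^ m) a = a"
    using j by (intro exI[of _ "Suc j"]) (auto simp del: funpow.simps simp: funpow_Suc_right)
  define m where "m = (LEAST m. m > 0 \<and> (f ^^ m) a = a)"
  have m: "m > 0" "(f ^^ m) a = a" using LeastI_ex[OF ex] by (auto simp: m_def)
  have mmin: "\<not> (f ^^ i) a = a" if "0 < i" "i < m" for i
    using not_less_Least[of i "\<lambda>m. m > 0 \<and> (f ^^ m) a = a"] that by (auto simp: m_def)
  have mult: "(f ^^ (m * q)) a = a" for q
    by (induction q) (auto simp: funpow_add m)
  have modm: "(f ^^ k) a = (f ^^ (k mod m)) a" for k
  proof -
    have "(f ^^ k) a = (f ^^ (k mod m + m * (k div m))) a" by simp
    also have "\<dots> = (f ^^ (k mod m)) a" by (simp only: funpow_add_apply mult)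
    finally show ?thesis .
  qed
  have injp: "inj_on (f ^^ k) C" for k
    using image_funpow[OF fC(2)] fC(1) by (simp add: eq_card_imp_inj_on)
  have injm: "inj_on (\<lambda>k. (f ^^ k) a) {..<m}"
  proof (rule linorder_inj_onI)
    fix i j assume ij: "i < j" "i \<in> {..<m}" "j \<in> {..<m}"
    show "(f ^^ i) a \<noteq> (f ^^ j) a"
    proof
      assume eq: "(f ^^ i) a = (f ^^ j) a"
      have "(f ^^ j) a = (f ^^ i) ((f ^^ (j - i)) a)"
        using ij by (simp flip: funpow_add_apply)
      then have "(f ^^ i) a = (f ^^ i) ((f ^^ (j - i)) a)" using eq by simp
      then have "a = (f ^^ (j - i)) a"
        using inj_onD[OF injp[of i]] assms(2) funpow_in_image[OF fC(2)] by blast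
      then have "(f ^^ (j - i)) a = a" by (rule sym)
      moreover have "0 < j - i" "j - i < m" using ij by auto
      ultimately show False using mmin by blast
    qed
  qed auto
  have "C = (\<lambda>k. (f ^^ k) a) ` {..<m}"
  proof
    show "C \<subseteq> (\<lambda>k. (f ^^ k) a) ` {..<m}"
    proof
      fix b assume "b \<in> C"
      then obtain k where "(f ^^ k) a = b" using tr assms by blast
      then show "b \<in> (\<lambda>k. (f ^^ k) a) ` {..<m}" using modm[of k] m(1) by auto
    qed
  qed (use funpow_in_image[OF fC(2)] assms in auto)
  then have card: "card C = m" using card_image[OF injm] by simp
  show ?thesis
  proof
    assume "(f ^^ k) a = a"
    then have "(f ^^ (k mod m)) a = a" using modm by metis
    then have "k mod m = 0" using mmin[of "k mod m"] m(1) by fastforce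
    then show "card C dvd k" using card by auto
  next
    assume "card C dvd k"
    then show "(f ^^ k) a = a" using mult card by (auto elim!: dvdE)
  qed
qed

lemma cyc_on_funpow_mod:
  assumes "cyc_on f C" "a \<in> C" "[i = j] (mod card C)"
  shows "(f ^^ i) a = (f ^^ j) a"
proof -
  have *: "(f ^^ i) a = (f ^^ (i mod card C)) a" for i
  proof -
    have "(f ^^ i) a = (f ^^ (i mod card C + card C * (i div card C))) a" by simp
    also have "\<dots> = (f ^^ (i mod card C)) a"
      using cyc_on_funpow_eq[OF assms(1,2), of "card C * (i div card C)"]
      by (simp only: funpow_add_apply) simp
    finally show ?thesis .
  qed
  show ?thesis using *[of i] *[of j] assms(3) by (simp add: cong_def)
qed

lemma funpow_funpow: "((f :: 'a \<Rightarrow> 'a) ^^ m) ^^ k = f ^^ (m * k)"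
  by (induction k) (auto simp: funpow_add)

lemma cyc_on_coprime_power:
  assumes "cyc_on f C" "coprime m (card C)"
  shows "cyc_on (f ^^ m) C"
  unfolding cyc_on_def
proof (intro conjI ballI)
  show "finite C" "(f ^^ m) ` C = C" using assms by (auto simp: cyc_on_def intro!: image_funpow)
  fix a b assume "a \<in> C" "b \<in> C"
  then obtain k where k: "(f ^^ k) a = b" using cyc_onD[OF assms(1)] by blast
  obtain j where "[m * j = 1] (mod card C)" using cong_solve_coprime_nat assms(2) by auto
  then have "[m * j * k = 1 * k] (mod card C)" by (rule cong_scalar_right)
  then have "(f ^^ (m * (j * k))) a = b"
    using cyc_on_funpow_mod[OF assms(1) \<open>a \<in> C\<close>] k by (metis mult.assoc mult_1)
  then show "\<exists>k. ((f ^^ m) ^^ k) a = b" by (metis funpow_funpow)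
qed

lemma cyc_on_fixed_point_free:
  assumes "cyc_on f C" "\<not> card C dvd m" "a \<in> C"
  shows "(f ^^ m) a \<noteq> a"
  using cyc_on_funpow_eq assms by metis

lemma cyc_on_invariant_subset:
  assumes "cyc_on f C" "f ` W = W"
  shows "W \<inter> C = {} \<or> C \<subseteq> W"
proof (cases "W \<inter> C = {}")
  case False
  then obtain a where "a \<in> W" "a \<in> C" by auto
  have "C \<subseteq> W"
  proof
    fix b assume "b \<in> C"
    then obtain k where "(f ^^ k) a = b" using cyc_onD[OF assms(1) \<open>a \<in> C\<close>] by blast
    then show "b \<in> W" using funpow_in_image[OF assms(2) \<open>a \<in> W\<close>] by metis
  qed
  then show ?thesis by simp
qed auto

lemma conj_funpow:
  assumes "inj h" "surj h"
  shows "((h \<circ> f \<circ> inv' h) ^^ k) = h \<circ> (f ^^ k) \<circ> inv' h"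
proof (induction k)
  case 0
  then show ?case using assms by (simp add: surj_iff)
next
  case (Suc k)
  have ih: "inv' h (h x) = x" for x using assms by simp
  have "(h \<circ> f \<circ> inv' h) \<circ> (h \<circ> (f ^^ k) \<circ> inv' h) = h \<circ> (f \<circ> (f ^^ k)) \<circ> inv' h"
    by (simp add: fun_eq_iff ih)
  then show ?case by (simp only: funpow.simps Suc)
qed

lemma cyc_on_conj:
  assumes "cyc_on f C" "bij h"
  shows "cyc_on (h \<circ> f \<circ> inv' h) (h ` C)"
proof -
  have ih: "inv' h (h x) = x" for x using assms(2) by (simp add: bij_is_inj)
  have "(h \<circ> f \<circ> inv' h) ` h ` C = h ` f ` C" by (simp add: image_comp[symmetric] image_image ih)
  moreover have "((h \<circ> f \<circ> inv' h) ^^ k) (h a) = h ((f ^^ k) a)" for a k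
    using conj_funpow[where h = h and f = f and k = k] assms(2) ih by (simp add: bij_is_inj bij_is_surj)
  ultimately show ?thesis using assms(1) unfolding cyc_on_def
    by (simp del: comp_apply) metis
qed

(* A fixed point contributes a part 1, so the parts add up to the number of points. *)
fun ctype :: "('a \<Rightarrow> 'a) \<Rightarrow> 'a set \<Rightarrow> nat list \<Rightarrow> bool" where
  "ctype f \<Omega> [] \<longleftrightarrow> \<Omega> = {}"
| "ctype f \<Omega> (l # ls) \<longleftrightarrow>
     (\<exists>C\<subseteq>\<Omega>. card C = l \<and> 0 < l \<and> cyc_on f C \<and> ctype f (\<Omega> - C) ls)"

text \<open>By \<open>ctype_invariant_card\<close> these are the only possible sizes of invariant
  sets; hence the orbit sizes of a group are subset sums of every cycle type that occurs in
  it.\<close>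

fun ssums :: "nat list \<Rightarrow> nat set" where
  "ssums [] = {0}"
| "ssums (l # ls) = ssums ls \<union> (+) l ` ssums ls"

lemma ctype_cong:
  "ctype f \<Omega> ls \<Longrightarrow> (\<And>x. x \<in> \<Omega> \<Longrightarrow> f x = g x) \<Longrightarrow> ctype g \<Omega> ls"
proof (induction ls arbitrary: \<Omega>)
  case (Cons l ls)
  then obtain C where C: "C \<subseteq> \<Omega>" "card C = l" "0 < l" "cyc_on f C" "ctype f (\<Omega> - C) ls" by auto
  have "cyc_on g C" using C Cons.prems by (metis cyc_on_cong subsetD)
  moreover have "ctype g (\<Omega> - C) ls" using C Cons by auto
  ultimately show ?case using C by auto
qed auto

lemma ctype_conj:
  "ctype f \<Omega> ls \<Longrightarrow> bij h \<Longrightarrow> ctype (h \<circ> f \<circ> inv' h) (h ` \<Omega>) ls"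
proof (induction ls arbitrary: \<Omega>)
  case (Cons l ls)
  then obtain C where C: "C \<subseteq> \<Omega>" "card C = l" "0 < l" "cyc_on f C" "ctype f (\<Omega> - C) ls" by auto
  have "ctype (h \<circ> f \<circ> inv' h) (h ` (\<Omega> - C)) ls" using C(5) Cons.prems(2) by (rule Cons.IH)
  moreover have "h ` (\<Omega> - C) = h ` \<Omega> - h ` C" using Cons.prems by (simp add: bij_is_inj image_set_diff)
  moreover have "card (h ` C) = l" using Cons.prems(2) C(2)
    by (metis bij_is_inj card_image inj_on_subset subset_UNIV)
  moreover have "h ` C \<subseteq> h ` \<Omega>" using C by auto
  ultimately show ?case using C cyc_on_conj[OF C(4) Cons.prems(2)] by (auto simp del: comp_apply)
qed auto

text \<open>An invariant set contains every cycle that it meets, so removing one cycle from the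
  domain and from \<open>W\<close> leaves an invariant set of the remaining cycles.\<close>

lemma ctype_invariant_card:
  "ctype f \<Omega> ls \<Longrightarrow> finite \<Omega> \<Longrightarrow> W \<subseteq> \<Omega> \<Longrightarrow> f ` W = W \<Longrightarrow> inj_on f \<Omega> \<Longrightarrow> card W \<in> ssums ls"
proof (induction ls arbitrary: \<Omega> W)
  case (Cons l ls)
  then obtain C where C: "C \<subseteq> \<Omega>" "card C = l" "cyc_on f C" "ctype f (\<Omega> - C) ls" by auto
  have fin: "finite W" using Cons.prems finite_subset by blast
  have "f ` (W - C) = f ` W - f ` C" using Cons.prems C by (intro inj_on_image_set_diff[of f \<Omega>]) auto
  then have "f ` (W - C) = W - C" using Cons.prems C by (simp add: cyc_on_def)
  then have IH: "card (W - C) \<in> ssums ls"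
    using Cons.prems C by (intro Cons.IH[of "\<Omega> - C"]) (auto intro: inj_on_subset)
  from cyc_on_invariant_subset[OF C(3) Cons.prems(4)] show ?case
  proof
    assume "W \<inter> C = {}"
    then have "W - C = W" by blast
    then show ?thesis using IH by simp
  next
    assume "C \<subseteq> W"
    then have "card W = l + card (W - C)" using C fin
      by (metis card_Diff_subset card_mono finite_subset le_add_diff_inverse)
    then show ?thesis using IH by simp
  qed
qed auto

lemma ctype_funpow_id:
  "ctype f \<Omega> ls \<Longrightarrow> (\<And>l. l \<in> set ls \<Longrightarrow> l dvd m) \<Longrightarrow> x \<in> \<Omega> \<Longrightarrow> (f ^^ m) x = x"
proof (induction ls arbitrary: \<Omega>)
  case (Cons l ls)
  then obtain C where C: "C \<subseteq> \<Omega>" "card C = l" "cyc_on f C" "ctype f (\<Omega> - C) ls" by auto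
  show ?case
  proof (cases "x \<in> C")
    case True
    then show ?thesis using cyc_on_funpow_eq[OF C(3)] C(2) Cons.prems by auto
  next
    case False
    then show ?thesis using Cons.IH[OF C(4)] Cons.prems by auto
  qed
qed auto

text \<open>Composition with the transposition of \<open>a\<close> and \<open>b\<close> inserts the
  new point \<open>b\<close> between \<open>a\<close> and \<open>f a\<close>. Each insertion changes
  the parity.\<close>

lemma cycle_exists:
  "finite C \<Longrightarrow> C \<noteq> {} \<Longrightarrow> \<exists>f. f permutes C \<and> cyc_on f C \<and> (evenperm f \<longleftrightarrow> odd (card C))"
proof (induction rule: finite_ne_induct)
  case (singleton x)
  show ?case by (rule exI[of _ id], simp add: cyc_on_def, rule conjI, simp add: fun_eq_iff, rule exI[of _ 0], simp)
next
  case (insert b C)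
  then obtain f a where f: "f permutes C" "cyc_on f C" "evenperm f \<longleftrightarrow> odd (card C)" and a: "a \<in> C" by auto
  define g where "g = f \<circ> transpose a b"
  have "a \<noteq> b" using a insert by auto
  have fb: "f b = b" using f(1) insert permutes_not_in by metis
  have gp: "g permutes insert b C"
    unfolding g_def using a permutes_subset[OF f(1), of "insert b C"]
    by (intro permutes_compose permutes_swap_id) auto
  have pf: "permutation f" using f(1) insert.hyps permutation_permutes by blast
  have "evenperm g \<longleftrightarrow> (evenperm f \<longleftrightarrow> evenperm (transpose a b))"
    unfolding g_def using evenperm_comp[OF pf permutation_swap_id] .
  then have ev: "evenperm g \<longleftrightarrow> odd (card (insert b C))"
    using f(3) insert \<open>a \<noteq> b\<close> by (simp add: evenperm_swap)
  have ga: "g a = b" "g b = f a" "\<And>x. x \<in> C \<Longrightarrow> x \<noteq> a \<Longrightarrow> g x = f x"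
    using \<open>a \<noteq> b\<close> fb insert by (auto simp: g_def transpose_def)
  have step: "\<exists>j. (g ^^ j) x = f x" if "x \<in> C" for x
  proof (cases "x = a")
    case True
    then show ?thesis using ga by (intro exI[of _ 2]) (simp add: numeral_2_eq_2)
  next
    case False
    then show ?thesis using ga that by (intro exI[of _ 1]) simp
  qed
  have reach: "\<exists>j. (g ^^ j) x = (f ^^ k) x" if "x \<in> C" for x k
  proof (induction k)
    case (Suc k)
    then obtain j where j: "(g ^^ j) x = (f ^^ k) x" by auto
    have "(f ^^ k) x \<in> C" using f that by (simp add: cyc_on_def funpow_in_image)
    then obtain i where "(g ^^ i) ((f ^^ k) x) = f ((f ^^ k) x)" using step by blast
    then have "(g ^^ (i + j)) x = (f ^^ Suc k) x" using j by (simp add: funpow_add)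
    then show ?case by blast
  qed (rule exI[of _ 0], simp)
  have reachC: "\<exists>j. (g ^^ j) x = y" if xy: "x \<in> C" "y \<in> C" for x y
  proof -
    obtain k where "(f ^^ k) x = y" using cyc_onD[OF f(2) xy] by blast
    then show ?thesis using reach[OF xy(1), of k] by simp
  qed
  have "\<exists>j. (g ^^ j) x = y" if xy: "x \<in> insert b C" "y \<in> insert b C" for x y
  proof -
    have "\<exists>i x'. x' \<in> C \<and> (g ^^ i) x = x'"
    proof (cases "x = b")
      case True
      then show ?thesis using ga f a by (intro exI[of _ 1]) (auto simp: cyc_on_def)
    next
      case False
      then show ?thesis using xy by (intro exI[of _ 0]) auto
    qed
    then obtain i x' where x': "x' \<in> C" "(g ^^ i) x = x'" by blast
    have "\<exists>j. (g ^^ j) x' = y"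
    proof (cases "y = b")
      case True
      obtain j where "(g ^^ j) x' = a" using reachC x' a by blast
      then show ?thesis using ga True by (intro exI[of _ "Suc j"]) simp
    next
      case False
      then show ?thesis using reachC x' xy by auto
    qed
    then obtain j where "(g ^^ j) x' = y" by blast
    then show ?thesis using x' by (intro exI[of _ "j + i"]) (simp add: funpow_add)
  qed
  then have "cyc_on g (insert b C)"
    unfolding cyc_on_def using permutes_image[OF gp] insert.hyps(1) by blast
  then show ?case using gp ev by blast
qed

text \<open>A cycle of length l has the parity of l - 1, so the parity of a permutation is that of
  the number of points plus the number of cycles, fixed points included. The later conditions
  \<open>even (n + length ls)\<close> come from here.\<close>

lemma ctype_exists:
  assumes "finite \<Omega>" "sum_list ls = card \<Omega>" "0 \<notin> set ls"
  shows "\<exists>f. f permutes \<Omega> \<and> ctype f \<Omega> ls \<and> (evenperm f \<longleftrightarrow> even (card \<Omega> + length ls))"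
  using assms
proof (induction ls arbitrary: \<Omega>)
  case Nil
  then show ?case by (intro exI[of _ id]) auto
next
  case (Cons l ls)
  obtain C where C: "C \<subseteq> \<Omega>" "card C = l"
    using Cons.prems by (metis le_add1 obtain_subset_with_card_n sum_list.Cons)
  have fC: "finite C" using C Cons.prems finite_subset by auto
  have cO: "card (\<Omega> - C) + card C = card \<Omega>" using C fC Cons.prems
    by (simp add: card_Diff_subset card_mono)
  have "l > 0" using Cons.prems by auto
  then have "C \<noteq> {}" using C by auto
  obtain f where f: "f permutes C" "cyc_on f C" "evenperm f \<longleftrightarrow> odd (card C)"
    using cycle_exists[OF fC \<open>C \<noteq> {}\<close>] by blast
  have "\<exists>g. g permutes (\<Omega> - C) \<and> ctype g (\<Omega> - C) ls \<and> (evenperm g \<longleftrightarrow> even (card (\<Omega> - C) + length ls))"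
    using Cons.prems C cO by (intro Cons.IH) auto
  then obtain g where g: "g permutes (\<Omega> - C)" "ctype g (\<Omega> - C) ls"
    "evenperm g \<longleftrightarrow> even (card (\<Omega> - C) + length ls)" by blast
  define h where "h = f \<circ> g"
  have hC: "h x = f x" if "x \<in> C" for x using g(1) that permutes_not_in[of g "\<Omega> - C" x] by (auto simp: h_def)
  have hD: "h x = g x" if "x \<in> \<Omega> - C" for x
  proof -
    have "g x \<in> \<Omega> - C" using permutes_in_image[OF g(1)] that by blast
    then show ?thesis using f(1) permutes_not_in[of f C "g x"] by (auto simp: h_def)
  qed
  have perm: "h permutes \<Omega>" unfolding h_def
    using f g C by (intro permutes_compose) (auto intro: permutes_subset)
  have "cyc_on h C" using f(2) hC by (metis cyc_on_cong subsetD)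
  moreover have "ctype h (\<Omega> - C) ls" using g(2) hD by (metis ctype_cong)
  moreover have "evenperm h \<longleftrightarrow> even (card \<Omega> + length (l # ls))"
  proof -
    have "permutation f" "permutation g"
      using f g fC Cons.prems permutation_permutes by (metis, metis finite_Diff)
    then have "evenperm h \<longleftrightarrow> (evenperm f \<longleftrightarrow> evenperm g)" unfolding h_def by (rule evenperm_comp)
    then show ?thesis using f g by (auto simp flip: cO)
  qed
  ultimately show ?case using perm C \<open>l > 0\<close> by auto
qed

section \<open>Permutation groups\<close>

definition moved :: "('a \<Rightarrow> 'a) \<Rightarrow> 'a set" where
  "moved f = {x. f x \<noteq> x}"

definition c3 :: "'a \<Rightarrow> 'a \<Rightarrow> 'a \<Rightarrow> 'a \<Rightarrow> 'a" where
  "c3 a b c = transpose a b \<circ> transpose b c"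

lemma c3_apply: "distinct [a, b, c] \<Longrightarrow> c3 a b c x = (if x = a then b else if x = b then c else if x = c then a else x)"
  by (auto simp: c3_def transpose_def)

lemma moved_conj:
  fixes h f :: "'a \<Rightarrow> 'a"
  assumes h: "bij h"
  shows "moved (h \<circ> f \<circ> inv' h) = h ` moved f"
proof -
  from h have "inv' h (h x) = x" "h (inv' h x) = x" for x
    by (simp_all add: bij_is_inj bij_is_surj surj_f_inv_f)
  then show ?thesis by (auto simp: moved_def image_iff) metis+
qed

lemma moved_cyc_on:
  assumes "cyc_on f C" "2 \<le> card C" "\<And>z. z \<notin> C \<Longrightarrow> f z = z"
  shows "moved f = C"
proof -
  have "f z \<noteq> z" if "z \<in> C" for z
    using cyc_on_fixed_point_free[OF assms(1) _ that, of 1] assms(2) by auto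
  then show ?thesis using assms(3) by (auto simp: moved_def)
qed

text \<open>The source of 3-cycles in the whole development. A point other than \<open>c\<close> is
  moved by at most one of \<open>x\<close> and \<open>y\<close>, which leaves little freedom; the
  commutator is evaluated at points written as \<open>y (x w)\<close>, where it gives
  \<open>x (y w)\<close>, so that no inverses have to be computed.\<close>

lemma moved_commutator:
  assumes "bij x" "bij y" "moved x \<inter> moved y = {c}"
  shows "moved (x \<circ> y \<circ> inv' x \<circ> inv' y) = {c, x c, y c}" "card {c, x c, y c} = 3"
proof -
  note inj = bij_is_inj[OF assms(1)] bij_is_inj[OF assms(2)]
  have ix: "inv' x z = w \<longleftrightarrow> z = x w" for z w
    using assms(1) by (metis bij_inv_eq_iff)
  have iy: "inv' y z = w \<longleftrightarrow> z = y w" for z w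
    using assms(2) by (metis bij_inv_eq_iff)
  have xm: "x z \<in> moved x \<longleftrightarrow> z \<in> moved x" for z using inj by (auto simp: moved_def inj_eq)
  have ym: "y z \<in> moved y \<longleftrightarrow> z \<in> moved y" for z using inj by (auto simp: moved_def inj_eq)
  have c: "x c \<noteq> c" "y c \<noteq> c" using assms(3) by (auto simp: moved_def)
  have cm: "c \<in> moved x" "c \<in> moved y" using assms(3) by auto
  have meet: "z = c" if "z \<in> moved x" "z \<in> moved y" for z using assms(3) that by auto
  have ne: "x c \<noteq> y c" using meet[of "x c"] xm[of c] ym[of c] cm c by auto
  show "card {c, x c, y c} = 3" using c ne by auto
  let ?q = "x \<circ> y \<circ> inv' x \<circ> inv' y"
  have fix_x: "x z = z" if "z \<notin> moved x" for z using that by (simp add: moved_def)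
  have fix_y: "y z = z" if "z \<notin> moved y" for z using that by (simp add: moved_def)
  have q: "?q (y (x w)) = x (y w)" for w using inj by simp
  have "?q z = z" if z: "z \<notin> {c, x c, y c}" for z
  proof -
    obtain w where w: "z = y (x w)" using assms by (metis bij_pointE)
    have qz: "?q z = x (y w)" unfolding w by (rule q)
    consider "z \<notin> moved x" "z \<notin> moved y" | "z \<in> moved x" "z \<notin> moved y" | "z \<in> moved y" "z \<notin> moved x"
      using meet z by blast
    then show ?thesis
    proof cases
      case 1
      then have "x w = z" using w ym fix_y by metis
      then have "w = z" using 1 xm fix_x by metis
      then show ?thesis using qz 1 fix_x fix_y by metis
    next
      case 2
      then have xw: "x w = z" using w ym fix_y by metis
      then have "w \<in> moved x" "w \<noteq> c" using 2 xm z by auto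
      then have "y w = w" using meet fix_y by blast
      then show ?thesis using qz xw by metis
    next
      case 3
      then have "x w \<in> moved y" using w ym by simp
      moreover have "x w \<noteq> c" using w z by auto
      ultimately have "x w \<notin> moved x" using meet by blast
      then have "x w = w" using xm fix_x by blast
      then have "y w = z" using w by simp
      then show ?thesis using qz fix_x[OF 3(2)] by metis
    qed
  qed
  moreover have "?q c \<noteq> c"
  proof -
    obtain w where w: "c = y (x w)" using assms by (metis bij_pointE)
    have qz: "?q c = x (y w)" unfolding w by (rule q)
    have "x w \<in> moved y" using w ym cm by metis
    moreover have "x w \<noteq> c" using w c by auto
    ultimately have "x w \<notin> moved x" using meet by blast
    then have "x w = w" using xm fix_x by blast
    then show ?thesis using qz w c by metis
  qed
  moreover have "?q (x c) \<noteq> x c"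
  proof -
    have "x c \<notin> moved y" using meet[of "x c"] xm cm c by auto
    then have "y (x c) = x c" using fix_y by simp
    moreover have "x (y c) = y c" using meet[of "y c"] ym cm c fix_x by blast
    ultimately show ?thesis using q[of c] ne by metis
  qed
  moreover have "?q (y c) \<noteq> y c"
  proof -
    obtain w where w: "x w = c" using assms by (metis bij_pointE)
    then have "w \<in> moved x" "w \<noteq> c" using xm cm c by auto
    then have "y w = w" using meet fix_y by blast
    then show ?thesis using q[of w] w c by metis
  qed
  ultimately show "moved ?q = {c, x c, y c}" by (auto simp: moved_def simp del: comp_apply)
qed

text \<open>Induction on the number of points of \<open>F\<close> missing from \<open>E\<close>:
  each exchange replaces a point of \<open>E - F\<close> by one of \<open>F - E\<close>.\<close>

lemma exchange_closed_all:
  assumes fin: "finite P" and start: "G \<in> \<O>" "G \<subseteq> P"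
    and step: "\<And>E a b. E \<in> \<O> \<Longrightarrow> E \<subseteq> P \<Longrightarrow> a \<in> E \<Longrightarrow> b \<in> P - E \<Longrightarrow> insert b (E - {a}) \<in> \<O>"
    and F: "F \<subseteq> P" "card F = card G"
  shows "F \<in> \<O>"
proof -
  have "F \<in> \<O>" if "E \<in> \<O>" "E \<subseteq> P" "card E = card F" "card (F - E) = d" for d E
    using that
  proof (induction d arbitrary: E)
    case 0
    have "finite F" "finite E" using F 0 fin finite_subset by auto
    then have "F \<subseteq> E" using 0 by auto
    then have "F = E" using 0 \<open>finite E\<close> by (simp add: card_subset_eq)
    then show ?case using 0 by simp
  next
    case (Suc d)
    have fin': "finite F" "finite E" using F Suc fin finite_subset by auto
    obtain b where b: "b \<in> F - E" using Suc.prems(4) by (metis card.empty ex_in_conv nat.simps(3))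
    have "\<not> E \<subseteq> F"
      using b Suc.prems(3) card_subset_eq[OF fin'(1), of E] by auto
    then obtain a where a: "a \<in> E" "a \<notin> F" by auto
    have "insert b (E - {a}) \<in> \<O>" using step Suc.prems a b F by blast
    moreover have "insert b (E - {a}) \<subseteq> P" using Suc.prems b F by auto
    moreover have "card (insert b (E - {a})) = card F"
    proof -
      have "card (insert b (E - {a})) = Suc (card (E - {a}))" using b fin' by (simp add: card_insert_if)
      also have "\<dots> = card E" using a fin' by (metis card.remove)
      finally show ?thesis using Suc.prems(3) by simp
    qed
    moreover have "card (F - insert b (E - {a})) = d"
    proof -
      have "F - insert b (E - {a}) = (F - E) - {b}" using a by auto
      then show ?thesis using b Suc.prems(4) fin' by simp
    qed
    ultimately show ?case by (rule Suc.IH)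
  qed
  then show ?thesis using start F by simp
qed

text \<open>The translates of \<open>A\<close> under powers of \<open>f\<close> are pairwise equal
  or disjoint, cover \<open>U\<close> and have equal size.\<close>

lemma translates_card_dvd:
  assumes U: "finite U" "f ` U = U" "A \<subseteq> U"
    and cover: "U \<subseteq> (\<Union>k. (f ^^ k) ` A)"
    and blk: "\<And>k. (f ^^ k) ` A = A \<or> (f ^^ k) ` A \<inter> A = {}"
  shows "card A dvd card U"
proof -
  have inj: "inj_on (f ^^ k) U" for k
    using image_funpow[OF U(2)] U(1) by (simp add: eq_card_imp_inj_on)
  have sub: "(f ^^ k) ` A \<subseteq> U" for k using image_funpow[OF U(2), of k] U(3) by blast
  have card: "card ((f ^^ k) ` A) = card A" for k
    using inj[of k] U(3) by (meson card_image inj_on_subset)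
  have dis: "(f ^^ i) ` A = (f ^^ j) ` A \<or> (f ^^ i) ` A \<inter> (f ^^ j) ` A = {}" if "i \<le> j" for i j
  proof -
    have e: "(f ^^ j) ` A = (f ^^ i) ` (f ^^ (j - i)) ` A"
      using that by (simp add: image_comp funpow_add[symmetric])
    show ?thesis
    proof (cases "(f ^^ (j - i)) ` A = A")
      case False
      then have d: "(f ^^ (j - i)) ` A \<inter> A = {}" using blk by blast
      have "(f ^^ i) ` ((f ^^ (j - i)) ` A \<inter> A) = (f ^^ i) ` (f ^^ (j - i)) ` A \<inter> (f ^^ i) ` A"
        using inj[of i] sub U(3) by (rule inj_on_image_Int)
      then show ?thesis using d e by auto
    qed (use e in simp)
  qed
  let ?C = "range (\<lambda>k. (f ^^ k) ` A)"
  have UC: "\<Union>?C = U" using cover sub by blast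
  have "card A dvd card (\<Union>?C)"
  proof (rule dvd_partition)
    show "finite (\<Union>?C)" using UC U by simp
    show "\<forall>c\<in>?C. card A dvd card c" using card by auto
    show "\<forall>c1\<in>?C. \<forall>c2\<in>?C. c1 \<noteq> c2 \<longrightarrow> c1 \<inter> c2 = {}"
    proof (intro ballI impI)
      fix c1 c2 assume "c1 \<in> ?C" "c2 \<in> ?C" "c1 \<noteq> c2"
      then obtain i j where "c1 = (f ^^ i) ` A" "c2 = (f ^^ j) ` A" by auto
      then show "c1 \<inter> c2 = {}" using dis[of i j] dis[of j i] \<open>c1 \<noteq> c2\<close>
        by (metis Int_commute nat_le_linear)
    qed
  qed
  then show ?thesis using UC by simp
qed

text \<open>The group is a bare set of functions that fix everything outside \<Omega>. Stabilizers
  and subgroups then interpret the same locale directly, also over a smaller set of points.\<close>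

locale perm_group =
  fixes \<Omega> :: "'a set" and H :: "('a \<Rightarrow> 'a) set"
  assumes finite_Omega: "finite \<Omega>"
    and perm: "h \<in> H \<Longrightarrow> h permutes \<Omega>"
    and id_mem: "id \<in> H"
    and comp_mem: "f \<in> H \<Longrightarrow> g \<in> H \<Longrightarrow> f \<circ> g \<in> H"
    and inv_mem: "h \<in> H \<Longrightarrow> inv' h \<in> H"
begin

lemma finite_H: "finite H"
  by (rule finite_subset[OF _ finite_permutations[OF finite_Omega]]) (use perm in blast)

lemma bij_mem: "h \<in> H \<Longrightarrow> bij h"
  using perm permutes_bij by auto

lemma inv_apply [simp]: "h \<in> H \<Longrightarrow> inv' h (h x) = x" "h \<in> H \<Longrightarrow> h (inv' h x) = x"
  using perm permutes_inverses by metis+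

lemma apply_eq_iff [simp]: "h \<in> H \<Longrightarrow> h x = h y \<longleftrightarrow> x = y"
  by (metis inv_apply(1))

lemma apply_mem_iff [simp]: "h \<in> H \<Longrightarrow> h x \<in> \<Omega> \<longleftrightarrow> x \<in> \<Omega>"
  using perm permutes_in_image by metis

lemma image_Omega: "h \<in> H \<Longrightarrow> h ` \<Omega> = \<Omega>"
  using perm permutes_image by metis

lemma inj_mem: "h \<in> H \<Longrightarrow> inj_on h A"
  by (auto intro: inj_onI)

lemma fixes_outside: "h \<in> H \<Longrightarrow> x \<notin> \<Omega> \<Longrightarrow> h x = x"
  using perm permutes_not_in by metis

lemma pow_mem: "h \<in> H \<Longrightarrow> h ^^ k \<in> H"
  by (induction k) (auto intro: comp_mem id_mem)

lemma conj_mem: "h \<in> H \<Longrightarrow> f \<in> H \<Longrightarrow> h \<circ> f \<circ> inv' h \<in> H"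
  by (intro comp_mem inv_mem)

lemma moved_subset: "h \<in> H \<Longrightarrow> moved h \<subseteq> \<Omega>"
  using fixes_outside by (auto simp: moved_def)

lemma image_diff: "h \<in> H \<Longrightarrow> h ` (A - B) = h ` A - h ` B"
  by (simp add: bij_is_inj bij_mem image_set_diff)

lemma image_int: "h \<in> H \<Longrightarrow> h ` (A \<inter> B) = h ` A \<inter> h ` B"
  by (simp add: bij_is_inj bij_mem image_Int)

lemma card_image_mem: "h \<in> H \<Longrightarrow> card (h ` A) = card A"
  by (simp add: card_image inj_mem)

lemma inv_image [simp]: "h \<in> H \<Longrightarrow> inv' h ` h ` A = A" "h \<in> H \<Longrightarrow> h ` inv' h ` A = A"
  by (auto simp: image_image)

definition trans_on :: bool where
  "trans_on \<longleftrightarrow> (\<forall>a\<in>\<Omega>. \<forall>b\<in>\<Omega>. \<exists>h\<in>H. h a = b)"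

definition two_trans :: bool where
  "two_trans \<longleftrightarrow> (\<forall>a\<in>\<Omega>. \<forall>b\<in>\<Omega>. \<forall>c\<in>\<Omega>. \<forall>d\<in>\<Omega>. a \<noteq> b \<longrightarrow> c \<noteq> d \<longrightarrow> (\<exists>h\<in>H. h a = c \<and> h b = d))"

definition blk :: "'a set \<Rightarrow> bool" where
  "blk A \<longleftrightarrow> (\<forall>h\<in>H. h ` A = A \<or> h ` A \<inter> A = {})"

definition primitive :: bool where
  "primitive \<longleftrightarrow> trans_on \<and> (\<forall>A\<subseteq>\<Omega>. blk A \<longrightarrow> 2 \<le> card A \<longrightarrow> A = \<Omega>)"

text \<open>A permutation with three moved points is a 3-cycle (\<open>three_moved_is_c3\<close>).
  The number of moved points does not refer to \<Omega>, so the property passes from a point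
  stabilizer to the group.\<close>

definition has3 :: bool where
  "has3 \<longleftrightarrow> (\<exists>f\<in>H. card (moved f) = 3)"

lemma trans_onD: "trans_on \<Longrightarrow> a \<in> \<Omega> \<Longrightarrow> b \<in> \<Omega> \<Longrightarrow> \<exists>h\<in>H. h a = b"
  by (simp add: trans_on_def)

lemma two_transD:
  "two_trans \<Longrightarrow> a \<in> \<Omega> \<Longrightarrow> b \<in> \<Omega> \<Longrightarrow> c \<in> \<Omega> \<Longrightarrow> d \<in> \<Omega> \<Longrightarrow> a \<noteq> b \<Longrightarrow> c \<noteq> d
    \<Longrightarrow> \<exists>h\<in>H. h a = c \<and> h b = d"
  by (simp add: two_trans_def)

lemma blk_card_dvd:
  assumes "trans_on" "A \<subseteq> \<Omega>" "blk A" "A \<noteq> {}"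
  shows "card A dvd card \<Omega>"
proof -
  let ?C = "(\<lambda>h. h ` A) ` H"
  have UC: "\<Union>?C = \<Omega>"
  proof
    show "\<Omega> \<subseteq> \<Union>?C"
    proof
      fix b assume "b \<in> \<Omega>"
      obtain a where "a \<in> A" using assms by auto
      then obtain h where "h \<in> H" "h a = b" using trans_onD[OF assms(1), of a b] assms \<open>b \<in> \<Omega>\<close> by auto
      then show "b \<in> \<Union>?C" using \<open>a \<in> A\<close> by auto
    qed
  qed (use assms(2) in auto)
  have "card A dvd card (\<Union>?C)"
  proof (rule dvd_partition)
    show "finite (\<Union>?C)" using UC finite_Omega by simp
    show "\<forall>c\<in>?C. card A dvd card c" by (auto simp: card_image_mem)
    show "\<forall>c1\<in>?C. \<forall>c2\<in>?C. c1 \<noteq> c2 \<longrightarrow> c1 \<inter> c2 = {}"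
    proof (intro ballI impI)
      fix c1 c2 assume "c1 \<in> ?C" "c2 \<in> ?C" and ne: "c1 \<noteq> c2"
      then obtain h k where h: "h \<in> H" "k \<in> H" "c1 = h ` A" "c2 = k ` A" by auto
      have m: "inv' h \<circ> k \<in> H" using h comp_mem inv_mem by auto
      have "inv' h ` c2 \<noteq> A" using ne h inv_image(2) by metis
      then have "(inv' h \<circ> k) ` A \<noteq> A" using h by (simp add: image_comp)
      then have "(inv' h \<circ> k) ` A \<inter> A = {}" using assms(3) m unfolding blk_def by blast
      then have "h ` ((inv' h \<circ> k) ` A \<inter> A) = {}" by simp
      then have "h ` (inv' h \<circ> k) ` A \<inter> h ` A = {}" using h image_int by metis
      then show "c1 \<inter> c2 = {}" using h by (auto simp: image_comp image_image)
    qed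
  qed
  then show ?thesis using UC by simp
qed

text \<open>\<open>D\<close> is a translate of \<open>G\<close> that meets \<open>G\<close>, differs
  from it and has the largest overlap with it. If \<open>k\<close> changed \<open>D\<close> in fewer
  points, transport by the element carrying \<open>G\<close> to \<open>D\<close> would give a better
  translate of \<open>G\<close>; so small a change cannot make the image of \<open>D\<close>
  disjoint from \<open>D\<close>.\<close>

lemma minimal_exchange:
  assumes "G \<subseteq> \<Omega>" "\<not> blk G"
  obtains D where "D \<in> (\<lambda>h. h ` G) ` H" "D \<noteq> G" "D \<inter> G \<noteq> {}" "card (D - G) = card (G - D)"
    "\<And>k. k \<in> H \<Longrightarrow> card (D - k ` D) < card (G - D) \<Longrightarrow> k ` D = D"
proof -
  have fin: "finite G" using assms finite_Omega finite_subset by auto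
  let ?P = "\<lambda>h. h \<in> H \<and> h ` G \<noteq> G \<and> h ` G \<inter> G \<noteq> {}"
  obtain h0 where "?P h0" using assms(2) by (auto simp: blk_def)
  then obtain g where g: "?P g" and gmin: "\<And>h. ?P h \<Longrightarrow> card (G - g ` G) \<le> card (G - h ` G)"
    using ex_has_least_nat[of ?P h0 "\<lambda>h. card (G - h ` G)"] by blast
  let ?D = "g ` G"
  have finD: "finite ?D" using fin by simp
  have cD: "card ?D = card G" using g card_image_mem by blast
  show ?thesis
  proof
    show "?D \<in> (\<lambda>h. h ` G) ` H" "?D \<noteq> G" "?D \<inter> G \<noteq> {}" using g by auto
    show "card (?D - G) = card (G - ?D)"
      using cD fin finD card_Diff_subset_Int[of ?D G] card_Diff_subset_Int[of G ?D]
      by (simp add: Int_commute)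
    fix k assume k: "k \<in> H" and less: "card (?D - k ` ?D) < card (G - ?D)"
    define h where "h = inv' g \<circ> k \<circ> g"
    have hH: "h \<in> H" unfolding h_def using g k by (auto intro!: comp_mem inv_mem)
    have ig: "inv' g \<in> H" using g inv_mem by auto
    have hG: "h ` G = inv' g ` k ` ?D" by (simp add: h_def image_comp)
    have "G - h ` G = inv' g ` (?D - k ` ?D)"
      using image_diff[OF ig] g hG by auto
    then have c: "card (G - h ` G) = card (?D - k ` ?D)" using card_image_mem[OF ig] by simp
    show "k ` ?D = ?D"
    proof (rule ccontr)
      assume ne: "k ` ?D \<noteq> ?D"
      then have "h ` G \<noteq> G" using hG g by (metis inv_image(2))
      moreover have "h ` G \<inter> G \<noteq> {}"
      proof
        assume "h ` G \<inter> G = {}"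
        then have "G - h ` G = G" by auto
        then have "card G < card (G - ?D)" using c less by simp
        then show False using card_mono[OF fin, of "G - ?D"] by auto
      qed
      ultimately show False using gmin[of h] hH c less by simp
    qed
  qed
qed

text \<open>As \<open>k\<close> acts only inside \<open>G\<close>, it changes \<open>D\<close>
  exactly by what it changes in \<open>A\<close>. If \<open>A\<close> and its image overlapped
  without being equal, this change would be smaller than \<open>A\<close>, and minimality would make
  \<open>D\<close>, hence \<open>A\<close>, invariant.\<close>

lemma exchange_block_inside:
  assumes fin: "finite G" and A: "A = G - D"
    and min: "\<And>k. k \<in> H \<Longrightarrow> card (D - k ` D) < card (G - D) \<Longrightarrow> k ` D = D"
    and k: "k \<in> H" "k ` G = G" "\<And>z. z \<notin> G \<Longrightarrow> k z = z"
  shows "k ` A = A \<or> k ` A \<inter> A = {}"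
proof (rule ccontr)
  assume "\<not> ?thesis"
  then have ne: "k ` A \<noteq> A" "k ` A \<inter> A \<noteq> {}" by auto
  have kA: "k ` A = G - k ` D" using A image_diff k by simp
  have kout: "k ` (D - G) = D - G"
  proof -
    have "k ` (D - G) = (\<lambda>z. z) ` (D - G)" using k(3) by (intro image_cong) auto
    then show ?thesis by simp
  qed
  then have kD: "k ` D - G = D - G" using image_diff[OF k(1), of D G] k(2) by simp
  have "z \<in> k ` D \<longleftrightarrow> z \<in> D" if "z \<notin> G" for z using kD that by (metis DiffE DiffI)
  then have diff: "D - k ` D = k ` A - A" unfolding kA unfolding A by auto
  have fA: "finite A" "finite (k ` A)" using fin A by auto
  have "card (k ` A - A) < card (k ` A)" using ne fA by (intro psubset_card_mono) auto
  also have "card (k ` A) = card A" using card_image_mem k by simp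
  finally have "k ` D = D" using min[OF k(1)] diff A by simp
  then have "k ` A = A" using kA A by simp
  then show False using ne by simp
qed

text \<open>The mirror image of \<open>exchange_block_inside\<close>: now \<open>G\<close> is fixed
  pointwise and \<open>D\<close> changes only in its part \<open>B\<close> outside
  \<open>G\<close>.\<close>

lemma exchange_block_outside:
  assumes fin: "finite D" and B: "B = D - G" "card B = card (G - D)"
    and min: "\<And>k. k \<in> H \<Longrightarrow> card (D - k ` D) < card (G - D) \<Longrightarrow> k ` D = D"
    and k: "k \<in> H" "\<And>z. z \<in> G \<Longrightarrow> k z = z"
  shows "k ` B = B \<or> k ` B \<inter> B = {}"
proof (rule ccontr)
  assume "\<not> ?thesis"
  then have ne: "k ` B \<noteq> B" "k ` B \<inter> B \<noteq> {}" by auto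
  have kG: "k ` S = S" if "S \<subseteq> G" for S
  proof -
    have "k ` S = (\<lambda>z. z) ` S" using k(2) that by (intro image_cong) auto
    then show ?thesis by simp
  qed
  have kB: "k ` B = k ` D - G" using B image_diff[OF k(1), of D G] kG[of G] by simp
  have kDG: "k ` D \<inter> G = D \<inter> G" using image_int[OF k(1), of D G] kG[of G] kG[of "D \<inter> G"] by simp
  have "z \<in> k ` D \<longleftrightarrow> z \<in> D" if "z \<in> G" for z using kDG that by (metis IntE IntI)
  then have diff: "D - k ` D = B - k ` B" unfolding kB unfolding B by auto
  have fB: "finite B" using fin B by auto
  have "card (B - k ` B) < card B" using ne fB by (intro psubset_card_mono) auto
  then have "k ` D = D" using min[OF k(1)] diff B by simp
  then have "k ` B = B" using kB B by simp
  then show False using ne by simp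
qed

text \<open>If \<open>A\<close> contains \<open>a\<close> and \<open>a'\<close> but not
  \<open>b\<close>, take a cycle whose support contains \<open>a\<close> and \<open>b\<close> but
  not \<open>a'\<close>. A power of it carries \<open>a\<close> to \<open>b\<close> and fixes
  \<open>a'\<close>, so it preserves the block \<open>A\<close>, which then contains
  \<open>b\<close>. The bounds on \<open>p\<close> make room for such a support.\<close>

lemma block_trivial:
  assumes P: "finite P" "2 \<le> p" "p < card P"
    and cyc: "\<And>E. E \<subseteq> P \<Longrightarrow> card E = p \<Longrightarrow> \<exists>y\<in>H. cyc_on y E \<and> (\<forall>z. z \<notin> E \<longrightarrow> y z = z)"
    and A: "A \<subseteq> P" "blk A" "2 \<le> card A"
  shows "A = P"
proof (rule ccontr)
  assume "A \<noteq> P"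
  then obtain b where b: "b \<in> P" "b \<notin> A" using A by auto
  obtain a a' where a: "a \<in> A" "a' \<in> A" "a \<noteq> a'"
  proof -
    obtain S where S: "S \<subseteq> A" "card S = 2" using A(3) obtain_subset_with_card_n by metis
    then obtain u v where "S = {u, v}" "u \<noteq> v" by (auto simp: card_2_iff)
    then show ?thesis using that[of u v] S by auto
  qed
  have ne: "a \<noteq> b" "a' \<noteq> b" using a b by metis+
  have inP: "a \<in> P" "a' \<in> P" using a A by auto
  have c2: "card {a, b} \<le> p" using ne P by simp
  have cP: "p \<le> card (P - {a'})" using inP P by simp
  have sub: "{a, b} \<subseteq> P - {a'}" using a ne inP b by auto
  obtain E where E: "{a, b} \<subseteq> E" "E \<subseteq> P - {a'}" "card E = p"
    using exists_subset_between[OF c2 cP sub] P by auto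
  obtain y where y: "y \<in> H" "cyc_on y E" "\<And>z. z \<notin> E \<Longrightarrow> y z = z" using cyc[of E] E by auto
  obtain j where j: "(y ^^ j) a = b" using cyc_onD[OF y(2), of a b] E by auto
  have "a' \<notin> E" using E by auto
  then have "(y ^^ j) a' = a'" using y(3) funpow_fixed by metis
  then have "(y ^^ j) ` A \<inter> A \<noteq> {}" using a by (metis IntI empty_iff imageI)
  then have eq: "(y ^^ j) ` A = A" using A(2) pow_mem[OF y(1), of j] unfolding blk_def by blast
  have "b \<in> (y ^^ j) ` A" by (rule image_eqI[where f = "y ^^ j", OF j[symmetric] a(1)])
  then have "b \<in> A" unfolding eq .
  with b(2) show False by contradiction
qed

end

section \<open>Jordan's theorem: a primitive group with a 3-cycle contains the alternating
  group\<close>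

lemma c3_rotate: "distinct [a, b, c] \<Longrightarrow> c3 a b c = c3 b c a"
  by (auto simp: fun_eq_iff c3_apply)

lemma c3_square: "distinct [a, b, c] \<Longrightarrow> c3 a b c \<circ> c3 a b c = c3 a c b"
  by (auto simp: fun_eq_iff c3_apply)

lemma c3_conj:
  assumes "bij h" "distinct [a, b, c]"
  shows "h \<circ> c3 a b c \<circ> inv' h = c3 (h a) (h b) (h c)"
proof
  fix x
  obtain y where y: "x = h y" using assms(1) by (metis bij_pointE)
  have "distinct [h a, h b, h c]" using assms by (simp add: bij_is_inj inj_eq)
  then show "(h \<circ> c3 a b c \<circ> inv' h) x = c3 (h a) (h b) (h c) x"
    using assms by (simp add: y c3_apply bij_is_inj inj_eq)
qed

lemma moved_c3: "distinct [a, b, c] \<Longrightarrow> moved (c3 a b c) = {a, b, c}"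
  by (auto simp: moved_def c3_apply split: if_splits)

lemma three_moved_is_c3:
  assumes "bij f" "card (moved f) = 3"
  obtains a b c where "distinct [a, b, c]" "f = c3 a b c"
proof -
  have inj: "f u = f v \<longleftrightarrow> u = v" for u v using assms(1) by (simp add: bij_is_inj inj_eq)
  have fin: "finite (moved f)" using assms(2) card.infinite by fastforce
  have mv: "f z \<in> moved f \<longleftrightarrow> z \<in> moved f" for z using inj by (auto simp: moved_def)
  obtain a where a: "a \<in> moved f" using assms(2) by fastforce
  define b c where "b = f a" and "c = f b"
  have ab: "b \<in> moved f" "a \<noteq> b" using mv a by (auto simp: b_def moved_def)
  have bc: "c \<in> moved f" "b \<noteq> c" using mv ab by (auto simp: c_def moved_def)
  have ca: "c \<noteq> a"
  proof
    assume "c = a"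
    have "card (moved f - {a, b}) = 1" using assms(2) a ab fin by (simp add: card_Diff_subset)
    then obtain d where d: "moved f - {a, b} = {d}" by (auto simp: card_1_singleton_iff)
    have "f d \<in> moved f" "f d \<noteq> d" using d mv by (auto simp: moved_def)
    then have "f d = a \<or> f d = b" using d by auto
    then show False using inj b_def c_def \<open>c = a\<close> d by (metis DiffE insertI1 insertI2)
  qed
  have eq: "{a, b, c} = moved f"
    using a ab bc ca assms(2) fin by (intro card_subset_eq) auto
  have "f c \<in> {a, b, c}" using eq mv bc by blast
  moreover have "f c \<noteq> c" using bc by (simp add: moved_def)
  moreover have "f c \<noteq> b" using inj b_def ca by metis
  ultimately have "f c = a" by simp
  have "f x = c3 a b c x" for x
    using eq \<open>f c = a\<close> ab bc ca
    by (cases "x \<in> moved f") (auto simp: c3_apply b_def[symmetric] c_def[symmetric] moved_def)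
  then show ?thesis using that[of a b c] ab bc ca by (auto simp: fun_eq_iff)
qed

context perm_group
begin

lemma conj_c3_mem:
  assumes "h \<in> H" "c3 a b c \<in> H" "distinct [a, b, c]"
  shows "c3 (h a) (h b) (h c) \<in> H"
  using c3_conj[OF bij_mem[OF assms(1)] assms(3)] conj_mem[OF assms(1,2)] by simp

lemma c3_swap_mem: "c3 a b c \<in> H \<Longrightarrow> distinct [a, b, c] \<Longrightarrow> c3 a c b \<in> H"
  using c3_square comp_mem by metis

lemma c3_rotate_mem: "c3 a b c \<in> H \<Longrightarrow> distinct [a, b, c] \<Longrightarrow> c3 b c a \<in> H"
  using c3_rotate by metis

lemma c3_mem_Omega: "c3 a b c \<in> H \<Longrightarrow> distinct [a, b, c] \<Longrightarrow> a \<in> \<Omega> \<and> b \<in> \<Omega> \<and> c \<in> \<Omega>"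
  using moved_subset[of "c3 a b c"] moved_c3[of a b c] by auto

text \<open>Lying on a common 3-cycle of the group is an invariant equivalence relation on the
  points, so its classes are blocks, and by primitivity any two points lie on a common 3-cycle.
  Conjugations then produce the prescribed one.\<close>

lemma primitive_has3_all:
  assumes prim: "primitive" and h3: "has3"
    and abc: "distinct [a, b, c]" "a \<in> \<Omega>" "b \<in> \<Omega>" "c \<in> \<Omega>"
  shows "c3 a b c \<in> H"
proof -
  define R where "R u v \<longleftrightarrow> u = v \<or> (\<exists>w. distinct [u, v, w] \<and> c3 u v w \<in> H)" for u v
  have sym: "R v u" if uv: "R u v" for u v
  proof (cases "u = v")
    case False
    then obtain w where w: "distinct [u, v, w]" "c3 u v w \<in> H" using uv by (auto simp: R_def)
    have "c3 u w v \<in> H" using c3_swap_mem w by blast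
    then have "c3 v u w \<in> H" using c3_rotate_mem[of u w v] c3_rotate_mem[of w v u] w by auto
    moreover have "distinct [v, u, w]" using w by auto
    ultimately show ?thesis unfolding R_def by blast
  qed (simp add: R_def)
  have trans: "R u d" if uv: "R u v" and vd: "R v d" for u v d
  proof (cases "u = v \<or> v = d \<or> u = d")
    case False
    then obtain w e where w: "distinct [u, v, w]" "c3 u v w \<in> H" and e: "distinct [v, d, e]" "c3 v d e \<in> H"
      using uv vd by (auto simp: R_def)
    show ?thesis
    proof (cases "d = w")
      case True
      then have "c3 u d v \<in> H" using c3_swap_mem w by blast
      moreover have "distinct [u, d, v]" using False by auto
      ultimately show ?thesis unfolding R_def by blast
    next
      case dw: False
      have m: "c3 u w v \<in> H" using c3_swap_mem w by blast
      have dis: "distinct [u, w, v]" using w by auto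
      have "c3 u w v v = u" "c3 u w v d = d" using c3_apply[OF dis] False dw dis by auto
      \<comment> \<open>Conjugation by \<open>c3 u w v\<close> carries \<open>v\<close> to
        \<open>u\<close> and fixes \<open>d\<close>.\<close>
      then have "c3 u d (c3 u w v e) \<in> H" using conj_c3_mem[OF m e(2,1)] by simp
      moreover have "distinct [u, d, c3 u w v e]"
        using e False \<open>c3 u w v v = u\<close> \<open>c3 u w v d = d\<close> apply_eq_iff[OF m, of e v] apply_eq_iff[OF m, of e d]
        by auto
      ultimately show ?thesis unfolding R_def by blast
    qed
  qed (use uv vd in \<open>auto simp: R_def\<close>)
  have inv: "R (h u) (h v)" if h: "h \<in> H" and uv: "R u v" for h u v
  proof (cases "u = v")
    case False
    then obtain w where w: "distinct [u, v, w]" "c3 u v w \<in> H" using uv by (auto simp: R_def)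
    have "distinct [h u, h v, h w]" using w h by simp
    then show ?thesis using conj_c3_mem[OF h w(2,1)] unfolding R_def by blast
  qed (simp add: R_def)
  obtain f where f: "f \<in> H" "card (moved f) = 3" using h3 by (auto simp: has3_def)
  then obtain x y z where xyz: "distinct [x, y, z]" "f = c3 x y z"
    using three_moved_is_c3 bij_mem by metis
  have xO: "x \<in> \<Omega>" "y \<in> \<Omega>" using c3_mem_Omega f xyz by metis+
  define A where "A = {v \<in> \<Omega>. R x v}"
  have "blk A" unfolding blk_def
  proof
    fix h assume h: "h \<in> H"
    show "h ` A = A \<or> h ` A \<inter> A = {}"
    proof (cases "h ` A \<inter> A = {}")
      case False
      then obtain v where v: "R x v" "R x (h v)" by (auto simp: A_def)
      have xh: "R x (h x)" using v sym trans inv[OF h v(1)] by blast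
      have "h ` A \<subseteq> A"
      proof
        fix w assume "w \<in> h ` A"
        then obtain t where t: "w = h t" "t \<in> \<Omega>" "R x t" by (auto simp: A_def)
        then have "R x (h t)" using inv[OF h t(3)] xh trans by blast
        then show "w \<in> A" using t h by (simp add: A_def)
      qed
      moreover have "A \<subseteq> h ` A"
      proof
        fix w assume w: "w \<in> A"
        have ih: "inv' h \<in> H" using h inv_mem by auto
        have "R x w" using w by (simp add: A_def)
        then have "R (h x) w" by (rule trans[OF sym[OF xh]])
        then have "R x (inv' h w)" using inv[OF ih, of "h x" w] h by simp
        then have "inv' h w \<in> A" using w ih by (simp add: A_def)
        then show "w \<in> h ` A" using h by (intro image_eqI[of w h "inv' h w"]) simp_all
      qed
      ultimately show ?thesis by blast
    qed simp
  qed
  moreover have "2 \<le> card A"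
  proof -
    have "R x y" using f xyz unfolding R_def by blast
    moreover have "R x x" by (simp add: R_def)
    ultimately have "{x, y} \<subseteq> A" using xO by (simp add: A_def)
    moreover have "finite A" using finite_Omega by (simp add: A_def)
    ultimately have "card {x, y} \<le> card A" by (rule card_mono[rotated])
    then show ?thesis using xyz by simp
  qed
  moreover have "A \<subseteq> \<Omega>" by (auto simp: A_def)
  ultimately have "A = \<Omega>" using prim unfolding primitive_def by blast
  then have R: "R u v" if "u \<in> \<Omega>" "v \<in> \<Omega>" for u v
    using that sym trans unfolding A_def by blast
  obtain d where d: "distinct [a, b, d]" "c3 a b d \<in> H" using R[of a b] abc by (auto simp: R_def)
  show ?thesis
  proof (cases "d = c")
    case False
    have "d \<in> \<Omega>" using c3_mem_Omega d by metis
    then obtain f where f: "distinct [d, c, f]" "c3 d c f \<in> H" using R[of d c] abc False by (auto simp: R_def)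
    \<comment> \<open>Conjugation by \<open>c3 d c f\<close> carries \<open>d\<close> to
      \<open>c\<close>. It fixes \<open>a\<close> and \<open>b\<close> unless \<open>f\<close> is
      one of them; in that case a second conjugation brings the three points together, up to the
      orientation of the cycle.\<close>
    note ap = c3_apply[OF f(1)]
    consider "f = a" | "f = b" | "f \<noteq> a" "f \<noteq> b" by blast
    then show ?thesis
    proof cases
      case 1
      then have "c3 d b c \<in> H" using conj_c3_mem[OF f(2) d(2,1)] ap d abc by auto
      then have "c3 c b a \<in> H" using conj_c3_mem[OF f(2), of d b c] ap d abc 1 f by auto
      then show ?thesis using c3_swap_mem[of c b a] c3_rotate_mem[of c a b] abc by auto
    next
      case 2
      then have "c3 a d c \<in> H" using conj_c3_mem[OF f(2) d(2,1)] ap d abc by auto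
      then have "c3 a c b \<in> H" using conj_c3_mem[OF f(2), of a d c] ap d abc 2 f by auto
      then show ?thesis using c3_swap_mem[of a c b] abc by auto
    next
      case 3
      then show ?thesis using conj_c3_mem[OF f(2) d(2,1)] ap d abc f by auto
    qed
  qed (use d in simp)
qed

end

lemma alt_subset_of_primitive_has3:
  assumes "perm_group {1..n} H" "perm_group.primitive {1..n} H" "perm_group.has3 H"
  shows "carrier (alt_group n) \<subseteq> H"
proof -
  interpret perm_group "{1..n}" H by fact
  have c3: "p \<in> H" if p: "p \<in> three_cycles n" for p
  proof -
    obtain cs where cs: "p = cycle_of_list cs" "cycle cs" "length cs = 3" "set cs \<subseteq> {1..n}" using p by blast
    then obtain a b c where abc: "cs = [a, b, c]" using stupid_lemma by blast
    have "p = c3 a b c" using cs abc by (simp add: c3_def)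
    then show ?thesis using primitive_has3_all[OF assms(2,3)] cs abc by auto
  qed
  have "p \<in> H" if "p \<in> generate (alt_group n) (three_cycles n)" for p
    using that
  proof (induction rule: generate.induct)
    case one
    then show ?case using id_mem by (simp only: alt_group_one)
  next
    case (incl h)
    then show ?case using c3 by blast
  next
    case (inv h)
    then have "h \<in> carrier (alt_group n)" using three_cycles_incl by blast
    then have "inv\<^bsub>alt_group n\<^esub> h = inv' h" by (rule alt_group_inv_equality)
    moreover have "inv' h \<in> H" using inv c3 inv_mem by blast
    ultimately show ?case by simp
  next
    case (eng h1 h2)
    then show ?case using comp_mem by (simp only: alt_group_mult)
  qed
  then show ?thesis using alt_group_carrier_as_three_cycles by blast
qed

section \<open>From one cycle type to homogeneity, primitivity and a 3-cycle\<close>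

context perm_group
begin

lemma commutator_mem: "x \<in> H \<Longrightarrow> y \<in> H \<Longrightarrow> x \<circ> y \<circ> inv' x \<circ> inv' y \<in> H"
  by (intro comp_mem inv_mem)

lemma has3_of_meet:
  assumes "x \<in> H" "y \<in> H" "moved x \<inter> moved y = {c}"
  shows has3
  using moved_commutator[OF bij_mem[OF assms(1)] bij_mem[OF assms(2)] assms(3)] commutator_mem[OF assms(1,2)]
  unfolding has3_def by metis

lemma has3_of_meet_conj:
  assumes "x \<in> H" "h \<in> H" "moved x \<inter> h ` moved x = {c}"
  shows has3
  using has3_of_meet[OF assms(1) conj_mem[OF assms(2,1)]] moved_conj[OF bij_mem[OF assms(2)], of x] assms(3) by simp

text \<open>The two moved points do not form a block, so some translate of the pair meets it in
  exactly one point.\<close>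

lemma has3_of_transposition:
  assumes "primitive" "x \<in> H" "card (moved x) = 2" "3 \<le> card \<Omega>"
  shows has3
proof -
  let ?S = "moved x"
  have "\<not> blk ?S"
  proof
    assume "blk ?S"
    then have "?S = \<Omega>" using assms(1,3) moved_subset[OF assms(2)] unfolding primitive_def by simp
    then show False using assms(3,4) by simp
  qed
  then obtain h where h: "h \<in> H" "h ` ?S \<noteq> ?S" "h ` ?S \<inter> ?S \<noteq> {}" by (auto simp: blk_def)
  then obtain c where c: "c \<in> h ` ?S" "c \<in> ?S" by auto
  have "?S \<inter> h ` ?S = {c}"
  proof (rule ccontr)
    assume "?S \<inter> h ` ?S \<noteq> {c}"
    then obtain d where d: "d \<in> ?S" "d \<in> h ` ?S" "d \<noteq> c" using c by blast
    have fin: "finite ?S" using assms(3) card.infinite by fastforce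
    have "{c, d} = ?S" using c d assms(3) fin by (intro card_subset_eq) auto
    moreover have "{c, d} = h ` ?S"
      using c d card_image_mem[OF h(1), of ?S] assms(3) fin by (intro card_subset_eq) auto
    ultimately show False using h by simp
  qed
  then show ?thesis using has3_of_meet_conj assms h by blast
qed

lemma pointwise_stabilizer: "perm_group \<Omega> {h \<in> H. \<forall>z\<in>R. h z = z}"
proof
  fix h assume "h \<in> {h \<in> H. \<forall>z\<in>R. h z = z}"
  then have h: "h \<in> H" "\<And>z. z \<in> R \<Longrightarrow> h z = z" by auto
  have "inv' h z = z" if "z \<in> R" for z using inv_apply(1)[OF h(1), of z] h(2)[OF that] by simp
  then show "inv' h \<in> {h \<in> H. \<forall>z\<in>R. h z = z}" using inv_mem[OF h(1)] by simp
qed (use finite_Omega perm id_mem comp_mem in auto)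

lemma conj_cycle:
  assumes "h \<in> H" "cyc_on y G" "\<And>z. z \<notin> G \<Longrightarrow> y z = z"
  shows "cyc_on (h \<circ> y \<circ> inv' h) (h ` G)" "z \<notin> h ` G \<Longrightarrow> (h \<circ> y \<circ> inv' h) z = z"
proof -
  show "cyc_on (h \<circ> y \<circ> inv' h) (h ` G)" by (intro cyc_on_conj bij_mem assms)
  assume "z \<notin> h ` G"
  then have "inv' h z \<notin> G" using assms(1) image_eqI[of z h "inv' h z" G] by simp metis
  then show "(h \<circ> y \<circ> inv' h) z = z" using assms by simp
qed

text \<open>A single exchange between \<open>G\<close> and \<open>Q\<close> is spread in two stages:
  first to all subsets of \<open>P = G \<union> Q\<close> of the size of \<open>G\<close>, by
  elements fixing \<open>R\<close> pointwise, and then, by exchanging points of \<open>P\<close>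
  against points of \<open>R\<close>, to all of \<Omega>. The divisibility condition ensures that
  \<open>P\<close> is not a block.\<close>

lemma exchange_core:
  assumes tr: trans_on
    and y: "y \<in> H" "cyc_on y G" "\<And>z. z \<notin> G \<Longrightarrow> y z = z"
    and x: "x \<in> H" "\<And>z. z \<in> G \<Longrightarrow> x z = z" "cyc_on x Q" "cyc_on x R"
    and part: "G \<union> Q \<union> R = \<Omega>" "G \<inter> Q = {}" "G \<inter> R = {}" "Q \<inter> R = {}"
    and p: "2 \<le> card G"
    and ab: "a0 \<in> G" "b0 \<in> Q" "g \<in> H" "g ` G = insert b0 (G - {a0})"
    and nd: "R = {} \<or> \<not> card (G \<union> Q) dvd card \<Omega>"
    and F: "F \<subseteq> \<Omega>" "card F = card G"
  shows "\<exists>h\<in>H. h ` G = F"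
proof -
  have fin: "finite G" "finite Q" "finite R" using part(1) finite_Omega by (metis finite_Un)+
  have yG: "y ` G = G" using y by (simp add: cyc_on_image)
  have ypG: "(y ^^ i) ` G = G" for i using image_funpow[OF yG] .
  have yfix: "(y ^^ i) z = z" if "z \<notin> G" for i z using y(3)[OF that] funpow_fixed by metis
  have xfix: "(x ^^ i) z = z" if "z \<in> G" for i z using x(2)[OF that] funpow_fixed by metis
  have xQ: "(x ^^ i) ` Q = Q" for i using x(3) by (intro image_funpow) (simp add: cyc_on_image)
  have xG: "(x ^^ i) ` G = G" for i
  proof -
    have "(x ^^ i) ` G = (\<lambda>z. z) ` G" by (rule image_cong) (simp_all add: xfix)
    then show ?thesis by simp
  qed
  have step1: "\<exists>h\<in>H. h ` G = insert b (G - {a})" if ab': "a \<in> G" "b \<in> Q" for a b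
  proof -
    obtain i where i: "(y ^^ i) a0 = a" using cyc_onD[OF y(2) ab(1) ab'(1)] by blast
    obtain j where j: "(x ^^ j) b0 = b" using cyc_onD[OF x(3) ab(2) ab'(2)] by blast
    have mem: "y ^^ i \<in> H" "x ^^ j \<in> H" using pow_mem x y by auto
    have bG: "b \<notin> G" using ab' part by auto
    have "((y ^^ i) \<circ> (x ^^ j) \<circ> g) ` G = (y ^^ i) ` (x ^^ j) ` insert b0 (G - {a0})"
      using ab(4) by (simp only: image_comp[symmetric])
    also have "(x ^^ j) ` insert b0 (G - {a0}) = insert b (G - {a0})"
      using j xG[of j] xfix[OF ab(1), of j] image_diff[OF mem(2), of G "{a0}"] by simp
    also have "(y ^^ i) ` \<dots> = insert b (G - {a})"
      using i ypG[of i] yfix[OF bG, of i] image_diff[OF mem(1), of G "{a0}"] by simp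
    finally show ?thesis
      by (rule bexI[where P = "\<lambda>h. h ` G = insert b (G - {a})"]) (intro comp_mem mem ab(3))
  qed
  define K where "K = {h \<in> H. \<forall>z\<in>R. h z = z}"
  interpret K: perm_group \<Omega> K unfolding K_def by (rule pointwise_stabilizer)
  have KH: "k \<in> K \<Longrightarrow> k \<in> H" for k by (simp add: K_def)
  \<comment> \<open>The elements of \<open>step1\<close> may move \<open>R\<close>; they only serve
    to conjugate \<open>y\<close> to a cycle on \<open>D\<close>, which is \<open>G\<close> with
    some \<open>a'\<close> other than \<open>a\<close> replaced by \<open>b\<close>. A power of that
    cycle carries \<open>b\<close> to \<open>a\<close>, fixes \<open>a'\<close> and all of
    \<open>R\<close>, and so replaces \<open>a\<close> by \<open>b\<close> in
    \<open>G\<close>.\<close>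
  have step2: "\<exists>k\<in>K. k ` G = insert b (G - {a})" if ab: "a \<in> G" "b \<in> Q" for a b
  proof -
    have "\<not> G \<subseteq> {a}" using p fin card_mono[of "{a}" G] by auto
    then obtain a' where a': "a' \<in> G" "a' \<noteq> a" by auto
    have bG: "b \<notin> G" using ab part by auto
    obtain h where h: "h \<in> H" "h ` G = insert b (G - {a'})" using step1[OF a'(1) ab(2)] by blast
    define D where "D = insert b (G - {a'})"
    define y' where "y' = h \<circ> y \<circ> inv' h"
    have y': "y' \<in> H" "cyc_on y' D" "\<And>z. z \<notin> D \<Longrightarrow> y' z = z"
      using conj_cycle[OF h(1) y(2,3)] conj_mem[OF h(1) y(1)] h(2) by (auto simp: y'_def D_def)
    have "b \<in> D" "a \<in> D" using a' ab by (auto simp: D_def)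
    then obtain j where j: "(y' ^^ j) b = a" using cyc_onD[OF y'(2)] by blast
    have yjK: "y' ^^ j \<in> K" unfolding K_def
    proof (intro CollectI conjI ballI)
      show "y' ^^ j \<in> H" using y' pow_mem by auto
      fix z assume "z \<in> R"
      then have "z \<notin> D" using part ab by (auto simp: D_def)
      then show "(y' ^^ j) z = z" using y'(3) funpow_fixed by metis
    qed
    have yjD: "(y' ^^ j) ` D = D" using y'(2) by (intro image_funpow) (simp add: cyc_on_image)
    have "a' \<notin> D" using a' bG by (auto simp: D_def)
    then have "(y' ^^ j) a' = a'" using y'(3) funpow_fixed by metis
    moreover have "G = insert a' (D - {b})" using a' bG by (auto simp: D_def)
    ultimately have "(y' ^^ j) ` G = insert a' (D - {a})"
      using yjD j K.image_diff[OF yjK, of D "{b}"] by simp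
    also have "\<dots> = insert b (G - {a})" using a' bG ab by (auto simp: D_def)
    finally show ?thesis using yjK by blast
  qed
  define P where "P = G \<union> Q"
  have finP: "finite P" using fin by (simp add: P_def)
  have PR: "P = \<Omega> - R" using part by (auto simp: P_def)
  have KP: "k ` P = P" if "k \<in> K" for k
  proof -
    have "k ` R = (\<lambda>z. z) ` R" using that by (intro image_cong) (auto simp: K_def)
    then show ?thesis unfolding PR using K.image_diff[OF that] K.image_Omega[OF that] by simp
  qed
  have homP: "\<exists>k\<in>K. k ` G = E" if "E \<subseteq> P" "card E = card G" for E
  proof -
    have "E \<in> (\<lambda>k. k ` G) ` K"
    proof (rule exchange_closed_all[OF finP, of G])
      show "G \<in> (\<lambda>k. k ` G) ` K" by (rule image_eqI[of _ _ id], simp, rule K.id_mem)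
      show "G \<subseteq> P" by (auto simp: P_def)
      fix E a b assume E: "E \<in> (\<lambda>k. k ` G) ` K" "E \<subseteq> P" and a: "a \<in> E" and b: "b \<in> P - E"
      then obtain k where k: "k \<in> K" "E = k ` G" by auto
      obtain a' where a': "a' \<in> G" "a = k a'" using a k by auto
      have "b \<in> k ` P" using b KP[OF k(1)] by simp
      then obtain b' where b': "b' \<in> P" "b = k b'" by auto
      then have "b' \<in> Q" using b k by (auto simp: P_def)
      obtain k' where k': "k' \<in> K" "k' ` G = insert b' (G - {a'})" using step2[OF a'(1) \<open>b' \<in> Q\<close>] by blast
      have "(k \<circ> k') ` G = k ` insert b' (G - {a'})" using k'(2) by (simp only: image_comp[symmetric])
      also have "\<dots> = insert b (E - {a})" using k a' b' by (simp add: K.image_diff)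
      finally show "insert b (E - {a}) \<in> (\<lambda>k. k ` G) ` K" using k k' K.comp_mem by blast
    qed (use that in auto)
    then show ?thesis by auto
  qed
  show ?thesis
  proof (cases "R = {}")
    case True
    then have "P = \<Omega>" using PR by simp
    then show ?thesis using homP F KH by blast
  next
    case R: False
    have Kcyc: "\<exists>y\<in>K. cyc_on y E \<and> (\<forall>z. z \<notin> E \<longrightarrow> y z = z)" if E: "E \<subseteq> P" "card E = card G" for E
    proof -
      obtain k where k: "k \<in> K" "k ` G = E" using homP[OF E] by blast
      have yK: "y \<in> K" using y part by (auto simp: K_def)
      show ?thesis
        using K.conj_cycle[OF k(1) y(2,3)] K.conj_mem[OF k(1) yK] k(2) by blast
    qed
    have Ktrans: "\<exists>k\<in>K. k u = v" if uv: "u \<in> P" "v \<in> P" for u v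
    proof -
      have "card {u, v} \<le> card G" using p by (cases "u = v") auto
      moreover have "card G \<le> card P" using finP by (auto simp: P_def intro: card_mono)
      ultimately obtain E where E: "{u, v} \<subseteq> E" "E \<subseteq> P" "card E = card G"
        using exists_subset_between[of "{u, v}" "card G" P] uv finP by auto
      obtain w where w: "w \<in> K" "cyc_on w E" using Kcyc[OF E(2,3)] by blast
      obtain j where "(w ^^ j) u = v" using cyc_onD[OF w(2), of u v] E by auto
      then show ?thesis using K.pow_mem[OF w(1)] by blast
    qed
    have PO: "P \<subseteq> \<Omega>" using PR by auto
    have Pne: "P \<noteq> {}" using p by (auto simp: P_def)
    have "\<not> blk P"
      using blk_card_dvd[OF tr PO _ Pne] nd R by (auto simp: P_def)
    then obtain D where D: "D \<in> (\<lambda>h. h ` P) ` H" "D \<noteq> P" "D \<inter> P \<noteq> {}" "card (D - P) = card (P - D)"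
      and Dmin: "\<And>k. k \<in> H \<Longrightarrow> card (D - k ` D) < card (P - D) \<Longrightarrow> k ` D = D"
      using minimal_exchange[OF PO] by blast
    have finD: "finite D" using D(1) finP by auto
    define A where "A = P - D"
    have "k ` A = A \<or> k ` A \<inter> A = {}" if k: "k \<in> K" for k
    proof (rule exchange_block_inside[OF finP A_def Dmin KH[OF k] KP[OF k]])
      fix z assume "z \<notin> P"
      then show "k z = z" using k K.fixes_outside[OF k] PR by (auto simp: K_def)
    qed
    then have Ablk: "K.blk A" by (simp add: K.blk_def)
    \<comment> \<open>\<open>A\<close> is a block of \<open>K\<close>. Since \<open>K\<close> has a
      cycle on every subset of \<open>P\<close> of the size of \<open>G\<close>, such a block is a
      single point or all of \<open>P\<close>, and the latter would make \<open>D\<close> disjoint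
      from \<open>P\<close>.\<close>
    have "card A = 1"
    proof -
      have "A \<noteq> {}"
      proof
        assume "A = {}"
        then have PD: "P - D = {}" by (simp add: A_def)
        then have "card (D - P) = 0" using D(4) by (simp only: PD card.empty)
        then have "P \<subseteq> D" "D \<subseteq> P" using finD PD by auto
        then show False using D by auto
      qed
      then have "card A \<noteq> 0" using finP by (simp add: A_def)
      moreover have "\<not> 2 \<le> card A"
      proof
        assume "2 \<le> card A"
        moreover have "card G < card P" using ab part finP fin unfolding P_def
          by (intro psubset_card_mono) auto
        ultimately have "A = P"
          by (intro K.block_trivial[OF finP p _ Kcyc _ Ablk]) (auto simp: A_def)
        then show False using D by (auto simp: A_def)
      qed
      ultimately show ?thesis by linarith
    qed
    then obtain a1 where a1: "P - D = {a1}" by (auto simp: A_def card_1_singleton_iff)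
    have "card (D - P) = 1" using a1 D(4) by simp
    then obtain b1 where b1: "D - P = {b1}" by (auto simp: card_1_singleton_iff)
    have Deq: "D = insert b1 (P - {a1})" using a1 b1 by blast
    obtain g1 where g1: "g1 \<in> H" "g1 ` P = D" using D by auto
    have "D \<subseteq> \<Omega>" using g1 image_Omega[OF g1(1)] PO by auto
    then have b1R: "b1 \<in> R" using b1 PR by auto
    have a1P: "a1 \<in> P" "b1 \<notin> P" using a1 b1 by auto
    have xP: "(x ^^ j) ` P = P" for j using xG[of j] xQ[of j] by (simp add: P_def image_Un)
    have stepP: "\<exists>h\<in>H. h ` P = insert b (P - {a})" if ab: "a \<in> P" "b \<in> R" for a b
    proof -
      obtain j where j: "(x ^^ j) b1 = b" using cyc_onD[OF x(4) b1R ab(2)] by blast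
      have "a \<in> (x ^^ j) ` P" using xP ab by simp
      then obtain a' where a': "a' \<in> P" "a = (x ^^ j) a'" by auto
      obtain k where k: "k \<in> K" "k a1 = a'" using Ktrans[OF a1P(1) a'(1)] by blast
      have xj: "x ^^ j \<in> H" using pow_mem x by auto
      have "((x ^^ j) \<circ> k \<circ> g1) ` P = (x ^^ j) ` k ` insert b1 (P - {a1})"
        using g1(2) Deq by (simp only: image_comp[symmetric])
      also have "\<dots> = (x ^^ j) ` insert b1 (P - {a'})"
        using k b1R KP[OF k(1)] by (simp add: K.image_diff K_def)
      also have "\<dots> = insert b (P - {a})" by (simp only: image_insert image_diff[OF xj] xP j image_empty a'(2))
      finally show ?thesis
        by (rule bexI[where P = "\<lambda>h. h ` P = insert b (P - {a})"]) (intro comp_mem xj KH k(1) g1(1))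
    qed
    have homO: "\<exists>h\<in>H. h ` P = E" if "E \<subseteq> \<Omega>" "card E = card P" for E
    proof -
      have "E \<in> (\<lambda>k. k ` P) ` H"
      proof (rule exchange_closed_all[OF finite_Omega, of P])
        show "P \<in> (\<lambda>k. k ` P) ` H" by (rule image_eqI[of _ _ id], simp, rule id_mem)
        fix E a b assume E: "E \<in> (\<lambda>k. k ` P) ` H" "E \<subseteq> \<Omega>" and a: "a \<in> E" and b: "b \<in> \<Omega> - E"
        then obtain k where k: "k \<in> H" "E = k ` P" by auto
        obtain a' where a': "a' \<in> P" "a = k a'" using a k by auto
        have "b \<in> k ` \<Omega>" using b image_Omega[OF k(1)] by simp
        then obtain b' where b': "b' \<in> \<Omega>" "b = k b'" by auto
        then have "b' \<in> R" using b k PR by auto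
        obtain k' where k': "k' \<in> H" "k' ` P = insert b' (P - {a'})" using stepP[OF a'(1) \<open>b' \<in> R\<close>] by blast
        have "(k \<circ> k') ` P = k ` insert b' (P - {a'})" using k'(2) by (simp only: image_comp[symmetric])
        also have "\<dots> = insert b (E - {a})" using k a' b' by (simp add: image_diff)
        finally show "insert b (E - {a}) \<in> (\<lambda>k. k ` P) ` H" using k k' comp_mem by blast
      qed (use that PO in auto)
      then show ?thesis by auto
    qed
    \<comment> \<open>\<open>F\<close> lies in some translate \<open>E\<close> of \<open>P\<close>;
      carried back into \<open>P\<close>, it is reached from \<open>G\<close> within
      \<open>K\<close>.\<close>
    have "card G \<le> card P" "card P \<le> card \<Omega>" using finP finite_Omega PO by (auto simp: P_def intro: card_mono)
    then obtain E where E: "F \<subseteq> E" "E \<subseteq> \<Omega>" "card E = card P"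
      using exists_subset_between[of F "card P" \<Omega>] F finite_Omega by auto
    obtain h where h: "h \<in> H" "h ` P = E" using homO[OF E(2,3)] by blast
    have ih: "inv' h \<in> H" using h inv_mem by auto
    have "inv' h ` F \<subseteq> P" using E(1) h inv_image(1)[OF h(1), of P] by (metis image_mono)
    then obtain k where k: "k \<in> K" "k ` G = inv' h ` F"
      using homP[of "inv' h ` F"] F card_image_mem[OF ih] by auto
    have "(h \<circ> k) ` G = h ` inv' h ` F" using k(2) by (simp only: image_comp[symmetric])
    also have "\<dots> = F" using h by simp
    finally show ?thesis using h k KH comp_mem by blast
  qed
qed

lemma cyc_power_translates:
  assumes "cyc_on f C" "A \<subseteq> C" "A \<noteq> {}"
    and "\<And>k. (f ^^ k) ` A = A \<or> (f ^^ k) ` A \<inter> A = {}"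
  shows "card A dvd card C"
proof (rule translates_card_dvd[of C f])
  show "finite C" "f ` C = C" using assms(1) by (auto simp: cyc_on_def)
  obtain a where a: "a \<in> A" using assms by auto
  show "C \<subseteq> (\<Union>k. (f ^^ k) ` A)"
  proof
    fix b assume "b \<in> C"
    then obtain k where "(f ^^ k) a = b" using cyc_onD[OF assms(1), of a b] a assms(2) by auto
    then show "b \<in> (\<Union>k. (f ^^ k) ` A)" using a by blast
  qed
qed (use assms in auto)

text \<open>Some power \<open>y\<close> of \<open>s\<close> is a cycle on \<open>G\<close> fixing
  all else, and \<open>x\<close>, the power with exponent \<open>card G\<close>, fixes
  \<open>G\<close> and is a cycle on \<open>Q\<close> and on \<open>R\<close>. For a minimal
  exchange \<open>D\<close>, the sets \<open>A = G - D\<close> and \<open>B = D - G\<close> have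
  equal size. Under powers of \<open>y\<close> the set \<open>A\<close> behaves as a block, so its
  size divides \<open>card G\<close>; under powers of \<open>x\<close> so does \<open>B\<close>, and
  its size divides that of \<open>Q\<close>, of \<open>R\<close> or of their union. By coprimality
  only one point is exchanged.\<close>

lemma three_orbits_homogeneous:
  assumes tr: trans_on and s: "s \<in> H"
    and cyc: "cyc_on s G" "cyc_on s Q" "cyc_on s R"
    and part: "G \<union> Q \<union> R = \<Omega>" "G \<inter> Q = {}" "G \<inter> R = {}" "Q \<inter> R = {}"
    and p: "2 \<le> card G" "Q \<noteq> {}"
    and co: "coprime (card G) (card Q)" "R = {} \<or> coprime (card G) (card R)" "coprime (card G) (card Q + card R)"
    and nd: "R = {} \<or> \<not> (card G + card Q) dvd card \<Omega>" "R = {} \<or> \<not> (card G + card R) dvd card \<Omega>"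
  obtains y where "y \<in> H" "cyc_on y G" "\<And>z. z \<notin> G \<Longrightarrow> y z = z"
    "\<And>F. F \<subseteq> \<Omega> \<Longrightarrow> card F = card G \<Longrightarrow> \<exists>h\<in>H. h ` G = F"
    "primitive"
proof -
  have fin: "finite G" "finite Q" "finite R" using part(1) finite_Omega by (metis finite_Un)+
  \<comment> \<open>The value 1 for empty \<open>R\<close> keeps the exponent
    \<open>card Q * r\<close> positive; two-cycle types are the case \<open>R = {}\<close>.\<close>
  define r where "r = (if R = {} then 1 else card R)"
  define y where "y = s ^^ (card Q * r)"
  define x where "x = s ^^ card G"
  have yH: "y \<in> H" "x \<in> H" using pow_mem s by (auto simp: y_def x_def)
  have ycyc: "cyc_on y G"
    unfolding y_def using co(1,2) by (intro cyc_on_coprime_power cyc) (auto simp: r_def ac_simps)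
  have yfix: "y z = z" if z: "z \<notin> G" for z
  proof -
    consider "z \<in> Q" | "z \<in> R" | "z \<notin> \<Omega>" using part(1) z by blast
    then show ?thesis
    proof cases
      case 1
      then show ?thesis using cyc_on_funpow_eq[OF cyc(2) 1, of "card Q * r"] by (simp add: y_def)
    next
      case 2
      then have "r = card R" by (auto simp: r_def)
      then show ?thesis using cyc_on_funpow_eq[OF cyc(3) 2, of "card Q * r"] by (simp add: y_def)
    next
      case 3
      then show ?thesis using fixes_outside yH by blast
    qed
  qed
  have xfix: "x z = z" if "z \<in> G" for z
    using cyc_on_funpow_eq[OF cyc(1) that, of "card G"] by (simp add: x_def)
  have xcyc: "cyc_on x Q" "cyc_on x R"
  proof -
    show "cyc_on x Q" unfolding x_def using co by (intro cyc_on_coprime_power cyc)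
    show "cyc_on x R"
    proof (cases "R = {}")
      case False
      then show ?thesis unfolding x_def using co by (intro cyc_on_coprime_power cyc) auto
    qed (simp add: cyc_on_def)
  qed
  have cO: "card \<Omega> = card G + (card Q + card R)"
  proof -
    have "card (G \<union> Q \<union> R) = card (G \<union> Q) + card R" using part fin by (intro card_Un_disjoint) auto
    then have "card \<Omega> = card (G \<union> Q) + card R" unfolding part(1) .
    also have "card (G \<union> Q) = card G + card Q" using part fin by (intro card_Un_disjoint) auto
    finally show ?thesis by simp
  qed
  have GO: "G \<subseteq> \<Omega>" "G \<noteq> {}" using part p by auto
  have "\<not> blk G"
  proof
    assume "blk G"
    then have "card G dvd card G + (card Q + card R)" using blk_card_dvd[OF tr GO(1) _ GO(2)] cO by simp
    then have "card G dvd card Q + card R" by simp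
    then have "card G = 1" using co(3) by (metis coprime_common_divisor_nat dvd_refl nat_dvd_1_iff_1)
    then show False using p by simp
  qed
  then obtain D where D: "D \<in> (\<lambda>h. h ` G) ` H" "D \<noteq> G" "D \<inter> G \<noteq> {}" "card (D - G) = card (G - D)"
    and Dmin: "\<And>k. k \<in> H \<Longrightarrow> card (D - k ` D) < card (G - D) \<Longrightarrow> k ` D = D"
    using minimal_exchange[OF GO(1)] by blast
  have finD: "finite D" using D(1) fin by auto
  obtain g where g: "g \<in> H" "g ` G = D" using D by auto
  have DO: "D \<subseteq> \<Omega>" using g image_Omega[OF g(1)] GO by blast
  define A where "A = G - D"
  define B where "B = D - G"
  have AB: "card B = card A" using D by (simp add: A_def B_def)
  have "A \<noteq> {}"
  proof
    assume "A = {}"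
    then have "card B = 0" using AB by simp
    then have "B = {}" using finD by (simp add: B_def)
    moreover have "G \<subseteq> D" using \<open>A = {}\<close> by (simp add: A_def)
    ultimately have "G \<subseteq> D" "B = {}" by auto
    then show False using D by (auto simp: B_def)
  qed
  then have Bne: "B \<noteq> {}" using AB fin by (auto simp: A_def)
  have fB: "finite B" using finD by (simp add: B_def)
  have ypG: "(y ^^ k) ` G = G" for k using ycyc by (intro image_funpow) (simp add: cyc_on_image)
  have yfixk: "z \<notin> G \<Longrightarrow> (y ^^ k) z = z" for z k by (simp add: funpow_fixed yfix)
  have xfixk: "z \<in> G \<Longrightarrow> (x ^^ k) z = z" for z k by (simp add: funpow_fixed xfix)
  have Ablk: "(y ^^ k) ` A = A \<or> (y ^^ k) ` A \<inter> A = {}" for k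
    by (rule exchange_block_inside[OF fin(1) A_def Dmin pow_mem[OF yH(1)] ypG yfixk])
  have Advd: "card A dvd card G"
    by (rule cyc_power_translates[OF ycyc _ \<open>A \<noteq> {}\<close> Ablk]) (simp add: A_def)
  have Bblk: "(x ^^ k) ` B = B \<or> (x ^^ k) ` B \<inter> B = {}" for k
    by (rule exchange_block_outside[OF finD B_def _ Dmin pow_mem[OF yH(2)] xfixk])
      (use D in \<open>simp_all add: B_def\<close>)
  have BQR: "B \<subseteq> Q \<union> R" using DO part by (auto simp: B_def)
  have "card A = 1"
  proof -
    consider "B \<subseteq> Q" | "B \<subseteq> R" | "B \<inter> Q \<noteq> {}" "B \<inter> R \<noteq> {}" using BQR by blast
    then have "coprime (card G) (card B) \<or> (\<exists>m. card B dvd m \<and> coprime (card G) m)"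
    proof cases
      case 1
      then show ?thesis using cyc_power_translates[OF xcyc(1) _ Bne Bblk] co by blast
    next
      case 2
      then have "R \<noteq> {}" using Bne by auto
      then show ?thesis using cyc_power_translates[OF xcyc(2) 2 Bne Bblk] co by blast
    next
      case 3
      then obtain u v where uv: "u \<in> B" "u \<in> Q" "v \<in> B" "v \<in> R" by auto
      have "card B dvd card (Q \<union> R)"
      proof (rule translates_card_dvd[of _ x])
        show "finite (Q \<union> R)" using fin by simp
        show "x ` (Q \<union> R) = Q \<union> R" using xcyc by (simp add: image_Un cyc_on_image)
        show "Q \<union> R \<subseteq> (\<Union>k. (x ^^ k) ` B)"
        proof
          fix b assume "b \<in> Q \<union> R"
          then have "(\<exists>k. (x ^^ k) u = b) \<or> (\<exists>k. (x ^^ k) v = b)"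
            using cyc_onD[OF xcyc(1) uv(2), of b] cyc_onD[OF xcyc(2) uv(4), of b] by blast
          then show "b \<in> (\<Union>k. (x ^^ k) ` B)" using uv by blast
        qed
      qed (use BQR Bblk in auto)
      then show ?thesis using co(3) fin part by (auto simp: card_Un_disjoint)
    qed
    then show ?thesis using Advd unfolding AB
      by (metis coprime_common_divisor_nat dvd_refl nat_dvd_1_iff_1)
  qed
  then obtain a0 where a0: "G - D = {a0}" by (auto simp: A_def card_1_singleton_iff)
  have "card (D - G) = 1" using a0 D(4) by simp
  then obtain b0 where b0: "D - G = {b0}" by (auto simp: card_1_singleton_iff)
  have Deq: "g ` G = insert b0 (G - {a0})" using a0 b0 g(2) by blast
  have a0G: "a0 \<in> G" using a0 by blast
  have b0QR: "b0 \<in> Q \<or> b0 \<in> R" using b0 BQR by (auto simp: B_def)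
  have hom: "\<exists>h\<in>H. h ` G = F" if F: "F \<subseteq> \<Omega>" "card F = card G" for F
    using b0QR
  proof
    assume b: "b0 \<in> Q"
    have nd': "R = {} \<or> \<not> card (G \<union> Q) dvd card \<Omega>" using nd(1) part fin by (simp add: card_Un_disjoint)
    show ?thesis
      by (rule exchange_core[OF tr yH(1) ycyc yfix yH(2) xfix xcyc part p(1) a0G b g(1) Deq nd' F])
  next
    assume b: "b0 \<in> R"
    then have "\<not> card (G \<union> R) dvd card \<Omega>" using nd(2) part fin by (auto simp: card_Un_disjoint)
    then have nd': "Q = {} \<or> \<not> card (G \<union> R) dvd card \<Omega>" by simp
    have part': "G \<union> R \<union> Q = \<Omega>" "R \<inter> Q = {}" using part by auto
    show ?thesis
      by (rule exchange_core[OF tr yH(1) ycyc yfix yH(2) xfix xcyc(2,1) part'(1) part(3,2) part'(2) p(1) a0G b g(1) Deq nd' F])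
  qed
  have prim: primitive
    unfolding primitive_def
  proof (intro conjI allI impI tr)
    fix A assume A: "A \<subseteq> \<Omega>" "blk A" "2 \<le> card A"
    show "A = \<Omega>"
    proof (rule block_trivial[OF finite_Omega p(1) _ _ A])
      show "card G < card \<Omega>" using cO p fin by (simp add: card_gt_0_iff)
      fix E assume E: "E \<subseteq> \<Omega>" "card E = card G"
      obtain h where h: "h \<in> H" "h ` G = E" using hom[OF E] by blast
      show "\<exists>y\<in>H. cyc_on y E \<and> (\<forall>z. z \<notin> E \<longrightarrow> y z = z)"
        using conj_cycle[OF h(1) ycyc yfix] conj_mem[OF h(1) yH(1)] h(2) by blast
    qed
  qed
  show ?thesis by (rule that[OF yH(1) ycyc yfix hom prim])
qed

text \<open>If 2p \<le> n + 1, two p-sets with exactly one common point fit into \<Omega>, and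
  homogeneity makes the second one a translate of \<open>G\<close>. Otherwise the complement of
  \<open>G\<close> is the smaller set; it is the whole support of the p-th power of \<open>s\<close>
  as soon as \<open>Q\<close> and a nonempty \<open>R\<close> have at least two points.\<close>

lemma three_orbits_has3:
  assumes tr: trans_on and s: "s \<in> H"
    and cyc: "cyc_on s G" "cyc_on s Q" "cyc_on s R"
    and part: "G \<union> Q \<union> R = \<Omega>" "G \<inter> Q = {}" "G \<inter> R = {}" "Q \<inter> R = {}"
    and p: "2 \<le> card G" "Q \<noteq> {}"
    and co: "coprime (card G) (card Q)" "R = {} \<or> coprime (card G) (card R)" "coprime (card G) (card Q + card R)"
    and nd: "R = {} \<or> \<not> (card G + card Q) dvd card \<Omega>" "R = {} \<or> \<not> (card G + card R) dvd card \<Omega>"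
    and small: "2 * card G \<le> card \<Omega> + 1 \<or> 2 \<le> card Q \<and> (R = {} \<or> 2 \<le> card R)"
  shows "primitive \<and> has3"
proof -
  obtain y where y: "y \<in> H" "cyc_on y G" "\<And>z. z \<notin> G \<Longrightarrow> y z = z"
    and hom: "\<And>F. F \<subseteq> \<Omega> \<Longrightarrow> card F = card G \<Longrightarrow> \<exists>h\<in>H. h ` G = F" and prim: primitive
    using three_orbits_homogeneous[OF tr s cyc part p co nd] by blast
  have fin: "finite G" "finite Q" "finite R" using part(1) finite_Omega by (metis finite_Un)+
  have GO: "G \<subseteq> \<Omega>" using part by auto
  have cG: "card (\<Omega> - G) = card \<Omega> - card G" "card G \<le> card \<Omega>"
    using GO finite_Omega fin by (auto simp: card_Diff_subset card_mono)
  have has3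
  proof (cases "2 * card G \<le> card \<Omega> + 1")
    case True
    obtain c where c: "c \<in> G" using p by fastforce
    have "card G - 1 \<le> card (\<Omega> - G)" using True cG by linarith
    then obtain F' where F': "F' \<subseteq> \<Omega> - G" "card F' = card G - 1" "finite F'"
      using obtain_subset_with_card_n by metis
    have "card (insert c F') = card G" using F' c p by (subst card_insert_disjoint) auto
    moreover have "insert c F' \<subseteq> \<Omega>" using F' c GO by auto
    ultimately obtain h where h: "h \<in> H" "h ` G = insert c F'" using hom by blast
    have "moved y = G" using moved_cyc_on y p by blast
    then have "moved y \<inter> h ` moved y = {c}" using h c F' by auto
    then show ?thesis using has3_of_meet_conj y(1) h(1) by blast
  next
    case False
    then have small': "2 \<le> card Q" "R = {} \<or> 2 \<le> card R" using small by auto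
    define x where "x = s ^^ card G"
    have xH: "x \<in> H" using pow_mem s by (simp add: x_def)
    have mx: "moved x = \<Omega> - G"
    proof -
      have "x z = z" if "z \<in> G" for z
        using cyc_on_funpow_eq[OF cyc(1) that, of "card G"] by (simp add: x_def)
      moreover have "x z \<noteq> z" if "z \<in> Q" for z
      proof -
        have "\<not> card Q dvd card G" using co(1) small'(1)
          by (metis coprime_common_divisor_nat dvd_refl nat_dvd_1_iff_1 not_less_eq_eq numeral_2_eq_2 le_refl One_nat_def)
        then show ?thesis using cyc_on_funpow_eq[OF cyc(2) that] by (simp add: x_def)
      qed
      moreover have "x z \<noteq> z" if "z \<in> R" for z
      proof -
        have "2 \<le> card R" "coprime (card G) (card R)" using small'(2) co(2) that by auto
        then have "\<not> card R dvd card G"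
          by (metis coprime_common_divisor_nat dvd_refl nat_dvd_1_iff_1 not_less_eq_eq numeral_2_eq_2 le_refl One_nat_def)
        then show ?thesis using cyc_on_funpow_eq[OF cyc(3) that] by (simp add: x_def)
      qed
      moreover have "x z = z" if "z \<notin> \<Omega>" for z using fixes_outside xH that by blast
      ultimately show ?thesis using part by (auto simp: moved_def)
    qed
    obtain c where c: "c \<in> Q" using p by auto
    have cO: "c \<in> \<Omega> - G" using c part by auto
    then have pos: "card (\<Omega> - G) > 0" using finite_Omega by (auto simp: card_gt_0_iff)
    have "card (\<Omega> - G) - 1 \<le> card G" using False cG by linarith
    then obtain F' where F': "F' \<subseteq> G" "card F' = card (\<Omega> - G) - 1" "finite F'"
      using obtain_subset_with_card_n by metis
    define E where "E = insert c F'"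
    have EO: "E \<subseteq> \<Omega>" using F' cO GO by (auto simp: E_def)
    have "card E = card (\<Omega> - G)" unfolding E_def using F' cO pos by (subst card_insert_disjoint) auto
    moreover have "card (\<Omega> - E) = card \<Omega> - card E"
      using EO finite_Omega F' by (intro card_Diff_subset) (auto simp: E_def)
    ultimately have "card (\<Omega> - E) = card G" using cG by simp
    then obtain h where h: "h \<in> H" "h ` G = \<Omega> - E" using hom[of "\<Omega> - E"] by auto
    have "h ` (\<Omega> - G) = E" using image_diff[OF h(1)] image_Omega[OF h(1)] h(2) EO by auto
    then have "moved x \<inter> h ` moved x = {c}" using mx cO F' by (auto simp: E_def)
    then show ?thesis using has3_of_meet_conj xH h(1) by blast
  qed
  then show ?thesis using prim by simp
qed

lemma ctype3D:
  assumes "ctype s \<Omega> [p, q, r]"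
  obtains G Q R where "cyc_on s G" "cyc_on s Q" "cyc_on s R" "G \<union> Q \<union> R = \<Omega>"
    "G \<inter> Q = {}" "G \<inter> R = {}" "Q \<inter> R = {}" "card G = p" "card Q = q" "card R = r" "0 < p" "0 < q" "0 < r"
proof -
  obtain G Q R where *: "G \<subseteq> \<Omega>" "card G = p" "0 < p" "cyc_on s G" "Q \<subseteq> \<Omega> - G" "card Q = q" "0 < q" "cyc_on s Q"
    "R \<subseteq> \<Omega> - G - Q" "card R = r" "0 < r" "cyc_on s R" "\<Omega> - G - Q - R = {}"
    using assms by auto
  show ?thesis by (rule that[of G Q R]) (use * in auto)
qed

text \<open>In the additional case q = 2, r = 1 the p-th power is a transposition, because p is
  odd.\<close>

lemma three_cycles_type_has3:
  assumes tr: trans_on and s: "s \<in> H" "ctype s \<Omega> [p, q, r]"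
    and p: "2 \<le> p" and co: "coprime p q" "coprime p r" "coprime p (q + r)"
    and nd: "\<not> (p + q) dvd card \<Omega>" "\<not> (p + r) dvd card \<Omega>"
    and small: "2 * p \<le> card \<Omega> + 1 \<or> 2 \<le> q \<and> 2 \<le> r \<or> q = 2 \<and> r = 1"
  shows "primitive \<and> has3"
proof -
  obtain G Q R where cyc: "cyc_on s G" "cyc_on s Q" "cyc_on s R" and part: "G \<union> Q \<union> R = \<Omega>"
    "G \<inter> Q = {}" "G \<inter> R = {}" "Q \<inter> R = {}" and c: "card G = p" "card Q = q" "card R = r" "0 < p" "0 < q" "0 < r"
    using ctype3D[OF s(2)] by metis
  have Qne: "Q \<noteq> {}" and p': "2 \<le> card G" using c p by auto
  have co': "coprime (card G) (card Q)" "R = {} \<or> coprime (card G) (card R)" "coprime (card G) (card Q + card R)"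
    and nd': "R = {} \<or> \<not> (card G + card Q) dvd card \<Omega>" "R = {} \<or> \<not> (card G + card R) dvd card \<Omega>"
    using co nd c by auto
  show ?thesis
  proof (cases "2 * p \<le> card \<Omega> + 1 \<or> 2 \<le> q \<and> 2 \<le> r")
    case True
    then show ?thesis
      using three_orbits_has3[OF tr s(1) cyc part p' Qne co' nd'] c by auto
  next
    case False
    then have qr: "q = 2" "r = 1" using small by auto
    have prim: primitive using three_orbits_homogeneous[OF tr s(1) cyc part p' Qne co' nd'] by metis
    define x where "x = s ^^ p"
    have xH: "x \<in> H" using pow_mem s by (simp add: x_def)
    have "moved x = Q"
    proof -
      have "x z = z" if "z \<in> G" for z
        using cyc_on_funpow_eq[OF cyc(1) that, of p] c by (simp add: x_def)
      moreover have "x z = z" if "z \<in> R" for z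
        using cyc_on_funpow_eq[OF cyc(3) that, of p] c qr by (simp add: x_def)
      moreover have "x z \<noteq> z" if "z \<in> Q" for z
        using cyc_on_funpow_eq[OF cyc(2) that, of p] c qr co by (simp add: x_def)
      moreover have "x z = z" if "z \<notin> \<Omega>" for z using fixes_outside xH that by blast
      ultimately show ?thesis using part by (auto simp: moved_def)
    qed
    moreover have "3 \<le> card \<Omega>"
    proof -
      have fin: "finite Q" "finite G" using part(1) finite_Omega by (metis finite_Un)+
      have "card (Q \<union> G) = q + p" using c part fin by (subst card_Un_disjoint) auto
      moreover have "card (Q \<union> G) \<le> card \<Omega>" using part finite_Omega by (intro card_mono) auto
      ultimately show ?thesis using qr p by simp
    qed
    ultimately have has3 using has3_of_transposition[OF prim xH] c qr by simp
    then show ?thesis using prim by simp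
  qed
qed

lemma two_cycles_type_has3:
  assumes tr: trans_on and s: "s \<in> H" "ctype s \<Omega> [p, q]"
    and p: "2 \<le> p" "p \<le> q" and co: "coprime p q"
  shows "primitive \<and> has3"
proof -
  obtain G Q where *: "G \<subseteq> \<Omega>" "card G = p" "0 < p" "cyc_on s G" "Q \<subseteq> \<Omega> - G" "card Q = q" "0 < q" "cyc_on s Q"
     "\<Omega> - G - Q = {}"
    using s(2) by auto
  have part: "G \<union> Q \<union> {} = \<Omega>" "G \<inter> Q = {}" "G \<inter> {} = {}" "Q \<inter> {} = {}" using * by auto
  have "card \<Omega> = p + q"
    using part * finite_Omega finite_subset[of G \<Omega>] by (metis card_Un_disjoint cyc_on_finite sup_bot_right)
  then show ?thesis
    using * p co by (intro three_orbits_has3[OF tr s(1) *(4,8) _ part]) (auto simp: cyc_on_def)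
qed

end

section \<open>Averaging over a group\<close>

context perm_group
begin

text \<open>The number of \<open>h\<close> carrying \<open>a\<close> to \<open>b\<close> does not
  depend on \<open>b\<close>, as left multiplication maps these elements injectively to those
  carrying \<open>a\<close> to another \<open>b'\<close>; so it is |H| / |Y|. The identity is
  multiplied out to remain in the natural numbers. The type of \<open>Y\<close> is open because
  points, pairs, group elements and cosets are all acted upon later.\<close>

lemma action_count:
  fixes act :: "('a \<Rightarrow> 'a) \<Rightarrow> 'b \<Rightarrow> 'b"
  assumes Y: "finite Y" "\<And>h y. h \<in> H \<Longrightarrow> y \<in> Y \<Longrightarrow> act h y \<in> Y"
    and act: "\<And>f g y. f \<in> H \<Longrightarrow> g \<in> H \<Longrightarrow> y \<in> Y \<Longrightarrow> act (f \<circ> g) y = act f (act g y)"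
    and tr: "\<And>y y'. y \<in> Y \<Longrightarrow> y' \<in> Y \<Longrightarrow> \<exists>h\<in>H. act h y = y'"
    and AB: "A \<subseteq> Y" "B \<subseteq> Y"
  shows "card Y * (\<Sum>h\<in>H. card {a\<in>A. act h a \<in> B}) = card H * (card A * card B)"
proof -
  define N where "N a b = card {h\<in>H. act h a = b}" for a b
  have le: "N a b \<le> N a b'" if ab: "a \<in> Y" "b \<in> Y" "b' \<in> Y" for a b b'
  proof -
    obtain k where k: "k \<in> H" "act k b = b'" using tr ab by blast
    have "inj_on ((\<circ>) k) {h\<in>H. act h a = b}"
    proof (rule inj_onI)
      fix f g assume "k \<circ> f = k \<circ> g"
      then have "k (f x) = k (g x)" for x by (metis comp_apply)
      then show "f = g" using k by auto
    qed
    moreover have "(\<circ>) k ` {h\<in>H. act h a = b} \<subseteq> {h\<in>H. act h a = b'}"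
      using k act ab comp_mem by auto
    ultimately show ?thesis unfolding N_def using finite_H by (intro card_inj_on_le) auto
  qed
  have const: "card Y * N a b = card H" if ab: "a \<in> Y" "b \<in> Y" for a b
  proof -
    have "card Y * N a b = (\<Sum>b'\<in>Y. N a b)" by simp
    also have "\<dots> = (\<Sum>b'\<in>Y. N a b')" using le ab by (intro sum.cong) (auto intro: antisym)
    also have "\<dots> = card (\<Union>b'\<in>Y. {h\<in>H. act h a = b'})"
      unfolding N_def using Y(1) finite_H by (subst card_UN_disjoint) auto
    also have "(\<Union>b'\<in>Y. {h\<in>H. act h a = b'}) = H" using Y(2) ab by auto
    finally show ?thesis .
  qed
  have fin: "finite A" "finite B" using AB Y(1) by (metis finite_subset)+
  have "(\<Sum>h\<in>H. card {a\<in>A. act h a \<in> B}) = (\<Sum>h\<in>H. \<Sum>a\<in>A. of_bool (act h a \<in> B))"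
    using fin by (simp add: Int_def)
  also have "\<dots> = (\<Sum>h\<in>H. \<Sum>a\<in>A. \<Sum>b\<in>B. of_bool (act h a = b))"
  proof (intro sum.cong refl)
    fix h a
    have "B \<inter> {b. act h a = b} = (if act h a \<in> B then {act h a} else {})" by auto
    then show "(of_bool (act h a \<in> B) :: nat) = (\<Sum>b\<in>B. of_bool (act h a = b))" using fin by simp
  qed
  also have "\<dots> = (\<Sum>a\<in>A. \<Sum>h\<in>H. \<Sum>b\<in>B. of_bool (act h a = b))" by (rule sum.swap)
  also have "\<dots> = (\<Sum>a\<in>A. \<Sum>b\<in>B. \<Sum>h\<in>H. of_bool (act h a = b))" by (intro sum.cong refl sum.swap)
  also have "\<dots> = (\<Sum>a\<in>A. \<Sum>b\<in>B. N a b)" using finite_H by (simp add: N_def Int_def)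
  finally have "card Y * (\<Sum>h\<in>H. card {a\<in>A. act h a \<in> B}) = (\<Sum>a\<in>A. \<Sum>b\<in>B. card Y * N a b)"
    by (simp add: sum_distrib_left)
  also have "\<dots> = (\<Sum>a\<in>A. \<Sum>b\<in>B. card H)" using const AB by (intro sum.cong refl) auto
  finally show ?thesis by (simp add: ac_simps)
qed

lemma point_count:
  assumes "Y \<subseteq> \<Omega>" "\<And>h y. h \<in> H \<Longrightarrow> y \<in> Y \<Longrightarrow> h y \<in> Y"
    "\<And>y y'. y \<in> Y \<Longrightarrow> y' \<in> Y \<Longrightarrow> \<exists>h\<in>H. h y = y'" "A \<subseteq> Y" "B \<subseteq> Y"
  shows "card Y * (\<Sum>h\<in>H. card {a\<in>A. h a \<in> B}) = card H * (card A * card B)"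
proof (rule action_count)
  show "finite Y" using assms finite_Omega finite_subset by blast
qed (use assms in auto)

section \<open>Moments of the overlap of a support with its conjugates, and Bochert's
  inequality\<close>

definition pairs :: "'a set \<Rightarrow> ('a \<times> 'a) set" where
  "pairs A = {(a, b). a \<in> A \<and> b \<in> A \<and> a \<noteq> b}"

lemma finite_pairs: "finite A \<Longrightarrow> finite (pairs A)"
  by (rule finite_subset[of _ "A \<times> A"]) (auto simp: pairs_def)

lemma card_pairs: "finite A \<Longrightarrow> card (pairs A) = card A * (card A - 1)"
proof -
  assume fin: "finite A"
  have "pairs A = (SIGMA a:A. A - {a})" by (auto simp: pairs_def)
  then have "card (pairs A) = (\<Sum>a\<in>A. card (A - {a}))" using fin by simp
  also have "\<dots> = (\<Sum>a\<in>A. card A - 1)" by (intro sum.cong) auto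
  finally show ?thesis by simp
qed

lemma pair_count:
  assumes "two_trans" "P \<subseteq> pairs \<Omega>" "Q \<subseteq> pairs \<Omega>"
  shows "card \<Omega> * (card \<Omega> - 1) * (\<Sum>h\<in>H. card {(a, b). (a, b) \<in> P \<and> (h a, h b) \<in> Q}) = card H * (card P * card Q)"
proof -
  let ?act = "\<lambda>h (a, b). (h a, h b)"
  have "card (pairs \<Omega>) * (\<Sum>h\<in>H. card {q\<in>P. ?act h q \<in> Q}) = card H * (card P * card Q)"
  proof (rule action_count)
    show "finite (pairs \<Omega>)" using finite_Omega finite_pairs by blast
    show "\<And>h y. h \<in> H \<Longrightarrow> y \<in> pairs \<Omega> \<Longrightarrow> (case y of (a, b) \<Rightarrow> (h a, h b)) \<in> pairs \<Omega>"
      by (auto simp: pairs_def)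
    fix y y' assume "y \<in> pairs \<Omega>" "y' \<in> pairs \<Omega>"
    then show "\<exists>h\<in>H. (case y of (a, b) \<Rightarrow> (h a, h b)) = y'"
      using two_transD[OF assms(1)] by (auto simp: pairs_def)
  qed (use assms in auto)
  moreover have "{q\<in>P. ?act h q \<in> Q} = {(a, b). (a, b) \<in> P \<and> (h a, h b) \<in> Q}" for h by auto
  ultimately show ?thesis using card_pairs[OF finite_Omega] by simp
qed

text \<open>The overlap of the support of \<open>x\<close> with the support of its conjugate under
  \<open>g\<close>, pulled back by \<open>g\<close>.\<close>

definition meet :: "('a \<Rightarrow> 'a) \<Rightarrow> ('a \<Rightarrow> 'a) \<Rightarrow> 'a set" where
  "meet x g = {a \<in> moved x. g a \<in> moved x}"

lemma finite_moved: "x \<in> H \<Longrightarrow> finite (moved x)"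
  using moved_subset finite_Omega finite_subset by metis

lemma finite_meet: "x \<in> H \<Longrightarrow> finite (meet x g)"
  using finite_moved by (simp add: meet_def)

lemma image_meet: "g ` meet x g = moved x \<inter> g ` moved x"
  by (auto simp: meet_def)

lemma meet_card: "g \<in> H \<Longrightarrow> card (moved x \<inter> g ` moved x) = card (meet x g)"
  using image_meet card_image_mem by metis

lemma meet_not_one:
  assumes "\<not> has3" "x \<in> H" "g \<in> H"
  shows "card (meet x g) \<noteq> 1"
proof
  assume "card (meet x g) = 1"
  then obtain c where "moved x \<inter> g ` moved x = {c}"
    using meet_card[OF assms(3), of x] by (auto simp: card_1_singleton_iff)
  then show False using has3_of_meet_conj assms by blast
qed

lemma sum_meet:
  assumes "two_trans" "2 \<le> card \<Omega>" "x \<in> H" and d: "d = card (moved x)"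
  shows "card \<Omega> * (\<Sum>g\<in>H. card (meet x g)) = card H * (d * d)"
proof -
  have "trans_on" unfolding trans_on_def
  proof (intro ballI)
    fix a b assume ab: "a \<in> \<Omega>" "b \<in> \<Omega>"
    have "\<exists>a'\<in>\<Omega>. a' \<noteq> a" for a
    proof (rule ccontr)
      assume "\<not> ?thesis"
      then have "\<Omega> \<subseteq> {a}" by auto
      then show False using assms(2) card_mono[of "{a}" \<Omega>] by simp
    qed
    then obtain a' b' where "a' \<in> \<Omega>" "a' \<noteq> a" "b' \<in> \<Omega>" "b' \<noteq> b" by metis
    then show "\<exists>h\<in>H. h a = b" using two_transD[OF assms(1), of a a' b b'] ab by auto
  qed
  then show ?thesis unfolding meet_def d
    using moved_subset[OF assms(3)] by (intro point_count) (auto simp: trans_on_def)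
qed

lemma two_trans_trans_on:
  assumes "two_trans" "2 \<le> card \<Omega>"
  shows trans_on
  unfolding trans_on_def
proof (intro ballI)
  fix a b assume ab: "a \<in> \<Omega>" "b \<in> \<Omega>"
  have "\<exists>a'\<in>\<Omega>. a' \<noteq> a" for a
  proof (rule ccontr)
    assume "\<not> ?thesis"
    then have "\<Omega> \<subseteq> {a}" by auto
    then show False using assms(2) card_mono[of "{a}" \<Omega>] by simp
  qed
  then obtain a' b' where "a' \<in> \<Omega>" "a' \<noteq> a" "b' \<in> \<Omega>" "b' \<noteq> b" by metis
  then show "\<exists>h\<in>H. h a = b" using two_transD[OF assms(1), of a a' b b'] ab by auto
qed

lemma two_trans_primitive:
  assumes "two_trans" "2 \<le> card \<Omega>"
  shows primitive
  unfolding primitive_def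
proof (intro conjI allI impI)
  show trans_on using two_trans_trans_on assms .
  fix A assume A: "A \<subseteq> \<Omega>" "blk A" "2 \<le> card A"
  obtain S where "S \<subseteq> A" "card S = 2" using A(3) obtain_subset_with_card_n by metis
  then obtain u v where uv: "u \<in> A" "v \<in> A" "u \<noteq> v" by (auto simp: card_2_iff)
  have "w \<in> A" if w: "w \<in> \<Omega>" for w
  proof (cases "w = u")
    case False
    then obtain h where h: "h \<in> H" "h u = u" "h v = w"
      using two_transD[OF assms(1), of u v u w] uv w A by auto
    then have "h ` A \<inter> A \<noteq> {}" using uv by (metis IntI empty_iff imageI)
    then have "h ` A = A" using A(2) h unfolding blk_def by blast
    then show ?thesis using h uv by (metis imageI)
  qed (use uv in simp)
  then show "A = \<Omega>" using A by auto
qed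

text \<open>Together with \<open>sum_meet\<close> this gives the first two factorial moments of the
  overlap size over the group.\<close>

lemma sum_meet_pairs:
  assumes "two_trans" "x \<in> H" and d: "d = card (moved x)"
  shows "card \<Omega> * (card \<Omega> - 1) * (\<Sum>g\<in>H. card (meet x g) * (card (meet x g) - 1))
    = card H * ((d * (d - 1)) * (d * (d - 1)))"
proof -
  have sub: "pairs (moved x) \<subseteq> pairs \<Omega>" using moved_subset[OF assms(2)] by (auto simp: pairs_def)
  have "card (meet x g) * (card (meet x g) - 1)
      = card {(a, b). (a, b) \<in> pairs (moved x) \<and> (g a, g b) \<in> pairs (moved x)}" if "g \<in> H" for g
  proof -
    have "pairs (meet x g) = {(a, b). (a, b) \<in> pairs (moved x) \<and> (g a, g b) \<in> pairs (moved x)}"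
      using that by (auto simp: pairs_def meet_def)
    then show ?thesis using card_pairs[OF finite_meet[OF assms(2)]] by metis
  qed
  then show ?thesis
    using pair_count[OF assms(1) sub sub] card_pairs[OF finite_moved[OF assms(2)]] d by simp
qed

text \<open>Let X be the overlap size and M the number of its points \<open>a\<close> with
  \<open>g (x a)\<close> outside the support. X = 1 is excluded and M > 0 forces X \<ge> K, so (K -
  2) M \<le> X (X - 2) for every \<open>g\<close>, strictly for the identity. The averages of X, X
  (X - 1) and M are d^2/n, d^2 (d - 1)^2/(n (n - 1)) and d^2 (n - d)/(n (n - 1)); cancelling d^2
  gives the claim.\<close>

lemma bochert_inequality:
  assumes tt: two_trans and no3: "\<not> has3" and x: "x \<in> H" "x \<noteq> id"
    and n: "n = card \<Omega>" "3 \<le> n" and d: "d = card (moved x)" and K: "2 \<le> K"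
    and big: "\<And>g a. g \<in> H \<Longrightarrow> a \<in> meet x g \<Longrightarrow> g (x a) \<notin> moved x \<Longrightarrow> K \<le> card (meet x g)"
  shows "(int K - 2) * (int n - int d) < (int d - 1)\<^sup>2 - (int n - 1)"
proof -
  let ?S = "moved x"
  have fS: "finite ?S" using finite_moved x by blast
  have SO: "?S \<subseteq> \<Omega>" using moved_subset x by blast
  have dn: "d \<le> n" using d n SO finite_Omega by (simp add: card_mono)
  obtain a where a: "a \<in> ?S" using x(2) by (auto simp: moved_def fun_eq_iff)
  have xa: "x a \<in> ?S" "x a \<noteq> a" using a x by (auto simp: moved_def)
  have d2: "2 \<le> d"
  proof -
    have "card {a, x a} \<le> card ?S" using a xa fS by (intro card_mono) auto
    then show ?thesis using xa d by simp
  qed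
  \<comment> \<open>A transposition has a conjugate meeting its support in one point. With d \<ge> 3
    the term X (X - 2) is positive at the identity, which is what makes the summed inequality
    strict.\<close>
  have "d \<noteq> 2"
  proof
    assume d2: "d = 2"
    then have Seq: "{a, x a} = ?S" using a xa fS d by (intro card_subset_eq) auto
    have "\<not> \<Omega> \<subseteq> ?S" using card_mono[OF fS, of \<Omega>] n d d2 by auto
    then obtain c where c: "c \<in> \<Omega>" "c \<notin> ?S" by auto
    obtain g where g: "g \<in> H" "g a = a" "g (x a) = c"
    proof -
      have "a \<in> \<Omega>" "x a \<in> \<Omega>" "a \<noteq> x a" "a \<noteq> c" using a xa c SO by auto
      then show ?thesis using two_transD[OF tt, of a "x a" a c] c(1) that by blast
    qed
    have "z = a" if z: "z \<in> meet x g" for z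
    proof -
      have "z \<in> {a, x a}" "g z \<in> moved x" using z Seq by (simp_all add: meet_def)
      then show ?thesis using g(3) c(2) by auto
    qed
    moreover have "a \<in> meet x g" using a g(2) by (simp add: meet_def)
    ultimately have "meet x g = {a}" by blast
    then show False using meet_not_one[OF no3 x(1) g(1)] by simp
  qed
  then have d3: "3 \<le> d" using d2 by simp
  define X where "X g = int (card (meet x g))" for g
  define M where "M g = int (card {a \<in> ?S. g a \<in> ?S \<and> g (x a) \<notin> ?S})" for g
  have pt: "(int K - 2) * M g \<le> X g * (X g - 1) - X g" if g: "g \<in> H" for g
  proof (cases "M g = 0")
    case True
    have "card (meet x g) \<noteq> 1" using meet_not_one no3 x g by blast
    then have "X g = 0 \<or> 2 \<le> X g" by (auto simp: X_def)
    then have "0 \<le> X g * (X g - 2)" by auto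
    then show ?thesis using True by (simp add: algebra_simps)
  next
    case False
    then have "{a \<in> ?S. g a \<in> ?S \<and> g (x a) \<notin> ?S} \<noteq> {}" unfolding M_def by fastforce
    then have KX: "int K \<le> X g" using big[OF g] by (auto simp: X_def meet_def)
    have "M g \<le> X g" unfolding M_def X_def meet_def using fS by (auto intro!: card_mono)
    then have "(int K - 2) * M g \<le> (X g - 2) * X g" using KX K by (intro mult_mono) (auto simp: M_def)
    then show ?thesis by (simp add: algebra_simps)
  qed
  have strict: "(int K - 2) * M id < X id * (X id - 1) - X id"
  proof -
    have "meet x id = ?S" by (auto simp: meet_def)
    then have "X id = int d" by (simp add: X_def d)
    moreover have "M id = 0" using x by (auto simp: M_def moved_def)
    moreover have "0 < int d * (int d - 2)" using d3 by simp
    ultimately show ?thesis by (simp add: algebra_simps)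
  qed
  have "(\<Sum>g\<in>H. (int K - 2) * M g) < (\<Sum>g\<in>H. X g * (X g - 1) - X g)"
    by (rule sum_strict_mono_ex1[OF finite_H]) (use pt strict id_mem in auto)
  then have sum: "(int K - 2) * (\<Sum>g\<in>H. M g) < (\<Sum>g\<in>H. X g * (X g - 1)) - (\<Sum>g\<in>H. X g)"
    by (simp add: sum_distrib_left sum_subtractf)
  let ?h = "int (card H)" and ?n = "int n" and ?d = "int d"
  have n1: "int (n - 1) = ?n - 1" "int (d - 1) = ?d - 1" using n d2 by auto
  have "int (card \<Omega> * (\<Sum>g\<in>H. card (meet x g))) = int (card H * (d * d))"
    using sum_meet[OF tt _ x(1) d] n by simp
  then have sX: "?n * (\<Sum>g\<in>H. X g) = ?h * (?d * ?d)" using n by (simp add: X_def)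
  have XX: "int (card (meet x g) * (card (meet x g) - 1)) = X g * (X g - 1)" for g
    by (cases "card (meet x g)") (auto simp: X_def algebra_simps)
  have "int (card \<Omega> * (card \<Omega> - 1) * (\<Sum>g\<in>H. card (meet x g) * (card (meet x g) - 1)))
    = int (card H * ((d * (d - 1)) * (d * (d - 1))))"
    using sum_meet_pairs[OF tt x(1) d] by presburger
  then have sXX: "?n * (?n - 1) * (\<Sum>g\<in>H. X g * (X g - 1)) = ?h * ((?d * (?d - 1)) * (?d * (?d - 1)))"
    unfolding of_nat_mult of_nat_sum using n1 n(1) XX by (simp add: of_nat_mult[symmetric] del: of_nat_mult)
  \<comment> \<open>M counts the pairs \<open>(a, x a)\<close> that \<open>g\<close> carries into
    support times complement, so its average is another instance of
    \<open>pair_count\<close>.\<close>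
  let ?P = "(\<lambda>a. (a, x a)) ` ?S" and ?Q = "?S \<times> (\<Omega> - ?S)"
  have P: "?P \<subseteq> pairs \<Omega>" "card ?P = d"
  proof -
    show "?P \<subseteq> pairs \<Omega>" using SO x by (auto simp: pairs_def moved_def)
    show "card ?P = d" unfolding d by (intro card_image inj_onI) auto
  qed
  have Q: "?Q \<subseteq> pairs \<Omega>" "card ?Q = d * (n - d)"
    using SO fS d n by (auto simp: pairs_def card_cartesian_product card_Diff_subset)
  have "card {(a, b). (a, b) \<in> ?P \<and> (g a, g b) \<in> ?Q} = card {a \<in> ?S. g a \<in> ?S \<and> g (x a) \<notin> ?S}"
    if g: "g \<in> H" for g
  proof -
    have "{(a, b). (a, b) \<in> ?P \<and> (g a, g b) \<in> ?Q} = (\<lambda>a. (a, x a)) ` {a \<in> ?S. g a \<in> ?S \<and> g (x a) \<notin> ?S}"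
      using SO g x by auto
    then show ?thesis by (simp add: card_image inj_on_def)
  qed
  then have "card \<Omega> * (card \<Omega> - 1) * (\<Sum>g\<in>H. card {a \<in> ?S. g a \<in> ?S \<and> g (x a) \<notin> ?S}) = card H * (d * (d * (n - d)))"
    using pair_count[OF tt P(1) Q(1)] P(2) Q(2) by simp
  then have "int (card \<Omega> * (card \<Omega> - 1) * (\<Sum>g\<in>H. card {a \<in> ?S. g a \<in> ?S \<and> g (x a) \<notin> ?S}))
     = int (card H * (d * (d * (n - d))))" by presburger
  then have sM: "?n * (?n - 1) * (\<Sum>g\<in>H. M g) = ?h * (?d * (?d * (?n - ?d)))"
    using n1 n(1) dn by (simp add: M_def of_nat_diff)
  have hpos: "0 < ?h" using id_mem finite_H by (auto simp: card_gt_0_iff)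
  have "?n * (?n - 1) * ((int K - 2) * (\<Sum>g\<in>H. M g)) < ?n * (?n - 1) * ((\<Sum>g\<in>H. X g * (X g - 1)) - (\<Sum>g\<in>H. X g))"
    using sum n by (intro mult_strict_left_mono) auto
  then have "(int K - 2) * (?n * (?n - 1) * (\<Sum>g\<in>H. M g))
     < ?n * (?n - 1) * (\<Sum>g\<in>H. X g * (X g - 1)) - (?n - 1) * (?n * (\<Sum>g\<in>H. X g))"
    by (simp add: algebra_simps)
  then have "(int K - 2) * (?h * (?d * (?d * (?n - ?d))))
     < ?h * ((?d * (?d - 1)) * (?d * (?d - 1))) - (?n - 1) * (?h * (?d * ?d))"
    unfolding sX sXX sM .
  then have "(?h * (?d * ?d)) * ((int K - 2) * (?n - ?d)) < (?h * (?d * ?d)) * ((?d - 1)\<^sup>2 - (?n - 1))"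
    by (simp add: algebra_simps power2_eq_square)
  then show ?thesis using hpos d2 by (simp add: mult_less_cancel_left_pos)
qed

text \<open>K = 2 is always admissible, because an overlap in one point yields a 3-cycle; the left
  side of the inequality then vanishes.\<close>

lemma small_degree_bound:
  assumes "two_trans" "\<not> has3" "x \<in> H" "x \<noteq> id" "3 \<le> card \<Omega>"
  shows "int (card \<Omega>) - 1 < (int (card (moved x)) - 1)\<^sup>2"
proof -
  have "(int 2 - 2) * (int (card \<Omega>) - int (card (moved x))) < (int (card (moved x)) - 1)\<^sup>2 - (int (card \<Omega>) - 1)"
  proof (rule bochert_inequality[OF assms(1-4) refl assms(5) refl])
    fix g a assume g: "g \<in> H" and a: "a \<in> meet x g"
    have "card (meet x g) \<noteq> 0" using a finite_meet[OF assms(3)] by auto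
    then show "2 \<le> card (meet x g)" using meet_not_one[OF assms(2,3) g] by linarith
  qed simp
  then show ?thesis by simp
qed

lemma small_degree_has3:
  assumes "two_trans" "x \<in> H" "x \<noteq> id" "card (moved x) \<le> d" "(d - 1)\<^sup>2 < card \<Omega>" "3 \<le> card \<Omega>"
  shows has3
proof (rule ccontr)
  assume no3: "\<not> has3"
  have 1: "int (card \<Omega>) - 1 < (int (card (moved x)) - 1)\<^sup>2"
    using small_degree_bound[OF assms(1) no3 assms(2,3,6)] .
  have "moved x \<noteq> {}" using assms(3) by (auto simp: moved_def fun_eq_iff)
  then have pos: "1 \<le> card (moved x)" using finite_moved[OF assms(2)] by (simp add: Suc_le_eq card_gt_0_iff)
  have "int ((d - 1)\<^sup>2) < int (card \<Omega>)" using assms(5) by (simp only: of_nat_less_iff)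
  moreover have "int (d - 1) = int d - 1" using pos assms(4) by simp
  ultimately have 2: "(int d - 1)\<^sup>2 < int (card \<Omega>)" by simp
  have "(int (card (moved x)) - 1)\<^sup>2 \<le> (int d - 1)\<^sup>2" using pos assms(4) by (intro power_mono) auto
  then show False using 1 2 by linarith
qed

lemma moved_commutator_subset:
  assumes x: "x \<in> H" and y: "y \<in> H"
  shows "moved (x \<circ> y \<circ> inv' x \<circ> inv' y) \<subseteq> (moved x \<inter> moved y) \<union> x ` (moved x \<inter> moved y) \<union> y ` (moved x \<inter> moved y)"
proof
  let ?I = "moved x \<inter> moved y" and ?q = "x \<circ> y \<circ> inv' x \<circ> inv' y"
  have xm: "x z \<in> moved x \<longleftrightarrow> z \<in> moved x" "y z \<in> moved y \<longleftrightarrow> z \<in> moved y" for z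
    using x y by (auto simp: moved_def)
  have fx: "z \<notin> moved x \<Longrightarrow> x z = z" and fy: "z \<notin> moved y \<Longrightarrow> y z = z" for z by (auto simp: moved_def)
  fix z assume zq: "z \<in> moved ?q"
  show "z \<in> ?I \<union> x ` ?I \<union> y ` ?I"
  proof (rule ccontr)
    assume z: "z \<notin> ?I \<union> x ` ?I \<union> y ` ?I"
    define w where "w = inv' x (inv' y z)"
    have yxw: "y (x w) = z" using x y by (simp add: w_def)
    have qz: "?q z = x (y w)" by (simp add: w_def)
    consider "z \<notin> moved x" "z \<notin> moved y" | "z \<in> moved x" "z \<notin> moved y" | "z \<in> moved y" "z \<notin> moved x"
      using z by blast
    then have "x (y w) = z"
    proof cases
      case 1
      have "x w = z" using yxw fy[OF 1(2)] y by (metis apply_eq_iff)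
      then have "w = z" using fx[OF 1(1)] x by (metis apply_eq_iff)
      then show ?thesis using fx[OF 1(1)] fy[OF 1(2)] by metis
    next
      case 2
      have xw: "x w = z" using yxw fy[OF 2(2)] y by (metis apply_eq_iff)
      then have "w \<in> moved x" "w \<notin> ?I" using 2 xm z by auto
      then show ?thesis using fy xw by (metis IntI)
    next
      case 3
      have "x w \<in> moved y" using yxw xm 3 by metis
      moreover have "x w \<notin> ?I" using z yxw by blast
      ultimately have "x w \<notin> moved x" by blast
      then have "x w = w" using xm fx by metis
      then show ?thesis using yxw fx[OF 3(2)] by metis
    qed
    then show False using zq qz by (simp add: moved_def)
  qed
qed

lemma commutator_not_id:
  assumes x: "x \<in> H" and y: "y \<in> H" and b: "b \<in> moved x" "y b \<notin> moved x"
  shows "x \<circ> y \<circ> inv' x \<circ> inv' y \<noteq> id"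
proof
  let ?q = "x \<circ> y \<circ> inv' x \<circ> inv' y"
  assume "?q = id"
  then have "?q (y (x b)) = y (x b)" by simp
  moreover have "?q (y (x b)) = x (y b)" using x y by simp
  ultimately have "x (y b) = y (x b)" by simp
  moreover have "x (y b) = y b" using b by (simp add: moved_def)
  ultimately have "x b = b" using y by (metis apply_eq_iff)
  then show False using b by (simp add: moved_def)
qed

lemma card_meet_union:
  assumes "x \<in> H" "g \<in> H"
  shows "card ((moved x \<inter> g ` moved x) \<union> u ` (moved x \<inter> g ` moved x) \<union> v ` (moved x \<inter> g ` moved x)) \<le> 3 * card (meet x g)"
proof -
  let ?I = "moved x \<inter> g ` moved x"
  have fin: "finite ?I" using finite_moved assms by blast
  have "card (?I \<union> u ` ?I \<union> v ` ?I) \<le> card ?I + card (u ` ?I) + card (v ` ?I)"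
    by (meson add_le_mono1 card_Un_le le_trans)
  also have "\<dots> \<le> 3 * card ?I" using card_image_le[OF fin, of u] card_image_le[OF fin, of v] by linarith
  finally show ?thesis using meet_card[OF assms(2)] by simp
qed

text \<open>The commutator of \<open>x\<close> with its conjugate is not the identity here, and it
  moves at most three points for each point of the overlap. Minimality of the degree thus bounds the
  overlap from below; this supplies the K of \<open>bochert_inequality\<close>.\<close>

lemma minimal_degree_meet:
  assumes min: "\<And>z. z \<in> H \<Longrightarrow> z \<noteq> id \<Longrightarrow> d \<le> card (moved z)" and x: "x \<in> H" and g: "g \<in> H"
    and a: "a \<in> meet x g" "g (x a) \<notin> moved x"
  shows "d \<le> 3 * card (meet x g)"
proof -
  let ?y = "g \<circ> x \<circ> inv' g"
  have y: "?y \<in> H" using conj_mem g x by blast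
  have my: "moved ?y = g ` moved x" using moved_conj[OF bij_mem[OF g]] .
  have ga: "g a \<in> moved x" using a by (simp add: meet_def)
  have "?y (g a) \<notin> moved x" using a g by simp
  then have ne: "x \<circ> ?y \<circ> inv' x \<circ> inv' ?y \<noteq> id" using commutator_not_id[OF x y ga] by blast
  have sub: "moved (x \<circ> ?y \<circ> inv' x \<circ> inv' ?y) \<subseteq>
    (moved x \<inter> g ` moved x) \<union> x ` (moved x \<inter> g ` moved x) \<union> ?y ` (moved x \<inter> g ` moved x)"
    using moved_commutator_subset[OF x y] unfolding my .
  have fin: "finite ((moved x \<inter> g ` moved x) \<union> x ` (moved x \<inter> g ` moved x) \<union> ?y ` (moved x \<inter> g ` moved x))"
    using finite_moved[OF x] by blast
  show ?thesis
    using min[OF commutator_mem[OF x y] ne] card_mono[OF fin sub] card_meet_union[OF x g, of x ?y] by linarith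
qed

lemma obtain_minimal_degree:
  assumes "x \<in> H" "x \<noteq> id"
  obtains m where "m \<in> H" "m \<noteq> id" "card (moved m) \<le> card (moved x)"
    "\<And>z. z \<in> H \<Longrightarrow> z \<noteq> id \<Longrightarrow> card (moved m) \<le> card (moved z)"
  using ex_has_least_nat[of "\<lambda>z. z \<in> H \<and> z \<noteq> id" x "\<lambda>z. card (moved z)"] assms by blast

text \<open>\<open>(d + 2) div 3\<close> is d/3 rounded up; d \<ge> 4 makes it at least 2.\<close>

lemma minimal_degree_inequality:
  assumes tt: two_trans and no3: "\<not> has3" and x: "x \<in> H" "x \<noteq> id" and n: "3 \<le> card \<Omega>"
    and min: "\<And>z. z \<in> H \<Longrightarrow> z \<noteq> id \<Longrightarrow> card (moved x) \<le> card (moved z)"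
    and d: "d = card (moved x)" "4 \<le> d"
  shows "(int ((d + 2) div 3) - 2) * (int (card \<Omega>) - int d) < (int d - 1)\<^sup>2 - (int (card \<Omega>) - 1)"
proof (rule bochert_inequality[OF tt no3 x refl n d(1)])
  show "2 \<le> (d + 2) div 3" using d by simp
  fix g a assume g: "g \<in> H" "a \<in> meet x g" "g (x a) \<notin> moved x"
  have "d \<le> 3 * card (meet x g)" using minimal_degree_meet[OF min x(1) g] d by simp
  then show "(d + 2) div 3 \<le> card (meet x g)" by linarith
qed

text \<open>Let d be the minimal degree. For d \<le> 6, 5^2 < 29 suffices. For d = 7 and d = 8,
  where K = 3, the inequality reads 2n < 44 and 2n < 58; this is the origin of 29. For d \<ge> 9, n
  \<ge> 4d + 1 and 3K \<ge> d make the left side at least (d - 1)^2 - 4d, which the right side does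
  not exceed.\<close>

lemma bochert:
  assumes tt: two_trans and x: "x \<in> H" "x \<noteq> id" "card (moved x) \<le> D"
    and n: "29 \<le> card \<Omega>" "D \<le> 8 \<or> 4 * D + 1 \<le> card \<Omega>"
  shows has3
proof (rule ccontr)
  assume no3: "\<not> has3"
  obtain m where m: "m \<in> H" "m \<noteq> id" "card (moved m) \<le> card (moved x)"
    "\<And>z. z \<in> H \<Longrightarrow> z \<noteq> id \<Longrightarrow> card (moved m) \<le> card (moved z)"
    using obtain_minimal_degree[OF x(1,2)] by blast
  define d where "d = card (moved m)"
  have n3: "3 \<le> card \<Omega>" using n by simp
  have dD: "d \<le> D" using m(3) x(3) unfolding d_def by linarith
  have "\<not> d \<le> 6"
  proof
    assume "d \<le> 6"
    then have "has3" using small_degree_has3[OF tt m(1,2), of 6] n(1) n3 by (simp add: d_def)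
    then show False using no3 by simp
  qed
  then have d7: "7 \<le> d" by simp
  define K where "K = (d + 2) div 3"
  have K: "d \<le> 3 * K" "3 \<le> K" "3 * K \<le> d + 2" using d7 unfolding K_def by linarith+
  define e where "e = int (card \<Omega>)"
  have ineq: "(int K - 2) * (e - int d) < (int d - 1)\<^sup>2 - (e - 1)"
    unfolding K_def e_def by (rule minimal_degree_inequality[OF tt no3 m(1,2) n3 m(4) d_def]) (use d7 in auto)
  show False
  proof (cases "d \<le> 8")
    case True
    then have "K = 3" "d = 7 \<or> d = 8" using d7 K by linarith+
    then show False using ineq n(1) by (auto simp: e_def)
  next
    case False
    have e: "4 * int d + 1 \<le> e" using n(2) dD False by (auto simp: e_def)
    have "(int K - 2) * (3 * int d + 1) \<le> (int K - 2) * (e - int d)"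
      using e K by (intro mult_left_mono) auto
    then have "(int K - 2) * (3 * int d + 1) < (int d - 1)\<^sup>2 - 4 * int d" using ineq e by linarith
    moreover have "int d * int d \<le> int d * (3 * int K)" using K by (intro mult_left_mono) auto
    moreover have "int d * (3 * int K) = int K * (int d * 3)" by simp
    ultimately show False using K by (simp add: algebra_simps power2_eq_square)
  qed
qed

section \<open>Sharper averages: degree 35 and products of two 3-cycles\<close>

lemma involution_even_degree:
  assumes x: "x \<in> H" "\<And>z. x (x z) = z"
  shows "even (card (moved x))"
proof -
  let ?C = "(\<lambda>z. {z, x z}) ` moved x"
  have U: "\<Union>?C = moved x" using x by (auto simp: moved_def)
  have "2 dvd card (\<Union>?C)"
  proof (rule dvd_partition)
    show "finite (\<Union>?C)" using U finite_moved x by metis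
    show "\<forall>c\<in>?C. 2 dvd card c" by (auto simp: moved_def)
    show "\<forall>c1\<in>?C. \<forall>c2\<in>?C. c1 \<noteq> c2 \<longrightarrow> c1 \<inter> c2 = {}" using x by auto
  qed
  then show ?thesis using U by simp
qed

text \<open>Here degree 10 is out of the reach of \<open>bochert\<close>. The inequality leaves only
  minimal degree 9. Then an overlap of two points is impossible too: it would be invariant,
  \<open>m\<close> would swap the two points, the square of \<open>m\<close> would move at most 7
  points and be the identity, and 9 would be even. So X (X - 1) \<ge> 2 X for all elements, but the
  averages are 5184/1190 and 81/35.\<close>

lemma degree_35:
  assumes tt: two_trans and x: "x \<in> H" "x \<noteq> id" "card (moved x) \<le> 10" and n: "card \<Omega> = 35"
  shows has3
proof (rule ccontr)
  assume no3: "\<not> has3"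
  obtain m where m: "m \<in> H" "m \<noteq> id" "card (moved m) \<le> card (moved x)"
    "\<And>z. z \<in> H \<Longrightarrow> z \<noteq> id \<Longrightarrow> card (moved m) \<le> card (moved z)"
    using obtain_minimal_degree[OF x(1,2)] by blast
  define d where "d = card (moved m)"
  have n3: "3 \<le> card \<Omega>" using n by simp
  have "\<not> d \<le> 6"
  proof
    assume "d \<le> 6"
    then have "has3" using small_degree_has3[OF tt m(1,2), of 6] n n3 by (simp add: d_def)
    then show False using no3 by simp
  qed
  moreover have "d \<le> 10" using m(3) x(3) unfolding d_def by linarith
  ultimately have "d = 7 \<or> d = 8 \<or> d = 9 \<or> d = 10" by linarith
  moreover have "(int ((d + 2) div 3) - 2) * (35 - int d) < (int d - 1)\<^sup>2 - 34"
    using minimal_degree_inequality[OF tt no3 m(1,2) n3 m(4) d_def] \<open>\<not> d \<le> 6\<close> n by simp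
  ultimately have d9: "d = 9" by auto
  have two: "card (meet m g) * 2 \<le> card (meet m g) * (card (meet m g) - 1)" if g: "g \<in> H" for g
  proof (rule ccontr)
    assume "\<not> ?thesis"
    then have "card (meet m g) \<noteq> 0" "card (meet m g) < 3" by auto
    then have c2: "card (meet m g) = 2" using meet_not_one[OF no3 m(1) g] by linarith
    have inv: "m a \<in> meet m g" if a: "a \<in> meet m g" for a
    proof (rule ccontr)
      assume "m a \<notin> meet m g"
      then have "g (m a) \<notin> moved m" using a m(1) by (auto simp: meet_def moved_def)
      then have "9 \<le> 3 * card (meet m g)"
        using minimal_degree_meet[OF m(4) m(1) g a] d9 by (simp add: d_def)
      then show False using c2 by simp
    qed
    obtain u v where uv: "meet m g = {u, v}" "u \<noteq> v" using c2 by (auto simp: card_2_iff)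
    have "u \<in> moved m" "v \<in> moved m" using uv by (auto simp: meet_def)
    then have ne: "m u \<noteq> u" "m v \<noteq> v" by (simp_all add: moved_def)
    then have "m u = v" "m v = u" using inv[of u] inv[of v] uv by auto
    then have fix2: "(m \<circ> m) u = u" "(m \<circ> m) v = v" by auto
    have "moved (m \<circ> m) \<subseteq> moved m - {u, v}" using fix2 by (auto simp: moved_def)
    then have "card (moved (m \<circ> m)) \<le> card (moved m - {u, v})" using finite_moved[OF m(1)] by (intro card_mono) auto
    also have "\<dots> = 7" using \<open>u \<in> moved m\<close> \<open>v \<in> moved m\<close> uv d9 finite_moved[OF m(1)] by (simp add: d_def card_Diff_subset)
    finally have "m \<circ> m = id" using m(4)[OF comp_mem[OF m(1,1)]] d9 by (force simp: d_def)
    then have "m (m z) = z" for z by (metis comp_apply id_apply)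
    then have "even d" using involution_even_degree[OF m(1)] by (simp add: d_def)
    then show False using d9 by simp
  qed
  have "(\<Sum>g\<in>H. card (meet m g)) * 2 \<le> (\<Sum>g\<in>H. card (meet m g) * (card (meet m g) - 1))"
    unfolding sum_distrib_right by (rule sum_mono) (use two in auto)
  then have "34 * (35 * (\<Sum>g\<in>H. card (meet m g))) * 2 \<le> 35 * 34 * (\<Sum>g\<in>H. card (meet m g) * (card (meet m g) - 1))"
    by simp
  moreover have "35 * 34 * (\<Sum>g\<in>H. card (meet m g) * (card (meet m g) - 1)) = card H * 5184"
    using sum_meet_pairs[OF tt m(1) d_def] n d9 by simp
  moreover have "35 * (\<Sum>g\<in>H. card (meet m g)) = card H * 81"
    using sum_meet[OF tt _ m(1) d_def] n d9 by simp
  moreover have "0 < card H" using id_mem finite_H by (auto simp: card_gt_0_iff)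
  ultimately show False by simp
qed

text \<open>The commutator moves at most the three points of \<open>T\<close> and
  \<open>y u\<close>, \<open>y v\<close>, and 4^2 < 19. It is not the identity, because the third
  point of \<open>T\<close> lies outside the support of \<open>y\<close>.\<close>

lemma same_cycle_meet_bound:
  assumes tt: two_trans and no3: "\<not> has3" and n: "19 \<le> card \<Omega>"
    and x: "x \<in> H" and y: "y \<in> H" and T: "T \<subseteq> moved x" "card T = 3" "cyc_on x T"
    and I: "moved x \<inter> moved y = {u, v}" "u \<noteq> v" "u \<in> T" "v \<in> T"
  shows False
proof -
  let ?I = "moved x \<inter> moved y"
  have fT: "finite T" using T(2) card.infinite by fastforce
  have "card (T - {u, v}) = 1" using T I fT by (simp add: card_Diff_subset)
  then obtain t where t: "T - {u, v} = {t}" by (auto simp: card_1_singleton_iff)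
  have tT: "t \<in> T" "t \<noteq> u" "t \<noteq> v" using t by auto
  have "t \<notin> moved y" using t I T(1) by blast
  have xT: "x ` T = T" using T(3) by (rule cyc_on_image)
  then obtain b where b: "b \<in> T" "t = x b" using tT by (metis imageE)
  have "b \<noteq> t" using b T(1) tT by (auto simp: moved_def)
  then have bI: "b \<in> {u, v}" using b t by blast
  then have bm: "b \<in> moved y" using I by blast
  have "x b \<notin> moved y" using b \<open>t \<notin> moved y\<close> by simp
  then have ne: "y \<circ> x \<circ> inv' y \<circ> inv' x \<noteq> id" using commutator_not_id[OF y x bm] by blast
  have "moved (y \<circ> x \<circ> inv' y \<circ> inv' x) \<subseteq> T \<union> {y u, y v}"
  proof -
    have J: "moved y \<inter> moved x = {u, v}" using I by blast
    have "moved (y \<circ> x \<circ> inv' y \<circ> inv' x) \<subseteq> {u, v} \<union> y ` {u, v} \<union> x ` {u, v}"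
      using moved_commutator_subset[OF y x] unfolding J .
    moreover have "x ` {u, v} \<subseteq> T" using xT I by blast
    ultimately show ?thesis using I by blast
  qed
  then have "card (moved (y \<circ> x \<circ> inv' y \<circ> inv' x)) \<le> card (T \<union> {y u, y v})"
    using fT by (intro card_mono) auto
  also have "\<dots> \<le> card T + card {y u, y v}" by (rule card_Un_le)
  also have "\<dots> \<le> 5" using T by (simp add: card_insert_if)
  finally have "has3" using small_degree_has3[OF tt commutator_mem[OF y x] ne, of 5] n by simp
  then show False using no3 by simp
qed

text \<open>\<open>E\<close> consists of the 12 ordered pairs of points on a common 3-cycle, among
  the 30 pairs of the support. The pointwise inequality \<open>le\<close> holds by inclusion and
  exclusion for overlaps of at least three points; for two points
  \<open>same_cycle_meet_bound\<close> excludes all pairs from \<open>E\<close>. Averaged, it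
  becomes 72 (n - 1) \<le> 1224, that is n \<le> 18.\<close>

lemma two_three_cycles_has3:
  assumes tt: two_trans and n: "19 \<le> card \<Omega>" and x: "x \<in> H"
    and T: "moved x = T1 \<union> T2" "T1 \<inter> T2 = {}" "card T1 = 3" "card T2 = 3" "cyc_on x T1" "cyc_on x T2"
  shows has3
proof (rule ccontr)
  assume no3: "\<not> has3"
  have fT: "finite T1" "finite T2" using T card.infinite by fastforce+
  have d6: "card (moved x) = 6" using T fT by (simp add: card_Un_disjoint)
  have SO: "moved x \<subseteq> \<Omega>" using moved_subset[OF x] .
  define E where "E = pairs T1 \<union> pairs T2"
  have cE: "card E = 12"
  proof -
    have "pairs T1 \<inter> pairs T2 = {}" using T(2) by (auto simp: pairs_def)
    then have "card E = card (pairs T1) + card (pairs T2)"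
      unfolding E_def using fT finite_pairs by (intro card_Un_disjoint) auto
    then show ?thesis using T fT by (simp add: card_pairs)
  qed
  let ?S = "pairs (moved x)"
  have cS: "card ?S = 30" using d6 finite_moved[OF x] by (simp add: card_pairs)
  have ES: "E \<subseteq> ?S" using T by (auto simp: E_def pairs_def)
  have S\<Omega>: "?S \<subseteq> pairs \<Omega>" using SO by (auto simp: pairs_def)
  have E\<Omega>: "E \<subseteq> pairs \<Omega>" using ES S\<Omega> by auto
  define c where "c P Q g = card {(a, b). (a, b) \<in> P \<and> (g a, g b) \<in> Q}" for P Q :: "('a \<times> 'a) set" and g :: "'a \<Rightarrow> 'a"
  let ?n = "card \<Omega>" let ?N = "?n * (?n - 1)"
  have s1: "?N * (\<Sum>g\<in>H. c E ?S g) = card H * 360" unfolding c_def using pair_count[OF tt E\<Omega> S\<Omega>] cE cS by simp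
  have s2: "?N * (\<Sum>g\<in>H. c ?S E g) = card H * 360" unfolding c_def using pair_count[OF tt S\<Omega> E\<Omega>] cE cS by simp
  have s3: "?N * (\<Sum>g\<in>H. c E E g) = card H * 144" unfolding c_def using pair_count[OF tt E\<Omega> E\<Omega>] cE by simp
  have s4: "?N * (\<Sum>g\<in>H. card (meet x g) * (card (meet x g) - 1)) = card H * 900"
    using sum_meet_pairs[OF tt x d6[symmetric]] by simp
  have s5: "?n * (\<Sum>g\<in>H. card (meet x g)) = card H * 36" using sum_meet[OF tt _ x d6[symmetric]] n by simp
  have le: "2 * card (meet x g) + c E ?S g + c ?S E g \<le> 2 * (card (meet x g) * (card (meet x g) - 1)) + c E E g"
    if g: "g \<in> H" for g
  proof -
    let ?A = "{(a, b). (a, b) \<in> E \<and> (g a, g b) \<in> ?S}" and ?B = "{(a, b). (a, b) \<in> ?S \<and> (g a, g b) \<in> E}"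
    have sub: "?A \<subseteq> pairs (meet x g)" "?B \<subseteq> pairs (meet x g)"
      using ES g by (auto simp: pairs_def meet_def)
    have finp: "finite (pairs (meet x g))" using finite_meet[OF x] finite_pairs by blast
    have fin: "finite ?A" "finite ?B" by (rule finite_subset[OF sub(1) finp], rule finite_subset[OF sub(2) finp])
    have "?A \<inter> ?B = {(a, b). (a, b) \<in> E \<and> (g a, g b) \<in> E}" using ES by auto
    then have U: "c E ?S g + c ?S E g = card (?A \<union> ?B) + c E E g"
      using card_Un_Int[OF fin] unfolding c_def by simp
    have "?A \<union> ?B \<subseteq> pairs (meet x g)" using sub by blast
    then have "card (?A \<union> ?B) \<le> card (pairs (meet x g))" using finp card_mono by blast
    then have Ule: "card (?A \<union> ?B) \<le> card (meet x g) * (card (meet x g) - 1)"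
      using card_pairs[OF finite_meet[OF x]] by metis
    have m1: "card (meet x g) \<noteq> 1" using meet_not_one[OF no3 x g] .
    show ?thesis
    proof (cases "3 \<le> card (meet x g)")
      case True
      then have "2 * card (meet x g) \<le> (card (meet x g) - 1) * card (meet x g)" by (intro mult_right_mono) auto
      then have "2 * card (meet x g) \<le> card (meet x g) * (card (meet x g) - 1)" by (simp add: mult.commute)
      then show ?thesis using U Ule by linarith
    next
      case False
      then consider "card (meet x g) = 0" | "card (meet x g) = 2" using m1 by linarith
      then show ?thesis
      proof cases
        case 1
        then show ?thesis using U Ule by simp
      next
        case 2
        then obtain u v where uv: "meet x g = {u, v}" "u \<noteq> v" by (auto simp: card_2_iff)
        let ?y = "g \<circ> x \<circ> inv' g"
        have y: "?y \<in> H" using conj_mem g x by blast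
        have my: "moved ?y = g ` moved x" using moved_conj[OF bij_mem[OF g]] .
        have I: "moved x \<inter> moved ?y = {g u, g v}" unfolding my using image_meet[of g x] uv by simp
        have I': "moved ?y \<inter> moved x = {g u, g v}" using I by blast
        have guv: "g u \<noteq> g v" using uv g by simp
        have "?A \<union> ?B = {}"
        proof (rule ccontr)
          assume "?A \<union> ?B \<noteq> {}"
          then obtain a b where ab: "(a, b) \<in> pairs (meet x g)" "(a, b) \<in> E \<or> (g a, g b) \<in> E"
            using sub by blast
          have "{a, b} = {u, v}" using ab(1) uv by (auto simp: pairs_def)
          then have uvE: "(\<exists>T\<in>{T1, T2}. u \<in> T \<and> v \<in> T) \<or> (\<exists>T\<in>{T1, T2}. g u \<in> T \<and> g v \<in> T)"
            using ab(2) by (auto simp: E_def pairs_def doubleton_eq_iff)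
          then show False
          proof
            assume "\<exists>T\<in>{T1, T2}. g u \<in> T \<and> g v \<in> T"
            then obtain T' where "T' \<subseteq> moved x" "card T' = 3" "cyc_on x T'" "g u \<in> T'" "g v \<in> T'"
              using T by auto
            then show False using same_cycle_meet_bound[OF tt no3 n x y _ _ _ I guv] by blast
          next
            assume "\<exists>T\<in>{T1, T2}. u \<in> T \<and> v \<in> T"
            then obtain T' where T': "T' \<subseteq> moved x" "card T' = 3" "cyc_on x T'" "u \<in> T'" "v \<in> T'"
              using T by auto
            have "cyc_on ?y (g ` T')" using cyc_on_conj[OF T'(3) bij_mem[OF g]] .
            moreover have "card (g ` T') = 3" using card_image_mem[OF g] T' by simp
            moreover have "g ` T' \<subseteq> moved ?y" using T' my by auto
            ultimately show False
              using same_cycle_meet_bound[OF tt no3 n y x _ _ _ I' guv] T' by blast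
          qed
        qed
        then have "card (?A \<union> ?B) = 0" by (simp only: card.empty)
        then show ?thesis unfolding 2 using U by simp
      qed
    qed
  qed
  have "(\<Sum>g\<in>H. 2 * card (meet x g) + c E ?S g + c ?S E g)
     \<le> (\<Sum>g\<in>H. 2 * (card (meet x g) * (card (meet x g) - 1)) + c E E g)"
    by (rule sum_mono) (rule le)
  then have "2 * (\<Sum>g\<in>H. card (meet x g)) + (\<Sum>g\<in>H. c E ?S g) + (\<Sum>g\<in>H. c ?S E g)
     \<le> 2 * (\<Sum>g\<in>H. card (meet x g) * (card (meet x g) - 1)) + (\<Sum>g\<in>H. c E E g)"
    by (simp add: sum.distrib sum_distrib_left)
  then have "?N * (2 * (\<Sum>g\<in>H. card (meet x g)) + (\<Sum>g\<in>H. c E ?S g) + (\<Sum>g\<in>H. c ?S E g))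
     \<le> ?N * (2 * (\<Sum>g\<in>H. card (meet x g) * (card (meet x g) - 1)) + (\<Sum>g\<in>H. c E E g))"
    by (rule mult_left_mono) simp
  moreover have "?N * (\<Sum>g\<in>H. card (meet x g)) = (?n - 1) * (card H * 36)"
    using s5 by (metis mult.assoc mult.commute)
  moreover have "N * (2 * A + B + C) = 2 * (N * A) + N * B + N * C" "N * (2 * A + B) = 2 * (N * A) + N * B" for N A B C :: nat
    by (simp_all add: distrib_left)
  ultimately have "2 * ((?n - 1) * (card H * 36)) + card H * 360 + card H * 360 \<le> 2 * (card H * 900) + card H * 144"
    by (simp only: s1 s2 s3 s4)
  then have "card H * (72 * (?n - 1)) \<le> card H * 1224" by (simp add: algebra_simps)
  moreover have "0 < card H" using id_mem finite_H by (auto simp: card_gt_0_iff)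
  ultimately show False using n by simp
qed

text \<open>The conjugate has the 3-cycle (a b e) with e = \<open>g c\<close>, and the commutator of
  (a b c) with (a b e) is the double transposition (a b)(c e). If the two other 3-cycles are
  disjoint, nothing else is moved, and 3^2 < 10. If they meet in one point, their commutator is a
  3-cycle, and squaring removes the double transposition.\<close>

lemma two_three_cycles_controlled:
  assumes tt: two_trans and n: "10 \<le> card \<Omega>" and x: "x \<in> H" and g: "g \<in> H"
    and T: "moved x = {a, b, c} \<union> T2" "distinct [a, b, c]" "x a = b" "x b = c" "x c = a"
      "{a, b, c} \<inter> T2 = {}" "x ` T2 = T2" "card T2 = 3"
    and gg: "g a = a" "g b = b" "g c \<notin> moved x" "c \<notin> g ` T2" "card (T2 \<inter> g ` T2) \<le> 1"
  shows has3
proof (rule ccontr)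
  assume no3: "\<not> has3"
  let ?y = "g \<circ> x \<circ> inv' g"
  have y: "?y \<in> H" using conj_mem g x by blast
  define e where "e = g c"
  have yg: "?y (g z) = g (x z)" for z using g by simp
  have yv: "?y a = b" "?y b = e" "?y e = a"
    using yg[of a] yg[of b] yg[of c] gg(1,2) T(3-5) by (simp_all add: e_def)
  have my: "moved ?y = g ` moved x" using moved_conj[OF bij_mem[OF g]] .
  have my': "moved ?y = {a, b, e} \<union> g ` T2" unfolding my T(1) by (auto simp: e_def gg)
  have ne: "e \<noteq> a" "e \<noteq> b" "e \<noteq> c" "e \<notin> T2" using gg(3) T(1) by (auto simp: e_def)
  have dis: "{a, b, e} \<inter> g ` T2 = {}"
  proof -
    have "g ` ({a, b, c} \<inter> T2) = {a, b, e} \<inter> g ` T2"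
      unfolding image_int[OF g] by (simp add: e_def gg)
    then show ?thesis using T(6) by simp
  qed
  have c_my: "c \<notin> moved ?y" using my' T(2) ne gg(4) by auto
  have xe: "x e = e" using gg(3) by (simp add: e_def moved_def)
  have yc: "?y c = c" using c_my by (simp add: moved_def)
  let ?q = "x \<circ> ?y \<circ> inv' x \<circ> inv' ?y"
  have qH: "?q \<in> H" using commutator_mem[OF x y] .
  have iy: "inv' ?y (?y z) = z" and ix: "inv' x (x z) = z" for z using inv_apply(1) x y by blast+
  have q: "?q (?y (x w)) = x (?y w)" for w using iy[of "x w"] ix[of w] by (simp only: comp_apply)
  have q1: "?q a = b" "?q e = c" "?q c = e" "?q b = a"
    using q[of e] q[of a] q[of b] q[of c] unfolding xe yv T(3-5) yc by (simp_all only:)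
  have qid: "?q \<noteq> id"
  proof
    assume "?q = id"
    then have "a = b" using q1(1) by (simp only: id_apply)
    then show False using T(2) by simp
  qed
  have I: "moved x \<inter> moved ?y = {a, b} \<union> (T2 \<inter> g ` T2)"
    unfolding my' T(1) using T(2,6) ne dis gg(4) by auto
  have sub: "moved ?q \<subseteq> {a, b, c, e} \<union> ((T2 \<inter> g ` T2) \<union> x ` (T2 \<inter> g ` T2) \<union> ?y ` (T2 \<inter> g ` T2))"
  proof -
    have "x ` {a, b} = {b, c}" "?y ` {a, b} = {b, e}" unfolding image_insert image_empty yv T(3-5) by simp_all
    then have "moved ?q \<subseteq> {a, b} \<union> (T2 \<inter> g ` T2) \<union> ({b, c} \<union> x ` (T2 \<inter> g ` T2)) \<union> ({b, e} \<union> ?y ` (T2 \<inter> g ` T2))"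
      using moved_commutator_subset[OF x y] by (simp only: I image_Un)
    then show ?thesis by blast
  qed
  have fT: "finite T2" using T(8) card.infinite by fastforce
  show False
  proof (cases "T2 \<inter> g ` T2 = {}")
    case True
    then have "moved ?q \<subseteq> {a, b, c, e}" using sub by auto
    then have "card (moved ?q) \<le> card {a, b, c, e}" by (intro card_mono) auto
    also have "\<dots> \<le> 4" by (simp add: card_insert_if)
    finally show False using small_degree_has3[OF tt qH qid, of 4] n no3 by simp
  next
    case False
    then have "card (T2 \<inter> g ` T2) = 1" using gg(5) fT by (simp add: le_Suc_eq)
    then obtain w where w: "T2 \<inter> g ` T2 = {w}" by (auto simp: card_1_singleton_iff)
    have wT: "w \<in> T2" "w \<in> g ` T2" using w by auto
    have ygT: "?y ` g ` T2 = g ` T2"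
    proof -
      have "?y ` g ` T2 = g ` x ` T2" using yg by (simp add: image_image)
      then show ?thesis using T(7) by simp
    qed
    have outx: "x z = z" if "z \<in> g ` T2" "z \<noteq> w" for z
    proof -
      have "z \<notin> moved x" unfolding T(1) using that w dis gg(4) by auto
      then show ?thesis by (simp add: moved_def)
    qed
    have outy: "?y z = z" if "z \<in> T2" "z \<noteq> w" for z
    proof -
      have "z \<notin> moved ?y" unfolding my' using that w T(6) ne by auto
      then show ?thesis by (simp add: moved_def)
    qed
    have wm: "x w \<noteq> w" "?y w \<noteq> w"
    proof -
      have "w \<in> moved x" "w \<in> moved ?y" unfolding T(1) my' using wT by auto
      then show "x w \<noteq> w" "?y w \<noteq> w" by (auto simp: moved_def)
    qed
    obtain v where v: "v \<in> g ` T2" "?y v = w" using ygT wT(2) by (metis imageE)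
    have "v \<noteq> w" using v wm by auto
    then have "x v = v" using outx v by blast
    then have qw: "?q w = x w" using q[of v] v(2) by (simp only:)
    have "x w \<in> T2" using T(7) wT by auto
    then have "?y (x w) = x w" using outy wm by blast
    moreover have "?y w \<in> g ` T2" using ygT wT by blast
    then have "x (?y w) = ?y w" using outx wm by blast
    ultimately have qxw: "?q (x w) = ?y w" using q[of w] by (simp only:)
    have "(?q \<circ> ?q) w = ?y w" using qw qxw by (simp only: comp_apply)
    then have ne2: "?q \<circ> ?q \<noteq> id" using wm by (metis id_apply)
    have fixed: "(?q \<circ> ?q) z = z" if "z \<in> {a, b, c, e}" for z
      using that q1 by (simp only: comp_apply insert_iff empty_iff) metis
    have "moved (?q \<circ> ?q) \<subseteq> {w, x w, ?y w}"
    proof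
      fix z assume z: "z \<in> moved (?q \<circ> ?q)"
      then have "?q z \<noteq> z" by (auto simp: moved_def)
      then have "z \<in> moved ?q" by (simp add: moved_def)
      moreover have "z \<notin> {a, b, c, e}" using fixed z by (auto simp: moved_def)
      ultimately show "z \<in> {w, x w, ?y w}" using sub unfolding w by blast
    qed
    then have "card (moved (?q \<circ> ?q)) \<le> card {w, x w, ?y w}" by (intro card_mono) auto
    also have "\<dots> \<le> 3" by (simp add: card_insert_if)
    finally show False using small_degree_has3[OF tt comp_mem[OF qH qH] ne2, of 3] n no3 by simp
  qed
qed

end

section \<open>Groups with prescribed cycle types\<close>

lemma ctype_moved_card:
  "ctype f \<Omega> ls \<Longrightarrow> finite \<Omega> \<Longrightarrow> card {z \<in> \<Omega>. (f ^^ m) z \<noteq> z} = sum_list (filter (\<lambda>l. \<not> l dvd m) ls)"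
proof (induction ls arbitrary: \<Omega>)
  case (Cons l ls)
  then obtain C where C: "C \<subseteq> \<Omega>" "card C = l" "cyc_on f C" "ctype f (\<Omega> - C) ls" by auto
  let ?M = "\<lambda>A. {z \<in> A. (f ^^ m) z \<noteq> z}"
  have "?M \<Omega> = ?M C \<union> ?M (\<Omega> - C)" using C by auto
  moreover have "finite (?M C)" "finite (?M (\<Omega> - C))" "?M C \<inter> ?M (\<Omega> - C) = {}"
    using finite_subset[OF C(1) Cons.prems(2)] Cons.prems(2) by auto
  ultimately have "card (?M \<Omega>) = card (?M C) + card (?M (\<Omega> - C))" by (simp add: card_Un_disjoint)
  moreover have "card (?M (\<Omega> - C)) = sum_list (filter (\<lambda>l. \<not> l dvd m) ls)"
    using Cons.IH[OF C(4)] Cons.prems by simp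
  moreover have "?M C = (if l dvd m then {} else C)"
    using cyc_on_funpow_eq[OF C(3)] C(2) by auto
  ultimately show ?case using C by auto
qed auto

text \<open>The iterates with even and with odd exponent are the two halves; the offset
  \<open>e\<close> in \<open>cyc\<close> treats both at once. Exponents such as
  \<open>k + m - 1\<close> and \<open>m * i - i\<close> stand for k - 1 and -i modulo m.\<close>

lemma cyc_on_square_split:
  assumes "cyc_on f C" "card C = 2 * m" "0 < m"
  obtains T where "T \<subseteq> C" "card T = m" "cyc_on (f ^^ 2) T" "cyc_on (f ^^ 2) (C - T)" "card (C - T) = m"
proof -
  have fC: "finite C" "f ` C = C" using assms by (auto simp: cyc_on_def)
  have "C \<noteq> {}" using assms by auto
  then obtain a where a: "a \<in> C" by auto
  let ?p = "\<lambda>k. (f ^^ k) a"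
  have eqm: "?p i = ?p j \<longleftrightarrow> [i = j] (mod (2 * m))" for i j
  proof
    show "[i = j] (mod (2 * m)) \<Longrightarrow> ?p i = ?p j" using cyc_on_funpow_mod[OF assms(1) a] assms(2) by metis
    have inj: "inj_on (f ^^ k) C" for k
      using image_funpow[OF fC(2)] fC(1) by (simp add: eq_card_imp_inj_on)
    have *: "[i = j] (mod (2 * m))" if eq: "?p i = ?p j" and ij: "i \<le> j" for i j
    proof -
      have "?p j = (f ^^ i) (?p (j - i))" using ij by (simp flip: funpow_add_apply)
      then have "?p (j - i) = a" using eq inj_onD[OF inj[of i]] a funpow_in_image[OF fC(2)] by metis
      then have "2 * m dvd j - i" using cyc_on_funpow_eq[OF assms(1) a] assms(2) by simp
      then have "[j = i] (mod (2 * m))" using ij by (simp add: cong_altdef_nat)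
      then show ?thesis by (rule cong_sym)
    qed
    assume eq: "?p i = ?p j"
    show "[i = j] (mod (2 * m))"
    proof (cases "i \<le> j")
      case False
      then have "[j = i] (mod (2 * m))" using *[of j i] eq by simp
      then show ?thesis by (rule cong_sym)
    qed (use *[of i j] eq in simp)
  qed
  have cyc: "cyc_on (f ^^ 2) ((\<lambda>k. ?p (2 * k + e)) ` UNIV)" "card ((\<lambda>k. ?p (2 * k + e)) ` UNIV) = m" for e
  proof -
    let ?T = "(\<lambda>k. ?p (2 * k + e)) ` UNIV"
    have TC: "?T \<subseteq> C" using a funpow_in_image[OF fC(2)] by auto
    have shift: "(f ^^ 2) (?p i) = ?p (i + 2)" for i by (simp add: funpow_add_apply[symmetric] add.commute)
    have per: "?p (i + 2 * m) = ?p i" for i by (simp add: eqm cong_def)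
    have reach: "((f ^^ 2) ^^ j) (?p i) = ?p (i + 2 * j)" for i j
      by (simp add: funpow_funpow funpow_add_apply[symmetric] add.commute)
    show "cyc_on (f ^^ 2) ?T" unfolding cyc_on_def
    proof (intro conjI ballI)
      show "finite ?T" using TC fC finite_subset by blast
      show "(f ^^ 2) ` ?T = ?T"
      proof
        show "(f ^^ 2) ` ?T \<subseteq> ?T"
        proof
          fix z assume "z \<in> (f ^^ 2) ` ?T"
          then obtain k where "z = (f ^^ 2) (?p (2 * k + e))" by auto
          then have "z = ?p (2 * (k + 1) + e)" unfolding shift by (simp add: algebra_simps)
          then show "z \<in> ?T" by blast
        qed
        show "?T \<subseteq> (f ^^ 2) ` ?T"
        proof
          fix z assume "z \<in> ?T"
          then obtain k where k: "z = ?p (2 * k + e)" by auto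
          have "(f ^^ 2) (?p (2 * (k + m - 1) + e)) = ?p (2 * k + e + 2 * m)"
            unfolding shift using assms(3) by (intro arg_cong[where f = ?p]) (simp add: algebra_simps)
          then have "z = (f ^^ 2) (?p (2 * (k + m - 1) + e))" using k per by simp
          then show "z \<in> (f ^^ 2) ` ?T" by blast
        qed
      qed
      fix u v assume "u \<in> ?T" "v \<in> ?T"
      then obtain i j where ij: "u = ?p (2 * i + e)" "v = ?p (2 * j + e)" by auto
      have "((f ^^ 2) ^^ (j + (m * i - i))) u = ?p (2 * i + e + 2 * (j + (m * i - i)))" unfolding ij reach ..
      also have "2 * i + e + 2 * (j + (m * i - i)) = 2 * j + e + 2 * m * i"
      proof -
        have "i \<le> m * i" using assms(3) by simp
        then obtain t where "m * i = i + t" by (auto simp: le_iff_add)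
        moreover have "2 * m * i = 2 * (m * i)" by simp
        ultimately show ?thesis by simp
      qed
      also have "?p (2 * j + e + 2 * m * i) = v" unfolding ij by (simp add: eqm cong_def)
      finally show "\<exists>k. ((f ^^ 2) ^^ k) u = v" by blast
    qed
    have "?T = (\<lambda>k. ?p (2 * k + e)) ` {..<m}"
    proof
      show "?T \<subseteq> (\<lambda>k. ?p (2 * k + e)) ` {..<m}"
      proof
        fix z assume "z \<in> ?T"
        then obtain k where k: "z = ?p (2 * k + e)" by auto
        have "[2 * k = 2 * (k mod m)] (mod 2 * m)" by (simp only: cong_def mult_mod_right mod_mod_trivial)
        then have "[2 * k + e = 2 * (k mod m) + e] (mod 2 * m)" by (intro cong_add) auto
        then have "z = ?p (2 * (k mod m) + e)" unfolding k by (rule eqm[THEN iffD2])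
        then show "z \<in> (\<lambda>k. ?p (2 * k + e)) ` {..<m}" using assms(3) by auto
      qed
    qed auto
    moreover have "inj_on (\<lambda>k. ?p (2 * k + e)) {..<m}"
    proof (rule inj_onI)
      fix i j assume ij: "i \<in> {..<m}" "j \<in> {..<m}" "?p (2 * i + e) = ?p (2 * j + e)"
      then have "[2 * i = 2 * j] (mod 2 * m)" using eqm cong_add_rcancel_nat by metis
      then show "i = j" using ij by (simp add: cong_def mult_mod_right[symmetric])
    qed
    ultimately show "card ?T = m" by (simp add: card_image)
  qed
  let ?T0 = "(\<lambda>k. ?p (2 * k + 0)) ` UNIV" and ?T1 = "(\<lambda>k. ?p (2 * k + 1)) ` UNIV"
  have sub: "?T0 \<subseteq> C" "?T1 \<subseteq> C" using funpow_in_image[OF fC(2) a] by blast+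
  have "?T0 \<inter> ?T1 = {}"
  proof (rule ccontr)
    assume "?T0 \<inter> ?T1 \<noteq> {}"
    then obtain i j where "?p (2 * i + 0) = ?p (2 * j + 1)" by auto
    then have "[2 * i + 0 = 2 * j + 1] (mod 2 * m)" by (rule eqm[THEN iffD1])
    then have "[2 * i = 2 * j + 1] (mod 2 * m)" by simp
    then have "[2 * i = 2 * j + 1] (mod 2)" by (rule cong_dvd_modulus_nat) simp
    then show False by (simp add: cong_def)
  qed
  moreover have "C \<subseteq> ?T0 \<union> ?T1"
  proof
    fix z assume "z \<in> C"
    then obtain k where k: "?p k = z" using cyc_onD[OF assms(1) a] by blast
    show "z \<in> ?T0 \<union> ?T1"
    proof (cases "even k")
      case True
      then obtain i where "k = 2 * i + 0" by auto
      then show ?thesis using k by blast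
    next
      case False
      then obtain i where "k = 2 * i + 1" by (rule oddE)
      then show ?thesis using k by blast
    qed
  qed
  ultimately have "C - ?T0 = ?T1" using sub by blast
  then show ?thesis using that[of ?T0] sub(1) cyc[of 0] cyc[of 1] by simp
qed

lemma ctype_square_split:
  assumes "cyc_on f C" "card C = 2 * m" "0 < m"
  shows "ctype (f ^^ 2) C [m, m]"
proof -
  obtain T where T: "T \<subseteq> C" "card T = m" "cyc_on (f ^^ 2) T" "cyc_on (f ^^ 2) (C - T)" "card (C - T) = m"
    using cyc_on_square_split[OF assms] by blast
  show ?thesis unfolding ctype.simps
    using T assms(3) by (intro exI[of _ T] exI[of _ "C - T"]) auto
qed

section \<open>Orbit sizes and multiple transitivity read off from cycle types\<close>

context perm_group
begin

lemma stabilizer: "a \<in> \<Omega> \<Longrightarrow> perm_group (\<Omega> - {a}) {h \<in> H. h a = a}"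
proof
  assume a: "a \<in> \<Omega>"
  show "finite (\<Omega> - {a})" using finite_Omega by simp
  fix h assume h: "h \<in> {h \<in> H. h a = a}"
  have "h x = x" if "x \<notin> \<Omega> - {a}" for x using h that fixes_outside by auto
  then show "h permutes (\<Omega> - {a})" using perm[of h] h unfolding permutes_def by auto
  show "inv' h \<in> {h \<in> H. h a = a}" using h inv_mem inv_apply(1)[of h a] by auto
next
  fix f g assume "f \<in> {h \<in> H. h a = a}" "g \<in> {h \<in> H. h a = a}"
  then show "f \<circ> g \<in> {h \<in> H. h a = a}" using comp_mem by auto
qed (use id_mem in auto)

lemma two_transI:
  assumes tr: trans_on and a: "a \<in> \<Omega>"
    and st: "\<And>b c. b \<in> \<Omega> - {a} \<Longrightarrow> c \<in> \<Omega> - {a} \<Longrightarrow> \<exists>h\<in>H. h a = a \<and> h b = c"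
  shows two_trans
  unfolding two_trans_def
proof (intro ballI impI)
  fix u v w z assume m: "u \<in> \<Omega>" "v \<in> \<Omega>" "w \<in> \<Omega>" "z \<in> \<Omega>" and ne: "u \<noteq> v" "w \<noteq> z"
  obtain k where k: "k \<in> H" "k u = a" using trans_onD[OF tr m(1) a] by blast
  obtain l where l: "l \<in> H" "l w = a" using trans_onD[OF tr m(3) a] by blast
  have "k v \<in> \<Omega> - {a}" using k m ne apply_eq_iff[OF k(1), of v u] by auto
  moreover have "l z \<in> \<Omega> - {a}" using l m ne apply_eq_iff[OF l(1), of z w] by auto
  ultimately obtain h where h: "h \<in> H" "h a = a" "h (k v) = l z" using st by blast
  have "(inv' l \<circ> h \<circ> k) u = w" using k l h inv_apply(1)[OF l(1), of w] by simp
  moreover have "(inv' l \<circ> h \<circ> k) v = z" using h inv_apply(1)[OF l(1), of z] by simp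
  moreover have "inv' l \<circ> h \<circ> k \<in> H" using h k l by (intro comp_mem inv_mem)
  ultimately show "\<exists>h\<in>H. h u = w \<and> h v = z" by blast
qed

definition orbit_of :: "'a \<Rightarrow> 'a set" where
  "orbit_of a = (\<lambda>h. h a) ` H"

lemma orbit_of_self: "a \<in> orbit_of a"
  unfolding orbit_of_def using id_mem by (metis id_apply image_eqI)

lemma orbit_of_sub: "a \<in> \<Omega> \<Longrightarrow> orbit_of a \<subseteq> \<Omega>"
  by (auto simp: orbit_of_def)

lemma orbit_of_invariant: "h \<in> H \<Longrightarrow> h ` orbit_of a = orbit_of a"
proof
  assume h: "h \<in> H"
  show "h ` orbit_of a \<subseteq> orbit_of a"
  proof
    fix z assume "z \<in> h ` orbit_of a"
    then obtain k where "k \<in> H" "z = (h \<circ> k) a" by (auto simp: orbit_of_def)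
    then show "z \<in> orbit_of a" using comp_mem[OF h] unfolding orbit_of_def by blast
  qed
  show "orbit_of a \<subseteq> h ` orbit_of a"
  proof
    fix z assume "z \<in> orbit_of a"
    then obtain k where k: "k \<in> H" "z = k a" by (auto simp: orbit_of_def)
    have "inv' h \<circ> k \<in> H" using h k by (intro comp_mem inv_mem)
    then have "(inv' h \<circ> k) a \<in> orbit_of a" unfolding orbit_of_def by blast
    then have "h ((inv' h \<circ> k) a) \<in> h ` orbit_of a" by blast
    then show "z \<in> h ` orbit_of a" using h k by simp
  qed
qed

lemma orbit_of_card:
  assumes "a \<in> \<Omega>" "s \<in> H" "ctype s \<Omega> ls"
  shows "card (orbit_of a) \<in> ssums ls"
  by (rule ctype_invariant_card[OF assms(3) finite_Omega orbit_of_sub[OF assms(1)] orbit_of_invariant[OF assms(2)] inj_mem[OF assms(2)]])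

lemma orbit_of_card_pos: "a \<in> \<Omega> \<Longrightarrow> 0 < card (orbit_of a)"
  using orbit_of_self orbit_of_sub finite_Omega by (metis card_gt_0_iff empty_iff finite_subset)

lemma trans_onI:
  assumes "\<And>a. a \<in> \<Omega> \<Longrightarrow> card (orbit_of a) = card \<Omega>"
  shows trans_on
  unfolding trans_on_def
proof (intro ballI)
  fix a b assume ab: "a \<in> \<Omega>" "b \<in> \<Omega>"
  have "orbit_of a = \<Omega>" using assms[OF ab(1)] orbit_of_sub[OF ab(1)] finite_Omega by (simp add: card_subset_eq)
  then show "\<exists>h\<in>H. h a = b" using ab(2) unfolding orbit_of_def by auto
qed

text \<open>Every orbit size is a subset sum of both types. The two types may coincide, as for an
  n-cycle.\<close>

lemma trans_on_of_types:
  assumes "s \<in> H" "ctype s \<Omega> ls" "t \<in> H" "ctype t \<Omega> ms" "ssums ls \<inter> ssums ms \<subseteq> {0, card \<Omega>}"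
  shows trans_on
proof (rule trans_onI)
  fix a assume a: "a \<in> \<Omega>"
  show "card (orbit_of a) = card \<Omega>"
    using orbit_of_card[OF a assms(1,2)] orbit_of_card[OF a assms(3,4)] orbit_of_card_pos[OF a] assms(5) by auto
qed

lemma fixed_point_type:
  assumes "ctype s \<Omega> (Suc 0 # ls)"
  obtains a where "a \<in> \<Omega>" "s a = a" "ctype s (\<Omega> - {a}) ls"
proof -
  obtain C where C: "C \<subseteq> \<Omega>" "card C = 1" "cyc_on s C" "ctype s (\<Omega> - C) ls" using assms by auto
  then obtain a where a: "C = {a}" by (auto simp: card_1_singleton_iff)
  then have "s ` {a} = {a}" using cyc_on_image[OF C(3)] by simp
  then have "s a = a" by simp
  then show ?thesis using that[of a] C a by auto
qed

text \<open>The stabilizer of the fixed point contains a cycle on all remaining points.\<close>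

lemma two_trans_of_types:
  assumes tr: trans_on and s: "s \<in> H" "ctype s \<Omega> [Suc 0, card \<Omega> - 1]"
  shows two_trans
proof -
  obtain a where a: "a \<in> \<Omega>" "s a = a" "ctype s (\<Omega> - {a}) [card \<Omega> - 1]" using fixed_point_type[OF s(2)] by blast
  interpret S: perm_group "\<Omega> - {a}" "{h \<in> H. h a = a}" by (rule stabilizer[OF a(1)])
  have sS: "s \<in> {h \<in> H. h a = a}" using s a by simp
  have tS: S.trans_on
    by (rule S.trans_on_of_types[OF sS a(3) sS a(3)]) (use a(1) finite_Omega in auto)
  show ?thesis by (rule two_transI[OF tr a(1)]) (use S.trans_onD[OF tS] in blast)
qed

lemma moved_power_card:
  assumes "s \<in> H" "ctype s \<Omega> ls"
  shows "card (moved (s ^^ m)) = sum_list (filter (\<lambda>l. \<not> l dvd m) ls)"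
proof -
  have "moved (s ^^ m) = {z \<in> \<Omega>. (s ^^ m) z \<noteq> z}"
    using moved_subset[OF pow_mem[OF assms(1)]] by (auto simp: moved_def)
  then show ?thesis using ctype_moved_card[OF assms(2) finite_Omega] by simp
qed

lemma not_id_of_card: "0 < card (moved x) \<Longrightarrow> x \<noteq> id"
  by (auto simp: moved_def)

lemma bochert_power:
  assumes "two_trans" "s \<in> H" "ctype s \<Omega> ls" "0 < sum_list (filter (\<lambda>l. \<not> l dvd m) ls)"
    "29 \<le> card \<Omega>" "sum_list (filter (\<lambda>l. \<not> l dvd m) ls) \<le> 8 \<or> 4 * sum_list (filter (\<lambda>l. \<not> l dvd m) ls) + 1 \<le> card \<Omega>"
  shows has3
proof (rule bochert[OF assms(1) pow_mem[OF assms(2)] _ _ assms(5,6)])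
  show "card (moved (s ^^ m)) \<le> sum_list (filter (\<lambda>l. \<not> l dvd m) ls)"
    using moved_power_card[OF assms(2,3)] by simp
  show "s ^^ m \<noteq> id" using moved_power_card[OF assms(2,3), of m] assms(4) not_id_of_card by metis
qed

text \<open>The power acts on the 6-cycle as the square and trivially on all other cycles, which
  isolates a product of two 3-cycles.\<close>

lemma six_cycle_square:
  assumes s: "s \<in> H" "ctype s \<Omega> (6 # ls)" and m: "[m = 2] (mod 6)" "\<And>l. l \<in> set ls \<Longrightarrow> l dvd m"
  obtains T1 T2 where "moved (s ^^ m) = T1 \<union> T2" "T1 \<inter> T2 = {}" "card T1 = 3" "card T2 = 3"
    "cyc_on (s ^^ m) T1" "cyc_on (s ^^ m) T2"
proof -
  obtain C where C: "C \<subseteq> \<Omega>" "card C = 6" "cyc_on s C" "ctype s (\<Omega> - C) ls" using s(2) by auto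
  have agree: "(s ^^ 2) z = (s ^^ m) z" if "z \<in> C" for z
    using cyc_on_funpow_mod[OF C(3) that, of m 2] m C(2) by simp
  obtain T where T: "T \<subseteq> C" "card T = 3" "cyc_on (s ^^ 2) T" "cyc_on (s ^^ 2) (C - T)" "card (C - T) = 3"
    using cyc_on_square_split[OF C(3), of 3] C(2) by auto
  have cyc: "cyc_on (s ^^ m) T" "cyc_on (s ^^ m) (C - T)"
  proof -
    show "cyc_on (s ^^ m) T" by (rule cyc_on_cong[OF T(3)]) (use agree T(1) in blast)
    show "cyc_on (s ^^ m) (C - T)" by (rule cyc_on_cong[OF T(4)]) (use agree in blast)
  qed
  have "\<not> 6 dvd m"
  proof
    assume "6 dvd m"
    then have "m mod 6 = 0" by simp
    then show False using m(1) by (simp add: cong_def)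
  qed
  have "moved (s ^^ m) = C"
  proof -
    have "(s ^^ m) z \<noteq> z" if "z \<in> C" for z
      using cyc_on_fixed_point_free[OF C(3) _ that, of m] C(2) \<open>\<not> 6 dvd m\<close> by simp
    moreover have "(s ^^ m) z = z" if "z \<notin> C" for z
    proof (cases "z \<in> \<Omega>")
      case True
      then show ?thesis using ctype_funpow_id[OF C(4) m(2)] that by blast
    next
      case False
      then show ?thesis using fixes_outside pow_mem s by blast
    qed
    ultimately show ?thesis by (auto simp: moved_def)
  qed
  then show ?thesis using that[of T "C - T"] T cyc by auto
qed

end

lemma dvd_ssums: "(\<And>l. l \<in> set ls \<Longrightarrow> p dvd l) \<Longrightarrow> t \<in> ssums ls \<Longrightarrow> p dvd t"
  by (induction ls arbitrary: t) auto

section \<open>Products of two 3-cycles under threefold and fourfold transitivity, for degrees 12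
  and 16\<close>

context perm_group
begin

text \<open>The interface between counting components and group theory: a component is known only by
  the cycle types that it must cover.\<close>

definition rich :: "(nat list \<Rightarrow> bool) \<Rightarrow> bool" where
  "rich P \<longleftrightarrow> (\<forall>ls. sum_list ls = card \<Omega> \<longrightarrow> 0 \<notin> set ls \<longrightarrow> P ls \<longrightarrow> (\<exists>s\<in>H. ctype s \<Omega> ls))"

lemma richD: "rich P \<Longrightarrow> sum_list ls = card \<Omega> \<Longrightarrow> 0 \<notin> set ls \<Longrightarrow> P ls \<Longrightarrow> \<exists>s\<in>H. ctype s \<Omega> ls"
  by (simp add: rich_def)

text \<open>Stated as transitivity of two-point stabilizers; with \<open>two_trans\<close> it
  amounts to threefold transitivity (\<open>three_trans_triples\<close>).\<close>

definition three_trans :: bool where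
  "three_trans \<longleftrightarrow> (\<forall>a\<in>\<Omega>. \<forall>b\<in>\<Omega> - {a}. \<forall>c\<in>\<Omega> - {a, b}. \<forall>d\<in>\<Omega> - {a, b}. \<exists>h\<in>H. h a = a \<and> h b = b \<and> h c = d)"

lemma three_cyc_points:
  assumes "cyc_on x T" "card T = 3"
  obtains a b c where "T = {a, b, c}" "distinct [a, b, c]" "x a = b" "x b = c" "x c = a"
proof -
  have "T \<noteq> {}" using assms by auto
  then obtain a where a: "a \<in> T" by auto
  have xT: "x ` T = T" using cyc_on_image assms by blast
  have p: "(x ^^ k) a = a \<longleftrightarrow> 3 dvd k" for k using cyc_on_funpow_eq[OF assms(1) a] assms(2) by simp
  have p': "(x ^^ k) (x a) = x a \<longleftrightarrow> 3 dvd k" for k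
    using cyc_on_funpow_eq[OF assms(1), of "x a"] assms(2) a xT by auto
  have e: "(x ^^ 2) a = x (x a)" "(x ^^ 3) a = x (x (x a))" by (simp_all add: numeral_2_eq_2 numeral_3_eq_3)
  have ne: "x a \<noteq> a" "x (x a) \<noteq> a" "x (x (x a)) = a" "x (x a) \<noteq> x a"
    using p[of 1] p[of 2] p[of 3] p'[of 1] unfolding e by simp_all
  have "{a, x a, x (x a)} \<subseteq> T" using a xT by auto
  moreover have "card {a, x a, x (x a)} = card T" using ne assms(2) by auto
  ultimately have "{a, x a, x (x a)} = T" using assms by (intro card_subset_eq) (auto simp: cyc_on_def)
  then show ?thesis using that[of a "x a" "x (x a)"] ne by auto
qed

lemma exists_small_average:
  assumes "N * (\<Sum>h\<in>H. f h) < N * (2 * card H)"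
  shows "\<exists>h\<in>H. f h \<le> (1::nat)"
proof (rule ccontr)
  assume "\<not> ?thesis"
  then have "\<And>h. h \<in> H \<Longrightarrow> 2 \<le> f h" by force
  then have "(\<Sum>h\<in>H. 2) \<le> (\<Sum>h\<in>H. f h)" by (intro sum_mono) auto
  then have "2 * card H \<le> (\<Sum>h\<in>H. f h)" by simp
  then have "N * (2 * card H) \<le> N * (\<Sum>h\<in>H. f h)" by (rule mult_left_mono) simp
  then show False using assms by simp
qed

text \<open>An element fixing \<open>a\<close> and \<open>b\<close> with the properties wanted by
  \<open>two_three_cycles_controlled\<close> is found by averaging. The weighted number of unwanted
  coincidences has mean 23/(n - 2), from 9 + 2 * 4 + 2 * 3, which is below 2 for n \<ge> 14. A
  coincidence of weight 2 is absent once the number is at most 1.\<close>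

lemma three_trans_two_three_cycles:
  assumes tt: two_trans and t3: three_trans and n: "14 \<le> card \<Omega>" and x: "x \<in> H"
    and T: "moved x = T1 \<union> T2" "T1 \<inter> T2 = {}" "card T1 = 3" "card T2 = 3" "cyc_on x T1" "cyc_on x T2"
  shows has3
proof -
  obtain a b c where abc: "T1 = {a, b, c}" "distinct [a, b, c]" "x a = b" "x b = c" "x c = a"
    using three_cyc_points[OF T(5,3)] by metis
  have SO: "moved x \<subseteq> \<Omega>" using moved_subset x by blast
  have inO: "a \<in> \<Omega>" "b \<in> \<Omega> - {a}" "c \<in> \<Omega> - {a, b}" "T2 \<subseteq> \<Omega> - {a, b}"
    using SO T abc by auto
  define K where "K = {h \<in> H. \<forall>z\<in>{a, b}. h z = z}"
  interpret K: perm_group \<Omega> K unfolding K_def by (rule pointwise_stabilizer)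
  let ?Y = "\<Omega> - {a, b}"
  have cY: "card ?Y = card \<Omega> - 2" using inO abc(2) finite_Omega by (simp add: card_Diff_subset)
  have KY: "h y \<in> ?Y" if h: "h \<in> K" and y: "y \<in> ?Y" for h y
  proof -
    have "h a = a" "h b = b" using h by (auto simp: K_def)
    then show ?thesis using y K.apply_eq_iff[OF h, of y a] K.apply_eq_iff[OF h, of y b] K.apply_mem_iff[OF h] by auto
  qed
  have Ktr: "\<exists>h\<in>K. h y = y'" if y: "y \<in> ?Y" "y' \<in> ?Y" for y y'
  proof -
    obtain h where "h \<in> H" "h a = a" "h b = b" "h y = y'"
      using t3 inO y unfolding three_trans_def by blast
    then show ?thesis by (intro bexI[of _ h]) (auto simp: K_def)
  qed
  have pc: "card ?Y * (\<Sum>h\<in>K. card {a\<in>A. h a \<in> B}) = card K * (card A * card B)"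
    if "A \<subseteq> ?Y" "B \<subseteq> ?Y" for A B
  proof (rule K.point_count[OF Diff_subset _ _ that])
    show "h y \<in> ?Y" if "h \<in> K" "y \<in> ?Y" for h y using KY[OF that] .
    show "\<exists>h\<in>K. h y = y'" if "y \<in> ?Y" "y' \<in> ?Y" for y y' using Ktr[OF that] .
  qed
  have c2: "finite T2" using T card.infinite by fastforce
  have cT: "card (insert c T2) = 4" using T abc c2 by (subst card_insert_disjoint) auto
  have s1: "card ?Y * (\<Sum>h\<in>K. card {z\<in>T2. h z \<in> T2}) = card K * 9" using pc[of T2 T2] inO T by simp
  have s2: "card ?Y * (\<Sum>h\<in>K. card {z\<in>{c}. h z \<in> insert c T2}) = card K * 4" using pc[of "{c}" "insert c T2"] inO cT by simp
  have s3: "card ?Y * (\<Sum>h\<in>K. card {z\<in>T2. h z \<in> {c}}) = card K * 3" using pc[of T2 "{c}"] inO T by simp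
  define f where "f h = card {z\<in>T2. h z \<in> T2} + 2 * card {z\<in>{c}. h z \<in> insert c T2} + 2 * card {z\<in>T2. h z \<in> {c}}" for h
  have "(\<Sum>h\<in>K. f h) = (\<Sum>h\<in>K. card {z\<in>T2. h z \<in> T2}) + 2 * (\<Sum>h\<in>K. card {z\<in>{c}. h z \<in> insert c T2}) + 2 * (\<Sum>h\<in>K. card {z\<in>T2. h z \<in> {c}})"
    unfolding f_def by (simp only: sum.distrib sum_distrib_left)
  then have "card ?Y * (\<Sum>h\<in>K. f h) = card K * 9 + 2 * (card K * 4) + 2 * (card K * 3)"
    using s1 s2 s3 by (simp only: distrib_left mult.left_commute[of "card ?Y" 2])
  moreover have "0 < card K" using K.id_mem K.finite_H by (auto simp: card_gt_0_iff)
  ultimately have "card ?Y * (\<Sum>h\<in>K. f h) < card ?Y * (2 * card K)" using n cY by simp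
  then obtain g where g: "g \<in> K" "f g \<le> 1" using K.exists_small_average by blast
  have gH: "g \<in> H" "g a = a" "g b = b" using g by (auto simp: K_def)
  have f0: "card {z\<in>{c}. g z \<in> insert c T2} = 0" "card {z\<in>T2. g z \<in> {c}} = 0" "card {z\<in>T2. g z \<in> T2} \<le> 1"
    using g(2) unfolding f_def by linarith+
  have gc: "g c \<notin> insert c T2" using f0(1) by auto
  have "g c \<in> ?Y" using KY g inO by blast
  then have 1: "g c \<notin> moved x" using gc T(1) abc by auto
  have "{z\<in>T2. g z \<in> {c}} = {}" using f0(2) c2 by simp
  then have 2: "c \<notin> g ` T2" by auto
  have "T2 \<inter> g ` T2 = g ` {z\<in>T2. g z \<in> T2}" by auto
  then have 3: "card (T2 \<inter> g ` T2) \<le> 1" using f0(3) card_image_mem[OF gH(1)] by simp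
  show has3
    by (rule two_three_cycles_controlled[OF tt _ x gH(1) _ abc(2-5) _ _ T(4) gH(2,3) 1 2 3])
      (use n T abc cyc_on_image[OF T(6)] in auto)
qed

text \<open>In degree 12 the mean 23/10 is too large. So the image of \<open>c\<close> is prescribed
  as a point \<open>e\<close> outside the support, by \<open>g0\<close>, and the average runs over
  the elements \<open>k\<close> fixing \<open>a\<close>, \<open>b\<close> and \<open>e\<close>; its
  mean is (9 + 2 * 3)/9.\<close>

lemma four_trans_two_three_cycles:
  assumes tt: two_trans and t3: three_trans and n: "card \<Omega> = 12" and x: "x \<in> H"
    and four: "\<And>a b e c d. distinct [a, b, e] \<Longrightarrow> {a, b, e} \<subseteq> \<Omega> \<Longrightarrow> c \<in> \<Omega> - {a, b, e} \<Longrightarrow> d \<in> \<Omega> - {a, b, e}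
       \<Longrightarrow> \<exists>h\<in>H. h a = a \<and> h b = b \<and> h e = e \<and> h c = d"
    and T: "moved x = T1 \<union> T2" "T1 \<inter> T2 = {}" "card T1 = 3" "card T2 = 3" "cyc_on x T1" "cyc_on x T2"
  shows has3
proof -
  obtain a b c where abc: "T1 = {a, b, c}" "distinct [a, b, c]" "x a = b" "x b = c" "x c = a"
    using three_cyc_points[OF T(5,3)] by metis
  have SO: "moved x \<subseteq> \<Omega>" using moved_subset x by blast
  have inO: "a \<in> \<Omega>" "b \<in> \<Omega> - {a}" "c \<in> \<Omega> - {a, b}" "T2 \<subseteq> \<Omega> - {a, b}"
    using SO T abc by auto
  have c2: "finite T2" using T card.infinite by fastforce
  have "card (moved x) = 6" using T c2 abc by (simp add: card_Un_disjoint)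
  then have "\<not> \<Omega> \<subseteq> moved x" using card_mono[OF finite_moved[OF x], of \<Omega>] n by auto
  then obtain e where e: "e \<in> \<Omega>" "e \<notin> moved x" by auto
  have eab: "e \<in> \<Omega> - {a, b}" "e \<noteq> c" "e \<notin> T2" using e T(1) abc by auto
  obtain g0 where g0: "g0 \<in> H" "g0 a = a" "g0 b = b" "g0 c = e"
    using t3 inO eab(1) unfolding three_trans_def by blast
  define K where "K = {h \<in> H. \<forall>z\<in>{a, b, e}. h z = z}"
  interpret K: perm_group \<Omega> K unfolding K_def by (rule pointwise_stabilizer)
  let ?Y = "\<Omega> - {a, b, e}"
  have dis: "distinct [a, b, e]" using abc eab by auto
  have cY: "card ?Y = 9"
  proof -
    have "card ?Y = card \<Omega> - card {a, b, e}" using inO e by (intro card_Diff_subset) auto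
    then show ?thesis using n dis by simp
  qed
  have KY: "h y \<in> ?Y" if h: "h \<in> K" and y: "y \<in> ?Y" for h y
  proof -
    have "h a = a" "h b = b" "h e = e" using h by (auto simp: K_def)
    then show ?thesis using y K.apply_eq_iff[OF h, of y a] K.apply_eq_iff[OF h, of y b] K.apply_eq_iff[OF h, of y e]
      K.apply_mem_iff[OF h] by auto
  qed
  have Ktr: "\<exists>h\<in>K. h y = y'" if y: "y \<in> ?Y" "y' \<in> ?Y" for y y'
  proof -
    have "{a, b, e} \<subseteq> \<Omega>" using inO e by auto
    then obtain h where "h \<in> H" "h a = a" "h b = b" "h e = e" "h y = y'" using four[OF dis _ y] by blast
    then show ?thesis by (auto simp: K_def)
  qed
  have pc: "card ?Y * (\<Sum>h\<in>K. card {a\<in>A. h a \<in> B}) = card K * (card A * card B)"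
    if "A \<subseteq> ?Y" "B \<subseteq> ?Y" for A B
  proof (rule K.point_count[OF Diff_subset _ _ that])
    show "h y \<in> ?Y" if "h \<in> K" "y \<in> ?Y" for h y using KY[OF that] .
    show "\<exists>h\<in>K. h y = y'" if "y \<in> ?Y" "y' \<in> ?Y" for y y' using Ktr[OF that] .
  qed
  define A where "A = g0 ` T2"
  have cA: "card A = 3" using card_image_mem[OF g0(1)] T by (simp add: A_def)
  have AY: "A \<subseteq> ?Y"
  proof -
    have "g0 ` ({a, b, c} \<inter> T2) = {a, b, e} \<inter> A" unfolding image_int[OF g0(1)] A_def using g0 by simp
    moreover have "{a, b, c} \<inter> T2 = {}" using T abc by simp
    ultimately have "{a, b, e} \<inter> A = {}" by simp
    moreover have "A \<subseteq> \<Omega>" using inO g0(1) by (auto simp: A_def)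
    ultimately show ?thesis by blast
  qed
  have sub: "T2 \<subseteq> ?Y" "{c} \<subseteq> ?Y" using inO eab by auto
  have s1: "card ?Y * (\<Sum>h\<in>K. card {z\<in>A. h z \<in> T2}) = card K * 9" using pc[of A T2] AY sub T cA by simp
  have s3: "card ?Y * (\<Sum>h\<in>K. card {z\<in>A. h z \<in> {c}}) = card K * 3" using pc[of A "{c}"] AY sub cA by simp
  define f where "f h = card {z\<in>A. h z \<in> T2} + 2 * card {z\<in>A. h z \<in> {c}}" for h
  have "(\<Sum>h\<in>K. f h) = (\<Sum>h\<in>K. card {z\<in>A. h z \<in> T2}) + 2 * (\<Sum>h\<in>K. card {z\<in>A. h z \<in> {c}})"
    unfolding f_def by (simp only: sum.distrib sum_distrib_left)
  then have "card ?Y * (\<Sum>h\<in>K. f h) = card K * 9 + 2 * (card K * 3)"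
    using s1 s3 by (simp only: distrib_left mult.left_commute[of "card ?Y" 2])
  moreover have "0 < card K" using K.id_mem K.finite_H by (auto simp: card_gt_0_iff)
  ultimately have "card ?Y * (\<Sum>h\<in>K. f h) < card ?Y * (2 * card K)" using cY by simp
  then obtain k where k: "k \<in> K" "f k \<le> 1" using K.exists_small_average by blast
  have kH: "k \<in> H" "k a = a" "k b = b" "k e = e" using k by (auto simp: K_def)
  have f0: "card {z\<in>A. k z \<in> {c}} = 0" "card {z\<in>A. k z \<in> T2} \<le> 1" using k(2) unfolding f_def by linarith+
  define g where "g = k \<circ> g0"
  have gH: "g \<in> H" "g a = a" "g b = b" "g c = e" using kH g0 comp_mem by (auto simp: g_def)
  have 1: "g c \<notin> moved x" using gH e by simp
  have fA: "finite A" using c2 by (simp add: A_def)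
  have "{z\<in>A. k z \<in> {c}} = {}" using f0(1) fA by simp
  then have 2: "c \<notin> g ` T2" by (auto simp: g_def A_def)
  have "T2 \<inter> g ` T2 = k ` {z\<in>A. k z \<in> T2}" by (auto simp: g_def A_def)
  then have 3: "card (T2 \<inter> g ` T2) \<le> 1" using f0(2) card_image_mem[OF kH(1)] by simp
  show has3
    by (rule two_three_cycles_controlled[OF tt _ x gH(1) _ abc(2-5) _ _ T(4) gH(2,3) 1 2 3])
      (use n T abc cyc_on_image[OF T(6)] in auto)
qed

text \<open>Squaring fixes both points of the 2-cycle and splits the other cycle; double
  transitivity moves the fixed points to \<open>a\<close> and \<open>b\<close>.\<close>

lemma square_of_two_orbits:
  assumes tt: two_trans and s: "s \<in> H" "ctype s \<Omega> [2, 2 * m]" and ab: "a \<in> \<Omega>" "b \<in> \<Omega>" "a \<noteq> b"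
  obtains t where "t \<in> H" "t a = a" "t b = b" "ctype t (\<Omega> - {a, b}) [m, m]"
proof -
  obtain C where C: "C \<subseteq> \<Omega>" "card C = 2" "cyc_on s C" "ctype s (\<Omega> - C) [2 * m]" using s(2) by auto
  obtain p q where pq: "C = {p, q}" "p \<noteq> q" using C(2) by (auto simp: card_2_iff)
  have "(s ^^ 2) z = z" if "z \<in> C" for z using cyc_on_funpow_eq[OF C(3) that, of 2] unfolding C(2) by simp
  then have fx: "(s ^^ 2) p = p" "(s ^^ 2) q = q" unfolding pq by simp_all
  obtain D where D: "D \<subseteq> \<Omega> - C" "card D = 2 * m" "0 < 2 * m" "cyc_on s D" "\<Omega> - C - D = {}" using C(4) by auto
  then have "D = \<Omega> - C" by auto
  then have ct: "ctype (s ^^ 2) (\<Omega> - C) [m, m]" using ctype_square_split[OF D(4,2)] D(3) by simp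
  obtain h where h: "h \<in> H" "h p = a" "h q = b" using two_transD[OF tt, of p q a b] C(1) pq ab by auto
  have "h ` (\<Omega> - C) = \<Omega> - {a, b}" unfolding image_diff[OF h(1)] image_Omega[OF h(1)] pq using h by simp
  then have "ctype (h \<circ> s ^^ 2 \<circ> inv' h) (\<Omega> - {a, b}) [m, m]" using ctype_conj[OF ct bij_mem[OF h(1)]] by simp
  moreover have "inv' h a = p" "inv' h b = q" using h inv_apply(1) by metis+
  moreover have "h \<circ> s ^^ 2 \<circ> inv' h \<in> H" using conj_mem h pow_mem s by blast
  ultimately show ?thesis using that[of "h \<circ> s ^^ 2 \<circ> inv' h"] fx h by simp
qed

text \<open>On the ten points outside \<open>a\<close> and \<open>b\<close>, orbit sizes of the
  stabilizer are subset sums of [5, 5] and of [1, 9].\<close>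

lemma three_trans_12:
  assumes tt: two_trans and n: "card \<Omega> = 12"
    and s: "s \<in> H" "ctype s \<Omega> [2, 10]" and r: "r \<in> H" "ctype r \<Omega> [Suc 0, Suc 0, Suc 0, 9]"
  shows three_trans
  unfolding three_trans_def
proof (intro ballI)
  fix a b c d assume ab: "a \<in> \<Omega>" "b \<in> \<Omega> - {a}" and cd: "c \<in> \<Omega> - {a, b}" "d \<in> \<Omega> - {a, b}"
  obtain t where t: "t \<in> H" "t a = a" "t b = b" "ctype t (\<Omega> - {a, b}) [5, 5]"
    using square_of_two_orbits[OF tt s(1), of 5 a b] s(2) ab by auto
  obtain p where p: "p \<in> \<Omega>" "r p = p" "ctype r (\<Omega> - {p}) [Suc 0, Suc 0, 9]" using fixed_point_type[OF r(2)] by blast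
  interpret S: perm_group "\<Omega> - {p}" "{h \<in> H. h p = p}" by (rule stabilizer[OF p(1)])
  obtain q where q: "q \<in> \<Omega> - {p}" "r q = q" "ctype r (\<Omega> - {p} - {q}) [Suc 0, 9]" using S.fixed_point_type[OF p(3)] by blast
  obtain h where h: "h \<in> H" "h p = a" "h q = b" using two_transD[OF tt, of p q a b] p q ab by auto
  let ?r = "h \<circ> r \<circ> inv' h"
  have iv: "inv' h a = p" "inv' h b = q" using h inv_apply(1) by metis+
  have "h ` (\<Omega> - {p} - {q}) = \<Omega> - {a} - {b}" unfolding image_diff[OF h(1)] image_Omega[OF h(1)] using h by simp
  then have r': "ctype ?r (\<Omega> - {a} - {b}) [Suc 0, 9]" using ctype_conj[OF q(3) bij_mem[OF h(1)]] by simp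
  have rH: "?r \<in> H" "?r a = a" "?r b = b" using conj_mem[OF h(1) r(1)] iv p q h by auto
  interpret A: perm_group "\<Omega> - {a}" "{h \<in> H. h a = a}" by (rule stabilizer[OF ab(1)])
  interpret B: perm_group "\<Omega> - {a} - {b}" "{h \<in> {h \<in> H. h a = a}. h b = b}" by (rule A.stabilizer[OF ab(2)])
  have eq: "\<Omega> - {a, b} = \<Omega> - {a} - {b}" by auto
  have cB: "card (\<Omega> - {a} - {b}) = 10" using ab n finite_Omega by simp
  have m: "t \<in> {h \<in> {h \<in> H. h a = a}. h b = b}" "?r \<in> {h \<in> {h \<in> H. h a = a}. h b = b}" using t rH by auto
  have "B.trans_on"
    by (rule B.trans_on_of_types[OF m(1) t(4)[unfolded eq] m(2) r']) (use cB in auto)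
  then show "\<exists>h\<in>H. h a = a \<and> h b = b \<and> h c = d" using B.trans_onD cd unfolding eq by blast
qed

lemma three_trans_triples:
  assumes tt: two_trans and t3: three_trans
    and "distinct [a, b, c]" "{a, b, c} \<subseteq> \<Omega>" "distinct [u, v, w]" "{u, v, w} \<subseteq> \<Omega>"
  shows "\<exists>h\<in>H. h a = u \<and> h b = v \<and> h c = w"
proof -
  obtain k where k: "k \<in> H" "k a = u" "k b = v" using two_transD[OF tt, of a b u v] assms by auto
  have "k c \<in> \<Omega> - {u, v}" using k assms apply_eq_iff[OF k(1), of c a] apply_eq_iff[OF k(1), of c b] by auto
  moreover have "u \<in> \<Omega>" "v \<in> \<Omega> - {u}" "w \<in> \<Omega> - {u, v}" using assms by auto
  ultimately obtain h where "h \<in> H" "h u = u" "h v = v" "h (k c) = w" using t3 unfolding three_trans_def by blast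
  then show ?thesis using k comp_mem by (intro bexI[of _ "h \<circ> k"]) auto
qed

text \<open>A conjugate of \<open>r\<close> has \<open>a\<close>, \<open>b\<close>, \<open>e\<close>
  as its fixed points, and its 9-cycle runs through all others.\<close>

lemma four_trans_12:
  assumes tt: two_trans and t3: three_trans and r: "r \<in> H" "ctype r \<Omega> [Suc 0, Suc 0, Suc 0, 9]"
    and abe: "distinct [a, b, e]" "{a, b, e} \<subseteq> \<Omega>" and cd: "c \<in> \<Omega> - {a, b, e}" "d \<in> \<Omega> - {a, b, e}"
  shows "\<exists>h\<in>H. h a = a \<and> h b = b \<and> h e = e \<and> h c = d"
proof -
  obtain p where p: "p \<in> \<Omega>" "r p = p" "ctype r (\<Omega> - {p}) [Suc 0, Suc 0, 9]" using fixed_point_type[OF r(2)] by blast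
  interpret S: perm_group "\<Omega> - {p}" "{h \<in> H. h p = p}" by (rule stabilizer[OF p(1)])
  obtain q where q: "q \<in> \<Omega> - {p}" "r q = q" "ctype r (\<Omega> - {p} - {q}) [Suc 0, 9]" using S.fixed_point_type[OF p(3)] by blast
  interpret S2: perm_group "\<Omega> - {p} - {q}" "{h \<in> {h \<in> H. h p = p}. h q = q}" by (rule S.stabilizer[OF q(1)])
  obtain z where z: "z \<in> \<Omega> - {p} - {q}" "r z = z" "ctype r (\<Omega> - {p} - {q} - {z}) [9]" using S2.fixed_point_type[OF q(3)] by blast
  have cyc: "cyc_on r (\<Omega> - {p} - {q} - {z})"
  proof -
    obtain C where "C \<subseteq> \<Omega> - {p} - {q} - {z}" "cyc_on r C" "\<Omega> - {p} - {q} - {z} - C = {}" using z(3) by auto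
    moreover then have "C = \<Omega> - {p} - {q} - {z}" by blast
    ultimately show ?thesis by simp
  qed
  have "distinct [p, q, z]" "{p, q, z} \<subseteq> \<Omega>" using p q z by auto
  then obtain h where h: "h \<in> H" "h p = a" "h q = b" "h z = e" using three_trans_triples[OF tt t3 _ _ abe] by blast
  let ?r = "h \<circ> r \<circ> inv' h"
  have iv: "inv' h a = p" "inv' h b = q" "inv' h e = z" using h inv_apply(1) by metis+
  have img: "h ` (\<Omega> - {p} - {q} - {z}) = \<Omega> - {a, b, e}"
    unfolding image_diff[OF h(1)] image_Omega[OF h(1)] using h by auto
  have c': "cyc_on ?r (\<Omega> - {a, b, e})" using cyc_on_conj[OF cyc bij_mem[OF h(1)]] unfolding img .
  have rH: "?r \<in> H" "?r a = a" "?r b = b" "?r e = e" using conj_mem[OF h(1) r(1)] iv p q z h by auto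
  obtain k where "(?r ^^ k) c = d" using cyc_onD[OF c' cd] by blast
  moreover have "(?r ^^ k) a = a" "(?r ^^ k) b = b" "(?r ^^ k) e = e"
    by (rule funpow_fixed, rule rH)+
  ultimately show ?thesis using pow_mem[OF rH(1), of k] by blast
qed

text \<open>If it failed, the subset sums of [m, m] would give every two-point stabilizer orbits of
  size exactly m. The orbit \<open>L\<close> of the pair \<open>(u, v)\<close> under the stabilizer
  of \<alpha> would have (2m + 1) m elements, an odd number. But \<open>t\<close> swaps
  \<open>u\<close> and \<open>v\<close>, so \<open>L\<close> is closed under reversal of pairs and
  its size is even.\<close>

lemma three_trans_tournament:
  assumes tt: two_trans and m: "odd m" "card \<Omega> = 2 * m + 2"
    and s: "s \<in> H" "ctype s \<Omega> [2, 2 * m]"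
    and t: "t \<in> H" "\<alpha> \<in> \<Omega>" "u \<in> \<Omega>" "v \<in> \<Omega>" "t \<alpha> = \<alpha>" "t u = v" "t v = u" "distinct [\<alpha>, u, v]"
  shows three_trans
proof (rule ccontr)
  define K where "K a b = {h \<in> {h \<in> H. h a = a}. h b = b}" for a b
  have Kg: "perm_group (\<Omega> - {a} - {b}) (K a b)" if ab: "a \<in> \<Omega>" "b \<in> \<Omega> - {a}" for a b
  proof -
    interpret A: perm_group "\<Omega> - {a}" "{h \<in> H. h a = a}" by (rule stabilizer[OF ab(1)])
    show ?thesis unfolding K_def by (rule A.stabilizer[OF ab(2)])
  qed
  define orb where "orb a b c = (\<lambda>h. h c) ` K a b" for a b c
  have size: "card (orb a b c) = m \<or> card (orb a b c) = 2 * m" and fin: "finite (orb a b c)" "orb a b c \<subseteq> \<Omega> - {a} - {b}"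
    if ab: "a \<in> \<Omega>" "b \<in> \<Omega> - {a}" and c: "c \<in> \<Omega> - {a} - {b}" for a b c
  proof -
    interpret B: perm_group "\<Omega> - {a} - {b}" "K a b" by (rule Kg[OF ab])
    have eq: "\<Omega> - {a, b} = \<Omega> - {a} - {b}" by auto
    have ne: "b \<in> \<Omega>" "a \<noteq> b" using ab by auto
    obtain x where x: "x \<in> H" "x a = a" "x b = b" "ctype x (\<Omega> - {a, b}) [m, m]"
      using square_of_two_orbits[OF tt s ab(1) ne] by blast
    have xK: "x \<in> K a b" using x by (simp add: K_def)
    have oe: "orb a b c = B.orbit_of c" by (simp add: orb_def B.orbit_of_def)
    show "orb a b c \<subseteq> \<Omega> - {a} - {b}" unfolding oe by (rule B.orbit_of_sub[OF c])
    then show "finite (orb a b c)" using finite_Omega by (meson finite_Diff finite_subset)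
    show "card (orb a b c) = m \<or> card (orb a b c) = 2 * m"
      using B.orbit_of_card[OF c xK x(4)[unfolded eq]] B.orbit_of_card_pos[OF c] unfolding oe by auto
  qed
  assume "\<not> three_trans"
  then obtain a b c d where ab: "a \<in> \<Omega>" "b \<in> \<Omega> - {a}" and cd: "c \<in> \<Omega> - {a, b}" "d \<in> \<Omega> - {a, b}"
    and no: "\<not> (\<exists>h\<in>H. h a = a \<and> h b = b \<and> h c = d)" unfolding three_trans_def by blast
  have small_ab: "card (orb a b z) = m" if z: "z \<in> \<Omega> - {a} - {b}" for z
  proof (rule ccontr)
    assume "card (orb a b z) \<noteq> m"
    then have "card (orb a b z) = 2 * m" using size[OF ab z] by simp
    moreover have "card (\<Omega> - {a} - {b}) = 2 * m" using ab m finite_Omega by simp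
    ultimately have full: "orb a b z = \<Omega> - {a} - {b}"
      using fin[OF ab z] finite_Omega by (intro card_subset_eq) auto
    then have "c \<in> orb a b z" "d \<in> orb a b z" using cd by auto
    then obtain h k where hk: "h \<in> K a b" "k \<in> K a b" "h z = c" "k z = d" by (auto simp: orb_def)
    interpret B: perm_group "\<Omega> - {a} - {b}" "K a b" by (rule Kg[OF ab])
    have "k \<circ> inv' h \<in> K a b" using hk by (intro B.comp_mem B.inv_mem)
    moreover have "(k \<circ> inv' h) c = d" using hk B.inv_apply(1)[OF hk(1), of z] by simp
    ultimately show False using no unfolding K_def by blast
  qed
  have small: "card (orb \<alpha> w z) = m" if w: "w \<in> \<Omega> - {\<alpha>}" and z: "z \<in> \<Omega> - {\<alpha>} - {w}" for w z
  proof -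
    obtain l where l: "l \<in> H" "l a = \<alpha>" "l b = w" using two_transD[OF tt, of a b \<alpha> w] ab w t(2) by auto
    have il: "inv' l \<in> H" using inv_mem l by auto
    have ila: "inv' l \<alpha> = a" "inv' l w = b" using l inv_apply(1) by metis+
    let ?z = "inv' l z"
    have z': "?z \<in> \<Omega> - {a} - {b}" using z ila apply_eq_iff[OF il] apply_mem_iff[OF il] by (metis Diff_iff singleton_iff)
    have "orb \<alpha> w z \<subseteq> l ` orb a b ?z"
    proof
      fix y assume "y \<in> orb \<alpha> w z"
      then obtain h where h: "h \<in> H" "h \<alpha> = \<alpha>" "h w = w" "y = h z" by (auto simp: orb_def K_def)
      have "inv' l \<circ> h \<circ> l \<in> K a b" using h l ila il by (auto simp: K_def intro!: comp_mem)
      then have "(inv' l \<circ> h \<circ> l) ?z \<in> orb a b ?z" unfolding orb_def by blast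
      then have "l ((inv' l \<circ> h \<circ> l) ?z) \<in> l ` orb a b ?z" by blast
      then show "y \<in> l ` orb a b ?z" using h l by simp
    qed
    moreover have "finite (l ` orb a b ?z)" using fin[OF ab z'] by simp
    ultimately have "card (orb \<alpha> w z) \<le> card (l ` orb a b ?z)" by (rule card_mono[rotated])
    then have "card (orb \<alpha> w z) \<le> m" using small_ab[OF z'] card_image_mem[OF l(1)] by simp
    then show ?thesis using size[OF t(2) w z] m(1) by (auto elim: oddE)
  qed
  define L where "L = (\<lambda>k. (k u, k v)) ` {h \<in> H. h \<alpha> = \<alpha>}"
  have Lsub: "L \<subseteq> pairs \<Omega>" using t(3,4,8) by (auto simp: L_def pairs_def)
  have finL: "finite L" using Lsub finite_pairs[OF finite_Omega] finite_subset by blast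
  have symL: "(q, p) \<in> L" if pq: "(p, q) \<in> L" for p q
  proof -
    obtain k where k: "k \<in> H" "k \<alpha> = \<alpha>" "p = k u" "q = k v" using pq by (auto simp: L_def)
    have "k \<circ> t \<in> {h \<in> H. h \<alpha> = \<alpha>}" using k t comp_mem by auto
    then have "((k \<circ> t) u, (k \<circ> t) v) \<in> L" unfolding L_def by blast
    then show ?thesis using k t by simp
  qed
  have "2 dvd card (\<Union>((\<lambda>(p, q). {(p, q), (q, p)}) ` L))"
  proof (rule dvd_partition)
    show "finite (\<Union>((\<lambda>(p, q). {(p, q), (q, p)}) ` L))" using finL by auto
    show "\<forall>c\<in>(\<lambda>(p, q). {(p, q), (q, p)}) ` L. 2 dvd card c" using Lsub by (auto simp: pairs_def)
  qed auto
  moreover have "\<Union>((\<lambda>(p, q). {(p, q), (q, p)}) ` L) = L" using symL by auto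
  ultimately have evenL: "even (card L)" by simp
  have fiber: "card {q. (w, q) \<in> L} = m" if w: "w \<in> \<Omega> - {\<alpha>}" for w
  proof -
    obtain k where k: "k \<in> H" "k \<alpha> = \<alpha>" "k u = w" using two_transD[OF tt, of \<alpha> u \<alpha> w] t w by auto
    have kv: "k v \<in> \<Omega> - {\<alpha>} - {w}"
      using k t apply_eq_iff[OF k(1), of v \<alpha>] apply_eq_iff[OF k(1), of v u] by auto
    have "{q. (w, q) \<in> L} = orb \<alpha> w (k v)"
    proof
      show "{q. (w, q) \<in> L} \<subseteq> orb \<alpha> w (k v)"
      proof
        fix q assume "q \<in> {q. (w, q) \<in> L}"
        then obtain h where h: "h \<in> H" "h \<alpha> = \<alpha>" "w = h u" "q = h v" by (auto simp: L_def)
        have "inv' k \<alpha> = \<alpha>" "inv' k w = u" using k inv_apply(1) by metis+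
        then have "h \<circ> inv' k \<in> K \<alpha> w" using h k by (auto simp: K_def intro!: comp_mem inv_mem)
        then have "(h \<circ> inv' k) (k v) \<in> orb \<alpha> w (k v)" unfolding orb_def by blast
        then show "q \<in> orb \<alpha> w (k v)" using h k by simp
      qed
      show "orb \<alpha> w (k v) \<subseteq> {q. (w, q) \<in> L}"
      proof
        fix q assume "q \<in> orb \<alpha> w (k v)"
        then obtain h where h: "h \<in> H" "h \<alpha> = \<alpha>" "h w = w" "q = h (k v)" by (auto simp: orb_def K_def)
        have "h \<circ> k \<in> {h \<in> H. h \<alpha> = \<alpha>}" using h k comp_mem by auto
        then have "((h \<circ> k) u, (h \<circ> k) v) \<in> L" unfolding L_def by blast
        then show "q \<in> {q. (w, q) \<in> L}" using h k by simp
      qed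
    qed
    then show ?thesis using small[OF w kv] by simp
  qed
  have "L = (SIGMA w:\<Omega> - {\<alpha>}. {q. (w, q) \<in> L})"
  proof -
    have "w \<in> \<Omega> - {\<alpha>}" if wq: "(w, q) \<in> L" for w q
    proof -
      obtain k where k: "k \<in> H" "k \<alpha> = \<alpha>" "w = k u" using wq by (auto simp: L_def)
      then show ?thesis using t apply_eq_iff[OF k(1), of u \<alpha>] by auto
    qed
    then show ?thesis by auto
  qed
  moreover have "card (SIGMA w:\<Omega> - {\<alpha>}. {q. (w, q) \<in> L}) = (\<Sum>w\<in>\<Omega> - {\<alpha>}. card {q. (w, q) \<in> L})"
  proof (rule card_SigmaI)
    show "\<forall>w\<in>\<Omega> - {\<alpha>}. finite {q. (w, q) \<in> L}"
    proof
      fix w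
      have "{q. (w, q) \<in> L} \<subseteq> snd ` L" by force
      then show "finite {q. (w, q) \<in> L}" using finL finite_subset by blast
    qed
  qed (use finite_Omega in simp)
  ultimately have "card L = (\<Sum>w\<in>\<Omega> - {\<alpha>}. m)" using fiber by simp
  then have "card L = (2 * m + 1) * m" using t(2) m finite_Omega by simp
  then show False using evenL m(1) by simp
qed

end

section \<open>Groups that cover all types without forbidden subset sums\<close>

lemma not_coprime_factor: "1 < d \<Longrightarrow> d dvd t \<Longrightarrow> d dvd n \<Longrightarrow> \<not> coprime t (n::nat)"
  by (metis coprime_common_divisor nat_dvd_1_iff_1 nat_neq_iff)

text \<open>The intransitive components found from two-cycle types have an invariant set of size
  coprime to n and different from 1 and n - 1, so they cover none of these types.\<close>

definition avoiding :: "nat \<Rightarrow> nat list \<Rightarrow> bool" where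
  "avoiding n ls \<longleftrightarrow> (\<forall>t\<in>ssums ls. coprime t n \<longrightarrow> t = 1 \<or> t = n - 1)"

lemma avoiding_dvd:
  assumes "1 < p" "p dvd n" "\<And>l. l \<in> set ls \<Longrightarrow> p dvd l"
  shows "avoiding n ls"
  unfolding avoiding_def using not_coprime_factor[OF assms(1) _ assms(2)] dvd_ssums[OF assms(3)] by blast

lemma avoiding_fixed_point: "2 \<le> n \<Longrightarrow> avoiding n [Suc 0, n - 1]"
  by (auto simp: avoiding_def)

lemma sum_list_replicate_nat: "sum_list (replicate k (c::nat)) = k * c"
  by (induct k) auto

context perm_group
begin

lemma two_trans_stabilizer_has3:
  assumes tt: two_trans and s: "s \<in> H" "ctype s \<Omega> [Suc 0, p, q]"
    and p: "2 \<le> p" "p \<le> q" and co: "coprime p q"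
  shows has3
proof -
  obtain a where a: "a \<in> \<Omega>" "s a = a" "ctype s (\<Omega> - {a}) [p, q]" using fixed_point_type[OF s(2)] .
  interpret K: perm_group "\<Omega> - {a}" "{h \<in> H. h a = a}" by (rule stabilizer[OF a(1)])
  have "K.trans_on"
    unfolding K.trans_on_def
  proof (intro ballI)
    fix b c assume bc: "b \<in> \<Omega> - {a}" "c \<in> \<Omega> - {a}"
    then obtain h where "h \<in> H" "h a = a" "h b = c" using two_transD[OF tt a(1) _ a(1), of b c] by blast
    then show "\<exists>h\<in>{h \<in> H. h a = a}. h b = c" by (intro bexI[of _ h]) auto
  qed
  then have "K.has3" using K.two_cycles_type_has3[OF _ _ a(3) p co] s(1) a(2) by simp
  then show ?thesis unfolding K.has3_def has3_def by blast
qed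

lemma rich_even_two_trans:
  assumes R: "rich (\<lambda>ls. even (card \<Omega> + length ls) \<and> avoiding (card \<Omega>) ls)"
    and n: "even (card \<Omega>)" "4 \<le> card \<Omega>"
  shows two_trans
proof -
  define n where "n = card \<Omega>"
  obtain m where m: "n = 2 * m" using n by (auto simp: n_def)
  have m2: "2 \<le> m" using n m by (simp add: n_def)
  obtain s where s: "s \<in> H" "ctype s \<Omega> [Suc 0, card \<Omega> - 1]"
    using richD[OF R, of "[Suc 0, card \<Omega> - 1]"] n avoiding_fixed_point[of "card \<Omega>"] by (auto simp del: ctype.simps)
  have "avoiding (card \<Omega>) [m, m]" using m m2 by (intro avoiding_dvd[of m]) (auto simp: n_def)
  then obtain t where t: "t \<in> H" "ctype t \<Omega> [m, m]"
    using richD[OF R, of "[m, m]"] n m m2 by (auto simp del: ctype.simps simp: n_def)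
  have "trans_on" using m m2 unfolding n_def by (intro trans_on_of_types[OF s t]) auto
  then show ?thesis using two_trans_of_types s by blast
qed

text \<open>If n = 2 modulo 4, a power of an element of type [4, n - 4] moves 4 points, and 3^2 <
  10. If 4 divides n, the square of an element of type [6, 2, ..., 2] is a product of two 3-cycles,
  which suffices from degree 19 on; in degrees 12 and 16 higher transitivity makes up for the small
  degree.\<close>

lemma rich_even_has3:
  assumes R: "rich (\<lambda>ls. even (card \<Omega> + length ls) \<and> avoiding (card \<Omega>) ls)"
    and n: "even (card \<Omega>)" "10 \<le> card \<Omega>"
  shows "primitive \<and> has3"
proof -
  have tt: two_trans using rich_even_two_trans[OF R] n by simp
  have ev: "\<exists>s\<in>H. ctype s \<Omega> ls"
    if ls: "sum_list ls = card \<Omega>" "even (length ls)" "\<forall>l\<in>set ls. 2 dvd l" "0 \<notin> set ls" for ls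
    using ls n by (intro richD[OF R]) (auto intro!: avoiding_dvd[of 2])
  have six: "\<exists>x T1 T2. x \<in> H \<and> moved x = T1 \<union> T2 \<and> T1 \<inter> T2 = {} \<and> card T1 = 3 \<and> card T2 = 3 \<and> cyc_on x T1 \<and> cyc_on x T2"
    if n4: "4 dvd card \<Omega>"
  proof -
    obtain k where k: "card \<Omega> = 4 * k" using n4 by auto
    \<comment> \<open>6 + 2j is the degree, and j is odd, so the number 1 + j of cycles is even as
      required.\<close>
    define j where "j = 2 * k - 3"
    have j: "j + 3 = 2 * k" using n k by (simp add: j_def)
    have "odd j" using j by presburger
    have "sum_list (6 # replicate j 2) = card \<Omega>" using j k by (simp add: sum_list_replicate_nat)
    then obtain s where s: "s \<in> H" "ctype s \<Omega> (6 # replicate j 2)"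
      using ev[of "6 # replicate j 2"] \<open>odd j\<close> by (auto simp del: ctype.simps split: if_splits)
    obtain T1 T2 where "moved (s ^^ 2) = T1 \<union> T2" "T1 \<inter> T2 = {}" "card T1 = 3" "card T2 = 3"
      "cyc_on (s ^^ 2) T1" "cyc_on (s ^^ 2) T2"
      using six_cycle_square[OF s, of 2] by (auto split: if_splits)
    then show ?thesis using pow_mem[OF s(1), of 2] by blast
  qed
  have "card \<Omega> mod 4 = 2 \<or> card \<Omega> = 12 \<or> card \<Omega> = 16 \<or> 4 dvd card \<Omega> \<and> 20 \<le> card \<Omega>"
    using n by presburger
  then consider (two) "card \<Omega> mod 4 = 2" | (twelve) "card \<Omega> = 12" | (sixteen) "card \<Omega> = 16"
    | (big) "4 dvd card \<Omega>" "20 \<le> card \<Omega>" by blast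
  then have has3
  proof cases
    case two
    obtain s where s: "s \<in> H" "ctype s \<Omega> [4, card \<Omega> - 4]" using ev[of "[4, card \<Omega> - 4]"] n by (auto simp del: ctype.simps)
    have nd: "\<not> 4 dvd card \<Omega> - 4" using two n by presburger
    have c: "card (moved (s ^^ (card \<Omega> - 4))) = 4" using moved_power_card[OF s] nd by simp
    show ?thesis
      using c n not_id_of_card[of "s ^^ (card \<Omega> - 4)"]
      by (intro small_degree_has3[OF tt pow_mem[OF s(1), of "card \<Omega> - 4"], of 4]) auto
  next
    case big
    then obtain x T1 T2 where "x \<in> H" "moved x = T1 \<union> T2" "T1 \<inter> T2 = {}" "card T1 = 3" "card T2 = 3" "cyc_on x T1" "cyc_on x T2"
      using six by blast
    then show ?thesis using two_three_cycles_has3[OF tt] big by simp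
  next
    case sixteen
    obtain s where s: "s \<in> H" "ctype s \<Omega> [2, 14]" using ev[of "[2, 14]"] sixteen by (auto simp del: ctype.simps)
    obtain t where t: "t \<in> H" "ctype t \<Omega> [4, 8, 2, 2]" using ev[of "[4, 8, 2, 2]"] sixteen by (auto simp del: ctype.simps)
    obtain A where A: "A \<subseteq> \<Omega>" "card A = 4" "cyc_on t A" "ctype t (\<Omega> - A) [8, 2, 2]" using t(2) by auto
    obtain B where B: "B \<subseteq> \<Omega> - A" "card B = 8" "cyc_on t B" using A(4) by auto
    obtain \<alpha> where \<alpha>: "\<alpha> \<in> A" using A(2) by fastforce
    obtain u where u: "u \<in> B" using B(2) by fastforce
    \<comment> \<open>The fourth power of \<open>t\<close> fixes the points of the 4-cycle and pairs
      off those of the 8-cycle; this is the involution demanded by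
      \<open>three_trans_tournament\<close> for 16 = 2 * 7 + 2.\<close>
    have 1: "(t ^^ 4) \<alpha> = \<alpha>" using cyc_on_funpow_eq[OF A(3) \<alpha>, of 4] A(2) by simp
    have 2: "(t ^^ 4) u \<noteq> u" using cyc_on_funpow_eq[OF B(3) u, of 4] B(2) by simp
    have 3: "(t ^^ 8) u = u" using cyc_on_funpow_eq[OF B(3) u, of 8] B(2) by simp
    have 4: "(t ^^ 4) ((t ^^ 4) u) = u" using 3 funpow_add_apply[of 4 4 t u] by simp
    have 5: "(t ^^ 4) u \<in> B" using funpow_in_image[OF cyc_on_image[OF B(3)] u] .
    have three_trans
      using sixteen s 2 5 u \<alpha> A(1) B(1)
      by (intro three_trans_tournament[OF tt, of 7 s, OF _ _ _ _ pow_mem[OF t(1), of 4] _ _ _ 1 refl 4]) auto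
    moreover obtain x T1 T2 where "x \<in> H" "moved x = T1 \<union> T2" "T1 \<inter> T2 = {}" "card T1 = 3" "card T2 = 3" "cyc_on x T1" "cyc_on x T2"
      using six sixteen by auto
    ultimately show ?thesis using three_trans_two_three_cycles[OF tt] sixteen by simp
  next
    case twelve
    obtain s where s: "s \<in> H" "ctype s \<Omega> [2, 10]" using ev[of "[2, 10]"] twelve by (auto simp del: ctype.simps)
    have nc: "\<not> coprime 2 (12::nat)" "\<not> coprime 3 (12::nat)" "\<not> coprime 9 (12::nat)" "\<not> coprime 10 (12::nat)"
      using not_coprime_factor[of 2 2 12] not_coprime_factor[of 3 3 12] not_coprime_factor[of 3 9 12] not_coprime_factor[of 2 10 12]
      by simp_all
    have "avoiding (card \<Omega>) [Suc 0, Suc 0, Suc 0, 9]"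
      unfolding avoiding_def twelve
    proof
      fix t assume "t \<in> ssums [Suc 0, Suc 0, Suc 0, 9]"
      then have "t = 0 \<or> t = 1 \<or> t = 2 \<or> t = 3 \<or> t = 9 \<or> t = 10 \<or> t = 11 \<or> t = 12" by auto
      then show "coprime t 12 \<longrightarrow> t = 1 \<or> t = 12 - 1" using nc by auto
    qed
    then obtain r where r: "r \<in> H" "ctype r \<Omega> [Suc 0, Suc 0, Suc 0, 9]"
      using richD[OF R, of "[Suc 0, Suc 0, Suc 0, 9]"] twelve by (auto simp del: ctype.simps)
    have t3: three_trans by (rule three_trans_12[OF tt twelve s r])
    obtain x T1 T2 where x: "x \<in> H" "moved x = T1 \<union> T2" "T1 \<inter> T2 = {}" "card T1 = 3" "card T2 = 3" "cyc_on x T1" "cyc_on x T2"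
      using six twelve by auto
    show ?thesis by (rule four_trans_two_three_cycles[OF tt t3 twelve x(1) four_trans_12[OF tt t3 r] x(2-7)])
  qed
  then show ?thesis using two_trans_primitive[OF tt] n by simp
qed

text \<open>For n = p m with p \<le> m, the type [2p, p, ..., p] has only multiples of p as subset
  sums, and its p-th power moves 2p points. That is small enough for \<open>bochert\<close> if m
  \<ge> 9 and n \<ge> 29. There remain m = p, deferred to the assumption \<open>square\<close>, and
  the degrees 15, 21, 27 and 35, each with a type or estimate of its own.\<close>

lemma rich_odd_has3:
  assumes R: "rich (avoiding (card \<Omega>))" and n: "odd (card \<Omega>)" "5 \<le> card \<Omega>" "\<not> prime (card \<Omega>)"
    and square: "\<And>p c s. two_trans \<Longrightarrow> prime p \<Longrightarrow> card \<Omega> = p * p \<Longrightarrow> c \<in> H \<Longrightarrow> ctype c \<Omega> [card \<Omega>]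
      \<Longrightarrow> s \<in> H \<Longrightarrow> ctype s \<Omega> (2 * p # replicate (p - 2) p) \<Longrightarrow> has3"
  shows "primitive \<and> has3"
proof -
  obtain c where c: "c \<in> H" "ctype c \<Omega> [card \<Omega>]"
    using richD[OF R, of "[card \<Omega>]"] n avoiding_dvd[of "card \<Omega>" "card \<Omega>" "[card \<Omega>]"] by (auto simp del: ctype.simps)
  obtain s where s: "s \<in> H" "ctype s \<Omega> [Suc 0, card \<Omega> - 1]"
    using richD[OF R, of "[Suc 0, card \<Omega> - 1]"] n avoiding_fixed_point[of "card \<Omega>"] by (auto simp del: ctype.simps)
  have trans_on by (rule trans_on_of_types[OF c c]) auto
  then have tt: two_trans using two_trans_of_types s by blast
  obtain p m where pm: "prime p" "card \<Omega> = p * m" "p \<le> m"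
  proof -
    obtain a b where ab: "card \<Omega> = a * b" "1 < a" "1 < b"
    proof -
      obtain q where q: "prime q" "q dvd card \<Omega>" using prime_factor_nat[of "card \<Omega>"] n by auto
      obtain e where e: "card \<Omega> = q * e" using q(2) by auto
      have "e \<noteq> 0" "e \<noteq> 1" using e n q(1) by auto
      then show thesis using that[OF e] prime_gt_1_nat[OF q(1)] by simp
    qed
    have *: "\<exists>q e. prime q \<and> card \<Omega> = q * e \<and> q \<le> e" if ab: "card \<Omega> = a * b" "1 < a" "a \<le> b" for a b
    proof -
      obtain q where q: "prime q" "q dvd a" using prime_factor_nat[of a] ab by auto
      then obtain e where e: "a = q * e" by auto
      have "0 < e" using e ab by (cases e) auto
      then have "q * 1 \<le> q * e" by (intro mult_left_mono) auto
      then have "q \<le> a" using e by simp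
      moreover have "1 * b \<le> e * b" using \<open>0 < e\<close> by (intro mult_right_mono) auto
      ultimately have "q \<le> e * b" using ab by linarith
      then show ?thesis using q e ab by (intro exI[of _ q] exI[of _ "e * b"]) (simp add: mult.assoc)
    qed
    have "\<exists>q e. prime q \<and> card \<Omega> = q * e \<and> q \<le> e"
    proof (cases "a \<le> b")
      case True then show ?thesis using * ab by blast
    next
      case False then show ?thesis using *[of b a] ab by (simp add: mult.commute)
    qed
    then show thesis using that by blast
  qed
  have odd: "odd p" "odd m" using pm n by auto
  then have p3: "3 \<le> p" using pm(1) prime_ge_2_nat[of p] by (cases "p = 2") auto
  have av: "avoiding (card \<Omega>) (2 * p # replicate (m - 2) p)"
    using pm prime_gt_1_nat by (intro avoiding_dvd[of p]) (auto split: if_splits)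
  have "sum_list (2 * p # replicate (m - 2) p) = card \<Omega>"
  proof -
    have "2 * p + (m - 2) * p = (2 + (m - 2)) * p" by (simp only: distrib_right)
    also have "2 + (m - 2) = m" using pm(3) p3 by simp
    finally show ?thesis using pm(2) by (simp only: sum_list_replicate_nat sum_list.Cons mult.commute)
  qed
  then obtain x where x: "x \<in> H" "ctype x \<Omega> (2 * p # replicate (m - 2) p)"
    using richD[OF R _ _ av] p3 by (auto simp del: ctype.simps)
  have fil: "sum_list (filter (\<lambda>l. \<not> l dvd p) (2 * p # replicate (m - 2) p)) = 2 * p"
    using p3 by (auto dest: dvd_imp_le)
  have deg: "card (moved (x ^^ p)) = 2 * p" using moved_power_card[OF x, of p] fil by simp
  have ni: "x ^^ p \<noteq> id" using deg p3 by (intro not_id_of_card) simp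
  have "has3"
  proof (cases "8 < m \<and> 29 \<le> card \<Omega>")
    case True
    then have "p * 9 \<le> p * m" by (intro mult_left_mono) auto
    then have "4 * (2 * p) + 1 \<le> card \<Omega>" unfolding pm(2) using p3 by linarith
    then show ?thesis using True deg ni by (intro bochert[OF tt pow_mem[OF x(1), of p], of "2 * p"]) simp_all
  next
    case False
    have "m = p \<or> p = 3 \<and> m = 5 \<or> p = 3 \<and> m = 7 \<or> p = 5 \<and> m = 7 \<or> p = 3 \<and> m = 9"
    proof (cases "8 < m")
      case True
      with False have *: "p * m < 29" using pm by simp
      have "p = 3"
      proof (rule ccontr)
        assume "p \<noteq> 3"
        then have "4 \<le> p" using p3 by simp
        then have "4 * 9 \<le> p * m" using True by (intro mult_mono) auto
        then show False using * by simp
      qed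
      then show ?thesis using * True odd by presburger
    next
      case False
      then have "m \<in> {3, 5, 7}" "p \<in> {3, 5, 7}" using odd p3 pm(3) by (auto; presburger)+
      then show ?thesis using pm(3) by auto
    qed
    then consider "m = p" | "card \<Omega> = 15" | "card \<Omega> = 21" | "card \<Omega> = 35" "p = 5" | "card \<Omega> = 27" "p = 3" using pm by auto
    then show ?thesis
    proof cases
      case 1 then show ?thesis using square[OF tt pm(1) _ c] pm(2) x by simp
    next
      case 2
      have nc: "\<not> coprime (k::nat) 15" if k: "3 dvd k \<or> 5 dvd k" for k
        using not_coprime_factor[of 3 k 15] not_coprime_factor[of 5 k 15] k by auto
      have "avoiding (card \<Omega>) [Suc 0, 5, 9]" using nc[of 5] nc[of 6] nc[of 9] nc[of 10] nc[of 0] nc[of 15] unfolding avoiding_def 2 by simp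
      then obtain y where y: "y \<in> H" "ctype y \<Omega> [Suc 0, 5, 9]" using richD[OF R, of "[Suc 0, 5, 9]"] 2 by (auto simp del: ctype.simps)
      have "coprime 5 (9::nat)" by (simp add: coprime_iff_gcd_eq_1 gcd_non_0_nat)
      then show ?thesis using two_trans_stabilizer_has3[OF tt y] by simp
    next
      case 3
      have nc: "\<not> coprime (k::nat) 21" if k: "3 dvd k \<or> 7 dvd k" for k
        using not_coprime_factor[of 3 k 21] not_coprime_factor[of 7 k 21] k by auto
      have "avoiding (card \<Omega>) [6, 1, 14]" using nc[of 0] nc[of 6] nc[of 7] nc[of 14] nc[of 15] nc[of 21] unfolding avoiding_def 3 by simp
      then obtain y where y: "y \<in> H" "ctype y \<Omega> [6, 1, 14]" using richD[OF R, of "[6, 1, 14]"] 3 by (auto simp del: ctype.simps)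
      obtain T1 T2 where "moved (y ^^ 14) = T1 \<union> T2" "T1 \<inter> T2 = {}" "card T1 = 3" "card T2 = 3"
        "cyc_on (y ^^ 14) T1" "cyc_on (y ^^ 14) T2"
      proof (rule six_cycle_square[OF y, of 14])
        show "[14 = 2] (mod (6::nat))" by (simp add: cong_def)
        show "l dvd 14" if l: "l \<in> set [1, 14]" for l :: nat using l by auto
      qed (use that in blast)
      then show ?thesis using two_three_cycles_has3[OF tt _ pow_mem[OF y(1), of 14]] 3 by simp
    next
      case 4 then show ?thesis using degree_35[OF tt pow_mem[OF x(1), of p] ni] deg by simp
    next
      case 5 then show ?thesis using small_degree_has3[OF tt pow_mem[OF x(1), of p] ni, of 6] deg by simp
    qed
  qed
  then show ?thesis using two_trans_primitive[OF tt] n by simp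
qed

end

section \<open>Sylow subgroups and degree \<open>p\<^sup>2\<close>\<close>

lemma orbit_cyc_on:
  assumes N: "(f ^^ N) x = x" "0 < N"
  defines "C \<equiv> (\<lambda>k. (f ^^ k) x) ` {..<N}"
  shows "cyc_on f C" "x \<in> C" "card C dvd N"
proof -
  have red: "(f ^^ k) x = (f ^^ (k mod N)) x" for k
  proof -
    have "(f ^^ (N * j)) x = x" for j
      using N(1) by (induction j) (simp_all add: funpow_add_apply)
    then have "(f ^^ (k mod N + N * (k div N))) x = (f ^^ (k mod N)) x" by (simp only: funpow_add_apply)
    then show ?thesis by (simp only: mod_mult_div_eq)
  qed
  have mem: "(f ^^ k) x \<in> C" for k
    using red[of k] N(2) unfolding C_def by (intro image_eqI[of _ _ "k mod N"]) auto
  have rep: "\<exists>k. a = (f ^^ k) x" if "a \<in> C" for a using that by (auto simp: C_def)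
  have img: "f ` C = C"
  proof
    show "f ` C \<subseteq> C"
    proof
      fix b assume "b \<in> f ` C"
      then obtain k where "b = f ((f ^^ k) x)" using rep by blast
      then show "b \<in> C" using mem[of "Suc k"] by simp
    qed
    show "C \<subseteq> f ` C"
    proof
      fix b assume "b \<in> C"
      then obtain k where k: "b = (f ^^ k) x" using rep by blast
      have "f ((f ^^ (k + (N - 1))) x) = (f ^^ (Suc (k + (N - 1)))) x" by simp
      also have "Suc (k + (N - 1)) = k + N" using N(2) by simp
      also have "(f ^^ (k + N)) x = b" unfolding k using red[of k] red[of "k + N"] by simp
      finally have "b = f ((f ^^ (k + (N - 1))) x)" by simp
      then show "b \<in> f ` C" using mem by blast
    qed
  qed
  show cyc: "cyc_on f C"
    unfolding cyc_on_def
  proof (intro conjI img ballI)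
    show "finite C" by (simp add: C_def)
    fix a b assume "a \<in> C" "b \<in> C"
    then obtain i j where ij: "a = (f ^^ i) x" "b = (f ^^ j) x" using rep by blast
    have "(f ^^ (N * i - i + j)) a = (f ^^ (N * i - i + j + i)) x" by (simp add: ij funpow_add_apply)
    also have "N * i - i + j + i = N * i + j" using N(2) by (cases N) auto
    also have "(f ^^ (N * i + j)) x = b" using red[of "N * i + j"] red[of j] ij by simp
    finally show "\<exists>k. (f ^^ k) a = b" by blast
  qed
  show "x \<in> C" using mem[of 0] by simp
  then show "card C dvd N" using cyc_on_funpow_eq[OF cyc] N(1) by blast
qed

text \<open>All orbit lengths divide a power of p; removing a nontrivial orbit does not change the
  cardinality modulo p.\<close>

lemma fixed_point_of_prime_power_order:
  assumes p: "prime p"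
  shows "finite Y \<Longrightarrow> (\<And>y. y \<in> Y \<Longrightarrow> f y \<in> Y) \<Longrightarrow> (\<And>y. y \<in> Y \<Longrightarrow> (f ^^ (p ^ k)) y = y) \<Longrightarrow> \<not> p dvd card Y
    \<Longrightarrow> \<exists>y\<in>Y. f y = y"
proof (induction "card Y" arbitrary: Y rule: less_induct)
  case less
  then obtain y where y: "y \<in> Y" by fastforce
  define C where "C = (\<lambda>i. (f ^^ i) y) ` {..<p ^ k}"
  have N: "0 < p ^ k" using p prime_gt_0_nat by simp
  note C = orbit_cyc_on[OF less.prems(3)[OF y] N, folded C_def]
  have "(f ^^ i) y \<in> Y" for i using y less.prems(2) by (induction i) auto
  then have CY: "C \<subseteq> Y" by (auto simp: C_def)
  show ?case
  proof (cases "card C = 1")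
    case True
    then have "C = {y}" using C(2) by (metis card_1_singletonE singletonD)
    then show ?thesis using cyc_on_image[OF C(1)] y by blast
  next
    case False
    then have pC: "p dvd card C" using C(3) p by (metis dvd_power divides_primepow_nat le_0_eq not_gr_zero power_0)
    have cY: "card Y = card C + card (Y - C)"
      using card_Un_disjoint[of C "Y - C"] CY less.prems(1) finite_subset[OF CY] by (simp add: Un_absorb1)
    have "card C \<noteq> 0" using C(2) CY less.prems(1) by (metis card_0_eq empty_iff finite_subset)
    then have "card (Y - C) < card Y" using cY by simp
    moreover have "f z \<in> Y - C" if z: "z \<in> Y - C" for z
    proof -
      have "f z \<notin> C"
      proof
        assume "f z \<in> C"
        then have "(f ^^ (p ^ k - 1)) (f z) \<in> C" using funpow_in_image[OF cyc_on_image[OF C(1)]] by blast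
        moreover have "(f ^^ (p ^ k - 1)) (f z) = (f ^^ (p ^ k)) z"
          using N funpow_add_apply[of "p ^ k - 1" 1 f z] by simp
        ultimately show False using less.prems(3)[of z] z by simp
      qed
      then show ?thesis using z less.prems(2) by blast
    qed
    moreover have "\<not> p dvd card (Y - C)" using pC cY less.prems(4) by (metis dvd_add)
    ultimately have "\<exists>y\<in>Y - C. f y = y" using less.hyps[of "Y - C"] less.prems by simp
    then show ?thesis by blast
  qed
qed

context perm_group
begin

lemma comp_inv [simp]: "h \<in> H \<Longrightarrow> inv' h \<circ> h = id" "h \<in> H \<Longrightarrow> h \<circ> inv' h = id"
  by (auto simp: fun_eq_iff)

text \<open>A bridge to the group records of HOL-Algebra, for Sylow's existence theorem and the
  orders of elements.\<close>

definition as_group :: "('a \<Rightarrow> 'a) monoid" where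
  "as_group = \<lparr>carrier = H, mult = (\<circ>), one = id\<rparr>"

lemma as_group_simps [simp]:
  "carrier as_group = H" "f \<otimes>\<^bsub>as_group\<^esub> g = f \<circ> g" "\<one>\<^bsub>as_group\<^esub> = id"
  by (simp_all add: as_group_def)

lemma group_as_group: "Group.group as_group"
proof (rule groupI)
  fix f assume f: "f \<in> carrier as_group"
  then show "\<exists>g\<in>carrier as_group. g \<otimes>\<^bsub>as_group\<^esub> f = \<one>\<^bsub>as_group\<^esub>"
    using inv_mem[of f] by (intro bexI[of _ "inv' f"]) auto
qed (simp_all add: comp_mem id_mem comp_assoc)

lemma as_group_inv: "f \<in> H \<Longrightarrow> inv\<^bsub>as_group\<^esub> f = inv' f"
  using group.inv_equality[OF group_as_group, of "inv' f" f] inv_mem[of f] by simp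

lemma as_group_pow: "f [^]\<^bsub>as_group\<^esub> (k::nat) = f ^^ k"
proof (induction k)
  case (Suc k)
  have "f [^]\<^bsub>as_group\<^esub> Suc k = (f ^^ k) \<circ> f" using Suc by simp
  then show ?case by (simp add: funpow_Suc_right del: funpow.simps)
qed simp

lemma pow_card: "h \<in> H \<Longrightarrow> h ^^ card H = id"
  using group.pow_order_eq_1[OF group_as_group, of h] finite_H by (simp add: order_def as_group_pow)

lemma subgroup_perm_group:
  assumes "subgroup K as_group"
  shows "perm_group \<Omega> K" "K \<subseteq> H"
proof -
  show KH: "K \<subseteq> H" using subgroup.subset[OF assms] by simp
  show "perm_group \<Omega> K"
  proof
    show "h permutes \<Omega>" if "h \<in> K" for h using KH perm that by blast
    show "id \<in> K" using subgroup.one_closed[OF assms] by simp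
    show "f \<circ> g \<in> K" if "f \<in> K" "g \<in> K" for f g using subgroup.m_closed[OF assms that] by simp
    show "inv' h \<in> K" if "h \<in> K" for h using subgroup.m_inv_closed[OF assms that] as_group_inv[of h] KH that by auto
  qed (rule finite_Omega)
qed

text \<open>The class equation: conjugacy classes have p-power size, while the number of elements
  other than \<open>id\<close> is -1 modulo p, so one of these forms a class by itself. The
  induction runs over invariant sets \<open>S\<close> so that classes can be removed one at a
  time.\<close>

lemma central_element:
  assumes p: "prime p" "card H = p ^ a" "0 < a"
  obtains y where "y \<in> H" "y \<noteq> id" "\<And>h. h \<in> H \<Longrightarrow> h \<circ> y = y \<circ> h"
proof -
  let ?act = "\<lambda>h y. h \<circ> y \<circ> inv' h"
  have "S \<subseteq> H \<Longrightarrow> (\<And>h y. h \<in> H \<Longrightarrow> y \<in> S \<Longrightarrow> ?act h y \<in> S) \<Longrightarrow> \<not> p dvd card S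
    \<Longrightarrow> \<exists>y\<in>S. \<forall>h\<in>H. h \<circ> y = y \<circ> h" for S
  proof (induction "card S" arbitrary: S rule: less_induct)
    case less
    have fS: "finite S" using less.prems(1) finite_H by (rule finite_subset)
    obtain y where y: "y \<in> S" using less.prems(3) by fastforce
    define Y where "Y = (\<lambda>h. ?act h y) ` H"
    have YS: "Y \<subseteq> S" using less.prems(2) y by (auto simp: Y_def)
    have yY: "y \<in> Y" using id_mem unfolding Y_def by (intro image_eqI[of _ _ id]) auto
    have act_comp: "?act (f \<circ> g) w = ?act f (?act g w)" if "f \<in> H" "g \<in> H" for f g w
      using that bij_mem[of f] bij_mem[of g] by (simp add: o_inv_distrib comp_assoc)
    have actY: "?act h w \<in> Y" if h: "h \<in> H" and w: "w \<in> Y" for h w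
    proof -
      obtain g where g: "g \<in> H" "w = ?act g y" using w by (auto simp: Y_def)
      have "?act h w = ?act (h \<circ> g) y" using act_comp[OF h g(1)] g(2) by simp
      then show ?thesis using comp_mem[OF h g(1)] by (auto simp: Y_def)
    qed
    have tr: "\<exists>h\<in>H. ?act h w = w'" if w: "w \<in> Y" "w' \<in> Y" for w w'
    proof -
      obtain g g' where g: "g \<in> H" "w = ?act g y" "g' \<in> H" "w' = ?act g' y" using w by (auto simp: Y_def)
      have k: "inv' g \<in> H" "g' \<circ> inv' g \<in> H" using g inv_mem comp_mem by auto
      have "?act (g' \<circ> inv' g) w = ?act ((g' \<circ> inv' g) \<circ> g) y" using act_comp[OF k(2) g(1)] g(2) by simp
      also have "(g' \<circ> inv' g) \<circ> g = g'" using g by (simp add: comp_assoc)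
      finally show ?thesis using g k by blast
    qed
    have "card Y * (\<Sum>h\<in>H. card {w\<in>{y}. ?act h w \<in> {y}}) = card H * (card {y} * card {y})"
      using yY finite_subset[OF YS fS] actY act_comp tr by (intro action_count) auto
    then have "p ^ a = card Y * (\<Sum>h\<in>H. card {w\<in>{y}. ?act h w \<in> {y}})" using p(2) by simp
    then have "card Y dvd p ^ a" by (rule dvdI)
    show ?case
    proof (cases "card Y = 1")
      case True
      then have Yy: "Y = {y}" using yY by (metis card_1_singletonE singletonD)
      have "h \<circ> y = y \<circ> h" if h: "h \<in> H" for h
      proof -
        have "?act h y = y" using Yy h by (auto simp: Y_def)
        then have "?act h y \<circ> h = y \<circ> h" by simp
        then show ?thesis using h by (simp add: comp_assoc)
      qed
      then show ?thesis using y by blast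
    next
      case False
      then have pY: "p dvd card Y" using \<open>card Y dvd p ^ a\<close> p(1) by (metis dvd_power divides_primepow_nat le_0_eq not_gr_zero power_0)
      have cS: "card S = card Y + card (S - Y)"
        using card_Un_disjoint[of Y "S - Y"] YS fS finite_subset[OF YS fS] by (simp add: Un_absorb1)
      have "card Y \<noteq> 0" using yY finite_subset[OF YS fS] by auto
      then have "card (S - Y) < card S" using cS by simp
      moreover have "?act h w \<in> S - Y" if h: "h \<in> H" and w: "w \<in> S - Y" for h w
      proof -
        have "w = ?act (inv' h) (?act h w)"
          using act_comp[OF inv_mem[OF h] h, of w] h by simp
        then have "?act h w \<notin> Y" using actY[OF inv_mem[OF h], of "?act h w"] w by auto
        then show ?thesis using less.prems(2) h w by blast
      qed
      moreover have "\<not> p dvd card (S - Y)" using pY cS less.prems(3) by (metis dvd_add)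
      ultimately have "\<exists>y\<in>S - Y. \<forall>h\<in>H. h \<circ> y = y \<circ> h" using less.hyps[of "S - Y"] less.prems(1) by blast
      then show ?thesis by blast
    qed
  qed
  note ind = this
  have "\<exists>y\<in>H - {id}. \<forall>h\<in>H. h \<circ> y = y \<circ> h"
  proof (rule ind)
    show "h \<circ> y \<circ> inv' h \<in> H - {id}" if h: "h \<in> H" and y: "y \<in> H - {id}" for h y
    proof -
      have "y z = z" if "h \<circ> y \<circ> inv' h = id" for z
        using fun_cong[OF that, of "h z"] h by simp
      then have "h \<circ> y \<circ> inv' h = id \<Longrightarrow> y = id" by auto
      then show ?thesis using conj_mem[OF h, of y] y by blast
    qed
    have "Suc (card (H - {id})) = p ^ a" by (simp only: p(2)[symmetric] card_Suc_Diff1[OF finite_H id_mem])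
    moreover have "p dvd p ^ a" using p(3) by simp
    ultimately show "\<not> p dvd card (H - {id})"
      using p(1) by (metis dvd_add_right_iff dvd_1_iff_1 not_prime_1 plus_1_eq_Suc add.commute One_nat_def)
  qed auto
  then show thesis using that by blast
qed

text \<open>An element \<open>w\<close> of p-power order permutes the cosets of a Sylow subgroup
  \<open>K\<close>, whose number is prime to p, and so fixes a coset h K; this means that the
  conjugate of \<open>w\<close> by h lies in \<open>K\<close>.\<close>

lemma sylow_conjugates:
  assumes p: "prime p"
  obtains K a where "perm_group \<Omega> K" "K \<subseteq> H" "card K = p ^ a"
    "\<And>w k. w \<in> H \<Longrightarrow> w ^^ (p ^ k) = id \<Longrightarrow> \<exists>h\<in>H. inv' h \<circ> w \<circ> h \<in> K"
proof -
  define a where "a = multiplicity p (card H)"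
  have H0: "card H \<noteq> 0" using id_mem finite_H by auto
  obtain m where m: "card H = p ^ a * m" "\<not> p dvd m"
    using multiplicity_decompose'[of "card H" p] H0 p unfolding a_def by (metis not_prime_unit)
  obtain K where K: "subgroup K as_group" "card K = p ^ a"
    using sylow_thm[OF p group_as_group, of a m] m(1) finite_H by (auto simp: order_def)
  note KH = subgroup_perm_group[OF K(1)]
  interpret K: perm_group \<Omega> K by (rule KH(1))
  define Y where "Y = (\<lambda>h. (\<circ>) h ` K) ` H"
  have KY: "K \<in> Y" unfolding Y_def using id_mem by (intro image_eqI[of _ _ id]) auto
  have compim: "(\<circ>) (f \<circ> g) ` A = (\<circ>) f ` (\<circ>) g ` A" for f g :: "'a \<Rightarrow> 'a" and A
    by (simp add: image_comp comp_def)
  have actY: "(\<circ>) h ` A \<in> Y" if h: "h \<in> H" and A: "A \<in> Y" for h A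
  proof -
    obtain g where g: "g \<in> H" "A = (\<circ>) g ` K" using A by (auto simp: Y_def)
    then have "(\<circ>) h ` A = (\<circ>) (h \<circ> g) ` K" by (simp only: compim)
    then show ?thesis using comp_mem[OF h g(1)] unfolding Y_def by (intro image_eqI[of _ _ "h \<circ> g"])
  qed
  have tr: "\<exists>h\<in>H. (\<circ>) h ` A = B" if AB: "A \<in> Y" "B \<in> Y" for A B
  proof -
    obtain g g' where g: "g \<in> H" "A = (\<circ>) g ` K" "g' \<in> H" "B = (\<circ>) g' ` K" using AB by (auto simp: Y_def)
    have "(\<circ>) (g' \<circ> inv' g) ` A = (\<circ>) (g' \<circ> inv' g \<circ> g) ` K" unfolding g(2) by (simp only: compim)
    also have "g' \<circ> inv' g \<circ> g = g'" using g by (simp add: comp_assoc)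
    finally show ?thesis using g comp_mem inv_mem by blast
  qed
  have fY: "finite Y" using finite_H by (simp add: Y_def)
  \<comment> \<open>Since h K = K exactly for h in \<open>K\<close>, the count of the action at the
    single coset \<open>K\<close> gives |Y| |K| = |H|.\<close>
  have "card Y * (\<Sum>h\<in>H. card {A\<in>{K}. (\<circ>) h ` A \<in> {K}}) = card H * (card {K} * card {K})"
    using KY by (intro action_count[OF fY actY compim tr]) simp_all
  moreover have "card {A\<in>{K}. (\<circ>) h ` A \<in> {K}} = (if h \<in> K then 1 else 0)" if h: "h \<in> H" for h
  proof (cases "h \<in> K")
    case True
    have "(\<circ>) h ` K = K"
    proof
      show "(\<circ>) h ` K \<subseteq> K" using K.comp_mem[OF True] by auto
      show "K \<subseteq> (\<circ>) h ` K"
      proof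
        fix g assume g: "g \<in> K"
        have "g = h \<circ> (inv' h \<circ> g)" using h by (simp add: comp_assoc[symmetric])
        then show "g \<in> (\<circ>) h ` K" using K.comp_mem[OF K.inv_mem[OF True] g] by blast
      qed
    qed
    then have "{A\<in>{K}. (\<circ>) h ` A \<in> {K}} = {K}" by auto
    then show ?thesis using True by simp
  next
    case False
    have "h = h \<circ> id" by simp
    then have "h \<in> (\<circ>) h ` K" using K.id_mem by blast
    then have "(\<circ>) h ` K \<noteq> K" using False by metis
    then have "{A\<in>{K}. (\<circ>) h ` A \<in> {K}} = {}" by auto
    then show ?thesis using False by simp
  qed
  then have "(\<Sum>h\<in>H. card {A\<in>{K}. (\<circ>) h ` A \<in> {K}}) = card K"
    using KH(2) finite_H by (simp add: sum.If_cases Int_absorb1)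
  ultimately have "card Y * p ^ a = p ^ a * m" using K(2) m(1) by simp
  then have "card Y = m" using prime_gt_0_nat[OF p] by simp
  have "\<exists>h\<in>H. inv' h \<circ> w \<circ> h \<in> K" if w: "w \<in> H" "w ^^ (p ^ k) = id" for w k
  proof -
    have pw: "((\<lambda>A. (\<circ>) w ` A) ^^ j) A = (\<circ>) (w ^^ j) ` A" for j and A :: "('a \<Rightarrow> 'a) set"
      by (induction j) (simp_all add: image_image comp_assoc)
    have "\<exists>A\<in>Y. (\<circ>) w ` A = A"
      using fixed_point_of_prime_power_order[OF p fY, of "\<lambda>A. (\<circ>) w ` A" k] actY[OF w(1)] pw w(2) \<open>card Y = m\<close> m(2)
      by simp
    then obtain h where h: "h \<in> H" "(\<circ>) w ` (\<circ>) h ` K = (\<circ>) h ` K" by (auto simp: Y_def)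
    have "h = h \<circ> id" by simp
    then have "h \<in> (\<circ>) h ` K" using K.id_mem by blast
    then have "w \<circ> h \<in> (\<circ>) h ` K" using h(2) by blast
    then obtain g where g: "g \<in> K" "w \<circ> h = h \<circ> g" by blast
    have "inv' h \<circ> w \<circ> h = inv' h \<circ> (h \<circ> g)" using g(2) by (simp add: comp_assoc)
    also have "\<dots> = g" using h(1) by (simp add: comp_assoc[symmetric])
    finally show ?thesis using g(1) h(1) by (intro bexI[of _ h]) simp_all
  qed
  then show thesis using that[OF KH K(2)] by blast
qed

end

section \<open>Degree p^2: rotations, blocks modulo p, and swapping two blocks\<close>

locale square_cycle = perm_group +
  fixes c :: "'a \<Rightarrow> 'a" and p :: nat and o0 :: 'a
  assumes p: "prime p" "odd p" and square: "card \<Omega> = p * p"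
    and c: "c \<in> H" "cyc_on c \<Omega>" and o0: "o0 \<in> \<Omega>"
begin

abbreviation P :: int where "P \<equiv> int p"

text \<open>The cycle \<open>c\<close> labels the points by residues modulo p^2; integer labels
  allow negative shifts. The points \<open>e (i + P * m)\<close> for fixed \<open>i\<close> form a
  block, an orbit of \<open>rot P\<close>, with \<open>m\<close> modulo p as inner
  coordinate.\<close>

definition e :: "int \<Rightarrow> 'a" where
  "e i = (c ^^ nat (i mod (P * P))) o0"

lemma p3: "3 \<le> p" and P3: "3 \<le> P" and P0: "0 < P" and PP0: "0 < P * P"
proof -
  show "3 \<le> p" using p prime_ge_2_nat[of p] by (cases "p = 2") auto
  then show "3 \<le> P" "0 < P" "0 < P * P" by simp_all
qed

lemma prime_P: "prime P"
  using p(1) by simp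

lemma e_mem: "e i \<in> \<Omega>"
  unfolding e_def using funpow_in_image[OF cyc_on_image[OF c(2)] o0] .

lemma c_pow_cong: "[int i = int j] (mod P * P) \<Longrightarrow> a \<in> \<Omega> \<Longrightarrow> (c ^^ i) a = (c ^^ j) a"
  using cyc_on_funpow_mod[OF c(2), of a i j] square by (simp add: cong_int_iff[symmetric])

lemma e_nat: "e (int k) = (c ^^ k) o0"
  unfolding e_def using PP0 by (intro c_pow_cong o0) (simp add: cong_def)

lemma e_cong: "[i = j] (mod P * P) \<Longrightarrow> e i = e j"
  by (simp add: e_def cong_def)

lemma e_add: "(c ^^ k) (e i) = e (i + int k)"
proof -
  have "(c ^^ k) (e i) = (c ^^ (k + nat (i mod (P * P)))) o0" by (simp add: e_def funpow_add_apply)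
  also have "\<dots> = e (int (k + nat (i mod (P * P))))" by (rule e_nat[symmetric])
  also have "\<dots> = e (i + int k)"
    using PP0 by (intro e_cong) (simp add: cong_def mod_add_left_eq mod_add_right_eq add.commute)
  finally show ?thesis .
qed

lemma e_surj: "a \<in> \<Omega> \<Longrightarrow> \<exists>i. a = e i"
  using cyc_onD[OF c(2) o0] e_nat by metis

lemma e_eq_iff: "e i = e j \<longleftrightarrow> [i = j] (mod P * P)"
proof
  assume eq: "e i = e j"
  define k where "k = nat ((j - i) mod (P * P))"
  have k: "int k = (j - i) mod (P * P)" using PP0 by (simp add: k_def)
  have "(c ^^ k) (e i) = e (i + (j - i) mod (P * P))" by (simp add: e_add k)
  also have "\<dots> = e i" unfolding eq by (intro e_cong) (simp add: cong_def mod_add_right_eq)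
  finally have "p * p dvd k" using cyc_on_funpow_eq[OF c(2) e_mem] square by simp
  then have "P * P dvd int k" by (metis int_dvd_int_iff of_nat_mult)
  then have "P * P dvd j - i" unfolding k by (simp add: dvd_eq_mod_eq_0)
  then have "[j = i] (mod P * P)" by (simp add: cong_iff_dvd_diff)
  then show "[i = j] (mod P * P)" by (rule cong_sym)
qed (rule e_cong)

definition rot :: "int \<Rightarrow> 'a \<Rightarrow> 'a" where
  "rot k = c ^^ nat (k mod (P * P))"

lemma rot_mem: "rot k \<in> H"
  unfolding rot_def by (rule pow_mem[OF c(1)])

lemma rot_e: "rot k (e i) = e (i + k)"
  unfolding rot_def e_add using PP0 by (intro e_cong) (simp add: cong_def mod_add_right_eq)

lemma mult_P_cong: "[P * a = P * b] (mod P * P) \<longleftrightarrow> [a = b] (mod P)"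
  using P0 by (simp add: cong_iff_dvd_diff flip: right_diff_distrib)

lemma e_block_cong: "[a = b] (mod P) \<Longrightarrow> e (i + P * a) = e (i + P * b)"
  by (intro e_cong cong_add) (simp_all add: mult_P_cong)

lemma e_block_eq_iff: "e (i + P * a) = e (i + P * b) \<longleftrightarrow> [a = b] (mod P)"
  unfolding e_eq_iff cong_add_lcancel by (rule mult_P_cong)

lemma cong_P_of_PP: "[i = j] (mod P * P) \<Longrightarrow> [i = j] (mod P)"
  by (erule cong_dvd_modulus) (rule dvd_triv_left)

lemma e_block_mem: "[i = j] (mod P) \<Longrightarrow> \<exists>m. j = i + P * m"
  by (auto simp: cong_iff_lin)

text \<open>Only points of one block are moved, at most p of them, and (p - 1)^2 < p^2.\<close>

lemma has3_of_block:
  assumes tt: two_trans and h: "h \<in> H" "\<And>i. \<not> [i = y] (mod P) \<Longrightarrow> h (e i) = e i" "h (e y) \<noteq> e y"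
  shows has3
proof -
  have "moved h \<subseteq> (\<lambda>m. e (y + P * m)) ` {0..<P}"
  proof
    fix a assume a: "a \<in> moved h"
    then obtain i where i: "a = e i" using moved_subset[OF h(1)] e_surj by blast
    then have "[y = i] (mod P)" using h(2)[of i] a by (auto simp: moved_def cong_sym_eq)
    then obtain m where m: "i = y + P * m" using e_block_mem by blast
    have "a = e (y + P * (m mod P))" unfolding i m by (rule e_block_cong) (simp add: cong_def)
    then show "a \<in> (\<lambda>m. e (y + P * m)) ` {0..<P}" using P0 by (intro image_eqI[of _ _ "m mod P"]) auto
  qed
  then have "card (moved h) \<le> card ((\<lambda>m. e (y + P * m)) ` {0..<P})" by (intro card_mono) auto
  also have "\<dots> \<le> card {0..<P}" by (rule card_image_le) simp
  finally have "card (moved h) \<le> p" by simp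
  moreover have "(p - 1)\<^sup>2 < card \<Omega>"
  proof -
    have "(p - 1) * (p - 1) < p * p" using p3 by (intro mult_strict_mono) auto
    then show ?thesis by (simp add: square power2_eq_square)
  qed
  moreover have "3 * 3 \<le> p * p" using p3 by (intro mult_mono) auto
  ultimately show ?thesis using h(3) square
    by (intro small_degree_has3[OF tt h(1), of p]) auto
qed

(* With j = y - x, the product of the rotation by j and v fixes the block of y and permutes the other
   blocks cyclically; its (p - 1)-st power q fixes every block, and is trivial on that of y only. *)
lemma block_swap_has3:
  assumes tt: two_trans and v: "v \<in> H" and xy: "\<not> [x = y] (mod P)" and lam: "\<not> P dvd \<nu>"
    and vx: "\<And>m. v (e (x + P * m)) = e (y + P * (\<nu> * m))"
    and vy: "\<And>m. v (e (y + P * (\<nu> * m))) = e (x + P * m)"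
    and vo: "\<And>i. \<not> [i = x] (mod P) \<Longrightarrow> \<not> [i = y] (mod P) \<Longrightarrow> v (e i) = e i"
  shows has3
proof -
  define j where "j = y - x"
  have y: "y = x + j" by (simp add: j_def)
  have jP: "\<not> P dvd j" using xy by (simp add: j_def cong_iff_dvd_diff dvd_diff_commute)
  have cop: "coprime \<nu> P" using prime_imp_coprime[OF prime_P lam] by (simp add: coprime_commute)
  obtain \<mu>0 where mu0: "[\<nu> * \<mu>0 = 1] (mod P)" using cong_solve_coprime_int[OF cop] by blast
  define m0 where "m0 = nat (\<mu>0 mod P)"
  define \<mu> where "\<mu> = int m0"
  have "\<mu> = \<mu>0 mod P" using P0 by (simp add: \<mu>_def m0_def)
  then have "[\<nu> * \<mu> = \<nu> * \<mu>0] (mod P)" by (simp add: cong_def mod_mult_right_eq)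
  then have mu: "[\<nu> * \<mu> = 1] (mod P)" using mu0 cong_trans by blast
  define w where "w = rot j \<circ> v"
  have w: "w \<in> H" unfolding w_def using rot_mem v by (rule comp_mem)
  have mul: "[\<nu> * (\<mu> * m) = m] (mod P)" for m using cong_mult[OF mu cong_refl[of m]] by (simp add: mult.assoc)
  have wy: "w (e (y + P * m)) = e (y + P * (\<mu> * m))" for m
  proof -
    have "v (e (y + P * m)) = v (e (y + P * (\<nu> * (\<mu> * m))))"
      by (rule arg_cong[of _ _ v], rule e_block_cong) (rule cong_sym[OF mul])
    also have "\<dots> = e (x + P * (\<mu> * m))" by (rule vy)
    finally have "w (e (y + P * m)) = e (x + P * (\<mu> * m) + j)" by (simp only: w_def o_apply rot_e)
    also have "x + P * (\<mu> * m) + j = y + P * (\<mu> * m)" by (simp add: y)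
    finally show ?thesis .
  qed
  have wx: "w (e (x + P * m)) = e (x + 2 * j + P * (\<nu> * m))" for m
    unfolding w_def o_apply vx rot_e by (simp add: y algebra_simps)
  have blk: "[x + int s * j + P * m = x + int t * j] (mod P) \<longleftrightarrow> [int s = int t] (mod P)" for s t m
  proof -
    have "[x + int s * j + P * m = x + int t * j] (mod P) \<longleftrightarrow> P dvd (int s - int t) * j + P * m"
      by (simp add: cong_iff_dvd_diff algebra_simps)
    also have "\<dots> \<longleftrightarrow> P dvd (int s - int t) * j" by (simp add: dvd_add_left_iff)
    also have "\<dots> \<longleftrightarrow> P dvd int s - int t" using prime_dvd_mult_iff[OF prime_P] jP by blast
    finally show ?thesis by (simp add: cong_iff_dvd_diff)
  qed
  have small: "[int s = int t] (mod P) \<longleftrightarrow> s = t" if "s < p" "t < p" for s t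
    using that by (simp add: cong_int_iff cong_def)
  have wo: "w (e (x + int s * j + P * m)) = e (x + int (Suc s) * j + P * m)" if s: "2 \<le> s" "s < p" for s m
  proof -
    have "\<not> [x + int s * j + P * m = x] (mod P)" using blk[of s m 0] small[of s 0] s by simp
    moreover have "\<not> [x + int s * j + P * m = y] (mod P)" using blk[of s m 1] small[of s 1] s p3 unfolding y by simp
    ultimately have "v (e (x + int s * j + P * m)) = e (x + int s * j + P * m)" by (rule vo)
    then show ?thesis unfolding w_def by (simp add: rot_e algebra_simps)
  qed
  have wpow: "(w ^^ t) (e (x + 2 * j + P * m)) = e (x + int (t + 2) * j + P * m)" if "t \<le> p - 2" for t m
    using that
  proof (induction t)
    case (Suc t)
    then show ?case using wo[of "t + 2" m] p3 by simp
  qed simp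
  define q where "q = w ^^ (p - 1)"
  have q: "q \<in> H" unfolding q_def by (rule pow_mem[OF w])
  have qw: "q ((w ^^ t) a) = (w ^^ t) (q a)" for t a
    unfolding q_def by (simp only: funpow_add_apply[symmetric] add.commute)
  have qx: "q (e (x + P * m)) = e (x + P * (j + \<nu> * m))" for m
  proof -
    have "q (e (x + P * m)) = (w ^^ (p - 2)) (w (e (x + P * m)))"
      unfolding q_def using funpow_add_apply[of "p - 2" 1 w] p3 by (simp add: numeral_2_eq_2 Suc_diff_Suc)
    also have "\<dots> = e (x + int p * j + P * (\<nu> * m))" unfolding wx using wpow[of "p - 2" "\<nu> * m"] p3 by simp
    finally show ?thesis by (simp add: algebra_simps)
  qed
  have qo: "q (e (x + int s * j + P * m)) = e (x + int s * j + P * (\<nu> * j + \<nu> * m))" if s: "2 \<le> s" "s < p" for s m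
  proof -
    have step: "(w ^^ (s - 1)) (e (x + P * m')) = e (x + int s * j + P * (\<nu> * m'))" for m'
    proof -
      have "(w ^^ (s - 1)) (e (x + P * m')) = (w ^^ (s - 2)) (w (e (x + P * m')))"
        using funpow_add_apply[of "s - 2" 1 w] s by (simp add: numeral_2_eq_2 Suc_diff_Suc)
      then show ?thesis unfolding wx using wpow[of "s - 2" "\<nu> * m'"] s by simp
    qed
    have "e (x + int s * j + P * m) = (w ^^ (s - 1)) (e (x + P * (\<mu> * m)))"
      unfolding step by (rule e_block_cong[OF cong_sym[OF mul]])
    then have "q (e (x + int s * j + P * m)) = (w ^^ (s - 1)) (e (x + P * (j + \<nu> * (\<mu> * m))))"
      by (simp only: qw qx)
    also have "\<dots> = e (x + int s * j + P * (\<nu> * (j + \<nu> * (\<mu> * m))))" by (rule step)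
    also have "\<dots> = e (x + int s * j + P * (\<nu> * (j + m)))"
      by (intro e_block_cong cong_mult cong_add mul cong_refl)
    finally show ?thesis by (simp add: distrib_left)
  qed
  \<comment> \<open>On the block of \<open>y\<close>, \<open>w\<close> multiplies the inner
    coordinate by \<mu>, so its (p - 1)-st power is trivial there by Fermat's theorem.\<close>
  have qy: "q (e (y + P * m)) = e (y + P * m)" for m
  proof -
    have "(w ^^ t) (e (y + P * m)) = e (y + P * (\<mu> ^ t * m))" for t
      by (induction t) (simp_all add: wy mult.assoc)
    moreover have "[\<mu> ^ (p - 1) = 1] (mod P)"
    proof -
      have "\<not> P dvd \<mu>"
      proof
        assume "P dvd \<mu>"
        then have "P dvd \<nu> * \<mu>" by simp
        then have "P dvd 1" using mu by (meson cong_dvd_iff)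
        then show False using P3 by simp
      qed
      then have "[m0 ^ (p - 1) = 1] (mod p)" unfolding \<mu>_def by (intro fermat_theorem[OF p(1)]) simp
      then have "[int (m0 ^ (p - 1)) = int 1] (mod P)" by (simp only: cong_int_iff)
      then show ?thesis by (simp add: \<mu>_def)
    qed
    ultimately show ?thesis unfolding q_def using e_block_cong[OF cong_mult[OF _ cong_refl[of m]]] by simp
  qed
  \<comment> \<open>The blocks are numbered as \<open>x + s * j\<close> with s < p; s = 1 is the
    block of \<open>y\<close>.\<close>
  have others: "\<exists>s m. i = x + int s * j + P * m \<and> (s = 0 \<or> 2 \<le> s) \<and> s < p" if i: "\<not> [i = y] (mod P)" for i
  proof -
    have "coprime j P" using prime_imp_coprime[OF prime_P jP] by (simp add: coprime_commute)
    then obtain k where k: "[j * k = 1] (mod P)" using cong_solve_coprime_int by blast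
    define s where "s = nat (((i - x) * k) mod P)"
    have s: "int s = ((i - x) * k) mod P" "s < p" using P0 by (simp_all add: s_def nat_less_iff)
    have "[int s * j = (i - x) * k * j] (mod P)" unfolding s(1) by (intro cong_mult) (simp_all add: cong_def)
    also have "(i - x) * k * j = (i - x) * (j * k)" by simp
    also have "[(i - x) * (j * k) = (i - x) * 1] (mod P)" by (intro cong_mult k cong_refl)
    finally have "[x + int s * j = x + (i - x) * 1] (mod P)" by (intro cong_add cong_refl)
    then have 1: "[x + int s * j = i] (mod P)" by simp
    then obtain m where m: "i = x + int s * j + P * m" using e_block_mem by blast
    have "s \<noteq> 1" using 1 i cong_sym[OF 1] unfolding y by auto
    then show ?thesis using m s(2) by (intro exI[of _ s] exI[of _ m]) auto
  qed
  have qe: "\<exists>\<kappa>. \<forall>m. q (e (i + P * m)) = e (i + P * (\<kappa> + \<nu> * m)) \<and> ([\<nu> = 1] (mod P) \<longrightarrow> [\<kappa> = j] (mod P))"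
    if i: "\<not> [i = y] (mod P)" for i
  proof -
    obtain s m0 where s: "i = x + int s * j + P * m0" "s = 0 \<or> 2 \<le> s" "s < p" using others[OF i] by blast
    show ?thesis
    proof (cases "s = 0")
      case True
      have "q (e (i + P * m)) = e (i + P * ((j + \<nu> * m0 - m0) + \<nu> * m))" for m
        using qx[of "m0 + m"] s(1) True by (simp add: algebra_simps)
      moreover have "[j + \<nu> * m0 - m0 = j] (mod P)" if l: "[\<nu> = 1] (mod P)"
        using cong_diff[OF cong_add[OF cong_refl[of j] cong_mult[OF l cong_refl[of m0]]] cong_refl[of m0]] by simp
      ultimately show ?thesis by blast
    next
      case False
      then have "q (e (i + P * m)) = e (i + P * ((\<nu> * j + \<nu> * m0 - m0) + \<nu> * m))" for m
        using qo[of s "m0 + m"] s by (simp add: algebra_simps)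
      moreover have "[\<nu> * j + \<nu> * m0 - m0 = j] (mod P)" if l: "[\<nu> = 1] (mod P)"
        using cong_diff[OF cong_add[OF cong_mult[OF l cong_refl[of j]] cong_mult[OF l cong_refl[of m0]]] cong_refl[of m0]] by simp
      ultimately show ?thesis by blast
    qed
  qed
  show ?thesis
  \<comment> \<open>Off the block of \<open>y\<close>, \<open>q\<close> sends an inner coordinate m
    to \<kappa> + \<nu> m. If \<nu> = 1, each \<kappa> is \<open>j\<close>, and the rotation by
    \<open>- (P * j)\<close> undoes \<open>q\<close> there but moves the block of \<open>y\<close>.
    If not, conjugation by \<open>q\<close> turns \<open>rot P\<close> into its \<nu>-th power
    there, yet leaves it as it is on the block of \<open>y\<close>; after division by that power
    only this block is moved.\<close>
  proof (cases "[\<nu> = 1] (mod P)")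
    case True
    show ?thesis
    proof (rule has3_of_block[OF tt comp_mem[OF rot_mem q]])
      fix i assume "\<not> [i = y] (mod P)"
      then obtain \<kappa> where k: "q (e (i + P * 0)) = e (i + P * (\<kappa> + \<nu> * 0))" "[\<kappa> = j] (mod P)"
        using qe True by blast
      then have "(rot (- (P * j)) \<circ> q) (e i) = e (i + P * (\<kappa> - j))" by (simp add: rot_e algebra_simps)
      also have "\<dots> = e (i + P * 0)" using k(2) by (intro e_block_cong) (simp add: cong_iff_dvd_diff)
      finally show "(rot (- (P * j)) \<circ> q) (e i) = e i" by simp
    next
      have "(rot (- (P * j)) \<circ> q) (e y) = e (y + P * (- j))" using qy[of 0] by (simp add: rot_e)
      moreover have "e (y + P * (- j)) \<noteq> e (y + P * 0)" unfolding e_block_eq_iff using jP by (simp add: cong_0_iff)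
      ultimately show "(rot (- (P * j)) \<circ> q) (e y) \<noteq> e y" by simp
    qed
  next
    case False
    define h where "h = rot (- (P * \<nu>)) \<circ> (q \<circ> rot P \<circ> inv' q)"
    have hH: "h \<in> H" unfolding h_def by (intro comp_mem rot_mem q inv_mem)
    have hq: "h (q a) = rot (- (P * \<nu>)) (q (rot P a))" for a using q by (simp add: h_def)
    show ?thesis
    proof (rule has3_of_block[OF tt hH])
      fix i assume i: "\<not> [i = y] (mod P)"
      then obtain \<kappa> where k: "\<And>m. q (e (i + P * m)) = e (i + P * (\<kappa> + \<nu> * m))" using qe by blast
      define m where "m = - (\<mu> * \<kappa>)"
      have "[\<kappa> + \<nu> * m = 0] (mod P)"
        using cong_diff[OF cong_refl[of \<kappa>] mul[of \<kappa>]] by (simp add: m_def algebra_simps)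
      then have "e (i + P * (\<kappa> + \<nu> * m)) = e (i + P * 0)" by (rule e_block_cong)
      then have ei: "q (e (i + P * m)) = e i" using k[of m] by simp
      have "h (e i) = rot (- (P * \<nu>)) (q (e (i + P * (m + 1))))"
        unfolding ei[symmetric] hq by (simp add: rot_e algebra_simps)
      also have "\<dots> = e (i + P * (\<kappa> + \<nu> * m))" unfolding k by (simp add: rot_e algebra_simps)
      finally show "h (e i) = e i" using k[of m] ei by simp
    next
      have "h (e y) = rot (- (P * \<nu>)) (q (e (y + P * 1)))"
        using hq[of "e y"] qy[of 0] by (simp add: rot_e)
      also have "\<dots> = e (y + P * (1 - \<nu>))" unfolding qy by (simp add: rot_e algebra_simps)
      also have "\<dots> \<noteq> e (y + P * 0)"
        unfolding e_block_eq_iff using False by (simp add: cong_0_iff cong_iff_dvd_diff dvd_diff_commute)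
      finally show "h (e y) \<noteq> e y" by simp
    qed
  qed
qed

end

section \<open>Finite differences modulo p and independent rotations of the blocks\<close>

definition fdiff :: "(int \<Rightarrow> int) \<Rightarrow> int \<Rightarrow> int" where
  "fdiff f i = f (i + 1) - f i"

lemma fdiff_pow_Suc: "(fdiff ^^ Suc m) f i = (fdiff ^^ m) f (i + 1) - (fdiff ^^ m) f i"
  by (simp add: fdiff_def)

lemma fdiff_pow_diff: "(fdiff ^^ m) (\<lambda>i. f i - l * g i) i = (fdiff ^^ m) f i - l * (fdiff ^^ m) g i"
  by (induction m arbitrary: i) (simp_all add: fdiff_def algebra_simps)

lemma fdiff_pow_sum:
  "(fdiff ^^ m) f i = (\<Sum>j\<le>m. (-1) ^ (m + j) * int (m choose j) * f (i + int j))"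
proof (induction m arbitrary: i)
  case (Suc m)
  let ?a = "\<lambda>m j. (-1) ^ (m + j) * int (m choose j)"
  have "(\<Sum>j\<le>m. ?a m j * f (i + int j)) = (\<Sum>j\<le>Suc m. ?a m j * f (i + int j))" by simp
  also have "\<dots> = ?a m 0 * f i + (\<Sum>j\<le>m. ?a m (Suc j) * f (i + int (Suc j)))"
    by (subst sum.atMost_Suc_shift) simp
  finally have *: "(\<Sum>j\<le>m. ?a m j * f (i + int j)) = ?a m 0 * f i + (\<Sum>j\<le>m. ?a m (Suc j) * f (i + int (Suc j)))" .
  have "(\<Sum>j\<le>Suc m. ?a (Suc m) j * f (i + int j))
      = ?a (Suc m) 0 * f i + (\<Sum>j\<le>m. ?a (Suc m) (Suc j) * f (i + int (Suc j)))"
    by (subst sum.atMost_Suc_shift) simp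
  also have "(\<Sum>j\<le>m. ?a (Suc m) (Suc j) * f (i + int (Suc j)))
      = (\<Sum>j\<le>m. ?a m j * f (i + 1 + int j)) - (\<Sum>j\<le>m. ?a m (Suc j) * f (i + int (Suc j)))"
    unfolding sum_subtractf[symmetric] by (intro sum.cong refl) (simp add: algebra_simps)
  finally show ?case unfolding fdiff_pow_Suc Suc.IH[of i] Suc.IH[of "i + 1"] * by simp
qed simp

text \<open>By Pascal's rule, p divides the sum of any two neighbouring entries of row p - 1, so
  these entries alternate between 1 and -1 modulo p.\<close>

lemma binomial_pred_prime_cong:
  assumes "prime p" "j < p"
  shows "[(-1) ^ j * int ((p - 1) choose j) = 1] (mod int p)"
  using assms(2)
proof (induction j)
  case (Suc j)
  have "p dvd (p choose Suc j)" using Suc.prems by (intro dvd_choose_prime assms(1)) auto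
  moreover have "p choose Suc j = ((p - 1) choose j) + ((p - 1) choose Suc j)"
    using Suc.prems by (cases p) auto
  ultimately have "int p dvd int ((p - 1) choose j) + int ((p - 1) choose Suc j)"
    by (metis int_dvd_int_iff of_nat_add)
  then have "int p dvd (-1) ^ Suc j * (int ((p - 1) choose j) + int ((p - 1) choose Suc j))" by simp
  moreover have "(-1) ^ Suc j * int ((p - 1) choose Suc j) - (-1) ^ j * int ((p - 1) choose j)
      = (-1) ^ Suc j * (int ((p - 1) choose j) + int ((p - 1) choose Suc j))"
    by (simp add: algebra_simps)
  ultimately have "[(-1) ^ Suc j * int ((p - 1) choose Suc j) = (-1) ^ j * int ((p - 1) choose j)] (mod int p)"
    by (simp add: cong_iff_dvd_diff)
  then show ?case using Suc cong_trans by (meson Suc_lessD)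
qed simp

context square_cycle
begin

text \<open>As p - 1 is even, every coefficient of the difference of order p - 1 is 1 modulo p. For
  a p-periodic function the resulting sum over a period is constant, so one further difference
  vanishes (\<open>fdiff_prime\<close>).\<close>

lemma fdiff_pred: "[(fdiff ^^ (p - 1)) f i = (\<Sum>j<p. f (i + int j))] (mod P)"
proof -
  have ev: "even (p - 1)" using p(2) by simp
  have "[(\<Sum>j\<le>p - 1. (-1) ^ (p - 1 + j) * int ((p - 1) choose j) * f (i + int j)) = (\<Sum>j\<le>p - 1. 1 * f (i + int j))] (mod P)"
  proof (intro cong_sum cong_mult cong_refl)
    fix j assume "j \<in> {..p - 1}"
    then have "[(-1) ^ j * int ((p - 1) choose j) = 1] (mod P)" using p3 by (intro binomial_pred_prime_cong p) auto
    then show "[(-1) ^ (p - 1 + j) * int ((p - 1) choose j) = 1] (mod P)" using ev by (simp add: power_add)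
  qed
  moreover have "{..p - 1} = {..<p}" using p3 by auto
  ultimately show ?thesis unfolding fdiff_pow_sum by simp
qed

lemma fdiff_prime:
  assumes "\<And>i. f (i + P) = f i"
  shows "[(fdiff ^^ p) f i = 0] (mod P)"
proof -
  have "(\<Sum>j<p. f (i + 1 + int j)) = (\<Sum>j<p. f (i + int (Suc j)))" by (intro sum.cong) (simp_all add: algebra_simps)
  also have "\<dots> = (\<Sum>j<p. f (i + int j)) + f (i + P) - f i"
    using sum.lessThan_Suc_shift[of "\<lambda>j. f (i + int j)" p] by (simp add: algebra_simps)
  finally have eq: "(\<Sum>j<p. f (i + 1 + int j)) = (\<Sum>j<p. f (i + int j))" using assms by simp
  have "(fdiff ^^ p) f i = (fdiff ^^ (p - 1)) f (i + 1) - (fdiff ^^ (p - 1)) f i"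
    using fdiff_pow_Suc[of "p - 1" f i] p3 by simp
  moreover have "[(fdiff ^^ (p - 1)) f (i + 1) - (fdiff ^^ (p - 1)) f i
     = (\<Sum>j<p. f (i + 1 + int j)) - (\<Sum>j<p. f (i + int j))] (mod P)"
    by (intro cong_diff fdiff_pred)
  ultimately show ?thesis using eq by simp
qed

text \<open>\<open>f\<close> tells how far each block is rotated in itself. Modulo p the functions
  realized in the group form a vector space invariant under translation of the argument, hence under
  \<open>fdiff\<close>.\<close>

definition shifts :: "(int \<Rightarrow> int) \<Rightarrow> bool" where
  "shifts f \<longleftrightarrow> (\<forall>i m. f (i + P * m) = f i) \<and> (\<exists>h\<in>H. \<forall>i. h (e i) = e (i + P * f i))"

lemma shifts_period: "shifts f \<Longrightarrow> f (i + P * m) = f i"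
  by (simp add: shifts_def)

lemma shifts_add:
  assumes "shifts f" "shifts g"
  shows "shifts (\<lambda>i. f i + g i)"
proof -
  obtain h k where hk: "h \<in> H" "\<And>i. h (e i) = e (i + P * f i)" "k \<in> H" "\<And>i. k (e i) = e (i + P * g i)"
    using assms unfolding shifts_def by blast
  have "(h \<circ> k) (e i) = e (i + P * (f i + g i))" for i
    using shifts_period[OF assms(1), of i "g i"] by (simp add: hk algebra_simps)
  moreover have "f (i + P * m) + g (i + P * m) = f i + g i" for i m
    using shifts_period[OF assms(1)] shifts_period[OF assms(2)] by simp
  ultimately show ?thesis using comp_mem[OF hk(1,3)] unfolding shifts_def by blast
qed

lemma shifts_cong:
  assumes "shifts f" "\<And>i m. g (i + P * m) = g i" "\<And>i. [f i = g i] (mod P)"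
  shows "shifts g"
proof -
  obtain h where h: "h \<in> H" "\<And>i. h (e i) = e (i + P * f i)" using assms unfolding shifts_def by blast
  then have "h (e i) = e (i + P * g i)" for i using e_block_cong[OF assms(3)] by simp
  then show ?thesis using assms(2) h(1) unfolding shifts_def by blast
qed

lemma shifts_zero: "shifts (\<lambda>i. 0)"
  unfolding shifts_def using id_mem by (auto intro!: bexI[of _ id])

lemma shifts_scale:
  assumes "shifts f"
  shows "shifts (\<lambda>i. l * f i)"
proof -
  have n: "shifts (\<lambda>i. int k * f i)" for k
  proof (induction k)
    case (Suc k)
    then show ?case using shifts_add[OF Suc assms] by (simp add: algebra_simps)
  qed (simp add: shifts_zero)
  show ?thesis
    by (rule shifts_cong[OF n[of "nat (l mod P)"]])
      (use P0 shifts_period[OF assms] in \<open>auto simp: cong_def mod_mult_left_eq\<close>)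
qed

lemma shifts_fdiff:
  assumes "shifts f"
  shows "shifts (fdiff f)"
proof -
  obtain h where h: "h \<in> H" "\<And>i. h (e i) = e (i + P * f i)" using assms unfolding shifts_def by blast
  have "(rot (-1) \<circ> h \<circ> rot 1) (e i) = e (i + P * f (i + 1))" for i by (simp add: rot_e h algebra_simps)
  moreover have "f (i + P * m + 1) = f (i + 1)" for i m
    using shifts_period[OF assms, of "i + 1" m] by (simp add: algebra_simps)
  moreover have "rot (-1) \<circ> h \<circ> rot 1 \<in> H" by (intro comp_mem rot_mem h(1))
  ultimately have "shifts (\<lambda>i. f (i + 1))" unfolding shifts_def by blast
  then have "shifts (\<lambda>i. f (i + 1) + (-1) * f i)" by (rule shifts_add[OF _ shifts_scale[OF assms]])
  moreover have "(\<lambda>i. f (i + 1) + (-1) * f i) = fdiff f" by (simp add: fun_eq_iff fdiff_def)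
  ultimately show ?thesis by simp
qed

lemma shifts_fdiff_pow: "shifts f \<Longrightarrow> shifts ((fdiff ^^ m) f)"
  by (induction m) (simp_all add: shifts_fdiff)

(* The finite differences of f of order < p form a basis of all p-periodic functions modulo p,
   because the difference of order p - 1 is the constant sum of the values of f. *)
lemma shifts_all:
  assumes f: "shifts f" and s: "\<not> P dvd (\<Sum>j<p. f (int j))"
  shows "m \<le> p \<Longrightarrow> (\<And>i k. g (i + P * k) = g i) \<Longrightarrow> (\<And>i. [(fdiff ^^ m) g i = 0] (mod P)) \<Longrightarrow> shifts g"
proof (induction m arbitrary: g)
  case 0
  then show ?case using shifts_cong[OF shifts_zero, of g] by (simp add: cong_sym_eq)
next
  case (Suc m)
  \<comment> \<open>The difference of order \<open>m\<close> of \<open>f1\<close> is that of order p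
    - 1 of \<open>f\<close>, a nonzero constant modulo p. That of \<open>g\<close> is constant as
    well, so subtracting a multiple of \<open>f1\<close> lowers the order of
    \<open>g\<close>.\<close>
  define f1 where "f1 = (fdiff ^^ (p - 1 - m)) f"
  have f1: "shifts f1" unfolding f1_def by (rule shifts_fdiff_pow[OF f])
  have const: "[F i = F 0] (mod P)" if F: "\<And>i. [F (i + 1) = F i] (mod P)" for F :: "int \<Rightarrow> int" and i
  proof (induction i rule: int_induct[where k = 0])
    case (step1 i)
    show ?case by (rule cong_trans[OF F step1(2)])
  next
    case (step2 i)
    have "[F i = F (i - 1)] (mod P)" using F[of "i - 1"] by simp
    then show ?case using step2(2) cong_trans cong_sym by blast
  qed simp
  have D1: "(fdiff ^^ m) f1 i = (fdiff ^^ (p - 1)) f i" for i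
    unfolding f1_def funpow_add_apply[symmetric] using Suc.prems(1) by simp
  have per: "f (i + P) = f i" for i using shifts_period[OF f, of i 1] by simp
  have c1: "[(fdiff ^^ m) f1 i = (fdiff ^^ m) f1 0] (mod P)" for i
  proof (rule const)
    show "[(fdiff ^^ m) f1 (i + 1) = (fdiff ^^ m) f1 i] (mod P)" for i
      using fdiff_prime[where f = f and i = i, OF per] fdiff_pow_Suc[of "p - 1" f i] p3
      unfolding D1 by (simp add: cong_iff_dvd_diff del: funpow.simps)
  qed
  have c2: "[(fdiff ^^ m) g i = (fdiff ^^ m) g 0] (mod P)" for i
    using Suc.prems(3) unfolding fdiff_pow_Suc by (intro const) (simp add: cong_iff_dvd_diff)
  have "\<not> P dvd (fdiff ^^ m) f1 0"
    unfolding D1 using s fdiff_pred[of f 0] by (simp add: cong_dvd_iff)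
  then have "coprime ((fdiff ^^ m) f1 0) P"
    using prime_imp_coprime[OF prime_P] coprime_commute by blast
  then obtain l0 where l0: "[(fdiff ^^ m) f1 0 * l0 = 1] (mod P)" using cong_solve_coprime_int by blast
  define l where "l = l0 * (fdiff ^^ m) g 0"
  have l: "[(fdiff ^^ m) g 0 = l * (fdiff ^^ m) f1 0] (mod P)"
    using cong_mult[OF l0 cong_refl[of "(fdiff ^^ m) g 0"]] by (simp add: l_def cong_sym_eq mult_ac)
  have "shifts (\<lambda>i. g i - l * f1 i)"
  proof (rule Suc.IH)
    show "g (i + P * k) - l * f1 (i + P * k) = g i - l * f1 i" for i k
      using Suc.prems(2) shifts_period[OF f1] by simp
    show "[(fdiff ^^ m) (\<lambda>i. g i - l * f1 i) i = 0] (mod P)" for i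
    proof -
      have "[(fdiff ^^ m) g i = l * (fdiff ^^ m) f1 0] (mod P)" using c2 l cong_trans by blast
      moreover have "[l * (fdiff ^^ m) f1 0 = l * (fdiff ^^ m) f1 i] (mod P)"
        by (intro cong_mult cong_refl cong_sym[OF c1])
      ultimately have "[(fdiff ^^ m) g i = l * (fdiff ^^ m) f1 i] (mod P)" by (rule cong_trans)
      then show ?thesis unfolding fdiff_pow_diff by (simp add: cong_iff_dvd_diff)
    qed
  qed (use Suc.prems(1) in simp)
  from shifts_add[OF this shifts_scale[OF f1, of l]] show ?case by simp
qed

text \<open>All p-periodic functions are realized, in particular the indicator of a single
  block.\<close>

lemma shifts_has3:
  assumes tt: two_trans and f: "shifts f" and s: "\<not> P dvd (\<Sum>j<p. f (int j))"
  shows has3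
proof -
  let ?g = "\<lambda>i. if P dvd i then 1 else 0 :: int"
  have per: "?g (i + P * k) = ?g i" for i k by (simp add: dvd_add_left_iff)
  have per1: "?g (i + P) = ?g i" for i using per[of i 1] by simp
  have "shifts ?g" by (rule shifts_all[OF f s order_refl per fdiff_prime[where f = ?g, OF per1]])
  then obtain h where h: "h \<in> H" "\<And>i. h (e i) = e (i + P * ?g i)" unfolding shifts_def by blast
  show ?thesis
  proof (rule has3_of_block[OF tt h(1), of 0])
    show "h (e i) = e i" if "\<not> [i = 0] (mod P)" for i using h(2)[of i] that by (simp add: cong_0_iff)
    have "e (0 + P * 1) \<noteq> e (0 + P * 0)" unfolding e_block_eq_iff using P3 by (simp add: cong_0_iff)
    then show "h (e 0) \<noteq> e 0" using h(2)[of 0] by simp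
  qed
qed

text \<open>Commuting with \<open>rot P\<close> means mapping blocks to blocks and inner coordinates
  by translation.\<close>

lemma commuting_rot:
  assumes u: "u \<in> H" "\<And>i. u (e (i + P)) = rot P (u (e i))"
  obtains U where "\<And>i m. u (e (i + P * m)) = e (U i + P * m)" "\<And>i j. [U i = U j] (mod P) \<Longrightarrow> [i = j] (mod P)"
proof -
  have "\<forall>i. \<exists>j. u (e i) = e j" using e_surj e_mem apply_mem_iff[OF u(1)] by blast
  then obtain U where U: "\<And>i. u (e i) = e (U i)" by metis
  have n: "u (e (i + P * int m)) = e (U i + P * int m)" for i m
  proof (induction m)
    case (Suc m)
    have "u (e (i + P * int (Suc m))) = u (e (i + P * int m + P))" by (simp add: algebra_simps)
    also have "\<dots> = e (U i + P * int m + P)" by (simp only: u(2) Suc rot_e)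
    finally show ?case by (simp add: algebra_simps)
  qed (simp add: U)
  have 1: "u (e (i + P * m)) = e (U i + P * m)" for i m
  proof -
    have c: "[m = int (nat (m mod P))] (mod P)" using P0 by (simp add: cong_def)
    show ?thesis unfolding e_block_cong[OF c] by (rule n)
  qed
  have 2: "[i = j] (mod P)" if U': "[U i = U j] (mod P)" for i j
  proof -
    obtain m where m: "U j = U i + P * m" using e_block_mem[OF U'] by blast
    have "u (e j) = e (U i + P * m)" by (simp only: U m)
    also have "\<dots> = u (e (i + P * m))" by (rule 1[symmetric])
    finally have "u (e j) = u (e (i + P * m))" .
    then have "[j = i + P * m] (mod P * P)" using u(1) by (simp add: e_eq_iff)
    then have "[j = i + P * m] (mod P)" by (rule cong_P_of_PP)
    then show ?thesis by (simp add: cong_def)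
  qed
  show thesis by (rule that[OF 1 2])
qed

lemma sum_reindex_mod:
  assumes k: "\<not> P dvd k" and f: "\<And>i m. f (i + P * m) = f i"
  shows "(\<Sum>j<p. f (int j * k)) = (\<Sum>j<p. f (int j) :: int)"
proof -
  have sum_int: "(\<Sum>j<p. F (int j)) = (\<Sum>j\<in>{0..<P}. F j)" for F :: "int \<Rightarrow> int"
    by (simp add: sum.reindex atLeast0LessThan[symmetric] comp_def flip: image_int_atLeastLessThan[of 0 p, simplified])
  let ?r = "\<lambda>j. (j * k) mod P"
  have inj: "inj_on ?r {0..<P}"
  proof (rule inj_onI)
    fix a b assume ab: "a \<in> {0..<P}" "b \<in> {0..<P}" "(a * k) mod P = (b * k) mod P"
    then have "P dvd (a - b) * k" by (simp add: mod_eq_dvd_iff left_diff_distrib)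
    then have "P dvd a - b" using prime_dvd_mult_iff[OF prime_P] k by blast
    then have "[a = b] (mod P)" by (simp add: cong_iff_dvd_diff)
    then show "a = b" using ab by (simp add: cong_def)
  qed
  have "?r ` {0..<P} \<subseteq> {0..<P}" using P0 by auto
  then have img: "?r ` {0..<P} = {0..<P}" by (intro endo_inj_surj inj) simp_all
  have fr: "f (j * k) = f (?r j)" for j
    using f[of "?r j" "(j * k) div P"] by (simp only: mod_mult_div_eq)
  have "(\<Sum>j<p. f (int j * k)) = (\<Sum>j\<in>{0..<P}. f (?r j))"
    unfolding sum_int[of "\<lambda>j. f (j * k)"] by (simp only: fr)
  also have "\<dots> = (\<Sum>j\<in>?r ` {0..<P}. f j)" by (simp only: sum.reindex[OF inj] comp_def)
  finally show ?thesis unfolding img sum_int[of f] .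
qed

text \<open>Composed with a rotation, \<open>u\<close> fixes the block of 0 and permutes the p - 1
  other blocks with p-power order. The orbits are shorter than p, so they are trivial: on blocks
  \<open>u\<close> is a rotation.\<close>

lemma commuting_shift:
  assumes K: "perm_group \<Omega> K" "card K = p ^ a" "K \<subseteq> H" "c \<in> K" "u \<in> K"
    and u: "\<And>i. u (e (i + P)) = rot P (u (e i))"
  obtains k f where "\<And>i m. f (i + P * m) = f i" "\<And>i. u (e i) = e (i + k + P * f i)"
proof -
  interpret K: perm_group \<Omega> K by (rule K(1))
  have uH: "u \<in> H" using K by blast
  obtain U where U: "\<And>i m. u (e (i + P * m)) = e (U i + P * m)" "\<And>i j. [U i = U j] (mod P) \<Longrightarrow> [i = j] (mod P)"
    by (rule commuting_rot[OF uH u]) blast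
  define k where "k = U 0"
  define b where "b = rot (- k) \<circ> u"
  have "b \<in> K" unfolding b_def rot_def by (intro K.comp_mem K.pow_mem K(4,5))
  then have bN: "b ^^ (p ^ a) = id" using K.pow_card K(2) by metis
  define \<beta> where "\<beta> r = (U r - k) mod P" for r
  have be: "b (e i) = e (U (i mod P) - k + P * (i div P))" for i
    using U(1)[of "i mod P" "i div P"] by (simp add: b_def rot_e algebra_simps)
  have bt: "\<exists>x. (b ^^ t) (e r) = e x \<and> (\<beta> ^^ t) r = x mod P" if r: "0 \<le> r" "r < P" for t r
  proof (induction t)
    case 0 then show ?case using r by (auto intro!: exI[of _ r])
  next
    case (Suc t)
    then obtain x where x: "(b ^^ t) (e r) = e x" "(\<beta> ^^ t) r = x mod P" by blast
    then have "(b ^^ Suc t) (e r) = e (U (x mod P) - k + P * (x div P))" by (simp add: be)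
    moreover have "(\<beta> ^^ Suc t) r = (U (x mod P) - k + P * (x div P)) mod P" using x by (simp add: \<beta>_def)
    ultimately show ?case by blast
  qed
  have fix_r: "(\<beta> ^^ (p ^ a)) r = r" if r: "0 \<le> r" "r < P" for r
  proof -
    obtain x where x: "(b ^^ (p ^ a)) (e r) = e x" "(\<beta> ^^ (p ^ a)) r = x mod P" using bt[OF r] by blast
    then have "[x = r] (mod P)" using bN cong_P_of_PP[of r x] by (simp add: e_eq_iff cong_sym_eq)
    then show ?thesis using x(2) r by (simp add: cong_def)
  qed
  have \<beta>R: "\<beta> r \<in> {1..<P}" if r: "r \<in> {1..<P}" for r
  proof -
    have "\<beta> r \<noteq> 0"
    proof
      assume "\<beta> r = 0"
      then have "[U r = U 0] (mod P)" by (simp add: \<beta>_def k_def cong_iff_dvd_diff dvd_eq_mod_eq_0)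
      then have "[r = 0] (mod P)" by (rule U(2))
      then show False using r by (simp add: cong_def)
    qed
    moreover have "0 \<le> \<beta> r" "\<beta> r < P" using P0 by (simp_all add: \<beta>_def)
    ultimately show ?thesis by simp
  qed
  have Urk: "[U r = r + k] (mod P)" if r: "0 \<le> r" "r < P" for r
  proof (cases "r = 0")
    case True then show ?thesis by (simp add: k_def)
  next
    case False
    then have rR: "r \<in> {1..<P}" using r by simp
    define C where "C = (\<lambda>t. (\<beta> ^^ t) r) ` {..<p ^ a}"
    note C = orbit_cyc_on[OF fix_r[OF r] zero_less_power[OF prime_gt_0_nat[OF p(1)]], folded C_def]
    have "(\<beta> ^^ t) r \<in> {1..<P}" for t by (induction t) (simp_all only: funpow.simps id_apply o_apply rR \<beta>R)
    then have "C \<subseteq> {1..<P}" by (auto simp: C_def)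
    then have "card C \<le> card {1..<P}" by (intro card_mono) auto
    then have "card C < p" using p3 by (simp add: nat_diff_distrib)
    moreover have "0 < card C" using C(2) cyc_on_finite[OF C(1)] by (auto simp: card_gt_0_iff)
    ultimately have "\<not> p dvd card C" by (simp add: nat_dvd_not_less)
    then have "card C = 1" using C(3) p(1) by (metis dvd_power divides_primepow_nat le_0_eq not_gr_zero power_0)
    then have "\<beta> r = r" using cyc_on_funpow_eq[OF C(1,2), of 1] by simp
    then have "(U r - k) mod P = r mod P" using r by (simp add: \<beta>_def)
    then have "[U r - k + k = r + k] (mod P)" by (intro cong_add cong_refl) (simp add: cong_def)
    then show ?thesis by simp
  qed
  define f where "f i = (U (i mod P) - (i mod P) - k) div P" for i
  have f: "U (i mod P) = i mod P + k + P * f i" for i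
  proof -
    have "P dvd U (i mod P) - (i mod P + k)" using Urk[of "i mod P"] P0 by (simp add: cong_iff_dvd_diff)
    then have "P * ((U (i mod P) - (i mod P + k)) div P) = U (i mod P) - (i mod P + k)" by (rule dvd_mult_div_cancel)
    then show ?thesis by (simp add: f_def algebra_simps)
  qed
  show thesis
  proof (rule that)
    show "f (i + P * m) = f i" for i m by (simp add: f_def)
    show "u (e i) = e (i + k + P * f i)" for i
    proof -
      have "u (e i) = e (U (i mod P) + P * (i div P))" using U(1)[of "i mod P" "i div P"] by simp
      also have "U (i mod P) + P * (i div P) = (i mod P + P * (i div P)) + k + P * f i" unfolding f[of i] by simp
      also have "i mod P + P * (i div P) = i" by (rule mod_mult_div_eq)
      finally show ?thesis .
    qed
  qed
qed

lemma shift_pow: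
  assumes f: "\<And>i m. f (i + P * m) = f i" and u: "\<And>i. u (e i) = e (i + k + P * f i)"
  shows "(u ^^ t) (e i) = e (i + int t * k + P * (\<Sum>j<t. f (i + int j * k)))"
proof (induction t)
  case (Suc t)
  have "f (i + int t * k + P * (\<Sum>j<t. f (i + int j * k))) = f (i + int t * k)" by (rule f)
  then show ?case by (simp add: Suc u algebra_simps)
qed simp

text \<open>The square of \<open>s\<close> has only p-cycles, so it rotates every block by a nonzero
  amount. The p-th power of \<open>s\<close> consists of p transpositions and commutes with the
  square; it swaps two blocks, which together make up the 2p-cycle. This is the situation of
  \<open>block_swap_has3\<close>.\<close>

lemma regular_shift_has3:
  assumes tt: two_trans and s: "s \<in> H" "ctype s \<Omega> (2 * p # replicate (p - 2) p)"
    and g: "\<And>i m. g (i + P * m) = g i" and u: "\<And>i. (s ^^ 2) (e i) = e (i + P * g i)"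
  shows has3
proof -
  let ?u = "s ^^ 2" and ?v = "s ^^ p"
  have upow: "(?u ^^ t) (e i) = e (i + P * (int t * g i))" for t i
    using shift_pow[of g ?u 0, OF g] u by simp
  have "sum_list (filter (\<lambda>l. \<not> l dvd 2) (2 * p # replicate (p - 2) p)) = p * p"
  proof -
    have "\<not> 2 * p dvd 2" "\<not> p dvd 2" using p3 by (auto dest: dvd_imp_le)
    moreover have "2 * p + (p - 2) * p = p * p"
    proof -
      have "2 + (p - 2) = p" using p3 by simp
      then show ?thesis by (metis distrib_right)
    qed
    ultimately show ?thesis by (simp add: sum_list_replicate_nat)
  qed
  then have "card (moved ?u) = card \<Omega>" using moved_power_card[OF s, of 2] square by simp
  then have mu: "moved ?u = \<Omega>" using moved_subset[OF pow_mem[OF s(1)]] finite_Omega by (metis card_subset_eq)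
  have gP: "\<not> P dvd g i" for i
  proof
    assume "P dvd g i"
    then have "e (i + P * g i) = e (i + P * 0)" by (intro e_block_cong) (simp add: cong_0_iff)
    then show False using mu e_mem[of i] u[of i] by (auto simp: moved_def)
  qed
  obtain C where C: "C \<subseteq> \<Omega>" "card C = 2 * p" "cyc_on s C" "ctype s (\<Omega> - C) (replicate (p - 2) p)"
    using s(2) by auto
  have vfix: "?v z = z" if "z \<in> \<Omega> - C" for z
    using that by (intro ctype_funpow_id[OF C(4)]) (auto split: if_splits)
  have vmove: "?v z \<noteq> z" if "z \<in> C" for z
    using cyc_on_fixed_point_free[OF C(3) _ that, of p] C(2) p3 by (auto dest: dvd_imp_le)
  have vv: "?v (?v z) = z" if "z \<in> C" for z
    using cyc_on_funpow_eq[OF C(3) that, of "2 * p"] C(2) unfolding mult_2 funpow_add_apply by simp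
  have uv: "?v ((?u ^^ t) z) = (?u ^^ t) (?v z)" for t z
    unfolding funpow_funpow by (simp only: funpow_add_apply[symmetric] add.commute)
  have uC: "(?u ^^ t) z \<in> C" if "z \<in> C" for t z
    unfolding funpow_funpow using funpow_in_image[OF cyc_on_image[OF C(3)] that] .
  have vC: "?v z \<in> C" if "z \<in> C" for z using funpow_in_image[OF cyc_on_image[OF C(3)] that] .
  have "C \<noteq> {}" using C(2) p3 by auto
  then obtain x where x: "e x \<in> C" using C(1) e_surj by blast
  obtain y where y: "?v (e x) = e y" using e_surj C(1) vC[OF x] by blast
  have inv_g: "\<exists>\<eta>. [g i * \<eta> = 1] (mod P)" for i
    using cong_solve_coprime_int prime_imp_coprime[OF prime_P gP[of i]] coprime_commute by metis
  obtain \<eta> where \<eta>: "[g x * \<eta> = 1] (mod P)" using inv_g by blast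
  define tm where "tm m = nat ((\<eta> * m) mod P)" for m
  have tm: "[int (tm m) * l = (\<eta> * m) * l] (mod P)" for m l
    using P0 by (intro cong_mult cong_refl) (simp add: tm_def cong_def)
  have tx: "[int (tm m) * g x = m] (mod P)" for m
  proof -
    have "[(\<eta> * m) * g x = 1 * m] (mod P)" using cong_mult[OF \<eta> cong_refl[of m]] by (simp add: mult_ac)
    then show ?thesis using tm[of m "g x"] cong_trans by simp blast
  qed
  have exm: "e (x + P * m) = (?u ^^ tm m) (e x)" for m
    unfolding upow by (rule e_block_cong[OF cong_sym[OF tx]])
  \<comment> \<open>The square of \<open>s\<close> steps by \<open>g x\<close> in one block and by
    \<open>g y\<close> in the other; \<nu> is the quotient of these steps modulo p.\<close>
  define \<nu> where "\<nu> = \<eta> * g y"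
  have \<nu>: "\<not> P dvd \<nu>"
  proof -
    have "\<not> P dvd \<eta>"
    proof
      assume "P dvd \<eta>"
      then have "P dvd g x * \<eta>" by simp
      then have "P dvd 1" using \<eta> cong_dvd_iff by blast
      then show False using P3 by simp
    qed
    then show ?thesis using gP[of y] prime_dvd_mult_iff[OF prime_P] by (simp add: \<nu>_def)
  qed
  have vx: "?v (e (x + P * m)) = e (y + P * (\<nu> * m))" for m
  proof -
    have "?v (e (x + P * m)) = (?u ^^ tm m) (e y)" unfolding exm uv y ..
    also have "\<dots> = e (y + P * (int (tm m) * g y))" by (rule upow)
    also have "\<dots> = e (y + P * (\<nu> * m))"
      using tm[of m "g y"] by (intro e_block_cong) (simp add: \<nu>_def mult_ac)
    finally show ?thesis .
  qed
  have exC: "e (x + P * m) \<in> C" for m unfolding exm by (rule uC[OF x])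
  have vy: "?v (e (y + P * (\<nu> * m))) = e (x + P * m)" for m
    using vv[OF exC[of m]] vx by simp
  \<comment> \<open>If the image stayed in the block, the swap would act at \<open>e x\<close> as a
    t-th power of the square; being an involution, it would give 2t = 0 modulo p and fix
    \<open>e x\<close>.\<close>
  have xy: "\<not> [x = y] (mod P)"
  proof
    assume "[x = y] (mod P)"
    then obtain m where m: "y = x + P * m" using e_block_mem by blast
    define t where "t = tm m"
    have 1: "?v (e x) = (?u ^^ t) (e x)" unfolding y m exm t_def ..
    then have "(?u ^^ (t + t)) (e x) = e x" using vv[OF x] uv[of t "e x"] by (simp add: funpow_add_apply)
    then have "e (x + P * (int (t + t) * g x)) = e (x + P * 0)" by (simp only: upow) simp
    then have "P dvd int (t + t) * g x" unfolding e_block_eq_iff by (simp add: cong_0_iff)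
    then have "P dvd 2 * int t" using prime_dvd_mult_iff[OF prime_P] gP[of x] by simp
    moreover have "\<not> P dvd 2" using P3 by (auto dest: zdvd_imp_le)
    ultimately have "P dvd int t" using prime_dvd_mult_iff[OF prime_P] by blast
    then have "e (x + P * (int t * g x)) = e (x + P * 0)" by (intro e_block_cong) (simp add: cong_0_iff)
    then have "?v (e x) = e x" unfolding 1 upow by simp
    then show False using vmove[OF x] by simp
  qed
  let ?B = "\<lambda>x. (\<lambda>m. e (x + P * m)) ` {0..<P}"
  have cB: "card (?B i) = p" for i
  proof -
    have "inj_on (\<lambda>m. e (i + P * m)) {0..<P}"
      by (rule inj_onI) (simp add: e_block_eq_iff cong_def)
    then show ?thesis by (simp add: card_image)
  qed
  have Bmod: "[j = i] (mod P)" if ej: "e j \<in> ?B i" for i j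
  proof -
    obtain m where "e j = e (i + P * m)" using ej by blast
    then have "[j = i + P * m] (mod P)" using cong_P_of_PP by (simp add: e_eq_iff)
    then show ?thesis by (simp add: cong_def)
  qed
  have disj: "?B x \<inter> ?B y = {}"
  proof (rule ccontr)
    assume "?B x \<inter> ?B y \<noteq> {}"
    then obtain m where "e (x + P * m) \<in> ?B y" by blast
    then have "[x + P * m = y] (mod P)" by (rule Bmod)
    then show False using xy by (simp add: cong_def)
  qed
  have "?B x \<subseteq> C" using exC by auto
  moreover have "?B y \<subseteq> C"
  proof
    fix z assume "z \<in> ?B y"
    then obtain m where m: "z = e (y + P * m)" by blast
    obtain \<eta>' where \<eta>': "[g y * \<eta>' = 1] (mod P)" using inv_g by blast
    have "[m = int (nat ((\<eta>' * m) mod P)) * g y] (mod P)"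
    proof -
      have "[int (nat ((\<eta>' * m) mod P)) * g y = (\<eta>' * m) * g y] (mod P)"
        using P0 by (intro cong_mult cong_refl) (simp add: cong_def)
      moreover have "[(\<eta>' * m) * g y = 1 * m] (mod P)" using cong_mult[OF \<eta>' cong_refl[of m]] by (simp add: mult_ac)
      ultimately show ?thesis using cong_trans cong_sym by (metis mult_1)
    qed
    then have "z = (?u ^^ nat ((\<eta>' * m) mod P)) (e y)" unfolding m upow by (rule e_block_cong)
    then show "z \<in> C" using uC vC[OF x] y by simp
  qed
  moreover have "card (?B x \<union> ?B y) = 2 * p" using card_Un_disjoint[OF finite_imageI finite_imageI disj] by (simp add: cB)
  ultimately have CB: "?B x \<union> ?B y = C"
    using cyc_on_finite[OF C(3)] C(2) by (intro card_subset_eq) simp_all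
  have vo: "?v (e i) = e i" if i: "\<not> [i = x] (mod P)" "\<not> [i = y] (mod P)" for i
  proof -
    have "e i \<notin> C" unfolding CB[symmetric] using Bmod[of i x] Bmod[of i y] i by blast
    then show ?thesis using vfix e_mem by blast
  qed
  show ?thesis by (rule block_swap_has3[OF tt pow_mem[OF s(1), of p] xy \<nu> vx vy vo])
qed

end

section \<open>Assembly of the degree p^2 case\<close>

lemma (in perm_group) conj_pow: "h \<in> H \<Longrightarrow> (h \<circ> f \<circ> inv' h) ^^ k = h \<circ> f ^^ k \<circ> inv' h"
  using conj_funpow bij_mem by (metis bij_betw_def)

text \<open>A Sylow subgroup contains conjugates of the p^2-cycle and of the square of
  \<open>s\<close>. Its central element commutes with the p^2-cycle, so it is a rotation, and some
  power of it is \<open>rot P\<close>. Hence the square commutes with \<open>rot P\<close> and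
  shifts the blocks by some \<open>k\<close>. If p divides \<open>k\<close>,
  \<open>regular_shift_has3\<close> applies; otherwise its p-th power being trivial forces the sum
  of \<open>f\<close> to be -k, nonzero modulo p, and \<open>shifts_has3\<close> applies.\<close>

lemma (in perm_group) prime_square_has3:
  assumes tt: two_trans and p: "prime p" "odd p" and sq: "card \<Omega> = p * p"
    and c: "c \<in> H" "ctype c \<Omega> [card \<Omega>]"
    and s: "s \<in> H" "ctype s \<Omega> (2 * p # replicate (p - 2) p)"
  shows has3
proof -
  obtain C where "C \<subseteq> \<Omega>" "card C = card \<Omega>" "cyc_on c C" using c(2) by auto
  then have cyc: "cyc_on c \<Omega>" using finite_Omega by (metis card_subset_eq)
  have p0: "0 < p * p" using prime_gt_0_nat[OF p(1)] by simp
  have "\<Omega> \<noteq> {}" using sq p0 by auto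
  then obtain o0 where o0: "o0 \<in> \<Omega>" by blast
  obtain K a where K: "perm_group \<Omega> K" "K \<subseteq> H" "card K = p ^ a"
    "\<And>w k. w \<in> H \<Longrightarrow> w ^^ (p ^ k) = id \<Longrightarrow> \<exists>h\<in>H. inv' h \<circ> w \<circ> h \<in> K"
    using sylow_conjugates[OF p(1)] by blast
  interpret K: perm_group \<Omega> K by (rule K(1))
  have conj: "\<exists>h\<in>H. h \<circ> w \<circ> inv' h \<in> K" if w: "w \<in> H" "\<And>z. z \<in> \<Omega> \<Longrightarrow> (w ^^ (p ^ k)) z = z" for w k
  proof -
    have "(w ^^ (p ^ k)) z = z" for z using w(2) fixes_outside[OF pow_mem[OF w(1)]] by (cases "z \<in> \<Omega>") auto
    then have "w ^^ (p ^ k) = id" by auto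
    then obtain h where h: "h \<in> H" "inv' h \<circ> w \<circ> h \<in> K" using K(4) w(1) by blast
    have "inv' (inv' h) = h" using bij_mem[OF h(1)] by (rule inv_inv_eq)
    then show ?thesis using h inv_mem[OF h(1)] by (intro bexI[of _ "inv' h"]) simp_all
  qed
  have "(c ^^ (p ^ 2)) z = z" if "z \<in> \<Omega>" for z
    using cyc_on_funpow_eq[OF cyc that, of "p ^ 2"] sq by (simp add: power2_eq_square)
  then obtain h where h: "h \<in> H" "h \<circ> c \<circ> inv' h \<in> K" using conj[OF c(1)] by blast
  define c1 where "c1 = h \<circ> c \<circ> inv' h"
  have c1: "c1 \<in> H" "c1 \<in> K" "cyc_on c1 \<Omega>"
    using h conj_mem[OF h(1) c(1)] cyc_on_conj[OF cyc bij_mem[OF h(1)]] image_Omega[OF h(1)] by (auto simp: c1_def)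
  have "((s ^^ 2) ^^ (p ^ 1)) z = z" if "z \<in> \<Omega>" for z
    unfolding funpow_funpow using that by (intro ctype_funpow_id[OF s(2)]) (auto split: if_splits)
  then obtain g where g: "g \<in> H" "g \<circ> s ^^ 2 \<circ> inv' g \<in> K" using conj[OF pow_mem[OF s(1), of 2]] by blast
  define s1 where "s1 = g \<circ> s \<circ> inv' g"
  have s1: "s1 \<in> H" "s1 ^^ 2 \<in> K" "ctype s1 \<Omega> (2 * p # replicate (p - 2) p)"
    using g conj_mem[OF g(1) s(1)] ctype_conj[OF s(2) bij_mem[OF g(1)]] image_Omega[OF g(1)] conj_pow[OF g(1), where f = s and k = 2]
    by (simp_all only: s1_def)
  interpret S: square_cycle \<Omega> H c1 p o0
    using p sq c1 o0 by unfold_locales auto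
  have a0: "0 < a"
  proof (rule ccontr)
    assume "\<not> 0 < a"
    then have "card K = 1" using K(3) by simp
    then have "c1 = id" using c1(2) K.id_mem by (metis card_1_singletonE singletonD)
    then have "card \<Omega> dvd 1" using cyc_on_funpow_eq[OF c1(3) o0, of 1] by simp
    then show False using sq p(1) by simp
  qed
  obtain y where y: "y \<in> K" "y \<noteq> id" "\<And>h. h \<in> K \<Longrightarrow> h \<circ> y = y \<circ> h"
    using K.central_element[OF p(1) K(3) a0] by blast
  have yH: "y \<in> H" using y(1) K(2) by blast
  obtain k where k: "y (S.e 0) = S.e k" using S.e_surj S.e_mem apply_mem_iff[OF yH] by blast
  have ye: "y (S.e i) = S.e (i + k)" for i
  proof -
    have com: "c1 (y z) = y (c1 z)" for z using fun_cong[OF y(3)[OF c1(2)], of z] by simp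
    have comp: "(c1 ^^ t) (y z) = y ((c1 ^^ t) z)" for t z by (induction t) (simp_all add: com)
    define t where "t = nat (i mod (S.P * S.P))"
    have t: "[int t = i] (mod (S.P * S.P))" using S.PP0 by (simp add: t_def cong_def)
    have "(c1 ^^ t) (S.e 0) = S.e i" unfolding S.e_add using S.e_cong[OF t] by simp
    then have "y (S.e i) = (c1 ^^ t) (y (S.e 0))" unfolding comp by simp
    also have "\<dots> = S.e (k + int t)" by (simp only: k S.e_add)
    also have "\<dots> = S.e (k + i)" using t by (intro S.e_cong cong_add cong_refl)
    finally show ?thesis by (simp add: add.commute)
  qed
  have yt: "(y ^^ t) (S.e i) = S.e (i + int t * k)" for t i
    by (induction t) (simp_all add: ye algebra_simps)
  have nk: "\<not> S.P * S.P dvd k"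
  proof
    assume kd: "S.P * S.P dvd k"
    have "y z = z" for z
    proof (cases "z \<in> \<Omega>")
      case True
      then obtain i where i: "z = S.e i" using S.e_surj by blast
      have "[i + k = i + 0] (mod (S.P * S.P))" using kd by (intro cong_add cong_refl) (simp add: cong_0_iff)
      then show ?thesis using S.e_cong[of "i + k" i] by (simp add: i ye)
    qed (use fixes_outside[OF yH] in blast)
    then show False using y(2) by auto
  qed
  \<comment> \<open>\<open>k\<close> is nonzero modulo p^2, so it is a unit or p times a unit, and p
    is a multiple of it in either case.\<close>
  have "\<exists>t. [t * k = S.P] (mod (S.P * S.P))"
  proof (cases "S.P dvd k")
    case True
    then obtain k' where k': "k = S.P * k'" by blast
    then have "\<not> S.P dvd k'" using nk by auto
    then have "coprime k' S.P" using prime_imp_coprime[OF S.prime_P] coprime_commute by blast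
    then obtain t where "[k' * t = 1] (mod S.P)" using cong_solve_coprime_int by blast
    then have "[S.P * (k' * t) = S.P * 1] (mod (S.P * S.P))" by (simp only: S.mult_P_cong)
    then show ?thesis unfolding k' by (intro exI[of _ t]) (simp add: mult_ac)
  next
    case False
    then have "coprime k S.P" using prime_imp_coprime[OF S.prime_P] coprime_commute by blast
    then have "coprime k (S.P * S.P)" by simp
    then obtain t where "[k * t = 1] (mod (S.P * S.P))" using cong_solve_coprime_int by blast
    then have "[(k * t) * S.P = 1 * S.P] (mod (S.P * S.P))" by (intro cong_mult cong_refl)
    then show ?thesis by (intro exI[of _ "t * S.P"]) (simp add: mult_ac)
  qed
  then obtain t0 where t0: "[t0 * k = S.P] (mod (S.P * S.P))" by blast
  define t where "t = nat (t0 mod (S.P * S.P))"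
  have "[int t * k = t0 * k] (mod (S.P * S.P))" using S.PP0 by (intro cong_mult cong_refl) (simp add: t_def cong_def)
  then have tk: "[int t * k = S.P] (mod (S.P * S.P))" using t0 cong_trans by blast
  have yP: "(y ^^ t) (S.e i) = S.e (i + S.P)" for i
    unfolding yt using tk by (intro S.e_cong cong_add cong_refl)
  let ?u = "s1 ^^ 2"
  have uy: "?u ((y ^^ t) z) = (y ^^ t) (?u z)" for z
  proof (induction t)
    case (Suc t)
    have "?u (y w) = y (?u w)" for w using fun_cong[OF y(3)[OF s1(2)], of w] by simp
    then show ?case using Suc by simp
  qed simp
  have u: "?u (S.e (i + S.P)) = S.rot S.P (?u (S.e i))" for i
  proof -
    obtain j where j: "?u (S.e i) = S.e j" using S.e_surj S.e_mem apply_mem_iff[OF pow_mem[OF s1(1)]] by blast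
    have "?u (S.e (i + S.P)) = (y ^^ t) (?u (S.e i))" unfolding yP[symmetric] uy ..
    also have "\<dots> = S.rot S.P (?u (S.e i))" unfolding j yP S.rot_e ..
    finally show ?thesis .
  qed
  obtain k f where f: "\<And>i m. f (i + S.P * m) = f i" "\<And>i. ?u (S.e i) = S.e (i + k + S.P * f i)"
  proof (rule S.commuting_shift[OF K(1,3,2) c1(2) s1(2) u])
    fix k f assume "\<And>i m. f (i + S.P * m) = f i" "\<And>i. ?u (S.e i) = S.e (i + k + S.P * f i)"
    then show thesis by (rule that)
  qed
  show ?thesis
  proof (cases "S.P dvd k")
    case True
    then obtain k' where k': "k = S.P * k'" by blast
    show ?thesis
    proof (rule S.regular_shift_has3[OF tt s1(1,3)])
      show "k' + f (i + S.P * m) = k' + f i" for i m using f(1) by simp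
      show "?u (S.e i) = S.e (i + S.P * (k' + f i))" for i unfolding f(2) k' by (simp add: algebra_simps)
    qed
  next
    case False
    have "(?u ^^ p) (S.e 0) = S.e 0"
      unfolding funpow_funpow by (intro ctype_funpow_id[OF s1(3)] S.e_mem) (auto split: if_splits)
    then have "S.e (0 + S.P * (k + (\<Sum>j<p. f (int j * k)))) = S.e (0 + S.P * 0)"
      unfolding S.shift_pow[OF f] by (simp add: algebra_simps)
    then have "S.P dvd k + (\<Sum>j<p. f (int j))"
      unfolding S.e_block_eq_iff S.sum_reindex_mod[OF False f(1)] by (simp add: cong_0_iff)
    then have nd: "\<not> S.P dvd (\<Sum>j<p. f (int j))" using False dvd_add_left_iff by blast
    have "(S.rot (- k) \<circ> ?u) (S.e i) = S.e (i + S.P * f i)" for i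
      unfolding o_apply f(2) S.rot_e by (rule arg_cong[of _ _ S.e]) simp
    then have "S.shifts f" unfolding S.shifts_def using f(1) comp_mem[OF S.rot_mem pow_mem[OF s1(1), of 2]] by blast
    then show ?thesis using S.shifts_has3[OF tt _ nd] by blast
  qed
qed

section \<open>Basic sets\<close>

lemma mem_conj_subset: "x \<in> conj_subset G H g \<longleftrightarrow> (\<exists>h\<in>H. x = inv\<^bsub>G\<^esub> g \<otimes>\<^bsub>G\<^esub> h \<otimes>\<^bsub>G\<^esub> g)"
  by (auto simp: conj_subset_def l_coset_def r_coset_def)

context group
begin

lemma conj_subset_conj_subset:
  assumes "H \<subseteq> carrier G" "a \<in> carrier G" "g \<in> carrier G"
  shows "conj_subset G (conj_subset G H a) g = conj_subset G H (a \<otimes> g)"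
proof -
  have "inv g \<otimes> (inv a \<otimes> h \<otimes> a) \<otimes> g = inv (a \<otimes> g) \<otimes> h \<otimes> (a \<otimes> g)" if "h \<in> H" for h
    using assms that by (simp add: inv_mult_group m_assoc subset_iff)
  moreover have "conj_subset G K b = (\<lambda>h. inv b \<otimes> h \<otimes> b) ` K" for K b
    by (auto simp: mem_conj_subset)
  ultimately show ?thesis by (simp add: image_image)
qed

lemma conj_subset_one:
  assumes "H \<subseteq> carrier G"
  shows "conj_subset G H \<one> = H"
proof -
  have "inv \<one> \<otimes> h \<otimes> \<one> = h" if "h \<in> H" for h using assms that by (auto simp: subset_iff)
  then show ?thesis by (auto simp: mem_conj_subset set_eq_iff)
qed

lemma centralizer_subgroup:
  assumes "x \<in> carrier G"
  shows "subgroup {y \<in> carrier G. x \<otimes> y = y \<otimes> x} G"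
proof (rule subgroupI)
  fix y assume y: "y \<in> {y \<in> carrier G. x \<otimes> y = y \<otimes> x}"
  then have yG: "y \<in> carrier G" and xy: "x \<otimes> y = y \<otimes> x" by auto
  have "inv y \<otimes> (x \<otimes> y) \<otimes> inv y = inv y \<otimes> (y \<otimes> x) \<otimes> inv y" by (simp add: xy)
  moreover have "inv y \<otimes> (x \<otimes> y) \<otimes> inv y = inv y \<otimes> x" using assms yG by (simp add: m_assoc)
  moreover have "inv y \<otimes> (y \<otimes> x) \<otimes> inv y = x \<otimes> inv y" using assms yG by (simp add: m_assoc[symmetric])
  ultimately have "inv y \<otimes> x = x \<otimes> inv y" by simp
  then show "inv y \<in> {y \<in> carrier G. x \<otimes> y = y \<otimes> x}" using yG by simp
next
  fix y z assume "y \<in> {y \<in> carrier G. x \<otimes> y = y \<otimes> x}" "z \<in> {y \<in> carrier G. x \<otimes> y = y \<otimes> x}"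
  then have y: "y \<in> carrier G" "x \<otimes> y = y \<otimes> x" and z: "z \<in> carrier G" "x \<otimes> z = z \<otimes> x" by auto
  have "x \<otimes> (y \<otimes> z) = (x \<otimes> y) \<otimes> z" using assms y(1) z(1) by (simp add: m_assoc)
  also have "\<dots> = y \<otimes> (x \<otimes> z)" unfolding y(2) using assms y(1) z(1) by (simp add: m_assoc)
  also have "\<dots> = (y \<otimes> z) \<otimes> x" unfolding z(2) using assms y(1) z(1) by (simp add: m_assoc)
  finally show "y \<otimes> z \<in> {y \<in> carrier G. x \<otimes> y = y \<otimes> x}" using y z by simp
qed (use assms in auto)

text \<open>An element lies in its own centralizer, which is proper unless the element is central; a
  central element lies in the proper centralizer of \<open>a\<close>. A covering family of least
  size has no two conjugate members, since one of them could be dropped.\<close>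

lemma basic_set_exists:
  assumes fin: "finite (carrier G)" and ab: "a \<in> carrier G" "b \<in> carrier G" "a \<otimes> b \<noteq> b \<otimes> a"
  shows "\<exists>\<H>. basic_set G \<H>"
proof -
  let ?proper = "\<lambda>H. subgroup H G \<and> H \<noteq> carrier G"
  define \<F> where "\<F> = {\<H>. finite \<H> \<and> (\<forall>H\<in>\<H>. ?proper H) \<and> carrier G \<subseteq> (\<Union>H\<in>\<H>. \<Union>g\<in>carrier G. conj_subset G H g)}"
  have sub: "H \<subseteq> carrier G" if "subgroup H G" for H by (rule subgroup.subset[OF that])
  have "{H. ?proper H} \<in> \<F>"
  proof -
    have "{H. ?proper H} \<subseteq> Pow (carrier G)" using sub by blast
    then have "finite {H. ?proper H}" using fin finite_subset by blast
    moreover have "\<exists>H. ?proper H \<and> x \<in> H" if x: "x \<in> carrier G" for x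
    proof (cases "\<exists>y\<in>carrier G. x \<otimes> y \<noteq> y \<otimes> x")
      case True
      then have "?proper {y \<in> carrier G. x \<otimes> y = y \<otimes> x}" using centralizer_subgroup[OF x] by blast
      then show ?thesis using x by blast
    next
      case False
      have "?proper {y \<in> carrier G. a \<otimes> y = y \<otimes> a}" using centralizer_subgroup[OF ab(1)] ab by blast
      moreover have "x \<in> {y \<in> carrier G. a \<otimes> y = y \<otimes> a}" using False x ab(1) by auto
      ultimately show ?thesis by blast
    qed
    then have "\<exists>H. ?proper H \<and> (\<exists>g\<in>carrier G. x \<in> conj_subset G H g)" if x: "x \<in> carrier G" for x
      using conj_subset_one sub one_closed that by metis
    ultimately show ?thesis unfolding \<F>_def by blast
  qed
  then obtain \<H> where \<H>: "\<H> \<in> \<F>" and min: "\<And>\<K>. \<K> \<in> \<F> \<Longrightarrow> card \<H> \<le> card \<K>"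
    using ex_has_least_nat[of "\<lambda>\<H>. \<H> \<in> \<F>" _ card] by blast
  have "\<not> conjugate_in G H K" if HK: "H \<in> \<H>" "K \<in> \<H>" "H \<noteq> K" for H K
  proof
    assume "conjugate_in G H K"
    then obtain g where g: "g \<in> carrier G" "K = conj_subset G H g" by (auto simp: conjugate_in_def)
    have HG: "H \<subseteq> carrier G" using \<H> HK sub by (auto simp: \<F>_def)
    have "x \<in> (\<Union>H\<in>\<H> - {K}. \<Union>g\<in>carrier G. conj_subset G H g)" if x: "x \<in> carrier G" for x
    proof -
      obtain L k where L: "L \<in> \<H>" "k \<in> carrier G" "x \<in> conj_subset G L k" using \<H> x by (auto simp: \<F>_def)
      show ?thesis
      proof (cases "L = K")
        case True
        then have "x \<in> conj_subset G H (g \<otimes> k)" using L g conj_subset_conj_subset[OF HG g(1)] by simp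
        then show ?thesis using HK L(2) g(1) m_closed[of g k] by blast
      qed (use L in blast)
    qed
    then have "\<H> - {K} \<in> \<F>" using \<H> by (auto simp: \<F>_def)
    then have "card \<H> \<le> card (\<H> - {K})" by (rule min)
    moreover have "card (\<H> - {K}) < card \<H>" using \<H> HK by (intro card_Diff1_less) (auto simp: \<F>_def)
    ultimately show False by simp
  qed
  moreover have "conj_subset G H g \<subseteq> carrier G" if "H \<in> \<H>" "g \<in> carrier G" for H g
  proof
    fix x assume "x \<in> conj_subset G H g"
    then obtain h where h: "h \<in> H" "x = inv g \<otimes> h \<otimes> g" by (auto simp: mem_conj_subset)
    have "H \<subseteq> carrier G" using \<H> that(1) sub by (auto simp: \<F>_def)
    then show "x \<in> carrier G" using h that(2) by auto
  qed
  ultimately have "(\<Union>H\<in>\<H>. \<Union>g\<in>carrier G. conj_subset G H g) \<subseteq> carrier G"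
    "\<forall>H\<in>\<H>. \<forall>K\<in>\<H>. H \<noteq> K \<longrightarrow> \<not> conjugate_in G H K" by (simp_all only: UN_subset_iff) blast+
  moreover have "finite \<H>" "\<forall>H\<in>\<H>. ?proper H" "carrier G \<subseteq> (\<Union>H\<in>\<H>. \<Union>g\<in>carrier G. conj_subset G H g)"
    using \<H> by (simp_all add: \<F>_def)
  ultimately have "basic_set G \<H>" unfolding basic_set_def by (simp only: set_eq_subset)
  then show ?thesis ..
qed

text \<open>The \<open>LEAST\<close> in the definition denotes an attained value only once a basic
  set exists.\<close>

lemma normal_covering_number_attained:
  assumes "finite (carrier G)" "a \<in> carrier G" "b \<in> carrier G" "a \<otimes> b \<noteq> b \<otimes> a"
  obtains \<H> where "basic_set G \<H>" "card \<H> = normal_covering_number G"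
  using LeastI_ex[of "\<lambda>k. \<exists>\<H>. basic_set G \<H> \<and> card \<H> = k"] basic_set_exists[OF assms]
  unfolding normal_covering_number_def by blast

end

(* The flag od tells S_n (True) from A_n (False).  In S_n the component A_n itself is allowed:
   it is primitive and contains 3-cycles, but consists of even permutations. *)
definition cycle_cover :: "nat \<Rightarrow> bool \<Rightarrow> (nat \<Rightarrow> nat) set set \<Rightarrow> bool" where
  "cycle_cover n od \<H> \<longleftrightarrow> finite \<H> \<and> (\<forall>H\<in>\<H>. perm_group {1..n} H) \<and>
    (\<forall>H\<in>\<H>. perm_group.primitive {1..n} H \<longrightarrow> perm_group.has3 H \<longrightarrow> od \<and> (\<forall>s\<in>H. evenperm s)) \<and>
    (\<forall>ls. sum_list ls = n \<longrightarrow> 0 \<notin> set ls \<longrightarrow> even (n + length ls) \<or> od \<longrightarrow>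
      (\<exists>H\<in>\<H>. \<exists>s\<in>H. ctype s {1..n} ls \<and> (evenperm s \<longleftrightarrow> even (n + length ls))))"

lemma evenperm_conj:
  assumes "finite S" "g permutes S" "f permutes S"
  shows "evenperm (g \<circ> f \<circ> inv' g) \<longleftrightarrow> evenperm f"
proof -
  have "permutation g" "permutation f" "permutation (inv' g)"
    using assms permutes_inv permutation_permutes by blast+
  then show ?thesis by (auto simp: evenperm_comp permutation_compose evenperm_inv)
qed

lemma sym_odd_generates:
  assumes H: "subgroup H (sym_group n)" and A: "carrier (alt_group n) \<subseteq> H" and s: "s \<in> H" "\<not> evenperm s"
  shows "H = carrier (sym_group n)"
proof
  interpret G: group "sym_group n" by (rule sym_group_is_group)
  show HG: "H \<subseteq> carrier (sym_group n)" by (rule subgroup.subset[OF H])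
  show "carrier (sym_group n) \<subseteq> H"
  proof
    fix x assume x: "x \<in> carrier (sym_group n)"
    have ps: "permutation s" "permutation x" using s x HG sym_group_carrier' by blast+
    have sp: "s permutes {1..n}" "x permutes {1..n}" using s x HG sym_group_carrier by blast+
    show "x \<in> H"
    proof (cases "evenperm x")
      case True then show ?thesis using A sp alt_group_carrier by blast
    next
      case False
      then have "x \<circ> s \<in> carrier (alt_group n)"
        using ps sp s by (simp add: alt_group_carrier permutes_compose evenperm_comp)
      then have xs: "x \<circ> s \<in> H" using A by blast
      have "inv\<^bsub>sym_group n\<^esub> s \<in> H" by (rule subgroup.m_inv_closed[OF H s(1)])
      then have "inv' s \<in> H" using s HG sym_group_inv_equality by (metis subsetD)
      then have "x \<circ> s \<circ> inv' s \<in> H" using subgroup.m_closed[OF H xs, of "inv' s"] by (simp add: sym_group_mult)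
      moreover have "x \<circ> s \<circ> inv' s = x" using permutes_inv_o(1)[OF sp(1)] by (simp add: comp_assoc)
      ultimately show ?thesis by simp
    qed
  qed
qed

text \<open>Cycle type and parity are invariant under conjugation, so a component whose conjugate
  contains a permutation of a given type contains one of that type itself. From here on the two
  groups differ only in the flag \<open>od\<close>.\<close>

lemma cover_common:
  assumes n: "5 \<le> n" and G: "G = sym_group n \<and> od \<or> G = alt_group n \<and> \<not> od"
  obtains \<H> where "cycle_cover n od \<H>" "card \<H> = normal_covering_number G"
proof -
  have grp: "group G" using G sym_group_is_group alt_group_is_group by auto
  have car: "x \<in> carrier G \<longleftrightarrow> x permutes {1..n} \<and> (od \<or> evenperm x)" for x
    using G by (auto simp: sym_group_carrier alt_group_carrier)
  have mlt: "x \<otimes>\<^bsub>G\<^esub> y = x \<circ> y" for x y using G by (auto simp: sym_group_mult alt_group_mult)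
  have on: "\<one>\<^bsub>G\<^esub> = id" using G by (auto simp: sym_group_one alt_group_one)
  have iv: "inv\<^bsub>G\<^esub> x = inv' x" if "x \<in> carrier G" for x
    using G that by (auto simp: sym_group_inv_equality alt_group_inv_equality)
  have "carrier G \<subseteq> {f. f permutes {1..n}}" using car by blast
  then have fin: "finite (carrier G)" using finite_permutations[of "{1..n}"] finite_subset by auto
  have c3G: "c3 a b c \<in> carrier G" if "distinct [a, b, c]" "{a, b, c} \<subseteq> {1..n}" for a b c
  proof -
    have "evenperm (c3 a b c)" unfolding c3_def using that by (simp add: evenperm_comp permutation_swap_id evenperm_swap)
    moreover have "c3 a b c permutes {1..n}" unfolding c3_def using that by (intro permutes_compose permutes_swap_id) auto
    ultimately show ?thesis by (simp add: car)
  qed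
  have "c3 1 2 3 \<circ> c3 1 2 4 \<noteq> c3 1 2 4 \<circ> c3 1 2 (3::nat)"
  proof
    assume "c3 1 2 3 \<circ> c3 1 2 4 = c3 1 2 4 \<circ> c3 1 2 (3::nat)"
    from fun_cong[OF this, of 1] show False by (simp add: c3_apply)
  qed
  then obtain \<H> where \<H>: "basic_set G \<H>" "card \<H> = normal_covering_number G"
    using group.normal_covering_number_attained[OF grp fin, of "c3 1 2 3" "c3 1 2 4"] c3G n mlt by auto
  have sg: "subgroup H G" "H \<noteq> carrier G" if "H \<in> \<H>" for H using \<H> that by (auto simp: basic_set_def)
  have HG: "H \<subseteq> carrier G" if "H \<in> \<H>" for H using sg[OF that] subgroup.subset by blast
  have pg: "perm_group {1..n} H" if H: "H \<in> \<H>" for H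
  proof
    show "h permutes {1..n}" if "h \<in> H" for h using HG[OF H] that car by blast
    show "id \<in> H" using subgroup.one_closed[OF sg(1)[OF H]] on by simp
    show "f \<circ> g \<in> H" if "f \<in> H" "g \<in> H" for f g using subgroup.m_closed[OF sg(1)[OF H] that] mlt by simp
    show "inv' f \<in> H" if f: "f \<in> H" for f
      using subgroup.m_inv_closed[OF sg(1)[OF H] f] iv[of f] HG[OF H] f by auto
  qed simp
  have "cycle_cover n od \<H>"
    unfolding cycle_cover_def
  proof (intro conjI ballI allI impI)
    show "finite \<H>" using \<H> by (simp add: basic_set_def)
    show "perm_group {1..n} H" if "H \<in> \<H>" for H by (rule pg[OF that])
  next
    fix H assume H: "H \<in> \<H>" and P: "perm_group.primitive {1..n} H" "perm_group.has3 H"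
    have A: "carrier (alt_group n) \<subseteq> H" by (rule alt_subset_of_primitive_has3[OF pg[OF H] P])
    have *: "od"
    proof (rule ccontr)
      assume "\<not> od"
      then have "G = alt_group n" using G by blast
      then show False using A HG[OF H] sg(2)[OF H] by blast
    qed
    then show od .
    fix s assume s: "s \<in> H"
    show "evenperm s"
    proof (rule ccontr)
      assume "\<not> evenperm s"
      moreover have "G = sym_group n" using * G by blast
      ultimately show False using sym_odd_generates[OF _ A s] sg[OF H] by blast
    qed
  next
    fix ls assume ls: "sum_list ls = n" "0 \<notin> set ls" "even (n + length ls) \<or> od"
    obtain f where f: "f permutes {1..n}" "ctype f {1..n} ls" "evenperm f \<longleftrightarrow> even (n + length ls)"
      using ctype_exists[of "{1..n}" ls] ls by auto
    then have "f \<in> carrier G" using car ls(3) by blast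
    moreover have "carrier G = (\<Union>H\<in>\<H>. \<Union>g\<in>carrier G. conj_subset G H g)"
      using \<H>(1) unfolding basic_set_def by (elim conjE)
    ultimately have "f \<in> (\<Union>H\<in>\<H>. \<Union>g\<in>carrier G. conj_subset G H g)" by (rule subst[rotated])
    then obtain H g where Hg: "H \<in> \<H>" "g \<in> carrier G" "f \<in> conj_subset G H g" by blast
    then obtain h where h: "h \<in> H" "f = inv' g \<circ> h \<circ> g" by (auto simp: mem_conj_subset mlt iv)
    have gp: "g permutes {1..n}" using Hg(2) car by blast
    have "h = g \<circ> f \<circ> inv' g"
      unfolding h(2) using permutes_inv_o(1)[OF gp] by (simp add: comp_assoc) (simp add: comp_assoc[symmetric])
    moreover have "ctype (g \<circ> f \<circ> inv' g) (g ` {1..n}) ls" using f(2) permutes_bij[OF gp] by (rule ctype_conj)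
    moreover have "evenperm (g \<circ> f \<circ> inv' g) \<longleftrightarrow> evenperm f" by (rule evenperm_conj[OF _ gp f(1)]) simp
    ultimately show "\<exists>H\<in>\<H>. \<exists>s\<in>H. ctype s {1..n} ls \<and> (evenperm s \<longleftrightarrow> even (n + length ls))"
      using Hg(1) h(1) f(3) permutes_image[OF gp] by auto
  qed
  then show thesis using that \<H>(2) by blast
qed

section \<open>Counting components\<close>

locale covered =
  fixes n :: nat and od :: bool and \<H> :: "(nat \<Rightarrow> nat) set set"
  assumes cover: "cycle_cover n od \<H>" and n5: "5 \<le> n"
begin

lemma finite_H [simp]: "finite \<H>"
  using cover by (simp add: cycle_cover_def)

lemma pg: "H \<in> \<H> \<Longrightarrow> perm_group {1..n} H"
  using cover by (simp add: cycle_cover_def)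

lemma component:
  assumes "sum_list ls = n" "0 \<notin> set ls" "even (n + length ls) \<or> od"
  obtains H s where "H \<in> \<H>" "s \<in> H" "ctype s {1..n} ls" "evenperm s \<longleftrightarrow> even (n + length ls)"
  using cover assms unfolding cycle_cover_def by blast

lemma not_large:
  assumes "H \<in> \<H>" "perm_group.primitive {1..n} H" "perm_group.has3 H"
  shows "od" "s \<in> H \<Longrightarrow> evenperm s"
  using cover assms unfolding cycle_cover_def by blast+

text \<open>A transitive component would contain A_n by \<open>big\<close>. In A_n this is
  impossible, and in S_n the component would be A_n, which has no element of the odd type.\<close>

lemma intransitive_component:
  assumes "sum_list ls = n" "0 \<notin> set ls" "even (n + length ls) \<or> od" "od \<longrightarrow> odd (n + length ls)"
    and big: "\<And>H s. perm_group {1..n} H \<Longrightarrow> perm_group.trans_on {1..n} H \<Longrightarrow> s \<in> H \<Longrightarrow> ctype s {1..n} ls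
      \<Longrightarrow> perm_group.primitive {1..n} H \<and> perm_group.has3 H"
  obtains H s where "H \<in> \<H>" "s \<in> H" "ctype s {1..n} ls" "\<not> perm_group.trans_on {1..n} H"
proof -
  obtain H s where H: "H \<in> \<H>" "s \<in> H" "ctype s {1..n} ls" "evenperm s \<longleftrightarrow> even (n + length ls)"
    using component[OF assms(1-3)] .
  have "\<not> perm_group.trans_on {1..n} H"
  proof
    assume "perm_group.trans_on {1..n} H"
    then have "perm_group.primitive {1..n} H" "perm_group.has3 H" using big[OF pg[OF H(1)] _ H(2,3)] by auto
    from not_large[OF H(1) this] H(2,4) assms(4) show False by blast
  qed
  then show thesis using that H by blast
qed

lemma n_cycle_trans:
  assumes "H \<in> \<H>" "s \<in> H" "ctype s {1..n} [n]"
  shows "perm_group.trans_on {1..n} H"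
  using perm_group.trans_on_of_types[OF pg[OF assms(1)] assms(2,3,2,3)] by auto

end

lemma card_le_fibers:
  assumes "finite A" "f ` A \<subseteq> B" "finite B" "\<And>b. b \<in> B \<Longrightarrow> card {a \<in> A. f a = b} \<le> c"
  shows "card A \<le> c * card B"
proof -
  have "card A = (\<Sum>b\<in>B. card {a \<in> A. f a = b})"
    using sum.group[OF assms(1,3,2), of "\<lambda>_. 1::nat"] by simp
  also have "\<dots> \<le> (\<Sum>b\<in>B. c)" by (intro sum_mono assms(4))
  finally show ?thesis by (simp add: mult.commute)
qed

lemma totient_half:
  assumes "3 \<le> n"
  shows "totient n = 2 * card {k. 0 < k \<and> 2 * k < n \<and> coprime k n}"
proof -
  let ?A = "{k. 0 < k \<and> 2 * k < n \<and> coprime k n}"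
  have fA: "finite ?A" by (rule finite_subset[of _ "{..n}"]) auto
  have cop: "coprime (n - k) n \<longleftrightarrow> coprime k n" if "k \<le> n" for k
    using that gcd_diff2_nat[of k n] by (simp only: coprime_iff_gcd_eq_1)
  have ne: "2 * k \<noteq> n" if "coprime k n" for k
  proof
    assume e: "2 * k = n"
    then have "k dvd 1" using that by (metis coprime_common_divisor dvd_refl dvd_triv_right)
    then show False using e assms by simp
  qed
  have "totatives n = ?A \<union> (\<lambda>k. n - k) ` ?A"
  proof
    show "totatives n \<subseteq> ?A \<union> (\<lambda>k. n - k) ` ?A"
    proof
      fix k assume k: "k \<in> totatives n"
      then have kk: "0 < k" "k \<le> n" "coprime k n" by (auto simp: totatives_def)
      have "k \<noteq> n" using kk(3) assms by auto
      show "k \<in> ?A \<union> (\<lambda>k. n - k) ` ?A"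
      proof (cases "2 * k < n")
        case False
        then have "2 * (n - k) < n" using ne[OF kk(3)] kk by linarith
        then show ?thesis using kk cop[OF kk(2)] \<open>k \<noteq> n\<close> by (intro UnI2 image_eqI[of _ _ "n - k"]) auto
      qed (use kk in auto)
    qed
    show "?A \<union> (\<lambda>k. n - k) ` ?A \<subseteq> totatives n" using cop by (auto simp: totatives_def)
  qed
  moreover have "?A \<inter> (\<lambda>k. n - k) ` ?A = {}" by auto
  then have "card (?A \<union> (\<lambda>k. n - k) ` ?A) = card ?A + card ((\<lambda>k. n - k) ` ?A)"
    by (intro card_Un_disjoint fA finite_imageI)
  moreover have "card ((\<lambda>k. n - k) ` ?A) = card ?A" by (rule card_image) (auto simp: inj_on_def)
  ultimately show ?thesis by (simp only: totient_def mult_2)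
qed

text \<open>One representative of each pair k, n - k of totatives, since invariant sets come with
  their complements.\<close>

definition half_totatives :: "nat \<Rightarrow> nat set" where
  "half_totatives n = {k. 0 < k \<and> 2 * k < n \<and> coprime k n}"

lemma finite_half_totatives [simp]: "finite (half_totatives n)"
  by (rule finite_subset[of _ "{..n}"]) (auto simp: half_totatives_def)

lemma card_half_totatives: "3 \<le> n \<Longrightarrow> 2 * card (half_totatives n) = totient n"
  using totient_half by (simp add: half_totatives_def)

lemma card_half_totatives_minus_one:
  assumes "3 \<le> n"
  shows "2 * card (half_totatives n - {1}) + 2 = totient n"
proof -
  have "1 \<in> half_totatives n" using assms by (simp add: half_totatives_def)
  then have "Suc (card (half_totatives n - {1})) = card (half_totatives n)" by (rule card_Suc_Diff1[OF finite_half_totatives])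
  then show ?thesis using card_half_totatives[OF assms] by simp
qed

section \<open>Two-cycle types: A_n of even degree and S_n of odd degree\<close>

context covered
begin

text \<open>The condition \<open>par\<close> makes these types even permutations for A_n and odd
  ones for S_n. Different types share only the subset sums 0 and n, so no intransitive component
  covers two of them. The value 1 is left out because the exchange argument needs a cycle of length
  at least 2.\<close>

lemma two_cycle_components:
  assumes par: "od \<longleftrightarrow> odd n"
  obtains h where "h ` (half_totatives n - {1}) \<subseteq> \<H>" "inj_on h (half_totatives n - {1})"
    "\<And>k. k \<in> half_totatives n - {1} \<Longrightarrow> \<exists>s\<in>h k. ctype s {1..n} [k, n - k]"
    "\<And>k. k \<in> half_totatives n - {1} \<Longrightarrow> \<not> perm_group.trans_on {1..n} (h k)"
proof -
  have "\<exists>H. H \<in> \<H> \<and> (\<exists>s\<in>H. ctype s {1..n} [k, n - k]) \<and> \<not> perm_group.trans_on {1..n} H"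
    if k: "k \<in> half_totatives n - {1}" for k
  proof -
    have kk: "2 \<le> k" "2 * k < n" "coprime k n" using k by (auto simp: half_totatives_def)
    then have co: "coprime k (n - k)" by (metis coprime_commute coprime_iff_gcd_eq_1 gcd_diff1_nat less_imp_le_nat le_less_trans le_add1 mult_2)
    obtain H s where "H \<in> \<H>" "s \<in> H" "ctype s {1..n} [k, n - k]" "\<not> perm_group.trans_on {1..n} H"
    proof (rule intransitive_component[of "[k, n - k]"])
      fix H s assume H: "perm_group {1..n} H" "perm_group.trans_on {1..n} H" "s \<in> H" "ctype s {1..n} [k, n - k]"
      show "perm_group.primitive {1..n} H \<and> perm_group.has3 H"
        by (rule perm_group.two_cycles_type_has3[OF H _ _ co]) (use kk in auto)
    qed (use kk par in auto)
    then show ?thesis by blast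
  qed
  then obtain h where h: "\<And>k. k \<in> half_totatives n - {1} \<Longrightarrow> h k \<in> \<H> \<and> (\<exists>s\<in>h k. ctype s {1..n} [k, n - k]) \<and> \<not> perm_group.trans_on {1..n} (h k)"
    by metis
  have "inj_on h (half_totatives n - {1})"
  proof (rule inj_onI, rule ccontr)
    fix k l assume k: "k \<in> half_totatives n - {1}" and l: "l \<in> half_totatives n - {1}" and kl: "h k = h l" "k \<noteq> l"
    obtain s t where s: "s \<in> h k" "ctype s {1..n} [k, n - k]" and t: "t \<in> h k" "ctype t {1..n} [l, n - l]"
      using h[OF k] h[OF l] kl by metis
    have "ssums [k, n - k] \<inter> ssums [l, n - l] \<subseteq> {0, card {1..n}}"
      using k l kl(2) by (auto simp: half_totatives_def)
    then show False using perm_group.trans_on_of_types[OF pg s t] h[OF k] by blast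
  qed
  then show thesis using that h by blast
qed

lemma transitive_component_bound:
  assumes par: "od \<longleftrightarrow> odd n" and H0: "H0 \<in> \<H>" "perm_group.trans_on {1..n} H0"
  shows "totient n \<le> 2 * card \<H>"
proof -
  obtain h where h: "h ` (half_totatives n - {1}) \<subseteq> \<H>" "inj_on h (half_totatives n - {1})"
    "\<And>k. k \<in> half_totatives n - {1} \<Longrightarrow> \<not> perm_group.trans_on {1..n} (h k)"
    using two_cycle_components[OF par] by metis
  have "H0 \<notin> h ` (half_totatives n - {1})" using h(3) H0(2) by blast
  then have "card (insert H0 (h ` (half_totatives n - {1}))) = Suc (card (half_totatives n - {1}))"
    using card_image[OF h(2)] by simp
  moreover have "card (insert H0 (h ` (half_totatives n - {1}))) \<le> card \<H>"
    using h(1) H0(1) by (intro card_mono) auto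
  ultimately show ?thesis using card_half_totatives_minus_one[of n] n5 by linarith
qed

text \<open>If there are fewer than phi(n)/2 + 1 components, then the phi(n)/2 - 1 intransitive ones
  and \<open>H0\<close> are all of them. An intransitive one has an orbit of size k or n - k, which
  is not a subset sum of an avoiding type; so \<open>H0\<close> alone must cover all these
  types.\<close>

lemma avoiding_component:
  assumes par: "od \<longleftrightarrow> odd n" and small: "2 * card \<H> < totient n + 2"
    and ls0: "sum_list ls0 = n" "0 \<notin> set ls0" "even (n + length ls0) \<or> od" "avoiding n ls0"
  obtains H0 where "H0 \<in> \<H>"
    "\<And>ls. sum_list ls = n \<Longrightarrow> 0 \<notin> set ls \<Longrightarrow> even (n + length ls) \<or> od \<Longrightarrow> avoiding n ls
      \<Longrightarrow> \<exists>s\<in>H0. ctype s {1..n} ls \<and> (evenperm s \<longleftrightarrow> even (n + length ls))"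
proof -
  obtain h where h: "h ` (half_totatives n - {1}) \<subseteq> \<H>" "inj_on h (half_totatives n - {1})"
    "\<And>k. k \<in> half_totatives n - {1} \<Longrightarrow> \<exists>s\<in>h k. ctype s {1..n} [k, n - k]"
    "\<And>k. k \<in> half_totatives n - {1} \<Longrightarrow> \<not> perm_group.trans_on {1..n} (h k)"
    using two_cycle_components[OF par] by metis
  let ?I = "h ` (half_totatives n - {1})"
  have out: "H \<notin> ?I" if H: "H \<in> \<H>" "s \<in> H" "ctype s {1..n} ls" and a: "avoiding n ls" for H s ls
  proof
    assume "H \<in> ?I"
    then obtain k where k: "k \<in> half_totatives n - {1}" "H = h k" by blast
    interpret perm_group "{1..n}" H by (rule pg[OF H(1)])
    have kk: "2 \<le> k" "2 * k < n" "coprime k n" using k(1) by (auto simp: half_totatives_def)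
    have co: "coprime (n - k) n" using kk gcd_diff2_nat[of k n] by (simp only: coprime_iff_gcd_eq_1)
    obtain t where t: "t \<in> H" "ctype t {1..n} [k, n - k]" using h(3)[OF k(1)] k(2) by blast
    obtain a where a: "a \<in> {1..n}" "card (orbit_of a) \<noteq> n" using h(4)[OF k(1)] trans_onI k(2) by auto
    have "card (orbit_of a) \<in> {k, n - k}"
      using orbit_of_card[OF a(1) t] orbit_of_card_pos[OF a(1)] a(2) kk by auto
    moreover have "card (orbit_of a) \<in> ssums ls" by (rule orbit_of_card[OF a(1) H(2,3)])
    ultimately have "k \<in> ssums ls \<or> n - k \<in> ssums ls" by auto
    then show False using \<open>avoiding n ls\<close> kk co unfolding avoiding_def by force
  qed
  obtain H0 s0 where H0: "H0 \<in> \<H>" "s0 \<in> H0" "ctype s0 {1..n} ls0" using component[OF ls0(1-3)] by metis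
  have H0I: "H0 \<notin> ?I" by (rule out[OF H0 ls0(4)])
  have "card (insert H0 ?I) = Suc (card (half_totatives n - {1}))"
    using card_image[OF h(2)] H0I by simp
  then have "card \<H> \<le> card (insert H0 ?I)" using small card_half_totatives_minus_one[of n] n5 by linarith
  then have eq: "insert H0 ?I = \<H>" using h(1) H0(1) by (intro card_seteq) auto
  show thesis
  proof (rule that[OF H0(1)])
    fix ls assume ls: "sum_list ls = n" "0 \<notin> set ls" "even (n + length ls) \<or> od" "avoiding n ls"
    obtain H s where H: "H \<in> \<H>" "s \<in> H" "ctype s {1..n} ls" "evenperm s \<longleftrightarrow> even (n + length ls)"
      using component[OF ls(1-3)] .
    have "H = H0" using out[OF H(1-3) ls(4)] eq H(1) by blast
    then show "\<exists>s\<in>H0. ctype s {1..n} ls \<and> (evenperm s \<longleftrightarrow> even (n + length ls))" using H by blast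
  qed
qed

lemma even_alternating_bound:
  assumes n: "even n" "10 \<le> n" and od: "\<not> od"
  shows "totient n + 2 \<le> 2 * card \<H>"
proof (rule ccontr)
  assume "\<not> ?thesis"
  then have small: "2 * card \<H> < totient n + 2" by simp
  have "avoiding n [Suc 0, n - 1]" using n by (intro avoiding_fixed_point) simp
  then obtain H0 where H0: "H0 \<in> \<H>"
    "\<And>ls. sum_list ls = n \<Longrightarrow> 0 \<notin> set ls \<Longrightarrow> even (n + length ls) \<or> od \<Longrightarrow> avoiding n ls
      \<Longrightarrow> \<exists>s\<in>H0. ctype s {1..n} ls \<and> (evenperm s \<longleftrightarrow> even (n + length ls))"
    using n od by (elim avoiding_component[OF _ small, rotated -1]) auto
  interpret perm_group "{1..n}" H0 by (rule pg[OF H0(1)])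
  have "rich (\<lambda>ls. even (card {1..n} + length ls) \<and> avoiding (card {1..n}) ls)"
    unfolding rich_def using H0(2) by fastforce
  then have "primitive \<and> has3" using n by (intro rich_even_has3) auto
  then show False using not_large(1)[OF H0(1)] od by blast
qed

lemma odd_composite_symmetric_bound:
  assumes n: "odd n" "\<not> prime n" and od: od
  shows "totient n + 2 \<le> 2 * card \<H>"
proof (rule ccontr)
  assume "\<not> ?thesis"
  then have small: "2 * card \<H> < totient n + 2" by simp
  have av: "avoiding n [Suc 0, n - 1]" using n5 by (intro avoiding_fixed_point) simp
  then obtain H0 where H0: "H0 \<in> \<H>"
    "\<And>ls. sum_list ls = n \<Longrightarrow> 0 \<notin> set ls \<Longrightarrow> even (n + length ls) \<or> od \<Longrightarrow> avoiding n ls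
      \<Longrightarrow> \<exists>s\<in>H0. ctype s {1..n} ls \<and> (evenperm s \<longleftrightarrow> even (n + length ls))"
    using n od n5 by (elim avoiding_component[OF _ small, rotated -1]) auto
  interpret perm_group "{1..n}" H0 by (rule pg[OF H0(1)])
  have "rich (avoiding (card {1..n}))"
    unfolding rich_def using H0(2) od by fastforce
  then have "primitive \<and> has3" using n n5 prime_square_has3
    by (intro rich_odd_has3) auto
  moreover obtain s where "s \<in> H0" "\<not> evenperm s" using H0(2)[of "[Suc 0, n - 1]"] n av n5 od by auto
  ultimately show False using not_large(2)[OF H0(1)] by blast
qed

lemma odd_symmetric_bound:
  assumes n: "odd n" and od: od
  shows "totient n \<le> 2 * card \<H>"
proof -
  obtain H s where H: "H \<in> \<H>" "s \<in> H" "ctype s {1..n} [n]" "evenperm s \<longleftrightarrow> even (n + length [n])"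
    by (rule component[of "[n]"]) (use n5 od in auto)
  show ?thesis by (rule transitive_component_bound[OF _ H(1) n_cycle_trans[OF H(1-3)]]) (use n od in simp)
qed

text \<open>A single component would cover every type; it would be doubly transitive and contain a
  3-cycle outright. This crude bound settles small cases: A_6, A_8, and S_n for n = 3u with u < 10
  not divisible by 3.\<close>

lemma even_two_components:
  assumes n: "even n"
  shows "2 \<le> card \<H>"
proof (rule ccontr)
  assume less2: "\<not> 2 \<le> card \<H>"
  obtain H0 s0 where H0: "H0 \<in> \<H>" "s0 \<in> H0" "ctype s0 {1..n} [Suc 0, n - 1]"
      "evenperm s0 \<longleftrightarrow> even (n + length [Suc 0, n - 1])"
    by (rule component[of "[Suc 0, n - 1]"]) (use n5 n in auto)
  have "card \<H> = 1" using less2 H0(1) card_gt_0_iff[of \<H>] by fastforce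
  then have one: "\<H> = {H0}" using H0(1) by (metis card_1_singletonE singletonD)
  interpret perm_group "{1..n}" H0 by (rule pg[OF H0(1)])
  have all: "\<exists>s\<in>H0. ctype s {1..n} ls \<and> (evenperm s \<longleftrightarrow> even (n + length ls))"
    if ls: "sum_list ls = n" "0 \<notin> set ls" "even (n + length ls) \<or> od" for ls
  proof -
    obtain H s where "H \<in> \<H>" "s \<in> H" "ctype s {1..n} ls" "evenperm s \<longleftrightarrow> even (n + length ls)"
      using component[OF ls] .
    then show ?thesis using one by blast
  qed
  have "rich (\<lambda>ls. even (card {1..n} + length ls) \<and> avoiding (card {1..n}) ls)"
    unfolding rich_def using all by fastforce
  then have tt: two_trans using n n5 by (intro rich_even_two_trans) auto
  have prim: primitive using two_trans_primitive[OF tt] n5 by simp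
  let ?ls = "3 # replicate (n - 3) (Suc 0)"
  have "even (n + length ?ls)" using n n5 by simp
  then obtain t where t: "t \<in> H0" "ctype t {1..n} ?ls"
    using all[of ?ls] n5 by (auto simp: sum_list_replicate_nat simp del: ctype.simps split: if_splits)
  have "card (moved (t ^^ 1)) = 3" using moved_power_card[OF t, of 1] by simp
  then have h3: has3 unfolding has3_def using t(1) by auto
  have od using not_large(1)[OF H0(1) prim h3] .
  then obtain s where "s \<in> H0" "\<not> evenperm s" using all[of "[n]"] n n5 by auto
  then show False using not_large(2)[OF H0(1) prim h3] by blast
qed

end

section \<open>Alternating groups of odd degree\<close>

text \<open>Sizes of invariant sets matter only up to sign modulo n, since the complement of an
  invariant set of size t has size n - t.\<close>

definition pm_cong :: "nat \<Rightarrow> nat \<Rightarrow> nat \<Rightarrow> bool" where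
  "pm_cong n t s \<longleftrightarrow> [int t = int s] (mod int n) \<or> [int t = - int s] (mod int n)"

lemma pm_cong_refl [simp]: "pm_cong n t t"
  by (simp add: pm_cong_def)

lemma pm_cong_sym: "pm_cong n t s \<Longrightarrow> pm_cong n s t"
  unfolding pm_cong_def by (metis cong_minus_minus_iff cong_sym minus_minus)

lemma pm_cong_trans: "pm_cong n t s \<Longrightarrow> pm_cong n s r \<Longrightarrow> pm_cong n t r"
  unfolding pm_cong_def by (metis cong_minus_minus_iff cong_trans minus_minus)

lemma pm_cong_mult: "pm_cong n t s \<Longrightarrow> pm_cong n (c * t) (c * s)"
  unfolding pm_cong_def using cong_mult[OF cong_refl[of "int c" "int n"]] by force

lemma pm_cong_cancel:
  assumes "pm_cong n (c * t) (c * s)" "coprime c n"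
  shows "pm_cong n t s"
proof -
  have "coprime (int c) (int n)" using assms(2) by simp
  then show ?thesis
    using assms(1) cong_mult_lcancel[of "int c" "int n" "int t"] unfolding pm_cong_def by (metis mult_minus_right of_nat_mult)
qed

lemma pm_cong_diff: "t \<le> n \<Longrightarrow> pm_cong n (n - t) t"
  by (simp add: pm_cong_def cong_iff_dvd_diff of_nat_diff)

lemma pm_cong_coprime: "pm_cong n t s \<Longrightarrow> coprime t n \<longleftrightarrow> coprime s n"
  unfolding pm_cong_def
  by (metis cong_imp_coprime cong_sym coprime_int_iff coprime_minus_left_iff)

lemma half_totative_unique:
  assumes "k \<in> half_totatives n" "l \<in> half_totatives n" "pm_cong n k l"
  shows "k = l"
proof -
  have kl: "2 * k < n" "2 * l < n" "0 < k" "0 < l" using assms by (auto simp: half_totatives_def)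
  show ?thesis using assms(3) unfolding pm_cong_def
  proof
    assume "[int k = int l] (mod int n)"
    then have "[k = l] (mod n)" by (simp only: cong_int_iff)
    then show ?thesis using kl by (simp add: cong_def)
  next
    assume "[int k = - int l] (mod int n)"
    then have "int n dvd int (k + l)" by (simp add: cong_iff_dvd_diff)
    then have "n dvd k + l" by (simp only: int_dvd_int_iff)
    then show ?thesis using kl by (auto dest: dvd_imp_le)
  qed
qed

lemma half_totative_exists:
  assumes "coprime t n" "3 \<le> n"
  obtains k where "k \<in> half_totatives n" "pm_cong n k t"
proof -
  define r where "r = t mod n"
  have r: "r < n" "pm_cong n r t" using assms by (auto simp: r_def pm_cong_def cong_def zmod_int)
  have co: "coprime r n" using pm_cong_coprime[OF r(2)] assms by simp
  then have r0: "0 < r" using assms(2) by (cases "r = 0") auto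
  have "2 * r \<noteq> n"
  proof
    assume e: "2 * r = n"
    then have "r dvd 1" using co by (metis coprime_common_divisor dvd_refl dvd_triv_right)
    then show False using e assms by simp
  qed
  then consider "2 * r < n" | "2 * (n - r) < n" using r by linarith
  then show thesis
  proof cases
    case 1 then show thesis using that[of r] r co r0 by (simp add: half_totatives_def)
  next
    case 2
    have "pm_cong n (n - r) t" using pm_cong_trans[OF pm_cong_diff r(2)] r by simp
    moreover from this have "coprime (n - r) n" using pm_cong_coprime assms(1) by blast
    ultimately show thesis using that[of "n - r"] 2 r by (simp add: half_totatives_def)
  qed
qed

section \<open>The transitive component when the used sizes are perfectly matched\<close>

lemma (in perm_group) has3_of_power:
  assumes "s \<in> H" "ctype s \<Omega> ls" "sum_list (filter (\<lambda>l. \<not> l dvd m) ls) = 3"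
  shows has3
  unfolding has3_def using pow_mem[OF assms(1), of m] moved_power_card[OF assms(1,2), of m] assms(3) by auto

(* Here t is "used" if some intransitive component has an invariant set of size congruent to t or -t.
   Such a component covers only the classes t and 2t, and if the lower bound fails, then the pairs {t, 2t}
   for the used t match all classes other than those of 1 and 2. *)
locale matched_sizes = perm_group +
  fixes used :: "nat \<Rightarrow> bool"
  assumes odd_degree: "odd (card \<Omega>)" and degree: "13 \<le> card \<Omega>"
    and used_cong: "pm_cong (card \<Omega>) t s \<Longrightarrow> used t \<Longrightarrow> used s"
    and used_coprime: "used t \<Longrightarrow> coprime t (card \<Omega>)"
    and used_not: "used t \<Longrightarrow> \<not> pm_cong (card \<Omega>) t 1" "used t \<Longrightarrow> \<not> pm_cong (card \<Omega>) t 2"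
      "used t \<Longrightarrow> \<not> pm_cong (card \<Omega>) (2 * t) 1"
    and used_double: "used t \<Longrightarrow> \<not> used (2 * t)"
    and used_cover: "coprime t (card \<Omega>) \<Longrightarrow> \<not> pm_cong (card \<Omega>) (2 * t) 1 \<Longrightarrow> \<not> pm_cong (card \<Omega>) (2 * t) 2
      \<Longrightarrow> used t \<or> used (2 * t)"
    and unused_rich: "rich (\<lambda>ls. odd (length ls) \<and> (\<forall>t\<in>ssums ls. \<not> used t))"
begin

lemma type_exists:
  "sum_list ls = card \<Omega> \<Longrightarrow> 0 \<notin> set ls \<Longrightarrow> odd (length ls) \<Longrightarrow> (\<And>t. t \<in> ssums ls \<Longrightarrow> \<not> used t)
    \<Longrightarrow> \<exists>s\<in>H. ctype s \<Omega> ls"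
  by (intro richD[OF unused_rich]) auto

lemma unused_complement: "t \<le> card \<Omega> \<Longrightarrow> \<not> used t \<Longrightarrow> \<not> used (card \<Omega> - t)"
  using used_cong pm_cong_diff by blast

lemma unused_ends [simp]: "\<not> used 0" "\<not> used (card \<Omega>)" "\<not> used 1" "\<not> used (Suc 0)" "\<not> used 2"
proof -
  show "\<not> used 0" "\<not> used (card \<Omega>)" using used_coprime[of 0] used_coprime[of "card \<Omega>"] degree by auto
  show "\<not> used 1" "\<not> used (Suc 0)" "\<not> used 2" using used_not(1)[of 1] used_not(2)[of 2] by auto
qed

lemma unused_noncoprime: "1 < d \<Longrightarrow> d dvd t \<Longrightarrow> d dvd card \<Omega> \<Longrightarrow> \<not> used t"
  using used_coprime not_coprime_factor by blast

lemma pm_small: "pm_cong (card \<Omega>) a b \<longleftrightarrow> a = b \<or> a + b = card \<Omega> \<or> a + b = 0" if "a < card \<Omega>" "b < card \<Omega>" for a b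
proof -
  have 1: "[int a = int b] (mod int (card \<Omega>)) \<longleftrightarrow> a = b"
    unfolding cong_int_iff using that by (simp add: cong_def)
  have "[int a = - int b] (mod int (card \<Omega>)) \<longleftrightarrow> int (card \<Omega>) dvd int (a + b)"
    by (simp add: cong_iff_dvd_diff)
  also have "\<dots> \<longleftrightarrow> card \<Omega> dvd a + b" by (simp only: int_dvd_int_iff)
  also have "\<dots> \<longleftrightarrow> a + b = card \<Omega> \<or> a + b = 0"
  proof
    assume "card \<Omega> dvd a + b"
    then obtain q where q: "a + b = card \<Omega> * q" by blast
    have "q < 2"
    proof (rule ccontr)
      assume "\<not> q < 2"
      then have "card \<Omega> * 2 \<le> card \<Omega> * q" by (intro mult_left_mono) auto
      then show False using q that by linarith
    qed
    then show "a + b = card \<Omega> \<or> a + b = 0" using q by (auto simp: less_2_cases_iff)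
  qed auto
  finally show ?thesis using 1 by (auto simp: pm_cong_def)
qed

lemma coprime_pow2: "coprime (2 ^ j) (card \<Omega>)"
  using odd_degree by simp

lemma used4: "used 4"
proof -
  have "\<not> pm_cong (card \<Omega>) (2 * 2) 1" "\<not> pm_cong (card \<Omega>) (2 * 2) 2" using degree by (simp_all add: pm_small)
  then show ?thesis using used_cover[of 2] coprime_pow2[of 1] by simp
qed

lemma unused8: "\<not> used 8"
  using used_double[OF used4] by simp

lemma next_pow:
  assumes "\<not> used (2 ^ j)" "\<not> pm_cong (card \<Omega>) (2 ^ Suc j) 1" "\<not> pm_cong (card \<Omega>) (2 ^ Suc j) 2"
  shows "used (2 ^ Suc j)" "\<not> used (2 ^ Suc (Suc j))"
proof -
  show "used (2 ^ Suc j)" using used_cover[of "2 ^ j"] coprime_pow2[of j] assms by simp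
  then show "\<not> used (2 ^ Suc (Suc j))" using used_double[of "2 ^ Suc j"] by simp
qed

lemma n_cycle: "\<exists>s\<in>H. ctype s \<Omega> [card \<Omega>]"
  using degree by (intro type_exists) (auto simp: insert_iff)

lemma matched_two_trans: two_trans
proof -
  define m where "m = (card \<Omega> - 1) div 2"
  have m: "card \<Omega> = Suc (2 * m)" "6 \<le> m" using odd_degree degree by (auto simp: m_def elim!: oddE)
  obtain c where c: "c \<in> H" "ctype c \<Omega> [card \<Omega>]" using n_cycle by blast
  have tr: trans_on by (rule trans_on_of_types[OF c c]) auto
  have um: "\<not> used m"
  proof
    assume "used m"
    moreover have "pm_cong (card \<Omega>) (2 * m) 1" using pm_cong_diff[of 1 "card \<Omega>"] m by simp
    ultimately show False using used_not(3) by blast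
  qed
  have um': "\<not> used (Suc m)" using unused_complement[OF _ um] m by simp
  have e1: "\<not> used (card \<Omega> - 1)" "\<not> used (card \<Omega> - 2)" using unused_complement[of 1] unused_complement[of 2] degree by auto
  have "\<exists>s\<in>H. ctype s \<Omega> [Suc 0, Suc 0, card \<Omega> - 2]"
  proof (rule type_exists)
    fix t assume "t \<in> ssums [Suc 0, Suc 0, card \<Omega> - 2]"
    then have "t = 0 \<or> t = 1 \<or> t = 2 \<or> t = card \<Omega> - 2 \<or> t = card \<Omega> - 1 \<or> t = card \<Omega>" using degree by auto
    then show "\<not> used t" using e1 unused_ends by blast
  qed (use degree in auto)
  then obtain s where s: "s \<in> H" "ctype s \<Omega> [Suc 0, Suc 0, card \<Omega> - 2]" by blast
  have "\<exists>s\<in>H. ctype s \<Omega> [Suc 0, m, m]"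
  proof (rule type_exists)
    fix t assume "t \<in> ssums [Suc 0, m, m]"
    then have "t = 0 \<or> t = 1 \<or> t = m \<or> t = Suc m \<or> t = card \<Omega> - 1 \<or> t = card \<Omega>" using m by auto
    then show "\<not> used t" using e1 um um' unused_ends by blast
  qed (use m in auto)
  then obtain r where r: "r \<in> H" "ctype r \<Omega> [Suc 0, m, m]" by blast
  obtain a where a: "a \<in> \<Omega>" "s a = a" "ctype s (\<Omega> - {a}) [Suc 0, card \<Omega> - 2]" using fixed_point_type[OF s(2)] .
  obtain b where b: "b \<in> \<Omega>" "r b = b" "ctype r (\<Omega> - {b}) [m, m]" using fixed_point_type[OF r(2)] .
  obtain h where h: "h \<in> H" "h b = a" using trans_onD[OF tr b(1) a(1)] by blast
  define r' where "r' = h \<circ> r \<circ> inv' h"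
  have r'H: "r' \<in> H" unfolding r'_def by (rule conj_mem[OF h(1) r(1)])
  have r'a: "r' a = a" unfolding r'_def using h b(2) by (metis inv_apply(1) o_apply)
  have "h ` (\<Omega> - {b}) = \<Omega> - {a}" using image_diff[OF h(1), of \<Omega> "{b}"] image_Omega[OF h(1)] h(2) by simp
  then have r't: "ctype r' (\<Omega> - {a}) [m, m]" using ctype_conj[OF b(3) bij_mem[OF h(1)]] unfolding r'_def by simp
  interpret K: perm_group "\<Omega> - {a}" "{h \<in> H. h a = a}" by (rule stabilizer[OF a(1)])
  have cK: "card (\<Omega> - {a}) = 2 * m" using a(1) m by simp
  have "K.trans_on"
    by (rule K.trans_on_of_types[OF _ a(3) _ r't]) (use s(1) a(2) r'H r'a m cK in auto)
  show ?thesis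
  proof (rule two_transI[OF tr a(1)])
    fix b c assume "b \<in> \<Omega> - {a}" "c \<in> \<Omega> - {a}"
    from K.trans_onD[OF \<open>K.trans_on\<close> this] show "\<exists>h\<in>H. h a = a \<and> h b = c" by blast
  qed
qed

text \<open>All other subset sums are 0, n or complements of the three sizes in question.\<close>

lemma three_parts_type:
  assumes n: "card \<Omega> = a + b + c" and pos: "0 < a" "0 < b" "0 < c"
    and u: "\<not> used b" "\<not> used c" "\<not> used (b + c)"
  shows "\<exists>s\<in>H. ctype s \<Omega> [b, c, a]"
proof (rule type_exists)
  have "\<not> used (a + c)" "\<not> used (a + b)" "\<not> used a"
    using unused_complement[OF _ u(1)] unused_complement[OF _ u(2)] unused_complement[OF _ u(3)] n by simp_all
  moreover fix t assume "t \<in> ssums [b, c, a]"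
  then have "t = 0 \<or> t = a \<or> t = c \<or> t = a + c \<or> t = b \<or> t = a + b \<or> t = b + c \<or> t = card \<Omega>" using n by auto
  ultimately show "\<not> used t" using u by (elim disjE) simp_all
qed (use n pos in auto)

lemma matched_has3:
  assumes n: "card \<Omega> = 13 \<or> card \<Omega> = 15 \<or> card \<Omega> = 21 \<or> card \<Omega> = 25 \<or> 29 \<le> card \<Omega>"
  shows has3
proof -
  note tt = matched_two_trans
  consider "card \<Omega> = 13" | "card \<Omega> = 15" | "card \<Omega> = 21" | "card \<Omega> = 25" | "29 \<le> card \<Omega>" using n by blast
  then show ?thesis
  proof cases
    case 1
    have "\<not> used 6" using used_not(3)[of 6] 1 by (auto simp: pm_cong_def cong_def)
    moreover have "\<not> used 5" using unused_complement[of 8] unused8 1 by simp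
    ultimately obtain s where s: "s \<in> H" "ctype s \<Omega> [1, 5, 7]" using three_parts_type[of 7 1 5] 1 by auto
    have "coprime 5 (7::nat)" by (simp add: coprime_iff_gcd_eq_1 gcd_non_0_nat)
    then show ?thesis using two_trans_stabilizer_has3[OF tt s(1), of 5 7] s(2) by simp
  next
    case 2
    have "\<not> used 3" "\<not> used 5" using unused_noncoprime[of 3 3] unused_noncoprime[of 5 5] 2 by simp_all
    then obtain s where s: "s \<in> H" "ctype s \<Omega> [3, 5, 7]" using three_parts_type[of 7 3 5] unused8 2 by auto
    show ?thesis by (rule has3_of_power[OF s, of 35]) simp
  next
    case 3
    have "\<not> used 6" using unused_noncoprime[of 3 6] 3 by simp
    then obtain s where s: "s \<in> H" "ctype s \<Omega> [6, 2, 13]" using three_parts_type[of 13 6 2] unused8 3 by auto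
    obtain T1 T2 where "moved (s ^^ 26) = T1 \<union> T2" "T1 \<inter> T2 = {}" "card T1 = 3" "card T2 = 3"
        "cyc_on (s ^^ 26) T1" "cyc_on (s ^^ 26) T2"
    proof (rule six_cycle_square[OF s, of 26])
      show "[26 = 2] (mod (6::nat))" by (simp add: cong_def)
      show "l dvd 26" if l: "l \<in> set [2, 13]" for l :: nat using l by auto
    qed (use that in blast)
    then show ?thesis using two_three_cycles_has3[OF tt _ pow_mem[OF s(1), of 26]] 3 by simp
  next
    case 4
    have "\<not> used (2 ^ 3)" using unused8 by simp
    then have "\<not> used (2 ^ 5)" using next_pow(2)[of 3] 4 by (simp add: pm_cong_def cong_def)
    then have "\<not> used (2 ^ 7)" using next_pow(2)[of 5] 4 by (simp add: pm_cong_def cong_def)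
    moreover have "pm_cong (card \<Omega>) 3 (2 ^ 7)" using 4 by (simp add: pm_cong_def cong_def)
    ultimately have "\<not> used 3" using used_cong by blast
    moreover have "\<not> used 5" using unused_noncoprime[of 5 5] 4 by simp
    ultimately obtain s where s: "s \<in> H" "ctype s \<Omega> [3, 5, 17]" using three_parts_type[of 17 3 5] unused8 4 by auto
    show ?thesis by (rule has3_of_power[OF s, of 85]) simp
  next
    case 5
    define N where "N = card \<Omega>"
    have N: "29 \<le> N" "odd N" using 5 odd_degree by (simp_all add: N_def)
    consider (six) "\<not> used 6" | (ten) "\<not> used 10" | (both) "used 6" "used 10" by blast
    then show ?thesis
    proof cases
      case six
      obtain s where s: "s \<in> H" "ctype s \<Omega> [2, 6, N - 8]"
        using three_parts_type[of "N - 8" 2 6] six unused8 N by (auto simp: N_def)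
      have "\<not> 2 dvd N - 8" "\<not> 6 dvd N - 8" using N by presburger+
      then show ?thesis using 5 by (intro bochert_power[OF tt s, of "N - 8"]) auto
    next
      case ten
      obtain s where s: "s \<in> H" "ctype s \<Omega> [2, 8, N - 10]"
        using three_parts_type[of "N - 10" 2 8] ten unused8 N by (auto simp: N_def)
      have od: "odd (N - 10)" using N by simp
      have "\<not> 8 dvd 2 * (N - 10)" using od by presburger
      then show ?thesis using 5 by (intro bochert_power[OF tt s, of "2 * (N - 10)"]) auto
    next
      case both
      have u: "\<not> used 3" "\<not> used 5" "\<not> used 12" "\<not> used 20"
        using used_double[of 3] used_double[of 5] used_double[of 6] used_double[of 10] both by auto
      obtain s where s: "s \<in> H" "ctype s \<Omega> [3, 5, N - 8]"
        using three_parts_type[of "N - 8" 3 5] u unused8 N by (auto simp: N_def)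
      show ?thesis
      proof (cases "15 dvd N - 8")
        case False
        have "prime (3::nat)" "prime (5::nat)" by simp_all
        show ?thesis
        proof (cases "3 dvd N - 8")
          case True
          have "\<not> 5 dvd N - 8"
          proof
            assume "5 dvd N - 8"
            then have "15 dvd N - 8" using True by presburger
            then show False using False by simp
          qed
          then have "\<not> 5 dvd 3 * (N - 8)" by presburger
          then show ?thesis using 5 by (intro bochert_power[OF tt s, of "3 * (N - 8)"]) auto
        next
          case False
          then have "\<not> 3 dvd 5 * (N - 8)" by presburger
          then show ?thesis by (intro has3_of_power[OF s, of "5 * (N - 8)"]) auto
        qed
      next
        case True
        \<comment> \<open>An odd N with N = 8 modulo 15 is 23, 53, 83 and so on, and 23 is below
          29.\<close>
        then have c: "N = 53 \<or> 83 \<le> N" using N by presburger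
        show ?thesis
        proof (cases "N = 53")
          case True
          then have N53: "card \<Omega> = 53" by (simp add: N_def)
          have step: "\<not> used (2 ^ Suc (Suc j))"
            if "\<not> used (2 ^ j)" "\<not> pm_cong 53 (2 ^ Suc j) 1" "\<not> pm_cong 53 (2 ^ Suc j) 2" for j
            using next_pow(2)[of j] that N53 by simp
          have "\<not> used (2 ^ 3)" using unused8 by simp
          then have "\<not> used (2 ^ 5)" using step[of 3] by (simp add: pm_cong_def cong_def)
          then have "\<not> used (2 ^ 7)" using step[of 5] by (simp add: pm_cong_def cong_def)
          then have "\<not> used (2 ^ 9)" using step[of 7] by (simp add: pm_cong_def cong_def)
          then have "\<not> used (2 ^ 11)" using step[of 9] by (simp add: pm_cong_def cong_def)
          then have "\<not> used (2 ^ 13)" using step[of 11] by (simp add: pm_cong_def cong_def)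
          then have "\<not> used (2 ^ 15)" using step[of 13] by (simp add: pm_cong_def cong_def)
          \<comment> \<open>2^15 = 32768 is 14 modulo 53. The 78th power of the type [2, 12, 39]
            moves 12 points, and 4 * 12 + 1 \<le> 53.\<close>
          moreover have "pm_cong (card \<Omega>) 14 (2 ^ 15)" unfolding N53 by (simp add: pm_cong_def cong_def)
          ultimately have "\<not> used 14" using used_cong by blast
          then obtain r where r: "r \<in> H" "ctype r \<Omega> [2, 12, 39]" using three_parts_type[of 39 2 12] u N53 by auto
          show ?thesis using N53 by (intro bochert_power[OF tt r, of 78]) auto
        next
          case False
          then have N83: "83 \<le> N" using c by simp
          have "\<not> used (2 ^ 3)" using unused8 by simp
          moreover have "\<not> pm_cong (card \<Omega>) (2 ^ Suc 3) 1" "\<not> pm_cong (card \<Omega>) (2 ^ Suc 3) 2"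
            using N83 unfolding N_def by (simp_all add: pm_small)
          ultimately have "\<not> used (2 ^ Suc (Suc 3))" by (rule next_pow(2))
          then have "\<not> used 32" by simp
          \<comment> \<open>3 divides N - 32, so the exponent 4 (N - 32) removes the 12-cycle and
            leaves degree 20; here 4 * 20 + 1 \<le> 83.\<close>
          then obtain r where r: "r \<in> H" "ctype r \<Omega> [12, 20, N - 32]"
            using three_parts_type[of "N - 32" 12 20] u N83 by (auto simp: N_def)
          obtain q where "N - 8 = 15 * q" using True by blast
          then have q: "N = 15 * q + 8" "5 \<le> q" using N83 by linarith+
          have "4 * (N - 32) = 12 * (5 * q - 8)" using q by simp
          then have "12 dvd 4 * (N - 32)" by simp
          have "4 * (N - 32) = 20 * (3 * q - 5) + 4" using q by simp
          moreover have "\<not> 20 dvd 20 * (3 * q - 5) + (4::nat)" by (subst dvd_add_right_iff) simp_all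
          ultimately have "\<not> 20 dvd 4 * (N - 32)" by simp
          with \<open>12 dvd 4 * (N - 32)\<close> show ?thesis using N83 unfolding N_def by (intro bochert_power[OF tt r[unfolded N_def], of "4 * (N - 32)"]) (auto simp: N_def)
        qed
      qed
    qed
  qed
qed

end

section \<open>Types [r, m, m] and the two bounds for A_n of odd degree\<close>

context covered
begin

text \<open>The odd one among k and n - k, so that the remaining points can be halved.\<close>

definition odd_rep :: "nat \<Rightarrow> nat" where
  "odd_rep k = (if odd k then k else n - k)"

lemma odd_rep:
  assumes n: "odd n" and k: "k \<in> half_totatives n - {1, 2}"
  shows "odd (odd_rep k)" "3 \<le> odd_rep k" "odd_rep k + 4 \<le> n" "coprime (odd_rep k) n" "pm_cong n (odd_rep k) k"
proof -
  have kk: "3 \<le> k" "2 * k < n" "coprime k n" using k by (auto simp: half_totatives_def)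
  show "odd (odd_rep k)" using n kk by (auto simp: odd_rep_def)
  show "3 \<le> odd_rep k" using kk by (auto simp: odd_rep_def)
  show "odd_rep k + 4 \<le> n"
  proof (cases "odd k")
    case True then show ?thesis using kk by (simp add: odd_rep_def)
  next
    case False
    then have "4 \<le> k" using kk(1) by presburger
    then show ?thesis using kk False by (simp add: odd_rep_def)
  qed
  show pm: "pm_cong n (odd_rep k) k" using pm_cong_diff[of k n] kk by (auto simp: odd_rep_def)
  show "coprime (odd_rep k) n" using pm_cong_coprime[OF pm] kk by simp
qed

text \<open>For r = \<open>odd_rep k\<close> and m = (n - r)/2 the type [r, m, m] is even in odd
  degree. Its proper sizes are r, m and their complements, and 2m = -r modulo n; so an invariant
  size a of the component leaves for k only the classes of a and 2a. The values 1 and 2 are left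
  out, as they give r = 1 or m = 1.\<close>

lemma balanced_components:
  assumes n: "odd n" and od: "\<not> od"
  obtains h a where "h ` (half_totatives n - {1, 2}) \<subseteq> \<H>"
    "\<And>k. k \<in> half_totatives n - {1, 2} \<Longrightarrow> \<not> perm_group.trans_on {1..n} (h k)"
    "\<And>H s ls. H \<in> h ` (half_totatives n - {1, 2}) \<Longrightarrow> s \<in> H \<Longrightarrow> ctype s {1..n} ls \<Longrightarrow> a H \<in> ssums ls"
    "\<And>k. k \<in> half_totatives n - {1, 2} \<Longrightarrow> pm_cong n k (a (h k)) \<or> pm_cong n k (2 * a (h k))"
proof -
  let ?K = "half_totatives n - {1, 2}"
  let ?m = "\<lambda>k. (n - odd_rep k) div 2"
  let ?ls = "\<lambda>k. [odd_rep k, ?m k, ?m k]"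
  have ex: "\<exists>H. H \<in> \<H> \<and> (\<exists>s\<in>H. ctype s {1..n} (?ls k)) \<and> \<not> perm_group.trans_on {1..n} H" and nm: "n = odd_rep k + 2 * ?m k"
    if k: "k \<in> ?K" for k
  proof -
    define r where "r = odd_rep k"
    define m where "m = ?m k"
    note o = odd_rep[OF n k, folded r_def]
    have m: "n = r + 2 * m" using o(1,3) n unfolding m_def r_def[symmetric] by (simp add: even_diff_nat)
    then show "n = odd_rep k + 2 * ?m k" by (simp only: r_def m_def)
    have m2: "2 \<le> m" using m o(3) by linarith
    have "gcd r n = gcd r (2 * m)" unfolding m by simp
    then have "coprime r (2 * m)" using o(4) by (simp only: coprime_iff_gcd_eq_1)
    then have co: "coprime r m" "coprime r (m + m)" by (simp_all add: mult_2[symmetric])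
    have nd: "\<not> r + m dvd n"
    proof
      assume "r + m dvd n"
      then have "r + m dvd (r + m) + m" using m by (metis add.assoc mult_2)
      then have "r + m dvd m" by (simp only: dvd_add_triv_left_iff)
      then show False using m2 o(2) by (auto dest: dvd_imp_le)
    qed
    have sum: "sum_list [r, m, m] = n" using m by simp
    have pos: "0 \<notin> set [r, m, m]" using m2 o(2) by auto
    have ev: "even (n + length [r, m, m]) \<or> od" using n by simp
    obtain H s where "H \<in> \<H>" "s \<in> H" "ctype s {1..n} [r, m, m]" "\<not> perm_group.trans_on {1..n} H"
    proof (rule intransitive_component[OF sum pos ev])
      fix H s assume H: "perm_group {1..n} H" "perm_group.trans_on {1..n} H" "s \<in> H" "ctype s {1..n} [r, m, m]"
      show "perm_group.primitive {1..n} H \<and> perm_group.has3 H"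
        by (rule perm_group.three_cycles_type_has3[OF H _ co(1,1,2)]) (use o(2) nd m2 in auto)
    qed (use od in auto)
    then show "\<exists>H. H \<in> \<H> \<and> (\<exists>s\<in>H. ctype s {1..n} (?ls k)) \<and> \<not> perm_group.trans_on {1..n} H" unfolding m_def r_def by blast
  qed
  then obtain h where h: "\<And>k. k \<in> ?K \<Longrightarrow> h k \<in> \<H> \<and> (\<exists>s\<in>h k. ctype s {1..n} (?ls k)) \<and> \<not> perm_group.trans_on {1..n} (h k)"
    by metis
  have "\<exists>a. 0 < a \<and> a < n \<and> (\<forall>s ls. s \<in> H \<longrightarrow> ctype s {1..n} ls \<longrightarrow> a \<in> ssums ls)" if H: "H \<in> h ` ?K" for H
  proof -
    obtain k where k: "k \<in> ?K" "H = h k" using H by blast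
    interpret perm_group "{1..n}" H using pg h k by blast
    obtain x where x: "x \<in> {1..n}" "card (orbit_of x) \<noteq> n" using h[OF k(1)] trans_onI k(2) by auto
    have "card (orbit_of x) \<le> n" using card_mono[OF _ orbit_of_sub[OF x(1)]] by simp
    then show ?thesis using x orbit_of_card[OF x(1)] orbit_of_card_pos[OF x(1)] by (intro exI[of _ "card (orbit_of x)"]) auto
  qed
  then obtain a where a: "\<And>H. H \<in> h ` ?K \<Longrightarrow> 0 < a H \<and> a H < n \<and> (\<forall>s ls. s \<in> H \<longrightarrow> ctype s {1..n} ls \<longrightarrow> a H \<in> ssums ls)"
    by metis
  have pm: "pm_cong n k (a (h k)) \<or> pm_cong n k (2 * a (h k))" if k: "k \<in> ?K" for k
  proof -
    define m where "m = ?m k"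
    define r where "r = odd_rep k"
    have nn: "r + 2 * m = n" using nm[OF k] by (simp only: m_def r_def)
    have "a (h k) \<in> ssums [r, m, m]" using a[of "h k"] h[OF k] k unfolding m_def r_def by blast
    moreover have "0 < a (h k)" "a (h k) < n" using a[of "h k"] k by blast+
    ultimately have "a (h k) = r \<or> a (h k) = n - r \<or> a (h k) = m \<or> a (h k) = n - m"
      using nn by auto
    then consider "a (h k) = r" | "a (h k) = n - r" | "a (h k) = m" | "a (h k) = n - m" by blast
    note cases = this
    have ok: "pm_cong n r k" unfolding r_def by (rule odd_rep(5)[OF n k])
    have le: "r \<le> n" "m \<le> n" "n - r = 2 * m" using nn by linarith+
    have 1: "pm_cong n (n - r) k" by (rule pm_cong_trans[OF pm_cong_diff[OF le(1)] ok])
    have 2: "pm_cong n (2 * m) k" using 1 unfolding le(3) .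
    have 3: "pm_cong n (2 * (n - m)) k"
      by (rule pm_cong_trans[OF pm_cong_mult[OF pm_cong_diff[OF le(2)]] 2])
    from cases show ?thesis by cases (use ok 1 2 3 pm_cong_sym in metis)+
  qed
  show thesis
  proof (rule that[of h a])
    show "a H \<in> ssums ls" if "H \<in> h ` ?K" "s \<in> H" "ctype s {1..n} ls" for H s ls using a that by blast
  qed (use h pm in blast)+
qed

text \<open>An intransitive component serves at most two values k, and the component of the n-cycle
  is a further one; this is phi(n)/4. If the second bound failed, every intransitive component would
  serve exactly two values, which is the matching described by \<open>matched_sizes\<close>; then
  \<open>H0\<close> would contain a 3-cycle.\<close>

lemma odd_alternating_bounds:
  assumes n: "odd n" and od: "\<not> od"
  shows "totient n \<le> 4 * card \<H>"
    and "13 \<le> n \<Longrightarrow> n = 13 \<or> n = 15 \<or> n = 21 \<or> n = 25 \<or> 29 \<le> n \<Longrightarrow> totient n + 2 \<le> 4 * card \<H>"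
proof -
  let ?K = "half_totatives n - {1, 2}"
  obtain h a where h: "h ` ?K \<subseteq> \<H>"
    "\<And>k. k \<in> ?K \<Longrightarrow> \<not> perm_group.trans_on {1..n} (h k)"
    and a: "\<And>H s ls. H \<in> h ` ?K \<Longrightarrow> s \<in> H \<Longrightarrow> ctype s {1..n} ls \<Longrightarrow> a H \<in> ssums ls"
    and pm: "\<And>k. k \<in> ?K \<Longrightarrow> pm_cong n k (a (h k)) \<or> pm_cong n k (2 * a (h k))"
    using balanced_components[OF n od] by blast
  obtain H0 s0 where H0: "H0 \<in> \<H>" "s0 \<in> H0" "ctype s0 {1..n} [n]" "evenperm s0 \<longleftrightarrow> even (n + length [n])"
    by (rule component[of "[n]"]) (use n n5 in auto)
  have H0t: "perm_group.trans_on {1..n} H0" by (rule n_cycle_trans[OF H0(1-3)])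
  have H0I: "H0 \<notin> h ` ?K" using h(2) H0t by blast
  have sub: "{1, 2} \<subseteq> half_totatives n" using n n5 by (auto simp: half_totatives_def)
  have cK: "2 * card ?K + 4 = totient n"
  proof -
    have "card ?K = card (half_totatives n) - 2" using sub by (subst card_Diff_subset) auto
    moreover have "2 \<le> card (half_totatives n)" using card_mono[OF _ sub] by simp
    ultimately show ?thesis using card_half_totatives[of n] n5 by simp
  qed
  have fib1: "card {k \<in> ?K. pm_cong n k t} \<le> 1" for t
  proof -
    have "k = l" if "k \<in> ?K" "pm_cong n k t" "l \<in> ?K" "pm_cong n l t" for k l
      using half_totative_unique[of k n l] pm_cong_trans[OF that(2) pm_cong_sym[OF that(4)]] that by blast
    then have "\<forall>k\<in>{k \<in> ?K. pm_cong n k t}. \<forall>l\<in>{k \<in> ?K. pm_cong n k t}. k = l" by blast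
    moreover have "finite {k \<in> ?K. pm_cong n k t}" by simp
    ultimately show ?thesis unfolding One_nat_def by (simp only: card_le_Suc0_iff_eq)
  qed
  have fsub: "{k \<in> ?K. h k = H} \<subseteq> {k \<in> ?K. pm_cong n k (a H)} \<union> {k \<in> ?K. pm_cong n k (2 * a H)}" for H
    using pm by blast
  have fib: "card {k \<in> ?K. h k = H} \<le> 2" for H
  proof -
    have "card {k \<in> ?K. h k = H} \<le> card ({k \<in> ?K. pm_cong n k (a H)} \<union> {k \<in> ?K. pm_cong n k (2 * a H)})"
      by (intro card_mono fsub) auto
    also have "\<dots> \<le> card {k \<in> ?K. pm_cong n k (a H)} + card {k \<in> ?K. pm_cong n k (2 * a H)}" by (rule card_Un_le)
    also have "\<dots> \<le> 2" using fib1[of "a H"] fib1[of "2 * a H"] by linarith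
    finally show ?thesis .
  qed
  have KI: "card ?K \<le> 2 * card (h ` ?K)" by (rule card_le_fibers[of _ h]) (use fib in auto)
  have ins: "card (insert H0 (h ` ?K)) = Suc (card (h ` ?K))" using H0I by simp
  have le: "Suc (card (h ` ?K)) \<le> card \<H>"
    unfolding ins[symmetric] using h(1) H0(1) by (intro card_mono) auto
  show "totient n \<le> 4 * card \<H>" using KI le cK by linarith
  show "totient n + 2 \<le> 4 * card \<H>" if n13: "13 \<le> n" and cases: "n = 13 \<or> n = 15 \<or> n = 21 \<or> n = 25 \<or> 29 \<le> n"
  proof (rule ccontr)
    assume "\<not> totient n + 2 \<le> 4 * card \<H>"
    then have lt: "2 * card \<H> < card ?K + 3" using cK by linarith
    then have eq: "card \<H> = Suc (card (h ` ?K))" using KI le by linarith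
    then have eq2: "card ?K = 2 * card (h ` ?K)" using KI lt by linarith
    have all: "insert H0 (h ` ?K) = \<H>" using h(1) H0(1) ins eq by (intro card_seteq) auto
    have two: "card {k \<in> ?K. h k = H} = 2" if H: "H \<in> h ` ?K" for H
    proof (rule ccontr)
      assume "card {k \<in> ?K. h k = H} \<noteq> 2"
      then have lt: "card {k \<in> ?K. h k = H} < 2" using fib[of H] by simp
      have "card ?K = (\<Sum>H\<in>h ` ?K. card {k \<in> ?K. h k = H})"
        using sum.group[of ?K "h ` ?K" h "\<lambda>_. 1::nat"] by simp
      also have "\<dots> < (\<Sum>H\<in>h ` ?K. 2)" using lt H fib by (intro sum_strict_mono_ex1) auto
      finally show False using eq2 by (simp add: mult.commute)
    qed
    have both: "\<exists>k\<in>?K. pm_cong n k (a H) \<and> h k = H" "\<exists>k\<in>?K. pm_cong n k (2 * a H) \<and> h k = H"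
      if H: "H \<in> h ` ?K" for H
    proof -
      let ?F = "{k \<in> ?K. h k = H}"
      show "\<exists>k\<in>?K. pm_cong n k (a H) \<and> h k = H"
      proof (rule ccontr)
        assume "\<not> ?thesis"
        then have "?F \<subseteq> {k \<in> ?K. pm_cong n k (2 * a H)}" using fsub[of H] by blast
        then have "card ?F \<le> 1" using fib1[of "2 * a H"] card_mono[of "{k \<in> ?K. pm_cong n k (2 * a H)}" ?F] by simp
        then show False using two[OF H] by simp
      qed
      show "\<exists>k\<in>?K. pm_cong n k (2 * a H) \<and> h k = H"
      proof (rule ccontr)
        assume "\<not> ?thesis"
        then have "?F \<subseteq> {k \<in> ?K. pm_cong n k (a H)}" using fsub[of H] by blast
        then have "card ?F \<le> 1" using fib1[of "a H"] card_mono[of "{k \<in> ?K. pm_cong n k (a H)}" ?F] by simp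
        then show False using two[OF H] by simp
      qed
    qed
    define used where "used t \<longleftrightarrow> (\<exists>H\<in>h ` ?K. pm_cong n (a H) t)" for t
    have used1: "\<exists>k\<in>?K. pm_cong n k t \<and> h k = H" "\<exists>k\<in>?K. pm_cong n k (2 * t) \<and> h k = H"
      if H: "H \<in> h ` ?K" "pm_cong n (a H) t" for H t
      using both[OF H(1)] H(2) pm_cong_trans pm_cong_mult by meson+
    have usedE: thesis
      if u: "used t" and that': "\<And>H k l. H \<in> h ` ?K \<Longrightarrow> pm_cong n (a H) t \<Longrightarrow> k \<in> ?K \<Longrightarrow> pm_cong n k t \<Longrightarrow> h k = H
        \<Longrightarrow> l \<in> ?K \<Longrightarrow> pm_cong n l (2 * t) \<Longrightarrow> h l = H \<Longrightarrow> thesis" for t thesis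
    proof -
      obtain H where H: "H \<in> h ` ?K" "pm_cong n (a H) t" using u unfolding used_def by blast
      obtain k where k: "k \<in> ?K" "pm_cong n k t" "h k = H" using used1(1)[OF H] by blast
      obtain l where l: "l \<in> ?K" "pm_cong n l (2 * t)" "h l = H" using used1(2)[OF H] by blast
      show thesis by (rule that'[OF H k l])
    qed
    have used_co: "coprime t n" if u: "used t" for t
    proof -
      obtain k where "k \<in> ?K" "pm_cong n k t" using u by (rule usedE)
      then show ?thesis using pm_cong_coprime[of n k t] by (simp add: half_totatives_def)
    qed
    have K12: "\<not> pm_cong n k 1" "\<not> pm_cong n k 2" if "k \<in> ?K" for k
      using half_totative_unique[of k n 1] half_totative_unique[of k n 2] sub that by auto
    have nK: "\<not> pm_cong n t 1" "\<not> pm_cong n t 2" if "k \<in> ?K" "pm_cong n k t" for k t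
      using K12[OF that(1)] pm_cong_trans[OF that(2)] by blast+
    interpret perm_group "{1..n}" H0 by (rule pg[OF H0(1)])
    interpret matched_sizes "{1..n}" H0 used
    proof
      show "odd (card {1..n})" "13 \<le> card {1..n}" using n n13 by simp_all
      show "used s" if "pm_cong (card {1..n}) t s" "used t" for t s
        using that pm_cong_trans unfolding used_def by simp blast
      show "coprime t (card {1..n})" if "used t" for t using used_co[OF that] by simp
      show "\<not> pm_cong (card {1..n}) t 1" "\<not> pm_cong (card {1..n}) t 2" "\<not> pm_cong (card {1..n}) (2 * t) 1" if u: "used t" for t
      proof -
        obtain k l where k: "k \<in> ?K" "pm_cong n k t" and l: "l \<in> ?K" "pm_cong n l (2 * t)" using u by (rule usedE)
        show "\<not> pm_cong (card {1..n}) t 1" "\<not> pm_cong (card {1..n}) t 2" "\<not> pm_cong (card {1..n}) (2 * t) 1"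
          using nK[OF k] nK[OF l] by (simp_all only: card_atLeastAtMost diff_Suc_1 not_False_eq_True)
      qed
      \<comment> \<open>The class of 2t belongs to one component only, so t and 2t would both be the
        invariant size of that component up to sign, and n would divide 1 or 3.\<close>
      show "\<not> used (2 * t)" if u: "used t" for t
      proof
        assume "used (2 * t)"
        then obtain H' k' where H': "H' \<in> h ` ?K" "pm_cong n (a H') (2 * t)" "k' \<in> ?K" "pm_cong n k' (2 * t)" "h k' = H'"
          by (rule usedE)
        obtain H k where H: "H \<in> h ` ?K" "pm_cong n (a H) t" "k \<in> ?K" "pm_cong n k (2 * t)" "h k = H"
          using u by (rule usedE)
        have "pm_cong n k k'" by (rule pm_cong_trans[OF H(4) pm_cong_sym[OF H'(4)]])
        then have "k = k'" using half_totative_unique[of k n k'] H(3) H'(3) by blast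
        then have "H = H'" using H(5) H'(5) by blast
        then have "pm_cong n t (2 * t)" using pm_cong_trans[OF pm_cong_sym[OF H(2)]] H'(2) by blast
        then have "[int t * 1 = int t * 2] (mod int n) \<or> [int t * 1 = int t * (- 2)] (mod int n)"
          by (simp add: pm_cong_def mult.commute)
        moreover have "coprime (int t) (int n)" using used_co[OF u] by simp
        ultimately have "[1 = 2] (mod int n) \<or> [1 = - 2] (mod int n)" using cong_mult_lcancel by blast
        then have "int n dvd 1 \<or> int n dvd 3" by (auto simp: cong_iff_dvd_diff)
        then show False using n13 by (auto dest: zdvd_imp_le)
      qed
      show "used t \<or> used (2 * t)"
        if t: "coprime t (card {1..n})" "\<not> pm_cong (card {1..n}) (2 * t) 1" "\<not> pm_cong (card {1..n}) (2 * t) 2" for t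
      proof -
        have c2: "coprime 2 n" using n by simp
        have "coprime (2 * t) n" using t(1) c2 by simp
        then obtain k where k: "k \<in> half_totatives n" "pm_cong n k (2 * t)" using n5 by (elim half_totative_exists) simp_all
        have kK: "k \<in> ?K"
        proof -
          have "k \<noteq> 1" "k \<noteq> 2" using pm_cong_sym[OF k(2)] t by auto
          then show ?thesis using k(1) by blast
        qed
        from pm[OF kK] show ?thesis
        proof
          assume "pm_cong n k (a (h k))"
          then have "pm_cong n (a (h k)) (2 * t)" using k(2) pm_cong_sym pm_cong_trans by blast
          then show ?thesis using kK unfolding used_def by blast
        next
          assume "pm_cong n k (2 * a (h k))"
          then have "pm_cong n (2 * a (h k)) (2 * t)" using k(2) pm_cong_sym pm_cong_trans by blast
          then have "pm_cong n (a (h k)) t" using c2 by (rule pm_cong_cancel)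
          then show ?thesis using kK unfolding used_def by blast
        qed
      qed
      show "rich (\<lambda>ls. odd (length ls) \<and> (\<forall>t\<in>ssums ls. \<not> used t))"
        unfolding rich_def
      proof (intro allI impI)
        fix ls assume ls: "sum_list ls = card {1..n}" "0 \<notin> set ls" "odd (length ls) \<and> (\<forall>t\<in>ssums ls. \<not> used t)"
        obtain H s where H: "H \<in> \<H>" "s \<in> H" "ctype s {1..n} ls" "evenperm s \<longleftrightarrow> even (n + length ls)"
          by (rule component[of ls]) (use ls n in auto)
        have "H \<notin> h ` ?K"
        proof
          assume HI: "H \<in> h ` ?K"
          then have "used (a H)" unfolding used_def by (intro bexI[of _ H]) simp_all
          then show False using a[OF HI H(2,3)] ls(3) by blast
        qed
        then have "H = H0" using all H(1) by blast
        then show "\<exists>s\<in>H0. ctype s {1..n} ls" using H by blast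
      qed
    qed
    have "has3" using matched_has3 cases by simp
    moreover have primitive using two_trans_primitive[OF matched_two_trans] n13 by simp
    ultimately show False using not_large(1)[OF H0(1)] od by blast
  qed
qed

end

section \<open>Symmetric groups of even degree\<close>

context covered
begin

text \<open>Three cycles in even degree form an odd permutation, so A_n covers none of these types.
  The orbit size a of an intransitive component is a subset sum of every type that it covers, so by
  \<open>fib\<close> it serves at most c indices; the component of the n-cycle is a further
  one.\<close>

lemma three_cycle_types_bound:
  fixes p q r :: "'k \<Rightarrow> nat"
  assumes n: "even n" and od: od and K: "finite K"
    and type: "\<And>k. k \<in> K \<Longrightarrow> p k + q k + r k = n \<and> 2 \<le> p k \<and> 0 < q k \<and> 0 < r k
      \<and> coprime (p k) (q k) \<and> coprime (p k) (r k) \<and> coprime (p k) (q k + r k)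
      \<and> \<not> p k + q k dvd n \<and> \<not> p k + r k dvd n
      \<and> (2 * p k \<le> n + 1 \<or> 2 \<le> q k \<and> 2 \<le> r k \<or> q k = 2 \<and> r k = 1)"
    and fib: "\<And>a. 0 < a \<Longrightarrow> a < n \<Longrightarrow> card {k \<in> K. a \<in> {p k, q k, r k, p k + q k, p k + r k, q k + r k}} \<le> c"
  shows "card K + c \<le> c * card \<H>"
proof -
  have "\<exists>H. H \<in> \<H> \<and> (\<exists>s\<in>H. ctype s {1..n} [p k, q k, r k]) \<and> \<not> perm_group.trans_on {1..n} H" if k: "k \<in> K" for k
  proof -
    note t = type[OF k]
    have sum: "sum_list [p k, q k, r k] = n" and pos: "0 \<notin> set [p k, q k, r k]" using t by auto
    have ev: "even (n + length [p k, q k, r k]) \<or> od" using od by simp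
    obtain H s where "H \<in> \<H>" "s \<in> H" "ctype s {1..n} [p k, q k, r k]" "\<not> perm_group.trans_on {1..n} H"
    proof (rule intransitive_component[OF sum pos ev])
      fix H s assume H: "perm_group {1..n} H" "perm_group.trans_on {1..n} H" "s \<in> H" "ctype s {1..n} [p k, q k, r k]"
      show "perm_group.primitive {1..n} H \<and> perm_group.has3 H"
        by (rule perm_group.three_cycles_type_has3[OF H]) (use t in auto)
    qed (use n in auto)
    then show ?thesis by blast
  qed
  then obtain h where h: "\<And>k. k \<in> K \<Longrightarrow> h k \<in> \<H> \<and> (\<exists>s\<in>h k. ctype s {1..n} [p k, q k, r k]) \<and> \<not> perm_group.trans_on {1..n} (h k)"
    by metis
  have fibH: "card {k \<in> K. h k = H} \<le> c" if H: "H \<in> h ` K" for H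
  proof -
    obtain k0 where k0: "k0 \<in> K" "H = h k0" using H by blast
    interpret perm_group "{1..n}" H using pg h k0 by blast
    obtain x where x: "x \<in> {1..n}" "card (orbit_of x) \<noteq> n" using h[OF k0(1)] trans_onI k0(2) by auto
    define a where "a = card (orbit_of x)"
    have "a \<le> n" using card_mono[OF _ orbit_of_sub[OF x(1)]] by (simp add: a_def)
    then have a: "0 < a" "a < n" using x orbit_of_card_pos[OF x(1)] by (auto simp: a_def)
    have "{k \<in> K. h k = H} \<subseteq> {k \<in> K. a \<in> {p k, q k, r k, p k + q k, p k + r k, q k + r k}}"
    proof
      fix k assume k: "k \<in> {k \<in> K. h k = H}"
      then obtain s where "s \<in> H" "ctype s {1..n} [p k, q k, r k]" using h by blast
      then have "a \<in> ssums [p k, q k, r k]" unfolding a_def by (rule orbit_of_card[OF x(1)])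
      moreover have "p k + (q k + r k) = n" using type k by fastforce
      ultimately show "k \<in> {k \<in> K. a \<in> {p k, q k, r k, p k + q k, p k + r k, q k + r k}}" using a k by auto
    qed
    then have "card {k \<in> K. h k = H} \<le> card {k \<in> K. a \<in> {p k, q k, r k, p k + q k, p k + r k, q k + r k}}"
      using K by (intro card_mono) auto
    then show ?thesis using fib[OF a] by linarith
  qed
  obtain H0 s0 where H0: "H0 \<in> \<H>" "s0 \<in> H0" "ctype s0 {1..n} [n]" "evenperm s0 \<longleftrightarrow> even (n + length [n])"
    by (rule component[of "[n]"]) (use od n5 in auto)
  have "H0 \<notin> h ` K" using h n_cycle_trans[OF H0(1-3)] by blast
  then have "card (insert H0 (h ` K)) = Suc (card (h ` K))" using K by simp
  moreover have "card (insert H0 (h ` K)) \<le> card \<H>" using h H0(1) by (intro card_mono) auto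
  ultimately have le: "Suc (card (h ` K)) \<le> card \<H>" by simp
  have "card K \<le> c * card (h ` K)" by (rule card_le_fibers[of _ h]) (use K fibH in auto)
  then have "card K + c \<le> c * Suc (card (h ` K))" by simp
  also have "\<dots> \<le> c * card \<H>" using le by (rule mult_left_mono) simp
  finally show ?thesis .
qed

end

section \<open>The three families of types for S_n of even degree\<close>

lemma coprime_diff_multiple:
  fixes i m :: nat
  assumes "coprime i m" "k * i \<le> m"
  shows "coprime i (m - k * i)"
proof -
  have "gcd i (m - k * i) = gcd i (k * i + (m - k * i))" by (simp add: gcd_add_mult)
  also have "\<dots> = gcd i m" using assms(2) by simp
  finally show ?thesis using assms(1) by (simp only: coprime_iff_gcd_eq_1)
qed

lemma coprime_add_multiple:
  fixes i m :: nat
  assumes "coprime i m"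
  shows "coprime i (m + k * i)"
proof -
  have "gcd i (k * i + m) = gcd i m" by (rule gcd_add_mult)
  then show ?thesis using assms by (simp add: coprime_iff_gcd_eq_1 add.commute)
qed

lemma card_le_two: "A \<subseteq> {x, y} \<Longrightarrow> card A \<le> 2"
  using card_mono[of "{x, y}" A] by (auto simp: card_insert_if split: if_splits)

lemma card_le_oneI: "finite A \<Longrightarrow> (\<And>x y. x \<in> A \<Longrightarrow> y \<in> A \<Longrightarrow> x = y) \<Longrightarrow> card A \<le> 1"
  using card_le_Suc0_iff_eq[of A] by simp

text \<open>The types are [n - 3i, 2i, i]; n - 3i \<ge> 2 gives the range of i. As i is odd, an even
  size is 2i or n - 2i, and an odd one is i, 3i or a complement of these. The sizes 3i and n - 3i
  are told apart modulo 3, so a size leaves at most two choices of i.\<close>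

lemma bound_not_three:
  assumes cov: "covered n True \<H>" and n: "even n" "\<not> 3 dvd n"
  shows "card {i. 0 < i \<and> 3 * i + 1 < n \<and> coprime i n} + 2 \<le> 2 * card \<H>"
proof -
  interpret covered n True \<H> by (rule cov)
  let ?K = "{i. 0 < i \<and> 3 * i + 1 < n \<and> coprime i n}"
  have odd: "odd i" if "i \<in> ?K" for i using that n(1) by (metis (mono_tags, lifting) coprime_common_divisor even_numeral dvd_refl mem_Collect_eq odd_one)
  show ?thesis
  proof (rule three_cycle_types_bound[of _ "\<lambda>i. n - 3 * i" "\<lambda>i. 2 * i" "\<lambda>i. i" 2])
    show "finite ?K" by (rule finite_subset[of _ "{..n}"]) auto
  next
    fix i assume i: "i \<in> ?K"
    then have ii: "0 < i" "3 * i + 1 < n" "coprime i n" by auto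
    define p where "p = n - 3 * i"
    have p: "n = p + 3 * i" "2 \<le> p" using ii by (auto simp: p_def)
    have "odd p" using p(1) n(1) odd[OF i] by presburger
    have c1: "coprime i p" unfolding p_def using coprime_diff_multiple[OF ii(3), of 3] ii by simp
    have c3: "coprime p 3"
    proof -
      have "\<not> 3 dvd p" using n(2) unfolding p(1) by (simp add: dvd_add_left_iff)
      then show ?thesis using prime_imp_coprime[of 3 p] by (simp add: coprime_commute)
    qed
    have c2: "coprime p 2" using \<open>odd p\<close> by simp
    have c4: "coprime p (2 * i + i)"
    proof -
      have "coprime p (3 * i)" using c1 c3 by (simp add: coprime_commute)
      then show ?thesis by simp
    qed
    have nd1: "\<not> p + 2 * i dvd n"
    proof
      assume "p + 2 * i dvd n"
      then have "p + 2 * i dvd (p + 2 * i) + i" unfolding p(1) by (simp add: algebra_simps)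
      then have "p + 2 * i dvd i" by (simp only: dvd_add_triv_left_iff)
      then show False using ii p by (auto dest: dvd_imp_le)
    qed
    have nd2: "\<not> p + i dvd n"
    proof
      assume "p + i dvd n"
      then have "p + i dvd (p + i) + 2 * i" unfolding p(1) by (simp add: algebra_simps)
      then have d: "p + i dvd 2 * i" by (simp only: dvd_add_triv_left_iff)
      have "coprime i (p + 1 * i)" by (rule coprime_add_multiple[OF c1])
      then have "coprime (p + i) i" by (simp add: coprime_commute)
      then have "p + i dvd 2" using d by (simp add: coprime_dvd_mult_left_iff)
      then show False using ii p by (auto dest: dvd_imp_le)
    qed
    have "i = 1 \<or> 2 \<le> i" using ii by linarith
    then show "n - 3 * i + 2 * i + i = n \<and> 2 \<le> n - 3 * i \<and> 0 < 2 * i \<and> 0 < i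
      \<and> coprime (n - 3 * i) (2 * i) \<and> coprime (n - 3 * i) i \<and> coprime (n - 3 * i) (2 * i + i)
      \<and> \<not> n - 3 * i + 2 * i dvd n \<and> \<not> n - 3 * i + i dvd n
      \<and> (2 * (n - 3 * i) \<le> n + 1 \<or> 2 \<le> 2 * i \<and> 2 \<le> i \<or> 2 * i = 2 \<and> i = 1)"
      using ii p c1 c2 c4 nd1 nd2 unfolding p_def[symmetric] by (auto simp: coprime_commute)
  next
    fix a assume a: "0 < a" "a < n"
    show "card {k \<in> ?K. a \<in> {n - 3 * k, 2 * k, k, n - 3 * k + 2 * k, n - 3 * k + k, 2 * k + k}} \<le> 2"
    proof (cases "even a")
      case True
      have "{k \<in> ?K. a \<in> {n - 3 * k, 2 * k, k, n - 3 * k + 2 * k, n - 3 * k + k, 2 * k + k}} \<subseteq> {a div 2, (n - a) div 2}"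
      proof
        fix k assume k: "k \<in> {k \<in> ?K. a \<in> {n - 3 * k, 2 * k, k, n - 3 * k + 2 * k, n - 3 * k + k, 2 * k + k}}"
        then have "odd k" "3 * k + 1 < n" using odd by auto
        then have "a = 2 * k \<or> a = n - 2 * k" using k True n(1) by auto
        then show "k \<in> {a div 2, (n - a) div 2}" using \<open>3 * k + 1 < n\<close> by auto
      qed
      then show ?thesis by (rule card_le_two)
    next
      case False
      have "{k \<in> ?K. a \<in> {n - 3 * k, 2 * k, k, n - 3 * k + 2 * k, n - 3 * k + k, 2 * k + k}}
          \<subseteq> {min a (n - a), if 3 dvd a then a div 3 else (n - a) div 3}"
      proof
        fix k assume k: "k \<in> {k \<in> ?K. a \<in> {n - 3 * k, 2 * k, k, n - 3 * k + 2 * k, n - 3 * k + k, 2 * k + k}}"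
        then have kk: "odd k" "3 * k + 1 < n" using odd by auto
        then have "a = k \<or> a = n - k \<or> a = 3 * k \<or> a = n - 3 * k" using k False n(1) by auto
        moreover have "\<not> 3 dvd n - 3 * k" using n(2) kk(2) by presburger
        ultimately show "k \<in> {min a (n - a), if 3 dvd a then a div 3 else (n - a) div 3}"
          using kk(2) by (elim disjE) (auto simp: min_def)
      qed
      then show ?thesis by (rule card_le_two)
    qed
  qed (use n in simp_all)
qed

text \<open>The types are [2u - i, u - i, 2i]. For 0 < i < u/2 the odd sizes 2u - i, u - i, 2u + i
  and u + i lie in the disjoint intervals (3u/2, 2u), (u/2, u), (2u, 5u/2) and (u, 3u/2), and the
  even sizes 2i and 3u - 2i lie below u and above 2u. So a size determines i. That 3 divides u makes
  2u - i prime to 3.\<close>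

lemma bound_nine:
  assumes cov: "covered n True \<H>" and n: "even n" "n = 3 * u" "3 dvd u"
  shows "card {i. u \<le> 6 * i \<and> 2 * i < u \<and> coprime i n} + 1 \<le> card \<H>"
proof -
  interpret covered n True \<H> by (rule cov)
  let ?K = "{i. u \<le> 6 * i \<and> 2 * i < u \<and> coprime i n}"
  have eu: "even u" using n by simp
  have u6: "6 \<le> u" using n5 n eu by presburger
  have odd: "odd i" if "i \<in> ?K" for i using that n(1) by (metis (mono_tags, lifting) coprime_common_divisor even_numeral dvd_refl mem_Collect_eq odd_one)
  have "card ?K + 1 \<le> 1 * card \<H>"
  proof (rule three_cycle_types_bound[of _ "\<lambda>i. 2 * u - i" "\<lambda>i. u - i" "\<lambda>i. 2 * i" 1])
    show "finite ?K" by (rule finite_subset[of _ "{..u}"]) auto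
  next
    fix i assume i: "i \<in> ?K"
    then have ii: "0 < i" "u \<le> 6 * i" "2 * i < u" "coprime i n" using u6 by auto
    have oi: "odd i" by (rule odd[OF i])
    have iu: "coprime i u" "coprime i (2 * u)" using ii(4) oi unfolding n(2) by simp_all
    define p where "p = 2 * u - i"
    define q where "q = u - i"
    have pq: "p + i = 2 * u" "q + i = u" "odd p" "p = u + q" using ii(3) oi by (auto simp: p_def q_def)
    have c1: "coprime i p" unfolding p_def using coprime_diff_multiple[OF iu(2), of 1] ii by simp
    have c2: "coprime i q" unfolding q_def using coprime_diff_multiple[OF iu(1), of 1] ii by simp
    have uq: "coprime q u" using coprime_add_multiple[of q i 1] c2 pq(2) by (simp add: coprime_commute add.commute)
    have c3: "coprime q p" using coprime_add_multiple[OF uq, of 1] pq(4) by simp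
    have up: "coprime u p" using coprime_add_multiple[of u q 1] uq pq(4) by (simp add: coprime_commute add.commute)
    have "coprime 3 p" using up n(3) by (metis coprime_divisors dvd_refl)
    then have "coprime p (3 * u)" using up by (simp add: coprime_commute)
    moreover have eq: "(q + 2 * i) + p = 3 * u" using pq by linarith
    ultimately have c4: "coprime p (q + 2 * i)"
      using coprime_diff_multiple[of p "3 * u" 1] by (metis add_diff_cancel_right' le_add2 mult_1)
    have nd1: "\<not> p + q dvd n"
    proof
      assume "p + q dvd n"
      moreover have "n = p + q + 2 * i" using eq n(2) by linarith
      ultimately have "p + q dvd 2 * i" by (simp only: dvd_add_triv_left_iff)
      then show False using ii pq by (auto dest: dvd_imp_le)
    qed
    have nd2: "\<not> p + 2 * i dvd n"
    proof
      assume "p + 2 * i dvd n"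
      moreover have "n = p + 2 * i + q" using eq n(2) by linarith
      ultimately have "p + 2 * i dvd q" by (simp only: dvd_add_triv_left_iff)
      then show False using ii pq by (auto dest: dvd_imp_le)
    qed
    show "2 * u - i + (u - i) + 2 * i = n \<and> 2 \<le> 2 * u - i \<and> 0 < u - i \<and> 0 < 2 * i
      \<and> coprime (2 * u - i) (u - i) \<and> coprime (2 * u - i) (2 * i) \<and> coprime (2 * u - i) (u - i + 2 * i)
      \<and> \<not> 2 * u - i + (u - i) dvd n \<and> \<not> 2 * u - i + 2 * i dvd n
      \<and> (2 * (2 * u - i) \<le> n + 1 \<or> 2 \<le> u - i \<and> 2 \<le> 2 * i \<or> u - i = 2 \<and> 2 * i = 1)"
      unfolding p_def[symmetric] q_def[symmetric]
      using c1 c3 c4 nd1 nd2 pq ii u6 eq n(2) by (auto simp: coprime_commute)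
  next
    fix a assume a: "0 < a" "a < n"
    show "card {k \<in> ?K. a \<in> {2 * u - k, u - k, 2 * k, 2 * u - k + (u - k), 2 * u - k + 2 * k, u - k + 2 * k}} \<le> 1"
    proof (rule card_le_oneI)
      show "finite {k \<in> ?K. a \<in> {2 * u - k, u - k, 2 * k, 2 * u - k + (u - k), 2 * u - k + 2 * k, u - k + 2 * k}}"
        by (rule finite_subset[of _ "{..u}"]) auto
      have shape: "(odd a \<and> (a + k = 2 * u \<or> a + k = u \<or> a = 2 * u + k \<or> a = u + k)
          \<or> even a \<and> (a = 2 * k \<or> a + 2 * k = 3 * u)) \<and> u \<le> 6 * k \<and> 2 * k < u"
        if k: "k \<in> {k \<in> ?K. a \<in> {2 * u - k, u - k, 2 * k, 2 * u - k + (u - k), 2 * u - k + 2 * k, u - k + 2 * k}}" for k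
      proof -
        have "odd k" "2 * k < u" "u \<le> 6 * k" using odd k by auto
        then show ?thesis using k eu by auto
      qed
      fix x y assume "x \<in> {k \<in> ?K. a \<in> {2 * u - k, u - k, 2 * k, 2 * u - k + (u - k), 2 * u - k + 2 * k, u - k + 2 * k}}"
        "y \<in> {k \<in> ?K. a \<in> {2 * u - k, u - k, 2 * k, 2 * u - k + (u - k), 2 * u - k + 2 * k, u - k + 2 * k}}"
      from shape[OF this(1)] shape[OF this(2)] show "x = y" by linarith
    qed
  qed (use n in simp_all)
  then show ?thesis by simp
qed

text \<open>The odd sizes for \<open>bound_three\<close>. The kinds occupy disjoint ranges, except
  that 2u - 3x and u + 3y both lie between u and 2u; these coincide only for 3 (x + y) = u, which is
  excluded.\<close>

lemma odd_sizes_distinct: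
  fixes a u x y :: nat
  assumes "x = 1 \<and> (a + 3 = u \<or> a = 2 * u + 3) \<or> a = x \<or> a + x = 3 * u \<or> a + 3 * x = 2 * u \<or> a = u + 3 * x"
   "y = 1 \<and> (a + 3 = u \<or> a = 2 * u + 3) \<or> a = y \<or> a + y = 3 * u \<or> a + 3 * y = 2 * u \<or> a = u + 3 * y"
   "3 * x < u" "0 < x" "3 * y < u" "0 < y" "10 \<le> u" "3 * (x + y) < u \<or> u < 3 * (x + y)"
  shows "x = y"
proof -
  let ?A = "\<lambda>z. z = 1 \<and> (a + 3 = u \<or> a = 2 * u + 3)"
  let ?M = "\<lambda>z. a + 3 * z = 2 * u \<or> a = u + 3 * z"
  have A: "u \<le> 3 * a \<and> a < u \<or> 2 * u < a \<and> 3 * a \<le> 8 * u" if "?A z" for z using that assms(7) by (elim disjE conjE) auto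
  have L: "3 * a < u" if "a = z" "3 * z < u" for z using that by simp
  have Hi: "8 * u < 3 * a" if "a + z = 3 * u" "3 * z < u" for z using that by linarith
  have M: "u < a \<and> a < 2 * u" if "?M z" "3 * z < u" "0 < z" for z using that by (elim disjE) auto
  have MM: "x = y" if "?M x" "?M y" using that assms(8) by (elim disjE) auto
  consider "?A x" | "a = x" | "a + x = 3 * u" | "?M x" using assms(1) by argo
  then show ?thesis
  proof cases
    case x: 1
    consider "?A y" | "a = y" | "a + y = 3 * u" | "?M y" using assms(2) by argo
    then show ?thesis
    proof cases
      case 1 then show ?thesis using x by simp
    next
      case 2 show ?thesis using A[OF x] L[OF 2 assms(5)] by linarith
    next
      case 3 show ?thesis using A[OF x] Hi[OF 3 assms(5)] assms(7) by linarith
    next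
      case 4 show ?thesis using A[OF x] M[OF 4 assms(5,6)] by linarith
    qed
  next
    case x: 2
    consider "?A y" | "a = y" | "a + y = 3 * u" | "?M y" using assms(2) by argo
    then show ?thesis
    proof cases
      case 1 show ?thesis using A[OF 1] L[OF x assms(3)] by linarith
    next
      case 2 then show ?thesis using x by simp
    next
      case 3 show ?thesis using L[OF x assms(3)] Hi[OF 3 assms(5)] by linarith
    next
      case 4 show ?thesis using L[OF x assms(3)] M[OF 4 assms(5,6)] by linarith
    qed
  next
    case x: 3
    consider "?A y" | "a = y" | "a + y = 3 * u" | "?M y" using assms(2) by argo
    then show ?thesis
    proof cases
      case 1 show ?thesis using A[OF 1] Hi[OF x assms(3)] assms(7) by linarith
    next
      case 2 show ?thesis using L[OF 2 assms(5)] Hi[OF x assms(3)] by linarith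
    next
      case 3 then show ?thesis using x by linarith
    next
      case 4 show ?thesis using Hi[OF x assms(3)] M[OF 4 assms(5,6)] by linarith
    qed
  next
    case x: 4
    consider "?A y" | "a = y" | "a + y = 3 * u" | "?M y" using assms(2) by argo
    then show ?thesis
    proof cases
      case 1 show ?thesis using A[OF 1] M[OF x assms(3,4)] by linarith
    next
      case 2 show ?thesis using L[OF 2 assms(5)] M[OF x assms(3,4)] by linarith
    next
      case 3 show ?thesis using Hi[OF 3 assms(5)] M[OF x assms(3,4)] by linarith
    next
      case 4 show ?thesis by (rule MM[OF x 4])
    qed
  qed
qed

text \<open>The even sizes for \<open>bound_three\<close>. The bound on 4x separates the two
  families: the first has sizes strictly between u + 2 and 2u + 2, the second sizes below u - 2 or
  above 2u + 2. Within a family a coincidence needs x + y to be u/2 or u/4, but distinct indices of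
  the first have a smaller sum, and those of the second a larger one.\<close>

lemma even_sizes_distinct:
  fixes a u x y :: nat
  assumes "x = 1 \<and> (a + 2 = u \<or> a = 2 * u + 2) \<or> 4 * x \<le> u + 2 \<and> 3 \<le> x \<and> (a = u + 2 * x \<or> a + 2 * x = 2 * u)
             \<or> u + 2 < 4 * x \<and> (a + 4 * x = 2 * u \<or> a = u + 4 * x)"
   "y = 1 \<and> (a + 2 = u \<or> a = 2 * u + 2) \<or> 4 * y \<le> u + 2 \<and> 3 \<le> y \<and> (a = u + 2 * y \<or> a + 2 * y = 2 * u)
             \<or> u + 2 < 4 * y \<and> (a + 4 * y = 2 * u \<or> a = u + 4 * y)"
   "3 * x < u" "0 < x" "3 * y < u" "0 < y" "10 \<le> u" "x = y \<or> x + 2 \<le> y \<or> y + 2 \<le> x"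
  shows "x = y"
proof -
  have mid: "x = y" if "4 * x \<le> u + 2" "4 * y \<le> u + 2" "a = u + 2 * x \<or> a + 2 * x = 2 * u" "a = u + 2 * y \<or> a + 2 * y = 2 * u"
    using that assms(8) by (elim disjE; linarith)
  let ?A = "\<lambda>x. x = 1 \<and> (a + 2 = u \<or> a = 2 * u + 2)"
  let ?B = "\<lambda>x. 4 * x \<le> u + 2 \<and> 3 \<le> x \<and> (a = u + 2 * x \<or> a + 2 * x = 2 * u)"
  let ?C = "\<lambda>x. u + 2 < 4 * x \<and> (a + 4 * x = 2 * u \<or> a = u + 4 * x)"
  have B: "u + 2 < a \<and> a < 2 * u + 2" if "?B z" "3 * z < u" for z using that assms(7) by (elim disjE conjE; linarith)
  have C: "a + 2 < u \<or> 2 * u + 2 < a" if "?C z" "3 * z < u" for z using that by (elim disjE conjE; linarith)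
  have A: "a + 2 = u \<or> a = 2 * u + 2" if "?A z" for z using that by blast
  have CC: "x = y" if "?C x" "?C y" using that assms(3,5) by (elim disjE conjE; linarith)
  consider "?A x" "?A y" | "?B x" "?B y" | "?C x" "?C y" | "?A x" "?B y" | "?A x" "?C y" | "?B x" "?A y" | "?B x" "?C y" | "?C x" "?A y" | "?C x" "?B y"
    using assms(1,2) by argo
  then show ?thesis
  proof cases
    case 1 then show ?thesis by simp
  next
    case 2 then show ?thesis using mid by blast
  next
    case 3 then show ?thesis by (rule CC)
  next
    case 4 show ?thesis using A[OF 4(1)] B[OF 4(2) assms(5)] assms(7) by linarith
  next
    case 5 show ?thesis using A[OF 5(1)] C[OF 5(2) assms(5)] assms(7) by linarith
  next
    case 6 show ?thesis using A[OF 6(2)] B[OF 6(1) assms(3)] assms(7) by linarith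
  next
    case 7 show ?thesis using B[OF 7(1) assms(3)] C[OF 7(2) assms(5)] assms(7) by linarith
  next
    case 8 show ?thesis using A[OF 8(2)] C[OF 8(1) assms(3)] assms(7) by linarith
  next
    case 9 show ?thesis using B[OF 9(2) assms(5)] C[OF 9(1) assms(3)] assms(7) by linarith
  qed
qed

text \<open>The natural type [i, 2u - 3i, u + 2i] has harmless odd sizes, as 3 does not divide u,
  but its even sizes u + 2i and 2u - 2j coincide when i + j = u/2. For 4i > u + 2 it is replaced by
  [i, u + 3i, 2u - 4i], which has the same odd sizes. The index 1 is too short for the distinguished
  cycle and gets [u - 3, 1, 2u + 2]. For u < 10 only the index 1 can occur.\<close>

lemma bound_three:
  assumes cov: "covered n True \<H>" and n: "even n" "n = 3 * u" "\<not> 3 dvd u"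
  shows "card {i. 0 < i \<and> 3 * i < u \<and> coprime i n} + 1 \<le> card \<H>"
proof (cases "u < 10")
  case True
  interpret covered n True \<H> by (rule cov)
  have "{i. 0 < i \<and> 3 * i < u \<and> coprime i n} \<subseteq> {1}"
  proof
    fix i assume i: "i \<in> {i. 0 < i \<and> 3 * i < u \<and> coprime i n}"
    have "odd i" using i n(1) by (metis (mono_tags, lifting) coprime_common_divisor even_numeral dvd_refl mem_Collect_eq odd_one)
    moreover have "0 < i" "i < 3" using i True by auto
    ultimately have "i = 1" by presburger
    then show "i \<in> {1}" by simp
  qed
  then have "card {i. 0 < i \<and> 3 * i < u \<and> coprime i n} \<le> card {1::nat}" by (intro card_mono) auto
  then show ?thesis using even_two_components[OF n(1)] by simp
next
  case False
  interpret covered n True \<H> by (rule cov)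
  let ?K = "{i. 0 < i \<and> 3 * i < u \<and> coprime i n}"
  have eu: "even u" using n by simp
  have u10: "10 \<le> u" using False by simp
  have odd: "odd i" if "i \<in> ?K" for i using that n(1) by (metis (mono_tags, lifting) coprime_common_divisor even_numeral dvd_refl mem_Collect_eq odd_one)
  let ?p = "\<lambda>i. if i = 1 then u - 3 else i"
  let ?q = "\<lambda>i. if i = 1 then 1 else if 4 * i \<le> u + 2 then 2 * u - 3 * i else u + 3 * i"
  let ?r = "\<lambda>i. if i = 1 then 2 * u + 2 else if 4 * i \<le> u + 2 then u + 2 * i else 2 * u - 4 * i"
  have "card ?K + 1 \<le> 1 * card \<H>"
  proof (rule three_cycle_types_bound[of _ ?p ?q ?r 1])
    show "finite ?K" by (rule finite_subset[of _ "{..u}"]) auto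
  next
    fix i assume i: "i \<in> ?K"
    then have ii: "0 < i" "3 * i < u" "coprime i n" by auto
    have oi: "odd i" by (rule odd[OF i])
    have iu: "coprime i u" "coprime i (2 * u)" "coprime i (3 * u)" using ii(3) oi unfolding n(2) by simp_all
    have c3u: "coprime 3 u" using prime_imp_coprime[of 3 u] n(3) by simp
    consider (one) "i = 1" | (A) "i \<noteq> 1" "4 * i \<le> u + 2" | (B) "i \<noteq> 1" "\<not> 4 * i \<le> u + 2" by blast
    then show "?p i + ?q i + ?r i = n \<and> 2 \<le> ?p i \<and> 0 < ?q i \<and> 0 < ?r i
      \<and> coprime (?p i) (?q i) \<and> coprime (?p i) (?r i) \<and> coprime (?p i) (?q i + ?r i)
      \<and> \<not> ?p i + ?q i dvd n \<and> \<not> ?p i + ?r i dvd n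
      \<and> (2 * ?p i \<le> n + 1 \<or> 2 \<le> ?q i \<and> 2 \<le> ?r i \<or> ?q i = 2 \<and> ?r i = 1)"
    proof cases
      case one
      define p where "p = u - 3"
      have p: "u = p + 3" "7 \<le> p" "odd p" using u10 eu by (auto simp: p_def)
      have "coprime p 8" using p(3) coprime_power_right_iff[of p 2 3] by simp
      then have "coprime p (8 + 2 * p)" by (rule coprime_add_multiple)
      then have 1: "coprime p (2 * u + 2)" using p(1) by (simp add: algebra_simps)
      have "\<not> 3 dvd p" using n(3) unfolding p(1) by simp
      then have "coprime p 9" using prime_imp_coprime[of 3 p] coprime_power_right_iff[of p 3 2] by (simp add: coprime_commute)
      then have "coprime p (9 + 2 * p)" by (rule coprime_add_multiple)
      then have 2: "coprime p (1 + (2 * u + 2))" using p(1) by (simp add: algebra_simps)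
      have 3: "\<not> p + 1 dvd n"
      proof
        assume "p + 1 dvd n"
        moreover have "n = (p + 1) * 3 + 6" using p(1) n(2) by simp
        ultimately have "p + 1 dvd 6" by (metis dvd_add_right_iff dvd_triv_left)
        then show False using p(2) by (auto dest: dvd_imp_le)
      qed
      have 4: "\<not> p + (2 * u + 2) dvd n"
      proof
        assume "p + (2 * u + 2) dvd n"
        moreover have "n = p + (2 * u + 2) + 1" using p(1) n(2) by simp
        ultimately have "p + (2 * u + 2) dvd 1" by (simp only: dvd_add_triv_left_iff)
        then show False by simp
      qed
      show ?thesis using one 1 2 3 4 p n(2) unfolding p_def[symmetric] by simp
    next
      case A
      have i3: "3 \<le> i" using A(1) oi ii(1) by presburger
      have c1: "coprime i (2 * u - 3 * i)" using coprime_diff_multiple[OF iu(2), of 3] ii by simp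
      have c2: "coprime i (u + 2 * i)" by (rule coprime_add_multiple[OF iu(1)])
      have c3: "coprime i (3 * u - 1 * i)" using ii by (intro coprime_diff_multiple[OF iu(3)]) simp
      have e: "2 * u - 3 * i + (u + 2 * i) = 3 * u - 1 * i" "i + (2 * u - 3 * i) = 2 * (u - i)" using ii by linarith+
      have nd1: "\<not> i + (2 * u - 3 * i) dvd n"
      proof
        assume "i + (2 * u - 3 * i) dvd n"
        then have d: "u - i dvd 3 * u" unfolding e(2) n(2) by (rule dvd_mult_right)
        have "coprime i (u - 1 * i)" using ii by (intro coprime_diff_multiple[OF iu(1)]) simp
        then have "coprime (u - i) (i + 1 * (u - i))" by (intro coprime_add_multiple) (simp add: coprime_commute)
        then have "coprime (u - i) u" using ii by simp
        then have "u - i dvd 3" using d by (simp add: coprime_dvd_mult_left_iff)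
        then show False using ii u10 by (auto dest: dvd_imp_le)
      qed
      have nd2: "\<not> i + (u + 2 * i) dvd n"
      proof
        assume "i + (u + 2 * i) dvd n"
        then have d: "u + 3 * i dvd 3 * u" unfolding n(2) by (simp add: algebra_simps)
        have "coprime u (3 * i + 1 * u)" using c3u iu(1) by (intro coprime_add_multiple) (simp add: coprime_commute)
        then have "coprime (u + 3 * i) u" by (simp add: coprime_commute add.commute)
        then have "u + 3 * i dvd 3" using d by (simp add: coprime_dvd_mult_left_iff)
        then show False using u10 by (auto dest: dvd_imp_le)
      qed
      show ?thesis using A i3 c1 c2 c3 e(1) nd1 nd2 ii n(2) by simp
    next
      case B
      have i3: "3 \<le> i" using B(1) oi ii(1) by presburger
      have c1: "coprime i (2 * u - 4 * i)" using coprime_diff_multiple[OF iu(2), of 4] ii by simp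
      have c2: "coprime i (u + 3 * i)" by (rule coprime_add_multiple[OF iu(1)])
      have c3: "coprime i (3 * u - 1 * i)" using ii by (intro coprime_diff_multiple[OF iu(3)]) simp
      have e: "u + 3 * i + (2 * u - 4 * i) = 3 * u - 1 * i" "i + (2 * u - 4 * i) = 2 * u - 3 * i" using ii by linarith+
      have nd1: "\<not> i + (u + 3 * i) dvd n"
      proof
        assume "i + (u + 3 * i) dvd n"
        moreover have "n = i + (u + 3 * i) + (2 * u - 4 * i)" using n(2) ii by linarith
        ultimately have "i + (u + 3 * i) dvd 2 * u - 4 * i" by (metis dvd_add_triv_left_iff)
        then have "i + (u + 3 * i) \<le> 2 * u - 4 * i" using ii by (intro dvd_imp_le) auto
        then show False using B(2) ii by linarith
      qed
      have nd2: "\<not> i + (2 * u - 4 * i) dvd n"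
      proof
        assume "i + (2 * u - 4 * i) dvd n"
        then have d: "2 * u - 3 * i dvd 3 * u" unfolding e(2) n(2) .
        have "coprime u (3 * i)" using c3u iu(1) by (simp add: coprime_commute)
        have "coprime u (2 * u - 3 * i)"
        proof (rule coprimeI)
          fix d assume d: "d dvd u" "d dvd 2 * u - 3 * i"
          have "d dvd 2 * u" using d(1) by simp
          moreover have "2 * u = (2 * u - 3 * i) + 3 * i" using ii by linarith
          ultimately have "d dvd 3 * i" using d(2) by (metis dvd_add_right_iff)
          then show "is_unit d" using \<open>coprime u (3 * i)\<close> d(1) coprime_common_divisor by blast
        qed
        then have "coprime (2 * u - 3 * i) u" by (simp only: coprime_commute)
        then have "2 * u - 3 * i dvd 3" using d by (simp only: coprime_dvd_mult_left_iff)
        then have "2 * u - 3 * i \<le> 3" by (rule dvd_imp_le) simp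
        then show False using ii u10 by linarith
      qed
      have pe: "?p i = i" "?q i = u + 3 * i" "?r i = 2 * u - 4 * i" using B by simp_all
      have c4: "coprime i (u + 3 * i + (2 * u - 4 * i))" unfolding e(1) by (rule c3)
      have le: "i + (u + 3 * i) + (2 * u - 4 * i) = n" "2 \<le> i" "0 < u + 3 * i" "0 < 2 * u - 4 * i" "2 * i \<le> n + 1"
        using ii i3 n(2) by linarith+
      show ?thesis unfolding pe by (intro conjI disjI1 le c1 c2 c4 nd1 nd2)
    qed
  next
    fix a assume a: "0 < a" "a < n"
    let ?S = "{k \<in> ?K. a \<in> {?p k, ?q k, ?r k, ?p k + ?q k, ?p k + ?r k, ?q k + ?r k}}"
    show "card ?S \<le> 1"
    proof (rule card_le_oneI)
      have "finite ?K" by (rule finite_subset[of _ "{..u}"]) auto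
      then show "finite ?S" by (rule finite_subset[OF Collect_restrict])
      have shape: "odd k \<and> 0 < k \<and> 3 * k < u \<and>
          (k = 1 \<and> (odd a \<and> (a = 1 \<or> a + 1 = 3 * u \<or> a + 3 = u \<or> a = 2 * u + 3) \<or> even a \<and> (a + 2 = u \<or> a = 2 * u + 2))
          \<or> k \<noteq> 1 \<and> odd a \<and> (a = k \<or> a + k = 3 * u \<or> a + 3 * k = 2 * u \<or> a = u + 3 * k)
          \<or> k \<noteq> 1 \<and> even a \<and> (4 * k \<le> u + 2 \<and> (a = u + 2 * k \<or> a + 2 * k = 2 * u)
             \<or> u + 2 < 4 * k \<and> (a + 4 * k = 2 * u \<or> a = u + 4 * k)))"
        if k: "k \<in> ?S" for k
      proof -
        have kk: "odd k" "0 < k" "3 * k < u" using odd k by auto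
        show ?thesis
        proof (cases "k = 1")
          case True
          then have "a = u - 3 \<or> a = 1 \<or> a = 2 * u + 2 \<or> a = u - 3 + 1 \<or> a = u - 3 + (2 * u + 2) \<or> a = 1 + (2 * u + 2)"
          proof -
            have "a \<in> {?p k, ?q k, ?r k, ?p k + ?q k, ?p k + ?r k, ?q k + ?r k}" using CollectD[OF k] by (rule conjunct2)
            moreover have "?p k = u - 3" "?q k = 1" "?r k = 2 * u + 2" using True by simp_all
            ultimately show ?thesis by (simp only: insert_iff empty_iff simp_thms)
          qed
          then show ?thesis using True kk u10 eu by (elim disjE) auto
        next
          case False
          show ?thesis
          proof (cases "4 * k \<le> u + 2")
            case True
            then have "a = k \<or> a = 2 * u - 3 * k \<or> a = u + 2 * k \<or> a = k + (2 * u - 3 * k) \<or> a = k + (u + 2 * k) \<or> a = 2 * u - 3 * k + (u + 2 * k)"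
            proof -
              have "a \<in> {?p k, ?q k, ?r k, ?p k + ?q k, ?p k + ?r k, ?q k + ?r k}" using CollectD[OF k] by (rule conjunct2)
              moreover have "?p k = k" "?q k = 2 * u - 3 * k" "?r k = u + 2 * k" using True False by simp_all
              ultimately show ?thesis by (simp only: insert_iff empty_iff simp_thms)
            qed
            then show ?thesis using True False kk eu by (elim disjE) auto
          next
            case F: False
            then have "a = k \<or> a = u + 3 * k \<or> a = 2 * u - 4 * k \<or> a = k + (u + 3 * k) \<or> a = k + (2 * u - 4 * k) \<or> a = u + 3 * k + (2 * u - 4 * k)"
            proof -
              have "a \<in> {?p k, ?q k, ?r k, ?p k + ?q k, ?p k + ?r k, ?q k + ?r k}" using CollectD[OF k] by (rule conjunct2)
              moreover have "?p k = k" "?q k = u + 3 * k" "?r k = 2 * u - 4 * k" using F False by simp_all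
              ultimately show ?thesis by (simp only: insert_iff empty_iff simp_thms)
            qed
            then show ?thesis using F False kk eu by (elim disjE) auto
          qed
        qed
      qed
      fix x y assume xy: "x \<in> ?S" "y \<in> ?S"
      have rng: "3 * k < u \<and> 0 < k" if k: "k \<in> ?S" for k using shape[OF k] by blast
      have so: "k = 1 \<and> (a + 3 = u \<or> a = 2 * u + 3) \<or> a = k \<or> a + k = 3 * u \<or> a + 3 * k = 2 * u \<or> a = u + 3 * k"
        if k: "k \<in> ?S" and "odd a" for k
        using shape[OF k] \<open>odd a\<close> by auto
      have se: "k = 1 \<and> (a + 2 = u \<or> a = 2 * u + 2) \<or> 4 * k \<le> u + 2 \<and> 3 \<le> k \<and> (a = u + 2 * k \<or> a + 2 * k = 2 * u)
             \<or> u + 2 < 4 * k \<and> (a + 4 * k = 2 * u \<or> a = u + 4 * k)"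
        if k: "k \<in> ?S" and "even a" for k
      proof -
        have "odd k" "0 < k" using shape[OF k] by blast+
        then have "k \<noteq> 1 \<Longrightarrow> 3 \<le> k" by presburger
        then show ?thesis using shape[OF k] \<open>even a\<close> by blast
      qed
      have "3 * (x + y) \<noteq> u" using n(3) by auto
      then have n3: "3 * (x + y) < u \<or> u < 3 * (x + y)" by linarith
      have "odd x" "odd y" using shape[OF xy(1)] shape[OF xy(2)] by blast+
      then have par: "x = y \<or> x + 2 \<le> y \<or> y + 2 \<le> x" by presburger
      show "x = y"
      proof (cases "odd a")
        case True
        show ?thesis
          by (rule odd_sizes_distinct[OF so[OF xy(1) True] so[OF xy(2) True] _ _ _ _ u10 n3]) (use rng[OF xy(1)] rng[OF xy(2)] in blast)+
      next
        case False
        then have ev: "even a" by simp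
        show ?thesis
          by (rule even_sizes_distinct[OF se[OF xy(1) ev] se[OF xy(2) ev] _ _ _ _ u10 par]) (use rng[OF xy(1)] rng[OF xy(2)] in blast)+
      qed
    qed
  qed (use n in simp_all)
  then show ?thesis by simp
qed

section \<open>Asymptotics\<close>

definition sieved :: "real \<Rightarrow> nat set \<Rightarrow> nat set" where
  "sieved x P = {i. 0 < i \<and> real i < x \<and> (\<forall>p\<in>P. \<not> p dvd i)}"

lemma finite_sieved [simp]: "finite (sieved x P)"
proof (rule finite_subset)
  show "sieved x P \<subseteq> {..nat \<lceil>x\<rceil>}" by (auto simp: sieved_def) linarith
qed simp

text \<open>Legendre's sieve as an induction: a new prime q removes q times the numbers sieved below
  x/q, so the error at most doubles with each prime.\<close>

lemma sieve_bound:
  assumes "finite P" "\<And>p. p \<in> P \<Longrightarrow> prime p" "0 \<le> x"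
  shows "\<bar>real (card (sieved x P)) - x * (\<Prod>p\<in>P. 1 - 1 / real p)\<bar> \<le> 2 ^ card P"
  using assms
proof (induction P arbitrary: x rule: finite_induct)
  case empty
  have "sieved x {} = {1..<nat \<lceil>x\<rceil>}" by (auto simp: sieved_def) linarith+
  then have "card (sieved x {}) = nat \<lceil>x\<rceil> - 1" by simp
  then show ?case using empty by simp linarith
next
  case (insert q P)
  have q: "prime q" "0 < q" using insert.prems(1)[of q] prime_gt_0_nat by auto
  let ?\<Pi> = "\<Prod>p\<in>P. 1 - 1 / real p"
  have eq: "sieved x P = sieved x (insert q P) \<union> (*) q ` sieved (x / real q) P"
  proof
    show "sieved x P \<subseteq> sieved x (insert q P) \<union> (*) q ` sieved (x / real q) P"
    proof
      fix i assume i: "i \<in> sieved x P"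
      show "i \<in> sieved x (insert q P) \<union> (*) q ` sieved (x / real q) P"
      proof (cases "q dvd i")
        case True
        then obtain j where j: "i = q * j" by blast
        then have "j \<in> sieved (x / real q) P" using i q by (auto simp: sieved_def field_simps)
        then show ?thesis using j by blast
      next
        case False
        then show ?thesis using i by (auto simp: sieved_def)
      qed
    qed
    have "q * j \<in> sieved x P" if j: "j \<in> sieved (x / real q) P" for j
    proof -
      have "\<not> p dvd q * j" if p: "p \<in> P" for p
      proof -
        have "prime p" "p \<noteq> q" using insert p by auto
        then have "\<not> p dvd q" using q(1) primes_dvd_imp_eq by blast
        then show ?thesis using j p \<open>prime p\<close> by (auto simp: sieved_def prime_dvd_mult_iff)
      qed
      then show ?thesis using j q by (auto simp: sieved_def field_simps)
    qed
    then show "sieved x (insert q P) \<union> (*) q ` sieved (x / real q) P \<subseteq> sieved x P" by (auto simp: sieved_def)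
  qed
  have disj: "sieved x (insert q P) \<inter> (*) q ` sieved (x / real q) P = {}" by (auto simp: sieved_def)
  have "card (sieved x P) = card (sieved x (insert q P)) + card ((*) q ` sieved (x / real q) P)"
    unfolding eq by (rule card_Un_disjoint) (use disj in simp_all)
  also have "card ((*) q ` sieved (x / real q) P) = card (sieved (x / real q) P)"
    using q by (intro card_image) (simp add: inj_on_def)
  finally have c: "real (card (sieved x (insert q P))) = real (card (sieved x P)) - real (card (sieved (x / real q) P))"
    by simp
  have 1: "\<bar>real (card (sieved x P)) - x * ?\<Pi>\<bar> \<le> 2 ^ card P" by (rule insert.IH) (use insert.prems in auto)
  have 2: "\<bar>real (card (sieved (x / real q) P)) - x / real q * ?\<Pi>\<bar> \<le> 2 ^ card P"
    by (rule insert.IH) (use insert.prems in auto)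
  have "x * (\<Prod>p\<in>insert q P. 1 - 1 / real p) = x * ?\<Pi> - x / real q * ?\<Pi>"
    using insert.hyps by (simp add: algebra_simps)
  then have "\<bar>real (card (sieved x (insert q P))) - x * (\<Prod>p\<in>insert q P. 1 - 1 / real p)\<bar>
      = \<bar>(real (card (sieved x P)) - x * ?\<Pi>) - (real (card (sieved (x / real q) P)) - x / real q * ?\<Pi>)\<bar>"
    unfolding c by (simp add: algebra_simps)
  also have "\<dots> \<le> 2 ^ card P + 2 ^ card P" using abs_triangle_ineq4 add_mono[OF 1 2] by (rule order_trans)
  also have "\<dots> = 2 ^ card (insert q P)" using insert.hyps by simp
  finally show ?case .
qed

lemma coprime_iff_prime_factors:
  fixes i n :: nat
  assumes "0 < n"
  shows "coprime i n \<longleftrightarrow> (\<forall>p\<in>prime_factors n. \<not> p dvd i)"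
proof
  assume "coprime i n"
  then have "\<not> p dvd i" if "prime p" "p dvd n" for p
    using that not_coprime_factor[of p i n] prime_gt_1_nat[of p] by blast
  then show "\<forall>p\<in>prime_factors n. \<not> p dvd i" by (simp add: in_prime_factors_iff)
next
  assume *: "\<forall>p\<in>prime_factors n. \<not> p dvd i"
  show "coprime i n"
  proof (rule ccontr)
    assume "\<not> coprime i n"
    then have "gcd i n \<noteq> 1" by (simp add: coprime_iff_gcd_eq_1)
    then obtain p where "prime p" "p dvd gcd i n" using prime_factor_nat by blast
    then show False using * assms by (auto simp: in_prime_factors_iff)
  qed
qed

lemma totient_over: "0 < n \<Longrightarrow> (\<Prod>p\<in>prime_factors n. 1 - 1 / real p) = real (totient n) / real n"
  by (simp add: totient_formula2)

lemma phi_interval_bound: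
  assumes n: "0 < n" and ab: "0 \<le> a" "a \<le> b"
  shows "\<bar>real (phi_interval {a..<b} n) - (b - a) * (real (totient n) / real n)\<bar> \<le> 2 * 2 ^ card (prime_factors n)"
proof -
  let ?P = "prime_factors n" and ?t = "real (totient n) / real n"
  have "{i. 0 < i \<and> real i \<in> {a..<b} \<and> coprime i n} = sieved b ?P - sieved a ?P"
    using coprime_iff_prime_factors[OF n] by (auto simp: sieved_def)
  moreover have "sieved a ?P \<subseteq> sieved b ?P" using ab by (auto simp: sieved_def)
  ultimately have "phi_interval {a..<b} n = card (sieved b ?P) - card (sieved a ?P)" "card (sieved a ?P) \<le> card (sieved b ?P)"
    by (simp_all add: phi_interval_def card_Diff_subset card_mono)
  then have "real (phi_interval {a..<b} n) = real (card (sieved b ?P)) - real (card (sieved a ?P))" by simp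
  moreover have "\<bar>real (card (sieved b ?P)) - b * ?t\<bar> \<le> 2 ^ card ?P" "\<bar>real (card (sieved a ?P)) - a * ?t\<bar> \<le> 2 ^ card ?P"
    unfolding totient_over[OF n, symmetric] using ab by (intro sieve_bound; auto)+
  ultimately show ?thesis unfolding left_diff_distrib by linarith
qed

text \<open>The interval has length n/d(n) up to a constant. The constants, including the summand 1
  of the bound, are absorbed since \<open>w\<close> is at least 1.\<close>

lemma sym_even_bound_deviation:
  assumes n: "18 \<le> n"
  shows "\<bar>sym_even_bound n - real (totient n) / (c_of n * d_of n)\<bar> \<le> 4 * 2 ^ card (prime_factors n)"
proof -
  define w where "w = (2::real) ^ card (prime_factors n)"
  define t where "t = real (totient n) / real n"
  have w: "1 \<le> w" by (simp add: w_def)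
  have t: "0 \<le> t" "t \<le> 1" using n totient_le[of n] by (simp_all add: t_def divide_le_eq)
  have nt: "real n * t = real (totient n)" using n by (simp add: t_def)
  have I: "\<bar>real (phi_interval {a..<b} n) - (b - a) * t\<bar> \<le> 2 * w" if "0 \<le> a" "a \<le> b" for a b
    using phi_interval_bound[of n a b] n that by (simp add: w_def t_def)
  consider (a) "\<not> 3 dvd n" | (b) "3 dvd n" "n mod 9 = 3 \<or> n mod 9 = 6" | (c) "3 dvd n" "\<not> (n mod 9 = 3 \<or> n mod 9 = 6)"
    by blast
  then show ?thesis
  proof cases
    case a
    have "\<bar>real (phi_interval {1..<(real n - 1) / 3} n) - ((real n - 1) / 3 - 1) * t\<bar> \<le> 2 * w"
      using n by (intro I) auto
    moreover have "((real n - 1) / 3 - 1) * t = (real n * t) / 3 - 4 / 3 * t" by (simp add: field_simps)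
    moreover have s: "sym_even_bound n = real (phi_interval {1..<(real n - 1) / 3} n) / 2 + 1" "c_of n * d_of n = 6"
      using a by (simp_all add: sym_even_bound_def c_of_def d_of_def I_of_def)
    ultimately show ?thesis using w t nt unfolding s w_def[symmetric] by linarith
  next
    case b
    have "\<bar>real (phi_interval {1..<real n / 9} n) - (real n / 9 - 1) * t\<bar> \<le> 2 * w"
      using n by (intro I) auto
    moreover have "(real n / 9 - 1) * t = (real n * t) / 9 - t" by (simp add: field_simps)
    moreover have s: "sym_even_bound n = real (phi_interval {1..<real n / 9} n) + 1" "c_of n * d_of n = 9"
      using b by (simp_all add: sym_even_bound_def c_of_def d_of_def I_of_def)
    ultimately show ?thesis using w t nt unfolding s w_def[symmetric] by linarith
  next
    case c
    have "\<bar>real (phi_interval {real n / 18..<real n / 6} n) - (real n / 6 - real n / 18) * t\<bar> \<le> 2 * w"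
      using n by (intro I) auto
    moreover have "(real n / 6 - real n / 18) * t = (real n * t) / 9" by (simp add: field_simps)
    moreover have s: "sym_even_bound n = real (phi_interval {real n / 18..<real n / 6} n) + 1" "c_of n * d_of n = 9"
      using c by (simp_all add: sym_even_bound_def c_of_def d_of_def I_of_def)
    ultimately show ?thesis using w t nt unfolding s w_def[symmetric] by linarith
  qed
qed

text \<open>Primes from 8 on are at least 8; each smaller one costs an extra factor 8, and there are
  fewer than 8 of them. The base 8 = 2^3 provides the third power needed in
  \<open>two_power_omega_small\<close>.\<close>

lemma prime_factor_count_bound:
  assumes "0 < n"
  shows "(8::nat) ^ card (prime_factors n) \<le> 8 ^ 8 * n"
proof -
  let ?P = "prime_factors n"
  have "(8::nat) ^ card ?P = (\<Prod>p\<in>?P. 8)" by simp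
  also have "\<dots> \<le> (\<Prod>p\<in>?P. p * (if p < 8 then 8 else 1))"
    by (intro prod_mono) (auto simp: in_prime_factors_iff dest: prime_gt_0_nat)
  also have "\<dots> = (\<Prod>p\<in>?P. p) * (\<Prod>p\<in>?P. if p < 8 then 8 else 1)" by (rule prod.distrib)
  also have "(\<Prod>p\<in>?P. if p < 8 then 8 else 1) = (8::nat) ^ card {p\<in>?P. p < 8}"
    by (simp add: prod.If_cases Int_def)
  also have "(\<Prod>p\<in>?P. p) \<le> (\<Prod>p\<in>?P. p ^ multiplicity p n)"
  proof (intro prod_mono conjI)
    fix p assume p: "p \<in> ?P"
    then have "1 \<le> multiplicity p n" "1 \<le> p"
      using assms by (auto simp: in_prime_factors_iff prime_multiplicity_gt_zero_iff Suc_le_eq dest: prime_gt_0_nat)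
    then show "p \<le> p ^ multiplicity p n" using power_increasing[of 1 "multiplicity p n" p] by simp
  qed simp
  also have "(\<Prod>p\<in>?P. p ^ multiplicity p n) = n" using prod_prime_factors[of n] assms by simp
  also have "(8::nat) ^ card {p\<in>?P. p < 8} \<le> 8 ^ 8"
  proof (rule power_increasing)
    have "card {p\<in>?P. p < 8} \<le> card {..<8::nat}" by (intro card_mono) auto
    then show "card {p\<in>?P. p < 8} \<le> 8" by simp
  qed simp
  finally show ?thesis by (simp add: mult.commute)
qed

text \<open>Every factor 1 - 1/p of phi(n)/n is at least 1/2.\<close>

lemma totient_lower_bound:
  assumes "0 < n"
  shows "real n \<le> real (totient n) * 2 ^ card (prime_factors n)"
proof -
  have "(1 / 2) ^ card (prime_factors n) = (\<Prod>p\<in>prime_factors n. (1 / 2 :: real))" by simp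
  also have "\<dots> \<le> (\<Prod>p\<in>prime_factors n. 1 - 1 / real p)"
  proof (intro prod_mono conjI)
    fix p assume "p \<in> prime_factors n"
    then have "2 \<le> real p" using prime_ge_2_nat[of p] by (auto simp: in_prime_factors_iff)
    then show "1 / 2 \<le> 1 - 1 / real p" by (simp add: field_simps)
  qed simp
  also have "\<dots> = real (totient n) / real n" by (rule totient_over[OF assms])
  finally show ?thesis using assms by (simp add: field_simps power_one_over)
qed

text \<open>From w^3 \<le> 8^8 n and n \<le> t w follows w^3 n \<le> 8^16 t^3, so w/t is at most a
  constant times n^(-1/3).\<close>

lemma two_power_omega_small:
  assumes \<epsilon>: "0 < (\<epsilon>::real)" and n: "0 < n" "8 ^ 16 / \<epsilon> ^ 3 \<le> real n"
  shows "2 ^ card (prime_factors n) \<le> \<epsilon> * real (totient n)"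
proof -
  define w where "w = (2::real) ^ card (prime_factors n)"
  define t where "t = real (totient n)"
  have w0: "0 < w" and t0: "0 < t" using n by (simp_all add: w_def t_def)
  have "w ^ 3 = real (8 ^ card (prime_factors n))" by (simp add: w_def power_mult[symmetric] mult.commute[of _ 3]) (simp add: power_mult)
  also have "\<dots> \<le> real (8 ^ 8 * n)" using prime_factor_count_bound[OF n(1)] of_nat_le_iff by blast
  finally have 1: "w ^ 3 \<le> 8 ^ 8 * real n" by simp
  have 2: "real n \<le> t * w" using totient_lower_bound[OF n(1)] by (simp add: w_def t_def)
  have "(w * real n) ^ 3 \<le> (w * (t * w)) ^ 3" using 2 w0 n by (intro power_mono mult_left_mono) auto
  also have "\<dots> = w ^ 3 * w ^ 3 * t ^ 3" by (simp add: power_mult_distrib power3_eq_cube)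
  also have "\<dots> \<le> (8 ^ 8 * real n) * (8 ^ 8 * real n) * t ^ 3" using 1 w0 t0 by (intro mult_mono) auto
  finally have "w ^ 3 * real n * (real n)\<^sup>2 \<le> 8 ^ 16 * t ^ 3 * (real n)\<^sup>2"
    by (simp add: power_mult_distrib power3_eq_cube power2_eq_square algebra_simps)
  then have 3: "w ^ 3 * real n \<le> 8 ^ 16 * t ^ 3" using n(1) by simp
  have "8 ^ 16 \<le> real n * \<epsilon> ^ 3" using n(2) \<epsilon> by (simp add: field_simps)
  then have "8 ^ 16 * t ^ 3 \<le> real n * \<epsilon> ^ 3 * t ^ 3" using t0 by (intro mult_right_mono) auto
  then have "w ^ 3 * real n \<le> (\<epsilon> * t) ^ 3 * real n" using 3 by (simp add: power_mult_distrib mult_ac)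
  then have "w ^ 3 \<le> (\<epsilon> * t) ^ 3" using n(1) by simp
  then have "w \<le> \<epsilon> * t" using \<epsilon> t0 by (intro power_le_imp_le_base[of w 2]) (simp_all add: numeral_3_eq_3)
  then show ?thesis by (simp add: w_def t_def)
qed

text \<open>The estimate is uniform in n, so \<open>S\<close> is left open; the three asymptotic
  lines are instances.\<close>

lemma sym_even_bound_asymp:
  "sym_even_bound \<sim>[inf at_top (principal S)] (\<lambda>n. real (totient n) / (c_of n * d_of n))"
  unfolding asymp_equiv_altdef
proof (rule landau_o.smallI)
  fix \<epsilon> :: real assume \<epsilon>: "0 < \<epsilon>"
  \<comment> \<open>36 = 4 * 9: the deviation is at most 4 * 2^omega(n), and c(n) d(n) is at most
    9.\<close>
  have "eventually (\<lambda>n::nat. 8 ^ 16 / (\<epsilon> / 36) ^ 3 \<le> real n) at_top"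
    using filterlim_real_sequentially unfolding filterlim_at_top by blast
  moreover have "eventually (\<lambda>n::nat. 18 \<le> n) at_top" by (rule eventually_ge_at_top)
  ultimately have "eventually (\<lambda>n::nat. norm (sym_even_bound n - real (totient n) / (c_of n * d_of n))
      \<le> \<epsilon> * norm (real (totient n) / (c_of n * d_of n))) at_top"
  proof eventually_elim
    case (elim n)
    have "2 ^ card (prime_factors n) \<le> \<epsilon> / 36 * real (totient n)"
      by (rule two_power_omega_small) (use \<epsilon> elim in auto)
    then have "norm (sym_even_bound n - real (totient n) / (c_of n * d_of n)) \<le> \<epsilon> * (real (totient n) / 9)"
      using sym_even_bound_deviation[OF elim(2)] by simp
    also have "\<dots> \<le> \<epsilon> * (real (totient n) / (c_of n * d_of n))"
      using \<epsilon> by (intro mult_left_mono divide_left_mono) (auto simp: c_of_def d_of_def)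
    finally show ?case by (simp add: c_of_def d_of_def)
  qed
  then show "eventually (\<lambda>n. norm (sym_even_bound n - real (totient n) / (c_of n * d_of n))
      \<le> \<epsilon> * norm (real (totient n) / (c_of n * d_of n))) (inf at_top (principal S))"
    unfolding eventually_inf_principal by (rule eventually_mono) simp
qed

section \<open>The lower bounds\<close>

lemma sym_cover:
  assumes "5 \<le> n"
  obtains \<H> where "covered n True \<H>" "card \<H> = normal_covering_number (sym_group n)"
  using cover_common[OF assms, of "sym_group n" True] assms by (auto simp: covered_def)

lemma alt_cover:
  assumes "5 \<le> n"
  obtains \<H> where "covered n False \<H>" "card \<H> = normal_covering_number (alt_group n)"
  using cover_common[OF assms, of "alt_group n" False] assms by (auto simp: covered_def)

lemma totient_6_8: "totient 6 = 2" "totient 8 = 4"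
proof -
  have "coprime (2::nat) 3" by simp
  then show "totient 6 = 2" using totient_mult_coprime[of 2 3] totient_prime[of 2] totient_prime[of 3] by simp
  show "totient 8 = 4" using totient_prime_power_Suc[of 2 2] by simp
qed

text \<open>n = 6 is below the range of the averaging argument, but phi(6) = 2 asks only for two
  components.\<close>

lemma alternating_even_lower_bound:
  assumes "even n" "5 \<le> n" "n \<noteq> 8"
  shows "totient n + 2 \<le> 2 * normal_covering_number (alt_group n)"
proof -
  obtain \<H> where H: "covered n False \<H>" "card \<H> = normal_covering_number (alt_group n)" using alt_cover[OF assms(2)] .
  interpret covered n False \<H> by (rule H(1))
  have "n = 6 \<or> 10 \<le> n" using assms by presburger
  then show ?thesis
  proof
    assume "n = 6"
    then show ?thesis using even_two_components assms H(2) totient_6_8 by simp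
  next
    assume "10 \<le> n"
    then show ?thesis using even_alternating_bound assms H(2) by simp
  qed
qed

lemma alternating_8_lower_bound: "totient 8 \<le> 2 * normal_covering_number (alt_group 8)"
proof -
  obtain \<H> where H: "covered 8 False \<H>" "card \<H> = normal_covering_number (alt_group 8)" using alt_cover[of 8] by auto
  then show ?thesis using covered.even_two_components[OF H(1)] totient_6_8 by simp
qed

text \<open>In the degrees 7, 11, 19, 23 and 27 the totient is 2 modulo 4, so the first bound rounds
  up to the second. The degrees 5, 9 and 17 have the form 2^e + 1.\<close>

lemma alternating_odd_lower_bounds:
  assumes "odd n" "5 \<le> n"
  shows "totient n \<le> 4 * normal_covering_number (alt_group n)"
    and "\<forall>e. n \<noteq> 2 ^ e + 1 \<Longrightarrow> totient n + 2 \<le> 4 * normal_covering_number (alt_group n)"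
proof -
  obtain \<H> where H: "covered n False \<H>" "card \<H> = normal_covering_number (alt_group n)" using alt_cover[OF assms(2)] .
  interpret covered n False \<H> by (rule H(1))
  note b = odd_alternating_bounds[OF assms(1) not_False_eq_True[THEN iffD2, OF TrueI]]
  show 1: "totient n \<le> 4 * normal_covering_number (alt_group n)" using b(1) H(2) by simp
  assume ne: "\<forall>e. n \<noteq> 2 ^ e + 1"
  have "n \<noteq> 2 ^ 2 + 1" "n \<noteq> 2 ^ 3 + 1" "n \<noteq> 2 ^ 4 + 1" using ne by blast+
  then have ne': "n \<noteq> 5" "n \<noteq> 9" "n \<noteq> 17" by simp_all
  have "(13 \<le> n \<and> (n = 13 \<or> n = 15 \<or> n = 21 \<or> n = 25 \<or> 29 \<le> n)) \<or> n \<in> {7, 11, 19, 23} \<or> n = 27"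
    using assms ne' by (simp only: insert_iff empty_iff) presburger
  then show "totient n + 2 \<le> 4 * normal_covering_number (alt_group n)"
  proof (elim disjE)
    assume "13 \<le> n \<and> (n = 13 \<or> n = 15 \<or> n = 21 \<or> n = 25 \<or> 29 \<le> n)"
    then show ?thesis using b(2) H(2) by simp
  next
    assume n: "n \<in> {7, 11, 19, 23}"
    have "prime (7::nat)" "prime (11::nat)" "prime (19::nat)" "prime (23::nat)" by simp_all
    then have "totient n = n - 1" using n totient_prime by blast
    then show ?thesis using 1 n by auto
  next
    assume n: "n = 27"
    have "totient (3 ^ Suc 2) = 3 ^ 2 * (3 - 1)" by (rule totient_prime_power_Suc) simp
    then show ?thesis using 1 n by simp
  qed
qed

lemma symmetric_even_lower_bound:
  assumes "even n" "5 \<le> n"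
  shows "sym_even_bound n \<le> real (normal_covering_number (sym_group n))"
proof -
  obtain \<H> where H: "covered n True \<H>" "card \<H> = normal_covering_number (sym_group n)" using sym_cover[OF assms(2)] .
  consider (a) "\<not> 3 dvd n" | (b) u where "n = 3 * u" "\<not> 3 dvd u" | (c) u where "n = 3 * u" "3 dvd u" by blast
  then show ?thesis
  proof cases
    case a
    have "{i. 0 < i \<and> real i \<in> {1..<(real n - 1) / 3} \<and> coprime i n} = {i. 0 < i \<and> 3 * i + 1 < n \<and> coprime i n}"
      by (auto simp: field_simps)
    then have "phi_interval (I_of n) n + 2 \<le> 2 * card \<H>"
      using bound_not_three[OF H(1) assms(1) a] a by (simp only: phi_interval_def I_of_def if_True not_False_eq_True)
    then show ?thesis using a H(2) by (simp add: sym_even_bound_def c_of_def)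
  next
    case b
    then have m: "n mod 9 = 3 \<or> n mod 9 = 6" by presburger
    have "{i. 0 < i \<and> real i \<in> {1..<real n / 9} \<and> coprime i n} = {i. 0 < i \<and> 3 * i < u \<and> coprime i n}"
      unfolding b(1) by auto
    moreover have "I_of n = {1..<real n / 9}" using b m by (simp add: I_of_def)
    ultimately have "phi_interval (I_of n) n + 1 \<le> card \<H>"
      using bound_three[OF H(1) assms(1) b] by (simp only: phi_interval_def)
    then show ?thesis using b H(2) by (simp add: sym_even_bound_def c_of_def)
  next
    case c
    then have m: "\<not> (n mod 9 = 3 \<or> n mod 9 = 6)" by presburger
    have "0 < u" using c assms by auto
    then have "{i. 0 < i \<and> real i \<in> {real n / 18..<real n / 6} \<and> coprime i n} = {i. u \<le> 6 * i \<and> 2 * i < u \<and> coprime i n}"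
      \<comment> \<open>With n = 3u the end points n/18 and n/6 become u/6 and u/2.\<close>
      unfolding c(1) by (auto simp: field_simps; linarith)
    moreover have "I_of n = {real n / 18..<real n / 6}" using c m by (simp add: I_of_def)
    ultimately have "phi_interval (I_of n) n + 1 \<le> card \<H>"
      using bound_nine[OF H(1) assms(1) c] by (simp only: phi_interval_def)
    then show ?thesis using c H(2) by (simp add: sym_even_bound_def c_of_def)
  qed
qed

lemma symmetric_odd_lower_bounds:
  assumes "odd n" "5 \<le> n"
  shows "totient n \<le> 2 * normal_covering_number (sym_group n)"
    and "\<not> prime n \<Longrightarrow> totient n + 2 \<le> 2 * normal_covering_number (sym_group n)"
proof -
  obtain \<H> where H: "covered n True \<H>" "card \<H> = normal_covering_number (sym_group n)" using sym_cover[OF assms(2)] .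
  interpret covered n True \<H> by (rule H(1))
  show "totient n \<le> 2 * normal_covering_number (sym_group n)" using odd_symmetric_bound assms H(2) by simp
  show "totient n + 2 \<le> 2 * normal_covering_number (sym_group n)" if "\<not> prime n"
    using odd_composite_symmetric_bound assms H(2) that by simp
qed

theorem theoremB:
  shows
    "(\<forall>n::nat. n \<ge> 5 \<longrightarrow>
        (odd n \<and> \<not> prime n \<longrightarrow>
           real (normal_covering_number (sym_group n)) \<ge> real (totient n) / 2 + 1) \<and>
        (even n \<and> n \<noteq> 8 \<longrightarrow>
           real (normal_covering_number (alt_group n)) \<ge> real (totient n) / 2 + 1) \<and>
        (prime n \<longrightarrow>
           real (normal_covering_number (sym_group n)) \<ge> real (totient n) / 2) \<and>
        (n = 8 \<longrightarrow>
           real (normal_covering_number (alt_group n)) \<ge> real (totient n) / 2) \<and>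
        (odd n \<and> (\<forall>e::nat. n \<noteq> 2 ^ e + 1) \<longrightarrow>
           real (normal_covering_number (alt_group n)) \<ge> (real (totient n) + 2) / 4) \<and>
        ((\<exists>e::nat. n = 2 ^ e + 1) \<longrightarrow>
           real (normal_covering_number (alt_group n)) \<ge> real (totient n) / 4) \<and>
        (even n \<longrightarrow>
           real (normal_covering_number (sym_group n)) \<ge> sym_even_bound n))
     \<and> (sym_even_bound \<sim>[inf at_top (principal {n. even n \<and> \<not> 3 dvd n})]
          (\<lambda>n. real (totient n) / (c_of n * d_of n)))
     \<and> (sym_even_bound \<sim>[inf at_top (principal {n. even n \<and> (n mod 9 = 3 \<or> n mod 9 = 6)})]
          (\<lambda>n. real (totient n) / (c_of n * d_of n)))
     \<and> (sym_even_bound \<sim>[inf at_top (principal {n. even n \<and> 9 dvd n})]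
          (\<lambda>n. real (totient n) / (c_of n * d_of n)))"
proof (intro conjI sym_even_bound_asymp allI impI)
  fix n :: nat assume n: "5 \<le> n"
  show "real (totient n) / 2 + 1 \<le> real (normal_covering_number (sym_group n))" if "odd n \<and> \<not> prime n"
    using symmetric_odd_lower_bounds(2)[OF _ n] that by fastforce
  show "real (totient n) / 2 + 1 \<le> real (normal_covering_number (alt_group n))" if "even n \<and> n \<noteq> 8"
    using alternating_even_lower_bound[OF _ n] that by fastforce
  show "real (totient n) / 2 \<le> real (normal_covering_number (sym_group n))" if "prime n"
  proof -
    have "odd n" using prime_odd_nat[OF that] n by simp
    then show ?thesis using symmetric_odd_lower_bounds(1)[OF _ n] by linarith
  qed
  show "real (totient n) / 2 \<le> real (normal_covering_number (alt_group n))" if "n = 8"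
    using alternating_8_lower_bound unfolding that by linarith
  show "(real (totient n) + 2) / 4 \<le> real (normal_covering_number (alt_group n))" if "odd n \<and> (\<forall>e. n \<noteq> 2 ^ e + 1)"
    using alternating_odd_lower_bounds(2)[OF _ n] that by fastforce
  show "real (totient n) / 4 \<le> real (normal_covering_number (alt_group n))" if ex: "\<exists>e. n = 2 ^ e + 1"
  proof -
    obtain e where e: "n = 2 ^ e + 1" using ex by blast
    have "0 < e" using e n by (cases e) auto
    then have "odd n" using e by simp
    then show ?thesis using alternating_odd_lower_bounds(1)[OF _ n] by linarith
  qed
  show "sym_even_bound n \<le> real (normal_covering_number (sym_group n))" if "even n"
    by (rule symmetric_even_lower_bound[OF that n])
qed

end
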